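(* Let $\gamma=1/6$. Assume that the powers of the transition operator $\mathbf R_N$ are uniformly bounded: there is a constant $c_1>0$, independent of $N,\Delta t,\varepsilon$, with $\|\mathbf R_N^{j}\|_\infty\le c_1$ for $j=1,\dots,T/\Delta t$. Let $c_0>0$ be a constant independent of $N,\Delta t,\varepsilon$. Then there is a constant $C>0$, independent of $N$, $\Delta t$ and $\varepsilon$, such that for all $\varepsilon$, all $\Delta t$ and all $N\ge N_0$ satisfying $L(N)^{-4}\le c_0\,\Delta t$, the exact solution $\mathbf u$ of the parabolic problem and the solution $\{\mathbf U^n_i\}$ of the totally discrete scheme satisfy $$\max_{0\le i\le N}\ \max_{1\le k\le M}\big|u_k(x_i,t_{n+1})-U^{n+1}_{k,i}\big|\le C\left((\Delta t)^2+\Big(\frac{L}{N}\Big)^4\right)$$ for every $n=0,1,\dots,T/\Delta t-1$. Here $N_0$ is the smallest positive integer such that $\max_{k}\{4\sigma_0^2(\|a_{kk}\|_\infty+2/\Delta t)/3\}<(N_0/L(N_0))^2$.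
   Context: **Continuous problem.** Let $M\ge 2$, $T>0$, $D=(0,1)\times(0,T]$, and let $\varepsilon$ be a small parameter, $0<\varepsilon\ll1$ ($\varepsilon\in(0,1)$). Let $\mathbf u=(u_1,\dots,u_M)^T$ solve $$\frac{\partial \mathbf u}{\partial t}+\mathbf L_{x,\varepsilon}\mathbf u=\mathbf f \text{ in } D,\quad \mathbf u(0,t)=\mathbf u(1,t)=\mathbf 0\ (t\in[0,T]),\quad \mathbf u(x,0)=\mathbf 0\ (x\in[0,1]),$$ where $\mathbf L_{x,\varepsilon}\mathbf v=-\varepsilon\,\partial_x^2\mathbf v+\mathbf A(x)\mathbf v$, $\mathbf A=(a_{ij}(x))_{M\times M}$. For all $x\in[0,1]$: $a_{ij}\le0$ for $i\ne j$, $a_{ii}>0$, and $\sum_{j=1}^M a_{ij}\ge\beta^*>0$ for $i=1,\dots,M$. The data $\mathbf A,\mathbf f$ do not depend on $\varepsilon$ and are sufficiently regular and compatible that $\mathbf u\in C^{6,3}(\overline D)^M$; moreover $\partial_x^s\partial_t^q\mathbf f(0,0)=\partial_x^s\partial_t^q\mathbf f(1,0)=\mathbf 0$ for $0\le s+2q\le4$. Fix $\beta\in(0,\beta^* )$. $\|\cdot\|_\infty$ denotes the maximum norm on $[0,1]$ for functions and the maximum norm (over nodes and components), with its induced operator norm, for mesh functions. Time levels: $t_n=n\Delta t$, $0\le n\le T/\Delta t$, with $T/\Delta t$ an integer. **Generalized Shishkin mesh.** $N$ is a positive multiple of 4, $L=L(N)$ satisfies $\ln(\ln N)<L\le\ln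 N$ and $e^{-L}\le L/N$; $\sigma_0\ge4/\sqrt\beta$ is a constant and $\sigma=\min\{1/4,\sigma_0\sqrt\varepsilon L\}$. Let $\mathcal K(t)=4\sigma t$ for $t\in[0,1/4]$ and $\mathcal K(t)=p(t-1/4)^3+4\sigma(t-1/4)+\sigma$ for $t\in[1/4,1/2]$, with $p$ determined by $\mathcal K(1/2)=1/2$. The nodes are $x_j=\mathcal K(j/N)$, $x_{N-j}=1-x_j$, $j=0,\dots,N/2$. Put $h_i=x_i-x_{i-1}$, $i=1,\dots,N$, and $h_{\max}=\max_ih_i$. **Coefficients.** Put $\widehat a_{kk}=a_{kk}+2/\Delta t$. For $k=1,\dots,M$: (i) if $1\le i\le N/4-1$ or $3N/4+1\le i\le N-1$: $q_i^{k,-}=q_i^{k,+}=\frac1{12}$, $q_i^{k,c}=\frac56$; (ii) if $N/4\le i\le3N/4$ and $\gamma h_{\max}^2\|\widehat a_{kk}\|_\infty\le\varepsilon$: $q_i^{k,-}=\frac{2h_i-h_{i+1}}{6(h_i+h_{i+1})}$, $q_i^{k,c}=\frac56$, $q_i^{k,+}=\frac{2h_{i+1}-h_i}{6(h_i+h_{i+1})}$; (iii) if $N/4\le i\le3N/4$ and $\gamma h_{\max}^2\|\widehat a_{kk}\|_\infty>\varepsilon$: $q_i^{k,-}=q_i^{k,+}=0$, $q_i^{k,c}=1$. Further $$r_i^{k,-}=\tfrac{\Delta t}2\Big(\tfrac{-2\varepsilon}{h_i(h_i+h_{i+1})}+q_i^{k,-}\big(a_{kk}(x_{i-1})+\tfrac2{\Delta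 t}\big)\Big),\quad r_i^{k,+}=\tfrac{\Delta t}2\Big(\tfrac{-2\varepsilon}{h_{i+1}(h_i+h_{i+1})}+q_i^{k,+}\big(a_{kk}(x_{i+1})+\tfrac2{\Delta t}\big)\Big),$$ $$r_i^{k,c}=\tfrac{\Delta t}2\big(q_i^{k,-}a_{kk}(x_{i-1})+q_i^{k,c}a_{kk}(x_i)+q_i^{k,+}a_{kk}(x_{i+1})\big)-r_i^{k,-}-r_i^{k,+}+1.$$ **Discrete operators.** For a scalar mesh function $V$ let $Q^k(V)_i=q_i^{k,-}V_{i-1}+q_i^{k,c}V_i+q_i^{k,+}V_{i+1}$ and $R^k(V)_i=r_i^{k,-}V_{i-1}+r_i^{k,c}V_i+r_i^{k,+}V_{i+1}$. For a vector mesh function $\mathbf V=(V_1,\dots,V_M)^T$ and $1\le i\le N-1$ let $[\mathbf Q\mathbf V]_i$ have $k$-th component $Q^k(V_k)_i$, and let $[\widehat{\mathbf L}^N_{x,\varepsilon}\mathbf V]_i$ have $k$-th component $R^k(V_k)_i+\frac{\Delta t}2\sum_{j\ne k}Q^k(a_{kj}V_j)_i$. **Totally discrete scheme.** $\mathbf U^0_i=\mathbf 0$ and $\mathbf L^N_{x,\varepsilon}\mathbf U^0_i=\mathbf L_{x,\varepsilon}\mathbf u(x_i,0)$ for $i=0,\dots,N$. For $n=0,\dots,T/\Delta t-1$: $\mathbf U^{n+1}_0=\mathbf U^{n+1}_N=\mathbf 0$ and $$[\widehat{\mathbf L}^N_{x,\varepsilon}\mathbf U^{n+1}]_i=[\mathbf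 Q\mathbf F^n]_i,\quad i=1,\dots,N-1,$$ with $\mathbf F^n(x_i)=\mathbf U^n_i+\frac{\Delta t}2\big(-\mathbf L^N_{x,\varepsilon}\mathbf U^n_i+\mathbf f(x_i,t_n)+\mathbf f(x_i,t_{n+1})\big)$ and, recursively, $$\mathbf L^N_{x,\varepsilon}\mathbf U^{n+1}_i=-\mathbf L^N_{x,\varepsilon}\mathbf U^n_i-2\,\frac{\mathbf U^{n+1}_i-\mathbf U^n_i}{\Delta t}+\mathbf f(x_i,t_n)+\mathbf f(x_i,t_{n+1})$$ (for all $i=0,\dots,N$). **Transition operator.** $\mathbf R_N$ is the linear operator, on vector mesh functions vanishing at $x_0$ and $x_N$, that performs one step of the totally discrete scheme with source term $\mathbf f$ equal to zero and zero boundary conditions; explicitly $\mathbf W=\mathbf R_N\mathbf V$ is given by $\mathbf W_0=\mathbf W_N=\mathbf 0$ and $[\widehat{\mathbf L}^N_{x,\varepsilon}\mathbf W]_i=2[\mathbf Q\mathbf V]_i-[\widehat{\mathbf L}^N_{x,\varepsilon}\mathbf V]_i$, $1\le i\le N-1$. *)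

theory Defs
  imports "HOL-Analysis.Analysis"
begin

text \<open>
  All derivatives are taken within the closed intervals (one-sided at the end points), so that
  the classes below are the usual spaces of functions whose derivatives extend continuously to
  the closed domain; values outside the domain play no role.
\<close>

definition dx :: "(real \<Rightarrow> real) \<Rightarrow> real \<Rightarrow> real" where
  "dx g x = vector_derivative g (at x within {0..1})"

definition pdx :: "(real \<Rightarrow> real \<Rightarrow> real) \<Rightarrow> real \<Rightarrow> real \<Rightarrow> real" where
  "pdx v x t = dx (\<lambda>y. v y t) x"

definition pdt :: "real \<Rightarrow> (real \<Rightarrow> real \<Rightarrow> real) \<Rightarrow> real \<Rightarrow> real \<Rightarrow> real" where
  "pdt T v x t = vector_derivative (\<lambda>r. v x r) (at t within {0..T})"

definition pd :: "real \<Rightarrow> nat \<Rightarrow> nat \<Rightarrow> (real \<Rightarrow> real \<Rightarrow> real) \<Rightarrow> real \<Rightarrow> real \<Rightarrow> real" where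
  "pd T s q v = (pdx ^^ s) ((pdt T ^^ q) v)"

text \<open>
  The parabolic class $C^{2m,m}(\overline D)$.  It is enough to ask for the derivatives in the
  order $\partial_x^s\partial_t^q$: since they are continuous, the other orders exist and agree.
\<close>

definition C_par :: "real \<Rightarrow> nat \<Rightarrow> (real \<Rightarrow> real \<Rightarrow> real) \<Rightarrow> bool" where
  "C_par T m v \<longleftrightarrow>
     (\<forall>s q. s + 2 * q \<le> 2 * m \<longrightarrow>
        continuous_on ({0..1} \<times> {0..T}) (\<lambda>(x, t). pd T s q v x t)) \<and>
     (\<forall>s q. s + 2 * q < 2 * m \<longrightarrow>
        (\<forall>x\<in>{0..1}. \<forall>t\<in>{0..T}. (\<lambda>y. pd T s q v y t) differentiable (at x within {0..1}))) \<and>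
     (\<forall>q<m. \<forall>x\<in>{0..1}. \<forall>t\<in>{0..T}. (\<lambda>r. pd T 0 q v x r) differentiable (at t within {0..T}))"

text \<open>
  The parabolic Hoelder class $C^{2m+\alpha,m+\alpha/2}(\overline D)$; the Hoelder conditions in
  time on the derivatives with $s+2q=2m-1$ follow from those on the top-order ones.
\<close>

definition C_par_hoelder :: "real \<Rightarrow> nat \<Rightarrow> real \<Rightarrow> (real \<Rightarrow> real \<Rightarrow> real) \<Rightarrow> bool" where
  "C_par_hoelder T m \<alpha> v \<longleftrightarrow> C_par T m v \<and>
     (\<forall>s q. s + 2 * q = 2 * m \<longrightarrow>
        (\<exists>H. \<forall>x\<in>{0..1}. \<forall>y\<in>{0..1}. \<forall>t\<in>{0..T}. \<forall>r\<in>{0..T}.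
           \<bar>pd T s q v x t - pd T s q v y r\<bar> \<le> H * (\<bar>x - y\<bar> powr \<alpha> + \<bar>t - r\<bar> powr (\<alpha> / 2))))"

definition C_hoelder :: "nat \<Rightarrow> real \<Rightarrow> (real \<Rightarrow> real) \<Rightarrow> bool" where
  "C_hoelder m \<alpha> g \<longleftrightarrow>
     (\<forall>s\<le>m. continuous_on {0..1} ((dx ^^ s) g)) \<and>
     (\<forall>s<m. \<forall>x\<in>{0..1}. (dx ^^ s) g differentiable (at x within {0..1})) \<and>
     (\<exists>H. \<forall>x\<in>{0..1}. \<forall>y\<in>{0..1}. \<bar>(dx ^^ m) g x - (dx ^^ m) g y\<bar> \<le> H * \<bar>x - y\<bar> powr \<alpha>)"

definition sup_norm01 :: "(real \<Rightarrow> real) \<Rightarrow> real" where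
  "sup_norm01 g = (SUP x\<in>{0..1}. \<bar>g x\<bar>)"

text \<open>The index type \<open>'n\<close> stands for $\{1,\dots,M\}$, and \<open>A x $ k $ j\<close> is $a_{kj}(x)$.\<close>

definition L_op :: "real \<Rightarrow> (real \<Rightarrow> real^'n^'n) \<Rightarrow> (real \<Rightarrow> real \<Rightarrow> real^'n) \<Rightarrow> real \<Rightarrow> real \<Rightarrow> real^'n" where
  "L_op eps A v x t = (\<chi> k. - eps * pdx (pdx (\<lambda>y r. v y r $ k)) x t) + A x *v v x t"

definition parabolic_solution ::
  "real \<Rightarrow> real \<Rightarrow> (real \<Rightarrow> real^'n^'n) \<Rightarrow> (real \<Rightarrow> real \<Rightarrow> real^'n) \<Rightarrow> (real \<Rightarrow> real \<Rightarrow> real^'n) \<Rightarrow> bool" where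
  "parabolic_solution T eps A f u \<longleftrightarrow>
     (\<forall>x\<in>{0<..<1}. \<forall>t\<in>{0<..T}.
        (\<chi> k. pdt T (\<lambda>y r. u y r $ k) x t) + L_op eps A u x t = f x t) \<and>
     (\<forall>t\<in>{0..T}. u 0 t = 0 \<and> u 1 t = 0) \<and>
     (\<forall>x\<in>{0..1}. u x 0 = 0)"

definition coupling_conditions :: "real \<Rightarrow> (real \<Rightarrow> real^'n^'n) \<Rightarrow> bool" where
  "coupling_conditions beta_star A \<longleftrightarrow>
     (\<forall>x\<in>{0..1}. \<forall>i. (\<forall>j. i \<noteq> j \<longrightarrow> A x $ i $ j \<le> 0) \<and> A x $ i $ i > 0 \<and>
        (\<Sum>j\<in>UNIV. A x $ i $ j) \<ge> beta_star)"

definition admissible_L :: "(nat \<Rightarrow> real) \<Rightarrow> bool" where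
  "admissible_L L \<longleftrightarrow>
     (\<forall>N. 0 < N \<and> 4 dvd N \<longrightarrow>
        ln (ln (real N)) < L N \<and> L N \<le> ln (real N) \<and> exp (- L N) \<le> L N / real N)"

definition shishkin_sigma :: "real \<Rightarrow> real \<Rightarrow> real \<Rightarrow> real" where
  "shishkin_sigma sigma0 eps l = min (1/4) (sigma0 * sqrt eps * l)"

definition mesh_fun :: "real \<Rightarrow> real \<Rightarrow> real \<Rightarrow> real" where
  "mesh_fun sg p t =
     (if t \<le> 1/4 then 4 * sg * t
      else p * (t - 1/4) ^ 3 + 4 * sg * (t - 1/4) + sg)"

definition mesh_p :: "real \<Rightarrow> real" where
  "mesh_p sg = 32 * (1 - 4 * sg)"

lemma mesh_p_determined: "mesh_fun sg p (1/2) = 1/2 \<longleftrightarrow> p = mesh_p sg"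
  by (simp add: mesh_fun_def mesh_p_def power3_eq_cube) linarith

definition mesh_node :: "real \<Rightarrow> real \<Rightarrow> real \<Rightarrow> nat \<Rightarrow> nat \<Rightarrow> real" where
  "mesh_node sigma0 eps l N j =
     (let sg = shishkin_sigma sigma0 eps l; K = mesh_fun sg (mesh_p sg)
      in if j \<le> N div 2 then K (real j / real N) else 1 - K (real (N - j) / real N))"

text \<open>Below, \<open>x :: nat \<Rightarrow> real\<close> is any mesh with nodes \<open>x 0, \<dots>, x N\<close>.\<close>

definition mesh_h :: "(nat \<Rightarrow> real) \<Rightarrow> nat \<Rightarrow> real" where
  "mesh_h x i = x i - x (i - 1)"

definition mesh_hmax :: "nat \<Rightarrow> (nat \<Rightarrow> real) \<Rightarrow> real" where
  "mesh_hmax N x = Max (mesh_h x ` {1..N})"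

definition a_hat :: "(real \<Rightarrow> real^'n^'n) \<Rightarrow> real \<Rightarrow> 'n \<Rightarrow> real \<Rightarrow> real" where
  "a_hat A dt k y = A y $ k $ k + 2 / dt"

text \<open>\<open>in_fine N i\<close> is meant for $1\le i\le N-1$; its negation is then $N/4\le i\le 3N/4$.\<close>

definition in_fine :: "nat \<Rightarrow> nat \<Rightarrow> bool" where
  "in_fine N i \<longleftrightarrow> i < N div 4 \<or> 3 * (N div 4) < i"

definition resolved ::
  "real \<Rightarrow> (real \<Rightarrow> real^'n^'n) \<Rightarrow> real \<Rightarrow> real \<Rightarrow> nat \<Rightarrow> (nat \<Rightarrow> real) \<Rightarrow> 'n \<Rightarrow> bool" where
  "resolved gam A eps dt N x k \<longleftrightarrow>
     gam * (mesh_hmax N x)\<^sup>2 * sup_norm01 (a_hat A dt k) \<le> eps"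

definition q_minus ::
  "real \<Rightarrow> (real \<Rightarrow> real^'n^'n) \<Rightarrow> real \<Rightarrow> real \<Rightarrow> nat \<Rightarrow> (nat \<Rightarrow> real) \<Rightarrow> 'n \<Rightarrow> nat \<Rightarrow> real" where
  "q_minus gam A eps dt N x k i =
     (if in_fine N i then 1/12
      else if resolved gam A eps dt N x k
        then (2 * mesh_h x i - mesh_h x (i+1)) / (6 * (mesh_h x i + mesh_h x (i+1)))
      else 0)"

definition q_plus ::
  "real \<Rightarrow> (real \<Rightarrow> real^'n^'n) \<Rightarrow> real \<Rightarrow> real \<Rightarrow> nat \<Rightarrow> (nat \<Rightarrow> real) \<Rightarrow> 'n \<Rightarrow> nat \<Rightarrow> real" where
  "q_plus gam A eps dt N x k i =
     (if in_fine N i then 1/12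
      else if resolved gam A eps dt N x k
        then (2 * mesh_h x (i+1) - mesh_h x i) / (6 * (mesh_h x i + mesh_h x (i+1)))
      else 0)"

definition q_cent ::
  "real \<Rightarrow> (real \<Rightarrow> real^'n^'n) \<Rightarrow> real \<Rightarrow> real \<Rightarrow> nat \<Rightarrow> (nat \<Rightarrow> real) \<Rightarrow> 'n \<Rightarrow> nat \<Rightarrow> real" where
  "q_cent gam A eps dt N x k i =
     (if in_fine N i then 5/6
      else if resolved gam A eps dt N x k then 5/6
      else 1)"

definition r_minus ::
  "real \<Rightarrow> (real \<Rightarrow> real^'n^'n) \<Rightarrow> real \<Rightarrow> real \<Rightarrow> nat \<Rightarrow> (nat \<Rightarrow> real) \<Rightarrow> 'n \<Rightarrow> nat \<Rightarrow> real" where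
  "r_minus gam A eps dt N x k i =
     dt / 2 * (- 2 * eps / (mesh_h x i * (mesh_h x i + mesh_h x (i+1)))
               + q_minus gam A eps dt N x k i * (A (x (i-1)) $ k $ k + 2 / dt))"

definition r_plus ::
  "real \<Rightarrow> (real \<Rightarrow> real^'n^'n) \<Rightarrow> real \<Rightarrow> real \<Rightarrow> nat \<Rightarrow> (nat \<Rightarrow> real) \<Rightarrow> 'n \<Rightarrow> nat \<Rightarrow> real" where
  "r_plus gam A eps dt N x k i =
     dt / 2 * (- 2 * eps / (mesh_h x (i+1) * (mesh_h x i + mesh_h x (i+1)))
               + q_plus gam A eps dt N x k i * (A (x (i+1)) $ k $ k + 2 / dt))"

definition r_cent ::
  "real \<Rightarrow> (real \<Rightarrow> real^'n^'n) \<Rightarrow> real \<Rightarrow> real \<Rightarrow> nat \<Rightarrow> (nat \<Rightarrow> real) \<Rightarrow> 'n \<Rightarrow> nat \<Rightarrow> real" where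
  "r_cent gam A eps dt N x k i =
     dt / 2 * (q_minus gam A eps dt N x k i * A (x (i-1)) $ k $ k
               + q_cent gam A eps dt N x k i * A (x i) $ k $ k
               + q_plus gam A eps dt N x k i * A (x (i+1)) $ k $ k)
     - r_minus gam A eps dt N x k i - r_plus gam A eps dt N x k i + 1"

definition Q_scal ::
  "real \<Rightarrow> (real \<Rightarrow> real^'n^'n) \<Rightarrow> real \<Rightarrow> real \<Rightarrow> nat \<Rightarrow> (nat \<Rightarrow> real) \<Rightarrow> 'n \<Rightarrow> (nat \<Rightarrow> real) \<Rightarrow> nat \<Rightarrow> real" where
  "Q_scal gam A eps dt N x k V i =
     q_minus gam A eps dt N x k i * V (i-1) + q_cent gam A eps dt N x k i * V i
     + q_plus gam A eps dt N x k i * V (i+1)"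

definition R_scal ::
  "real \<Rightarrow> (real \<Rightarrow> real^'n^'n) \<Rightarrow> real \<Rightarrow> real \<Rightarrow> nat \<Rightarrow> (nat \<Rightarrow> real) \<Rightarrow> 'n \<Rightarrow> (nat \<Rightarrow> real) \<Rightarrow> nat \<Rightarrow> real" where
  "R_scal gam A eps dt N x k V i =
     r_minus gam A eps dt N x k i * V (i-1) + r_cent gam A eps dt N x k i * V i
     + r_plus gam A eps dt N x k i * V (i+1)"

definition Q_vec ::
  "real \<Rightarrow> (real \<Rightarrow> real^'n^'n) \<Rightarrow> real \<Rightarrow> real \<Rightarrow> nat \<Rightarrow> (nat \<Rightarrow> real) \<Rightarrow> (nat \<Rightarrow> real^'n) \<Rightarrow> nat \<Rightarrow> real^'n" where
  "Q_vec gam A eps dt N x V i = (\<chi> k. Q_scal gam A eps dt N x k (\<lambda>l. V l $ k) i)"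

definition L_hat ::
  "real \<Rightarrow> (real \<Rightarrow> real^'n^'n) \<Rightarrow> real \<Rightarrow> real \<Rightarrow> nat \<Rightarrow> (nat \<Rightarrow> real) \<Rightarrow> (nat \<Rightarrow> real^'n) \<Rightarrow> nat \<Rightarrow> real^'n" where
  "L_hat gam A eps dt N x V i =
     (\<chi> k. R_scal gam A eps dt N x k (\<lambda>l. V l $ k) i
           + dt / 2 * (\<Sum>j\<in>UNIV - {k}. Q_scal gam A eps dt N x k (\<lambda>l. A (x l) $ k $ j * V l $ j) i))"

text \<open>
  \<open>LU \<dots> U n i\<close> is the recursively defined quantity $\mathbf L^N_{x,\varepsilon}\mathbf U^n_i$,
  with \<open>U n i\<close> for $\mathbf U^n_i$; the exact solution \<open>u\<close> enters only through its initial value.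
\<close>

primrec LU ::
  "(real \<Rightarrow> real^'n^'n) \<Rightarrow> (real \<Rightarrow> real \<Rightarrow> real^'n) \<Rightarrow> (real \<Rightarrow> real \<Rightarrow> real^'n) \<Rightarrow> real \<Rightarrow> real \<Rightarrow>
   (nat \<Rightarrow> real) \<Rightarrow> (nat \<Rightarrow> nat \<Rightarrow> real^'n) \<Rightarrow> nat \<Rightarrow> nat \<Rightarrow> real^'n" where
  "LU A f u eps dt x U 0 i = L_op eps A u (x i) 0"
| "LU A f u eps dt x U (Suc n) i =
     - LU A f u eps dt x U n i - (2 / dt) *\<^sub>R (U (Suc n) i - U n i)
     + f (x i) (real n * dt) + f (x i) (real (Suc n) * dt)"

definition F_rhs ::
  "(real \<Rightarrow> real^'n^'n) \<Rightarrow> (real \<Rightarrow> real \<Rightarrow> real^'n) \<Rightarrow> (real \<Rightarrow> real \<Rightarrow> real^'n) \<Rightarrow> real \<Rightarrow> real \<Rightarrow>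
   (nat \<Rightarrow> real) \<Rightarrow> (nat \<Rightarrow> nat \<Rightarrow> real^'n) \<Rightarrow> nat \<Rightarrow> nat \<Rightarrow> real^'n" where
  "F_rhs A f u eps dt x U n i =
     U n i + (dt / 2) *\<^sub>R (- LU A f u eps dt x U n i
                           + f (x i) (real n * dt) + f (x i) (real (Suc n) * dt))"

definition discrete_solution ::
  "real \<Rightarrow> real \<Rightarrow> (real \<Rightarrow> real^'n^'n) \<Rightarrow> (real \<Rightarrow> real \<Rightarrow> real^'n) \<Rightarrow> (real \<Rightarrow> real \<Rightarrow> real^'n) \<Rightarrow>
   real \<Rightarrow> real \<Rightarrow> nat \<Rightarrow> (nat \<Rightarrow> real) \<Rightarrow> (nat \<Rightarrow> nat \<Rightarrow> real^'n) \<Rightarrow> bool" where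
  "discrete_solution gam T A f u eps dt N x U \<longleftrightarrow>
     (\<forall>i\<le>N. U 0 i = 0) \<and>
     (\<forall>n. real (Suc n) \<le> T / dt \<longrightarrow>
        U (Suc n) 0 = 0 \<and> U (Suc n) N = 0 \<and>
        (\<forall>i\<in>{1..N-1}.
           L_hat gam A eps dt N x (U (Suc n)) i
             = Q_vec gam A eps dt N x (F_rhs A f u eps dt x U n) i))"

definition mesh_norm :: "nat \<Rightarrow> (nat \<Rightarrow> real^'n) \<Rightarrow> real" where
  "mesh_norm N V = Max ((\<lambda>(i, k). \<bar>V i $ k\<bar>) ` ({0..N} \<times> UNIV))"

text \<open>
  Mesh functions vanishing at both end points; they are extended by zero beyond \<open>N\<close>, so that
  equality of HOL functions is equality of mesh functions.
\<close>

definition mesh0 :: "nat \<Rightarrow> (nat \<Rightarrow> real^'n) set" where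
  "mesh0 N = {V. V 0 = 0 \<and> (\<forall>i\<ge>N. V i = 0)}"

text \<open>The operator norm on \<open>mesh0 N\<close> induced by \<open>mesh_norm N\<close>, in the form of \<open>onorm\<close>.\<close>

definition mesh_onorm :: "nat \<Rightarrow> ((nat \<Rightarrow> real^'n) \<Rightarrow> nat \<Rightarrow> real^'n) \<Rightarrow> real" where
  "mesh_onorm N R = (SUP V\<in>mesh0 N. mesh_norm N (R V) / mesh_norm N V)"

definition transition_step ::
  "real \<Rightarrow> (real \<Rightarrow> real^'n^'n) \<Rightarrow> real \<Rightarrow> real \<Rightarrow> nat \<Rightarrow> (nat \<Rightarrow> real) \<Rightarrow>
   (nat \<Rightarrow> real^'n) \<Rightarrow> (nat \<Rightarrow> real^'n) \<Rightarrow> bool" where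
  "transition_step gam A eps dt N x V W \<longleftrightarrow> W \<in> mesh0 N \<and>
     (\<forall>i\<in>{1..N-1}.
        L_hat gam A eps dt N x W i
          = 2 *\<^sub>R Q_vec gam A eps dt N x V i - L_hat gam A eps dt N x V i)"

definition transition_defined ::
  "real \<Rightarrow> (real \<Rightarrow> real^'n^'n) \<Rightarrow> real \<Rightarrow> real \<Rightarrow> nat \<Rightarrow> (nat \<Rightarrow> real) \<Rightarrow> bool" where
  "transition_defined gam A eps dt N x \<longleftrightarrow>
     (\<forall>V\<in>mesh0 N. \<exists>!W. transition_step gam A eps dt N x V W)"

text \<open>Meaningful on \<open>mesh0 N\<close> when \<open>transition_defined\<close> holds.\<close>

definition transition_op ::
  "real \<Rightarrow> (real \<Rightarrow> real^'n^'n) \<Rightarrow> real \<Rightarrow> real \<Rightarrow> nat \<Rightarrow> (nat \<Rightarrow> real) \<Rightarrow>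
   (nat \<Rightarrow> real^'n) \<Rightarrow> nat \<Rightarrow> real^'n" where
  "transition_op gam A eps dt N x V = (THE W. transition_step gam A eps dt N x V W)"

definition admissible_dt :: "real \<Rightarrow> real \<Rightarrow> bool" where
  "admissible_dt T dt \<longleftrightarrow> 0 < dt \<and> (\<exists>m::nat. 0 < m \<and> T / dt = real m)"

text \<open>
  The minimum is taken over the admissible mesh sizes, i.e. the positive multiples of 4, since
  \<open>L\<close> is prescribed only there.
\<close>

definition N_zero :: "real \<Rightarrow> (nat \<Rightarrow> real) \<Rightarrow> (real \<Rightarrow> real^'n^'n) \<Rightarrow> real \<Rightarrow> nat" where
  "N_zero sigma0 L A dt =
     (LEAST N. 0 < N \<and> 4 dvd N \<and>
        Max (range (\<lambda>k. 4 * sigma0\<^sup>2 * (sup_norm01 (\<lambda>y. A y $ k $ k) + 2 / dt) / 3))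
          < (real N / L N)\<^sup>2)"

end

theory Submission
  imports Defs
begin

text \<open>
  The error of the scheme satisfies the recursion of the scheme itself with source
  $\mathbf Q\rho+\frac{\Delta t}2(\tau^n+\tau^{n+1})$, where $\rho$ is the error of the trapezoidal rule and $\tau$ the
  truncation error in space. Power boundedness of $\mathbf R_N=2\widehat{\mathbf L}^{-1}\mathbf Q-\mathbf I$ bounds
  $\widehat{\mathbf L}^{-1}$ as well, because $\mathbf Q$ is strictly diagonally dominant, so errors at most add up over
  the $T/\Delta t$ steps; it remains to show $\rho=O(\Delta t^3)$ and $\tau=O((L/N)^4)$ uniformly in $\varepsilon$.

  This requires bounds for the derivatives of $\mathbf u$. The maximum principle with the weights
  $1+\varepsilon^{-m/2}(e^{-\sqrt\beta x/\sqrt\varepsilon}+e^{-\sqrt\beta(1-x)/\sqrt\varepsilon})$ handles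
  $\partial_x^m$ for $m\le4$ as well as $\partial_t$ and $\partial_t^2$, since the data needed for them are bounded.
  For $\partial_t^3$ and for $\partial_x^6$ away from the boundary the data are only Hoelder continuous in time; there
  a cut-off heat kernel, tested against the equation on cells of width $O(\sqrt\varepsilon)$, yields the time
  derivative of the solution from the Hoelder continuity in time of the source, and $\partial_x^6$ follows from the
  equation. In the coarse part of the mesh the layer terms are $O((L/N)^4)$; in the resolved case
  $\varepsilon^{-1}=O(N^2)$ absorbs the remaining negative powers of $\varepsilon$, and in the unresolved case
  $\varepsilon=O(L^4/N^2)$ because $1/\Delta t=O(L^4)$.
\<close>

section \<open>Parabolic regularity for the heat equation\<close>

text \<open>A comparison argument for the third time derivative would need three time derivatives of
  \<open>f\<close>, one more than the data have. What is known is that \<open>u_tt\<close> solves a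
  heat equation with a source that is Hoelder in time. The time derivative of a heat potential has a
  kernel of size \<open>1 / \<tau>\<close>, just not integrable; a Hoelder exponent \<open>a\<close>
  lowers this to \<open>\<tau>\<close> to the power \<open>a - 1\<close>, with finite integral.
  Which powers of \<open>d = sqrt eps\<close> are affordable decides the rest. In the fine mesh
  \<open>h / d = O(L / N)\<close>, so even the crude \<open>d^-6\<close> for the sixth x-derivative
  is harmless. In the coarse mesh it may cost only \<open>d^-2\<close> beyond the weight, to be
  cancelled by the factor \<open>d^2\<close> of the diffusion term. That bound is sought in the
  interior only, because the fourth x-derivative has no zero boundary values about which it could be
  reflected. The fourth power comes from \<open>sqrt beta * sigma0 >= 4\<close>: at the transition
  point the layer is of size \<open>exp (- 4 L)\<close>, and \<open>exp (- L) <= L / N\<close>. In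
  the time stepping the norm bound is applied to each power of the transition operator, never to a
  product, so \<open>c1\<close> enters the final constant only polynomially.\<close>

definition heat_kernel :: "real \<Rightarrow> real \<Rightarrow> real \<Rightarrow> real" where
  "heat_kernel k \<tau> y = exp (- k * y\<^sup>2 / \<tau>) / sqrt \<tau>"

definition heat_kernel_t :: "real \<Rightarrow> real \<Rightarrow> real \<Rightarrow> real" where
  "heat_kernel_t k \<tau> y = heat_kernel k \<tau> y * (k * y\<^sup>2 / \<tau>\<^sup>2 - 1 / (2 * \<tau>))"

definition heat_kernel_tt :: "real \<Rightarrow> real \<Rightarrow> real \<Rightarrow> real" where
  "heat_kernel_tt k \<tau> y = heat_kernel k \<tau> y *
     ((k * y\<^sup>2 / \<tau>\<^sup>2 - 1 / (2 * \<tau>))\<^sup>2 - 2 * k * y\<^sup>2 / \<tau> ^ 3 + 1 / (2 * \<tau>\<^sup>2))"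

definition heat_kernel_y :: "real \<Rightarrow> real \<Rightarrow> real \<Rightarrow> real" where
  "heat_kernel_y k \<tau> y = heat_kernel k \<tau> y * (- 2 * k * y / \<tau>)"

definition heat_kernel_ty :: "real \<Rightarrow> real \<Rightarrow> real \<Rightarrow> real" where
  "heat_kernel_ty k \<tau> y = heat_kernel k \<tau> y *
     ((- 2 * k * y / \<tau>) * (k * y\<^sup>2 / \<tau>\<^sup>2 - 1 / (2 * \<tau>)) + 2 * k * y / \<tau>\<^sup>2)"

lemma heat_kernel_deriv_y:
  assumes "\<tau> > 0"
  shows "(heat_kernel k \<tau> has_real_derivative heat_kernel_y k \<tau> y) (at y)"
  using assms unfolding heat_kernel_def[abs_def] heat_kernel_y_def
  by (auto intro!: derivative_eq_intros simp: power2_eq_square field_simps)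

lemma heat_kernel_deriv_t:
  assumes "\<tau> > 0"
  shows "((\<lambda>\<tau>. heat_kernel k \<tau> y) has_real_derivative heat_kernel_t k \<tau> y) (at \<tau>)"
proof -
  have "((\<lambda>\<tau>. exp (- k * y\<^sup>2 / \<tau>) / sqrt \<tau>) has_real_derivative
      (exp (- k * y\<^sup>2 / \<tau>) * (k * y\<^sup>2 / \<tau>\<^sup>2) * sqrt \<tau> - exp (- k * y\<^sup>2 / \<tau>) * (inverse (sqrt \<tau>) / 2))
       / (sqrt \<tau> * sqrt \<tau>)) (at \<tau>)"
    using assms by (auto intro!: derivative_eq_intros simp: power2_eq_square)
  moreover have "(exp (- k * y\<^sup>2 / \<tau>) * (k * y\<^sup>2 / \<tau>\<^sup>2) * sqrt \<tau> - exp (- k * y\<^sup>2 / \<tau>) * (inverse (sqrt \<tau>) / 2))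
       / (sqrt \<tau> * sqrt \<tau>) = heat_kernel_t k \<tau> y"
    using assms unfolding heat_kernel_def heat_kernel_t_def
    by (simp add: field_simps)
  ultimately show ?thesis
    unfolding heat_kernel_def by simp
qed

text \<open>This is the heat equation \<open>v_t = v_yy / (4 * k)\<close>: no separate function for
  the second y-derivative is introduced, \<open>4 * k * heat_kernel_t\<close> takes its place.
  \<open>heat_kernel_ty_deriv_y\<close> is the same fact one time derivative higher.\<close>

lemma heat_kernel_y_deriv_y:
  assumes "\<tau> > 0"
  shows "(heat_kernel_y k \<tau> has_real_derivative 4 * k * heat_kernel_t k \<tau> y) (at y)"
  using assms unfolding heat_kernel_y_def[abs_def]
  by (auto intro!: derivative_eq_intros heat_kernel_deriv_y
        simp: heat_kernel_y_def heat_kernel_t_def power2_eq_square field_simps)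

lemma heat_kernel_y_deriv_t:
  assumes "\<tau> > 0"
  shows "((\<lambda>\<tau>. heat_kernel_y k \<tau> y) has_real_derivative heat_kernel_ty k \<tau> y) (at \<tau>)"
  using assms unfolding heat_kernel_y_def[abs_def]
  by (auto intro!: derivative_eq_intros heat_kernel_deriv_t
        simp: heat_kernel_t_def heat_kernel_ty_def power2_eq_square field_simps)

lemma heat_kernel_t_deriv_t:
  assumes "\<tau> > 0"
  shows "((\<lambda>\<tau>. heat_kernel_t k \<tau> y) has_real_derivative heat_kernel_tt k \<tau> y) (at \<tau>)"
  using assms unfolding heat_kernel_t_def[abs_def]
  by (auto intro!: derivative_eq_intros heat_kernel_deriv_t
        simp: heat_kernel_t_def heat_kernel_tt_def power2_eq_square power3_eq_cube field_simps)

lemma heat_kernel_t_deriv_y: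
  assumes "\<tau> > 0"
  shows "(heat_kernel_t k \<tau> has_real_derivative heat_kernel_ty k \<tau> y) (at y)"
  using assms unfolding heat_kernel_t_def[abs_def]
  by (auto intro!: derivative_eq_intros heat_kernel_deriv_y
        simp: heat_kernel_y_def heat_kernel_ty_def power2_eq_square field_simps)

lemma heat_kernel_ty_deriv_y:
  assumes "\<tau> > 0"
  shows "(heat_kernel_ty k \<tau> has_real_derivative 4 * k * heat_kernel_tt k \<tau> y) (at y)"
  using assms unfolding heat_kernel_ty_def[abs_def]
  by (auto intro!: derivative_eq_intros heat_kernel_deriv_y
        simp: heat_kernel_y_def heat_kernel_tt_def power2_eq_square power3_eq_cube field_simps)

text \<open>The cutoff is so flat at 0 that its derivatives cancel the singularity of the kernel there.\<close>

definition cutoff :: "real \<Rightarrow> real" where "cutoff y = (1 - y ^ 4) ^ 3"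
definition cutoff1 :: "real \<Rightarrow> real" where "cutoff1 y = - 12 * y ^ 3 * (1 - y ^ 4)\<^sup>2"
definition cutoff2 :: "real \<Rightarrow> real" where
  "cutoff2 y = - 36 * y\<^sup>2 * (1 - y ^ 4)\<^sup>2 + 96 * y ^ 6 * (1 - y ^ 4)"

lemma cutoff_deriv: "(cutoff has_real_derivative cutoff1 y) (at y)"
  unfolding cutoff_def[abs_def] cutoff1_def by (auto intro!: derivative_eq_intros)

lemma cutoff1_deriv: "(cutoff1 has_real_derivative cutoff2 y) (at y)"
  unfolding cutoff1_def[abs_def] cutoff2_def
  by (auto intro!: derivative_eq_intros simp: algebra_simps eval_nat_numeral)

lemma cutoff_bounds:
  assumes "\<bar>y\<bar> \<le> 1"
  shows "\<bar>cutoff y\<bar> \<le> 1" "\<bar>cutoff1 y\<bar> \<le> 12 * \<bar>y\<bar> ^ 3" "\<bar>cutoff2 y\<bar> \<le> 132 * y\<^sup>2" "1 - cutoff y \<le> 3 * \<bar>y\<bar>"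
proof -
  define z where "z = y ^ 4"
  have z: "0 \<le> z" "z \<le> 1" "z \<le> \<bar>y\<bar>"
  proof -
    show "0 \<le> z" by (simp add: z_def)
    have "\<bar>y\<bar> ^ 4 \<le> \<bar>y\<bar> ^ 1" by (rule power_decreasing) (use assms in auto)
    then show "z \<le> \<bar>y\<bar>" by (simp add: z_def)
    then show "z \<le> 1" using assms by simp
  qed
  show "\<bar>cutoff y\<bar> \<le> 1" using z
    by (auto simp: cutoff_def z_def[symmetric] power_le_one)
  have "(1 - z)\<^sup>2 \<le> 1" using z by (simp add: power_le_one)
  then have "\<bar>y\<bar> ^ 3 * (1 - z)\<^sup>2 \<le> \<bar>y\<bar> ^ 3 * 1" by (intro mult_left_mono) auto
  then show "\<bar>cutoff1 y\<bar> \<le> 12 * \<bar>y\<bar> ^ 3"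
    by (simp add: cutoff1_def abs_mult power_abs z_def)
  have "cutoff2 y = y\<^sup>2 * (- 36 * (1 - z)\<^sup>2 + 96 * (z * (1 - z)))"
    by (simp add: cutoff2_def z_def algebra_simps eval_nat_numeral)
  moreover have "\<bar>- 36 * (1 - z)\<^sup>2 + 96 * (z * (1 - z))\<bar> \<le> 132"
  proof -
    have "0 \<le> (1 - z)\<^sup>2" "0 \<le> z * (1 - z)" "z * (1 - z) \<le> 1"
      using z by (auto intro!: mult_le_one)
    with \<open>(1 - z)\<^sup>2 \<le> 1\<close> show ?thesis by linarith
  qed
  ultimately show "\<bar>cutoff2 y\<bar> \<le> 132 * y\<^sup>2"
    by (simp add: abs_mult mult.commute mult_left_mono)
  have "1 - (1 - z) ^ 3 \<le> 3 * z"
    using z Bernoulli_inequality[of "- z" 3] by simp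
  then show "1 - cutoff y \<le> 3 * \<bar>y\<bar>" using z unfolding cutoff_def z_def[symmetric] by linarith
qed

section \<open>Gaussian bounds through an integrable majorant\<close>

definition poisson :: "real \<Rightarrow> real \<Rightarrow> real" where "poisson \<tau> y = sqrt \<tau> / (\<tau> + y\<^sup>2)"

text \<open>\<open>poisson \<tau>\<close> is \<open>pi\<close> times the Poisson kernel of the half
  plane at height \<open>sqrt \<tau>\<close>. It serves as majorant for the Gaussians because its
  primitive is an arctangent, which bounds its mass by \<open>pi\<close> for every
  \<open>\<tau>\<close>.\<close>

lemma poisson_integral:
  assumes "\<tau> > 0"
  shows "poisson \<tau> integrable_on {-1..1}" "integral {-1..1} (poisson \<tau>) \<le> pi"
proof -
  have "(poisson \<tau> has_integral (arctan (1 / sqrt \<tau>) - arctan ((-1) / sqrt \<tau>))) {-1..1}"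
  proof (rule fundamental_theorem_of_calculus)
    fix y :: real assume "y \<in> {-1..1}"
    have "((\<lambda>y. arctan (y / sqrt \<tau>)) has_real_derivative inverse (1 + (y / sqrt \<tau>)\<^sup>2) * (1 / sqrt \<tau>)) (at y within {-1..1})"
      using assms by (auto intro!: derivative_eq_intros simp: divide_inverse)
    moreover have "inverse (1 + (y / sqrt \<tau>)\<^sup>2) * (1 / sqrt \<tau>) = poisson \<tau> y"
    proof -
      define s where "s = sqrt \<tau>"
      have s: "s > 0" "\<tau> = s\<^sup>2" using assms by (auto simp: s_def)
      have "s\<^sup>2 + y\<^sup>2 > 0" using s(1) by (simp add: add_pos_nonneg)
      then show ?thesis using s(1) unfolding poisson_def s_def[symmetric] unfolding s(2)
        by (simp add: field_simps power2_eq_square)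
    qed
    ultimately show "((\<lambda>y. arctan (y / sqrt \<tau>)) has_vector_derivative poisson \<tau> y) (at y within {-1..1})"
      by (simp add: has_real_derivative_iff_has_vector_derivative)
  qed simp
  moreover have "arctan (1 / sqrt \<tau>) - arctan ((-1) / sqrt \<tau>) \<le> pi"
    using arctan_bounded[of "1 / sqrt \<tau>"] arctan_bounded[of "(-1) / sqrt \<tau>"] by linarith
  ultimately show "poisson \<tau> integrable_on {-1..1}" "integral {-1..1} (poisson \<tau>) \<le> pi"
    by (auto simp: has_integral_iff)
qed

lemma integral_le_poisson:
  assumes "\<tau> > 0" "c \<ge> 0" "g integrable_on {-1..1}" "\<And>y. \<bar>y\<bar> \<le> 1 \<Longrightarrow> g y \<le> c * poisson \<tau> y"
  shows "integral {-1..1} g \<le> c * pi"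
proof -
  have "integral {-1..1} g \<le> integral {-1..1} (\<lambda>y. c * poisson \<tau> y)"
    using assms poisson_integral(1)[OF assms(1)]
    by (intro integral_le integrable_on_mult_right) (auto simp: abs_le_iff)
  also have "\<dots> \<le> c * pi"
    using poisson_integral(2)[OF assms(1)] assms(2) by (simp add: mult_left_mono)
  finally show ?thesis .
qed

text \<open>The exponent 5 is 4 + 1: one factor \<open>1 + z\<close> converts
  \<open>1 / sqrt \<tau>\<close> into the Poisson kernel, the other four pay for polynomial factors
  in \<open>z = y\<^sup>2 / \<tau>\<close>. The bound is the fifth power of
  \<open>c * (1 + z) \<le> exp (k / 5 * z)\<close>.\<close>

lemma exp_decay_power_bound:
  fixes k :: real
  assumes "k > 0"
  obtains C where "C > 0" "\<And>z. z \<ge> 0 \<Longrightarrow> (1 + z) ^ 5 * exp (- (k * z)) \<le> C"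
proof -
  define c where "c = min 1 (k / 5)"
  have c: "0 < c" "c \<le> 1" "c \<le> k / 5" using assms by (auto simp: c_def)
  have "(1 + z) ^ 5 * exp (- (k * z)) \<le> 1 / c ^ 5" if "z \<ge> 0" for z
  proof -
    have "c * (1 + z) \<le> 1 + (k / 5) * z"
      using c that mult_right_mono[OF c(3) that] by (simp add: algebra_simps)
    also have "\<dots> \<le> exp (k / 5 * z)" by (rule exp_ge_add_one_self)
    finally have "(c * (1 + z)) ^ 5 \<le> exp (k / 5 * z) ^ 5"
      using c that by (intro power_mono) auto
    also have "\<dots> = exp (k * z)" by (simp add: exp_of_nat_mult[symmetric])
    finally have "c ^ 5 * (1 + z) ^ 5 * exp (- (k * z)) \<le> 1"
      unfolding power_mult_distrib by (simp add: exp_minus field_simps)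
    then show ?thesis using c by (simp add: field_simps)
  qed
  with c show ?thesis by (intro that[of "1 / c ^ 5"]) auto
qed

text \<open>Every expression is a polynomial in \<open>z = y\<^sup>2 / \<tau>\<close> times a power
  of \<open>\<tau>\<close> times the kernel. The last two bounds are the point of the cutoff: where
  a derivative falls on it, the flatness at 0 gains a full factor \<open>\<tau>\<close>, so the
  cutoff terms are never singular, not even after a time derivative.\<close>

lemma heat_kernel_bounds:
  assumes k: "k > 0"
  obtains C where "C \<ge> 1"
    "\<And>\<tau> y. \<tau> > 0 \<Longrightarrow> \<bar>y\<bar> \<le> 1 \<Longrightarrow> \<bar>cutoff y * heat_kernel k \<tau> y\<bar> \<le> C * poisson \<tau> y"
    "\<And>\<tau> y. \<tau> > 0 \<Longrightarrow> \<bar>y\<bar> \<le> 1 \<Longrightarrow> \<bar>y\<bar> * heat_kernel k \<tau> y \<le> C * sqrt \<tau> * poisson \<tau> y"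
    "\<And>\<tau> y. \<tau> > 0 \<Longrightarrow> \<bar>y\<bar> \<le> 1 \<Longrightarrow> \<bar>cutoff y * heat_kernel_t k \<tau> y\<bar> \<le> C / \<tau> * poisson \<tau> y"
    "\<And>\<tau> y. \<tau> > 0 \<Longrightarrow> \<bar>y\<bar> \<le> 1 \<Longrightarrow>
       \<bar>cutoff2 y * heat_kernel k \<tau> y + 2 * cutoff1 y * heat_kernel_y k \<tau> y\<bar> \<le> C * \<tau> * poisson \<tau> y"
    "\<And>\<tau> y. \<tau> > 0 \<Longrightarrow> \<bar>y\<bar> \<le> 1 \<Longrightarrow>
       \<bar>cutoff2 y * heat_kernel_t k \<tau> y + 2 * cutoff1 y * heat_kernel_ty k \<tau> y\<bar> \<le> C * poisson \<tau> y"
proof -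
  obtain C0 where C0: "C0 > 0" "\<And>z. z \<ge> 0 \<Longrightarrow> (1 + z) ^ 5 * exp (- (k * z)) \<le> C0"
    using exp_decay_power_bound[OF k] by blast
  define C where "C = 1 + C0 + C0 * (132 * (k + 1) + 48 * k * (k + 2)) + C0 * (132 + 48 * k)"
  have main: "(1 + y\<^sup>2 / \<tau>) ^ 4 * heat_kernel k \<tau> y \<le> C0 * poisson \<tau> y" if t: "\<tau> > 0" for \<tau> y
  proof -
    define z where "z = y\<^sup>2 / \<tau>"
    have z: "z \<ge> 0" using t by (simp add: z_def)
    have 1: "poisson \<tau> y = 1 / (sqrt \<tau> * (1 + z))"
    proof -
      have "sqrt \<tau> * (1 + z) = (\<tau> + y\<^sup>2) / sqrt \<tau>"
        using t unfolding z_def by (simp add: field_simps)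
      then show ?thesis by (simp add: poisson_def)
    qed
    have 2: "heat_kernel k \<tau> y = exp (- (k * z)) / sqrt \<tau>"
      by (simp add: heat_kernel_def z_def)
    have 3: "(1 + z) ^ 5 = (1 + z) ^ 4 * (1 + z)" by (simp add: eval_nat_numeral)
    have "(1 + z) ^ 4 * heat_kernel k \<tau> y = ((1 + z) ^ 5 * exp (- (k * z))) * poisson \<tau> y"
      using z t unfolding 1 2 3 by (simp add: divide_simps)
    also have "\<dots> \<le> C0 * poisson \<tau> y"
      using C0(2)[OF z] t by (intro mult_right_mono) (auto simp: poisson_def add_pos_nonneg)
    finally show ?thesis by (simp add: z_def)
  qed
  have pw: "z ^ i \<le> (1 + z) ^ 4" if "z \<ge> 0" "i \<le> 4" for z :: real and i
  proof -
    have "z ^ i \<le> (1 + z) ^ i" using that by (intro power_mono) auto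
    also have "\<dots> \<le> (1 + z) ^ 4" using that by (intro power_increasing) auto
    finally show ?thesis .
  qed
  have Gp: "heat_kernel k \<tau> y \<ge> 0" "poisson \<tau> y \<ge> 0" if "\<tau> > 0" for \<tau> y
    using that by (auto simp: heat_kernel_def poisson_def add_nonneg_nonneg)
  have C: "C \<ge> 1" "C0 \<le> C" "C0 * (k + 1) \<le> C" "C0 * (132 * (k + 1) + 48 * k * (k + 2)) \<le> C"
      "C0 * (132 + 48 * k) \<le> C"
    using C0(1) k by (auto simp: C_def algebra_simps)
  \<comment> \<open>\<open>w\<close> stands for the scale of the bound (1,
    \<open>sqrt \<tau>\<close>, \<open>1 / \<tau>\<close> or \<open>\<tau>\<close>) and
    \<open>c\<close> for the polynomial coefficient; the five claims are instances.\<close>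
  have step: "X \<le> C * w * poisson \<tau> y"
    if "\<tau> > 0" "w \<ge> 0" "X \<le> c * w * ((1 + y\<^sup>2 / \<tau>) ^ 4 * heat_kernel k \<tau> y)" "c \<ge> 0" "C0 * c \<le> C" for X w c \<tau> y
  proof -
    note that(3)
    also have "c * w * ((1 + y\<^sup>2 / \<tau>) ^ 4 * heat_kernel k \<tau> y) \<le> c * w * (C0 * poisson \<tau> y)"
      using main[OF that(1)] that by (intro mult_left_mono) auto
    also have "\<dots> = C0 * c * (w * poisson \<tau> y)" by simp
    also have "\<dots> \<le> C * (w * poisson \<tau> y)" using that Gp(2)[OF that(1)] by (intro mult_right_mono) auto
    finally show ?thesis by simp
  qed
  show ?thesis
  proof (rule that[OF C(1)])
    fix \<tau> y :: real assume t: "\<tau> > 0" and y: "\<bar>y\<bar> \<le> 1"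
    define z where "z = y\<^sup>2 / \<tau>"
    define G where "G = heat_kernel k \<tau> y"
    have z: "z \<ge> 0" using t by (simp add: z_def)
    have G: "G \<ge> 0" using Gp(1)[OF t] by (simp add: G_def)
    have y2: "y\<^sup>2 = \<tau> * z" using t by (simp add: z_def)
    have ky: "k * y\<^sup>2 / \<tau>\<^sup>2 = k * z / \<tau>" using t unfolding y2 by (simp add: power2_eq_square)
    note cb = cutoff_bounds[OF y]
    have "\<bar>cutoff y * G\<bar> \<le> 1 * 1 * ((1 + z) ^ 4 * G)"
    proof -
      have "\<bar>cutoff y * G\<bar> \<le> 1 * G" unfolding abs_mult using cb(1) G by (intro mult_mono) auto
      also have "\<dots> \<le> (1 + z) ^ 4 * G" using pw[OF z, of 0] G by (intro mult_right_mono) auto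
      finally show ?thesis by simp
    qed
    from step[OF t _ this[unfolded z_def G_def]] C
    show "\<bar>cutoff y * heat_kernel k \<tau> y\<bar> \<le> C * poisson \<tau> y" by simp
    have "\<bar>y\<bar> * G \<le> 1 * sqrt \<tau> * ((1 + z) ^ 4 * G)"
    proof -
      have "\<bar>y\<bar> = sqrt \<tau> * sqrt z" using y2 by (metis real_sqrt_abs real_sqrt_mult)
      also have "\<dots> \<le> sqrt \<tau> * (1 + z) ^ 4"
      proof -
        have "sqrt z \<le> 1 + z" using z by (intro real_le_lsqrt) (auto simp: power2_eq_square algebra_simps)
        also have "\<dots> \<le> (1 + z) ^ 4" using power_increasing[of 1 4 "1 + z"] z by simp
        finally show ?thesis using t by (intro mult_left_mono) auto
      qed
      finally have "\<bar>y\<bar> * G \<le> sqrt \<tau> * (1 + z) ^ 4 * G" using G by (rule mult_right_mono)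
      then show ?thesis by (simp add: mult.assoc)
    qed
    from step[OF t _ this[unfolded z_def G_def]] C t
    show "\<bar>y\<bar> * heat_kernel k \<tau> y \<le> C * sqrt \<tau> * poisson \<tau> y" by simp
    have Gt: "\<bar>heat_kernel_t k \<tau> y\<bar> \<le> (k + 1) * (1 + z) * G / \<tau>"
    proof -
      have "heat_kernel_t k \<tau> y = G * (k * z - 1 / 2) / \<tau>"
        using t unfolding heat_kernel_t_def G_def[symmetric] ky by (simp add: field_simps)
      moreover have "\<bar>k * z - 1 / 2\<bar> \<le> (k + 1) * (1 + z)"
      proof -
        have "0 \<le> k * z" using k z by simp
        moreover have "(k + 1) * (1 + z) = k * z + k + z + 1" by (simp add: algebra_simps)
        ultimately show ?thesis using k z by linarith
      qed
      ultimately show ?thesis using G t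
        by (simp add: abs_mult divide_right_mono mult.commute[of G] mult_right_mono)
    qed
    have "\<bar>cutoff y * heat_kernel_t k \<tau> y\<bar> \<le> (k + 1) * (1 / \<tau>) * ((1 + z) ^ 4 * G)"
    proof -
      have "\<bar>cutoff y * heat_kernel_t k \<tau> y\<bar> \<le> 1 * \<bar>heat_kernel_t k \<tau> y\<bar>"
        using cb(1) unfolding abs_mult by (intro mult_right_mono) auto
      also have "\<dots> \<le> (k + 1) * (1 + z) * G / \<tau>" using Gt by simp
      also have "\<dots> \<le> (k + 1) * (1 + z) ^ 4 * G / \<tau>"
        using power_increasing[of 1 4 "1 + z"] z k G t
        by (intro divide_right_mono mult_right_mono mult_left_mono) auto
      finally show ?thesis by (simp add: mult.assoc)
    qed
    from step[OF t _ this[unfolded z_def G_def]] C t k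
    show "\<bar>cutoff y * heat_kernel_t k \<tau> y\<bar> \<le> C / \<tau> * poisson \<tau> y" by simp
    \<comment> \<open>The origin of the gain: \<open>y\<^sup>2\<close> equals
      \<open>\<tau> * z\<close>, and \<open>z\<close> is absorbed by the exponential.\<close>
    have c2: "\<bar>cutoff2 y\<bar> \<le> 132 * \<tau> * z" using cb(3) y2 by simp
    have "\<bar>cutoff2 y * G + 2 * cutoff1 y * heat_kernel_y k \<tau> y\<bar> \<le> (132 + 48 * k) * \<tau> * ((1 + z) ^ 4 * G)"
    proof -
      have 1: "\<bar>cutoff2 y * G\<bar> \<le> 132 * \<tau> * (z * G)"
        using mult_right_mono[OF c2 G] G by (simp add: abs_mult mult.assoc)
      have hy: "\<bar>heat_kernel_y k \<tau> y\<bar> = 2 * k * (\<bar>y\<bar> / \<tau>) * G"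
        using t k G by (simp add: heat_kernel_y_def abs_mult G_def)
      have "\<bar>cutoff1 y * heat_kernel_y k \<tau> y\<bar> \<le> (12 * \<bar>y\<bar> ^ 3) * (2 * k * (\<bar>y\<bar> / \<tau>) * G)"
        using cb(2) unfolding abs_mult hy using k t G by (intro mult_right_mono) auto
      also have "\<dots> = 24 * k * (y\<^sup>2 * y\<^sup>2 / \<tau>) * G"
        using t by (simp add: field_simps power2_eq_square eval_nat_numeral)
      also have "\<dots> = 24 * k * \<tau> * (z ^ 2 * G)"
        using t unfolding y2 by (simp add: power2_eq_square)
      finally have 2: "\<bar>cutoff1 y * heat_kernel_y k \<tau> y\<bar> \<le> 24 * k * \<tau> * (z ^ 2 * G)" .
      have 3: "z * G \<le> (1 + z) ^ 4 * G" "z ^ 2 * G \<le> (1 + z) ^ 4 * G"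
        using pw[OF z, of 1] pw[OF z, of 2] G by (auto intro: mult_right_mono)
      have "132 * \<tau> * (z * G) \<le> 132 * \<tau> * ((1 + z) ^ 4 * G)" 
        "24 * k * \<tau> * (z ^ 2 * G) \<le> 24 * k * \<tau> * ((1 + z) ^ 4 * G)"
        using 3 k t by (auto intro!: mult_left_mono)
      with 1 2 show ?thesis unfolding abs_le_iff by (simp add: algebra_simps)
    qed
    from step[OF t _ this[unfolded z_def G_def]] C t k
    show "\<bar>cutoff2 y * heat_kernel k \<tau> y + 2 * cutoff1 y * heat_kernel_y k \<tau> y\<bar> \<le> C * \<tau> * poisson \<tau> y"
      by simp
    have "\<bar>cutoff2 y * heat_kernel_t k \<tau> y + 2 * cutoff1 y * heat_kernel_ty k \<tau> y\<bar>
        \<le> (132 * (k + 1) + 48 * k * (k + 2)) * 1 * ((1 + z) ^ 4 * G)"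
    proof -
      have "\<bar>cutoff2 y * heat_kernel_t k \<tau> y\<bar> \<le> (132 * \<tau> * z) * ((k + 1) * (1 + z) * G / \<tau>)"
        unfolding abs_mult using c2 Gt t z by (intro mult_mono) auto
      also have "\<dots> = 132 * (k + 1) * ((z * (1 + z)) * G)" using t by simp
      also have "\<dots> \<le> 132 * (k + 1) * ((1 + z) ^ 4 * G)"
      proof -
        have "z * (1 + z) \<le> (1 + z) * (1 + z)" using z by (intro mult_right_mono) auto
        also have "\<dots> \<le> (1 + z) ^ 4" using power_increasing[of 2 4 "1 + z"] z by (simp add: power2_eq_square)
        finally show ?thesis using k G by (intro mult_left_mono mult_right_mono) auto
      qed
      finally have 1: "\<bar>cutoff2 y * heat_kernel_t k \<tau> y\<bar> \<le> 132 * (k + 1) * ((1 + z) ^ 4 * G)" .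
      have e: "heat_kernel_ty k \<tau> y = 2 * k * (y / \<tau>\<^sup>2) * (3 / 2 - k * z) * G"
        using t unfolding heat_kernel_ty_def G_def[symmetric] ky by (simp add: field_simps power2_eq_square)
      have hy: "\<bar>heat_kernel_ty k \<tau> y\<bar> = 2 * k * (\<bar>y\<bar> / \<tau>\<^sup>2) * \<bar>3 / 2 - k * z\<bar> * G"
        unfolding e using t k G by (simp add: abs_mult)
      have "\<bar>cutoff1 y * heat_kernel_ty k \<tau> y\<bar> \<le> (12 * \<bar>y\<bar> ^ 3) * (2 * k * (\<bar>y\<bar> / \<tau>\<^sup>2) * \<bar>3 / 2 - k * z\<bar> * G)"
        using cb(2) unfolding abs_mult hy using k t G by (intro mult_right_mono) auto
      also have "\<dots> = 24 * k * (y\<^sup>2 * y\<^sup>2 / \<tau>\<^sup>2) * (\<bar>3 / 2 - k * z\<bar> * G)"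
        using t by (simp add: field_simps power2_eq_square eval_nat_numeral)
      also have "\<dots> = 24 * k * ((z ^ 2 * \<bar>3 / 2 - k * z\<bar>) * G)"
        using t unfolding y2 by (simp add: power2_eq_square)
      also have "\<dots> \<le> 24 * k * ((k + 2) * (1 + z) ^ 4 * G)"
      proof -
        have "\<bar>3 / 2 - k * z\<bar> \<le> (k + 2) * (1 + z)"
        proof -
          have "0 \<le> k * z" using k z by simp
          moreover have "(k + 2) * (1 + z) = k * z + k + 2 * z + 2" by (simp add: algebra_simps)
          ultimately show ?thesis using k z by linarith
        qed
        then have "z ^ 2 * \<bar>3 / 2 - k * z\<bar> \<le> z ^ 2 * ((k + 2) * (1 + z))" by (intro mult_left_mono) auto
        also have "\<dots> \<le> (1 + z) ^ 2 * ((k + 2) * (1 + z))"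
          using z k by (intro mult_right_mono power_mono) auto
        also have "\<dots> = (k + 2) * (1 + z) ^ 3" by (simp add: eval_nat_numeral)
        also have "\<dots> \<le> (k + 2) * (1 + z) ^ 4" using power_increasing[of 3 4 "1 + z"] z k by (intro mult_left_mono) auto
        finally show ?thesis using k G by (intro mult_left_mono mult_right_mono) auto
      qed
      finally have 2: "\<bar>cutoff1 y * heat_kernel_ty k \<tau> y\<bar> \<le> 24 * k * ((k + 2) * (1 + z) ^ 4 * G)" .
      from 1 2 show ?thesis unfolding abs_le_iff by (simp add: algebra_simps)
    qed
    from step[OF t _ this[unfolded z_def G_def]] C t k
    show "\<bar>cutoff2 y * heat_kernel_t k \<tau> y + 2 * cutoff1 y * heat_kernel_ty k \<tau> y\<bar> \<le> C * poisson \<tau> y"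
      by simp
  qed
qed

section \<open>Weak form of the heat equation and the cut-off kernel\<close>

definition test_function :: "(real \<Rightarrow> real) \<Rightarrow> (real \<Rightarrow> real) \<Rightarrow> (real \<Rightarrow> real) \<Rightarrow> bool" where
  "test_function \<theta> \<theta>1 \<theta>2 \<longleftrightarrow>
     (\<forall>y. (\<theta> has_real_derivative \<theta>1 y) (at y)) \<and> (\<forall>y. (\<theta>1 has_real_derivative \<theta>2 y) (at y)) \<and>
     continuous_on {-1..1} \<theta>2 \<and> \<theta> (-1) = 0 \<and> \<theta> 1 = 0 \<and> \<theta>1 (-1) = 0 \<and> \<theta>1 1 = 0"

text \<open>The integral of \<open>(W_t - W_yy / (4 * k)) * \<theta>\<close> with both y-derivatives
  moved to the test function, which vanishes to first order at both ends. The weak form is used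
  because the oddly reflected function to which it is applied need not be twice differentiable at
  the reflection point.\<close>

definition weak_form ::
  "real \<Rightarrow> (real \<Rightarrow> real \<Rightarrow> real) \<Rightarrow> (real \<Rightarrow> real \<Rightarrow> real) \<Rightarrow> real \<Rightarrow> (real \<Rightarrow> real) \<Rightarrow> (real \<Rightarrow> real) \<Rightarrow> real" where
  "weak_form k W Wt t \<theta> \<theta>2 = integral {-1..1} (\<lambda>y. Wt y t * \<theta> y - W y t * \<theta>2 y / (4 * k))"

lemma has_derivative_bound_of_lipschitz:
  fixes g :: "real \<Rightarrow> real"
  assumes "T > 0" "t \<in> {0..T}" "(g has_real_derivative g') (at t within {0..T})"
    and "\<And>s. s \<in> {0..T} \<Longrightarrow> \<bar>g s - g t\<bar> \<le> B * \<bar>s - t\<bar>"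
  shows "\<bar>g'\<bar> \<le> B"
proof (rule tendsto_upperbound)
  show "((\<lambda>s. \<bar>(g s - g t) / (s - t)\<bar>) \<longlongrightarrow> \<bar>g'\<bar>) (at t within {0..T})"
    using assms(3) unfolding has_field_derivative_iff by (rule tendsto_rabs)
  show "\<forall>\<^sub>F s in at t within {0..T}. \<bar>(g s - g t) / (s - t)\<bar> \<le> B"
    unfolding eventually_at_filter using assms(4)
    by (intro always_eventually) (auto simp: divide_le_eq)
  show "at t within {0..T} \<noteq> bot"
    using assms(1,2) by (simp add: at_within_Icc_at trivial_limit_within islimpt_Icc)
qed

definition cut_kernel where "cut_kernel k \<tau> y = cutoff y * heat_kernel k \<tau> y"
definition cut_kernel1 where "cut_kernel1 k \<tau> y = cutoff1 y * heat_kernel k \<tau> y + cutoff y * heat_kernel_y k \<tau> y"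
text \<open>The commutator of the cutoff with the heat operator: what remains of the second
  y-derivative of \<open>cut_kernel\<close> after subtracting
  \<open>4 * k * cut_kernel_t\<close>.\<close>

definition cut_rest where
  "cut_rest k \<tau> y = cutoff2 y * heat_kernel k \<tau> y + 2 * cutoff1 y * heat_kernel_y k \<tau> y"
definition cut_kernel_t where "cut_kernel_t k \<tau> y = cutoff y * heat_kernel_t k \<tau> y"
definition cut_kernel_t1 where
  "cut_kernel_t1 k \<tau> y = cutoff1 y * heat_kernel_t k \<tau> y + cutoff y * heat_kernel_ty k \<tau> y"
definition cut_kernel_tt where "cut_kernel_tt k \<tau> y = cutoff y * heat_kernel_tt k \<tau> y"
definition cut_rest_t where
  "cut_rest_t k \<tau> y = cutoff2 y * heat_kernel_t k \<tau> y + 2 * cutoff1 y * heat_kernel_ty k \<tau> y"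

lemma cut_kernel_deriv_t:
  assumes "\<tau> > 0"
  shows "((\<lambda>\<tau>. cut_kernel k \<tau> y) has_real_derivative cut_kernel_t k \<tau> y) (at \<tau>)"
    "((\<lambda>\<tau>. cut_kernel_t k \<tau> y) has_real_derivative cut_kernel_tt k \<tau> y) (at \<tau>)"
    "((\<lambda>\<tau>. cut_rest k \<tau> y) has_real_derivative cut_rest_t k \<tau> y) (at \<tau>)"
  unfolding cut_kernel_def cut_kernel_t_def cut_kernel_tt_def cut_rest_def cut_rest_t_def
  using assms
  by (auto intro!: derivative_eq_intros heat_kernel_deriv_t heat_kernel_t_deriv_t heat_kernel_y_deriv_t)

lemma continuous_cut_kernel:
  assumes "continuous_on S p" "continuous_on S q" "\<And>x. x \<in> S \<Longrightarrow> p x > 0"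
  shows "continuous_on S (\<lambda>x. cut_kernel k (p x) (q x))" "continuous_on S (\<lambda>x. cut_kernel_t k (p x) (q x))"
    "continuous_on S (\<lambda>x. cut_kernel_tt k (p x) (q x))" "continuous_on S (\<lambda>x. cut_rest k (p x) (q x))"
    "continuous_on S (\<lambda>x. cut_rest_t k (p x) (q x))" "continuous_on S (\<lambda>x. heat_kernel k (p x) (q x))"
proof -
  have nz: "\<And>x. x \<in> S \<Longrightarrow> p x \<noteq> 0" "\<And>x. x \<in> S \<Longrightarrow> sqrt (p x) \<noteq> 0" using assms(3) by force+
  show "continuous_on S (\<lambda>x. cut_kernel k (p x) (q x))" "continuous_on S (\<lambda>x. cut_kernel_t k (p x) (q x))"
    "continuous_on S (\<lambda>x. cut_kernel_tt k (p x) (q x))" "continuous_on S (\<lambda>x. cut_rest k (p x) (q x))"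
    "continuous_on S (\<lambda>x. cut_rest_t k (p x) (q x))" "continuous_on S (\<lambda>x. heat_kernel k (p x) (q x))"
    unfolding cut_kernel_def cut_kernel_t_def cut_kernel_tt_def cut_rest_def cut_rest_t_def
      heat_kernel_def heat_kernel_t_def heat_kernel_tt_def heat_kernel_y_def heat_kernel_ty_def
      cutoff_def cutoff1_def cutoff2_def
    by (intro continuous_intros assms ballI; use nz in force)+
qed

lemma test_function_cut_kernel:
  assumes "\<tau> > 0"
  shows "test_function (cut_kernel k \<tau>) (cut_kernel1 k \<tau>)
           (\<lambda>y. cut_rest k \<tau> y + 4 * k * cut_kernel_t k \<tau> y)"
  unfolding test_function_def
proof (intro conjI allI)
  fix y
  show "(cut_kernel k \<tau> has_real_derivative cut_kernel1 k \<tau> y) (at y)"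
    unfolding cut_kernel_def[abs_def] cut_kernel1_def
    by (auto intro!: derivative_eq_intros cutoff_deriv heat_kernel_deriv_y assms)
  show "(cut_kernel1 k \<tau> has_real_derivative cut_rest k \<tau> y + 4 * k * cut_kernel_t k \<tau> y) (at y)"
    unfolding cut_kernel1_def[abs_def] cut_rest_def cut_kernel_t_def
    by (auto intro!: derivative_eq_intros cutoff_deriv cutoff1_deriv heat_kernel_deriv_y
        heat_kernel_y_deriv_y assms simp: algebra_simps)
  show "continuous_on {-1..1} (\<lambda>y. cut_rest k \<tau> y + 4 * k * cut_kernel_t k \<tau> y)"
    using assms by (intro continuous_intros continuous_cut_kernel) auto
qed (auto simp: cut_kernel_def cut_kernel1_def cutoff_def cutoff1_def)

lemma test_function_cut_kernel_t:
  assumes "\<tau> > 0"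
  shows "test_function (cut_kernel_t k \<tau>) (cut_kernel_t1 k \<tau>)
           (\<lambda>y. cut_rest_t k \<tau> y + 4 * k * cut_kernel_tt k \<tau> y)"
  unfolding test_function_def
proof (intro conjI allI)
  fix y
  show "(cut_kernel_t k \<tau> has_real_derivative cut_kernel_t1 k \<tau> y) (at y)"
    unfolding cut_kernel_t_def[abs_def] cut_kernel_t1_def
    by (auto intro!: derivative_eq_intros cutoff_deriv heat_kernel_t_deriv_y assms)
  show "(cut_kernel_t1 k \<tau> has_real_derivative cut_rest_t k \<tau> y + 4 * k * cut_kernel_tt k \<tau> y) (at y)"
    unfolding cut_kernel_t1_def[abs_def] cut_rest_t_def cut_kernel_tt_def
    by (auto intro!: derivative_eq_intros cutoff_deriv cutoff1_deriv heat_kernel_t_deriv_y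
        heat_kernel_ty_deriv_y assms simp: algebra_simps)
  show "continuous_on {-1..1} (\<lambda>y. cut_rest_t k \<tau> y + 4 * k * cut_kernel_tt k \<tau> y)"
    using assms by (intro continuous_intros continuous_cut_kernel) auto
qed (auto simp: cut_kernel_t_def cut_kernel_t1_def cutoff_def cutoff1_def)

lemma abs_integral_le_poisson:
  assumes "\<tau> > 0" "c \<ge> 0" "continuous_on {-1..1} g" "\<And>y. \<bar>y\<bar> \<le> 1 \<Longrightarrow> \<bar>g y\<bar> \<le> c * poisson \<tau> y"
  shows "integral {-1..1} (\<lambda>y. \<bar>g y\<bar>) \<le> c * pi" "\<bar>integral {-1..1} g\<bar> \<le> c * pi"
proof -
  have c: "(\<lambda>y. \<bar>g y\<bar>) integrable_on {-1..1}"
    using assms by (intro integrable_continuous_interval continuous_intros)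
  show 1: "integral {-1..1} (\<lambda>y. \<bar>g y\<bar>) \<le> c * pi"
    by (rule integral_le_poisson[OF assms(1,2) c assms(4)])
  have "norm (integral {-1..1} g) \<le> integral {-1..1} (\<lambda>y. \<bar>g y\<bar>)"
    by (rule integral_norm_bound_integral[OF integrable_continuous_interval[OF assms(3)] c]) simp
  with 1 show "\<bar>integral {-1..1} g\<bar> \<le> c * pi" by simp
qed

text \<open>On \<open>\<bar>y\<bar> \<le> sqrt \<tau>\<close> the exponent is at least
  \<open>- k\<close>, and this interval has length \<open>2 * sqrt \<tau>\<close>. A lower bound
  uniform in \<open>\<tau>\<close> is all that is asked of the unnormalised kernel.\<close>

lemma heat_kernel_mass:
  assumes "k > 0" "0 < \<tau>" "\<tau> \<le> 1"
  shows "2 * exp (- k) \<le> integral {-1..1} (heat_kernel k \<tau>)"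
proof -
  have c: "continuous_on S (heat_kernel k \<tau>)" for S
    using assms continuous_cut_kernel(6)[of S "\<lambda>_. \<tau>" "\<lambda>y. y"] by (simp add: continuous_intros)
  have s: "0 < sqrt \<tau>" "sqrt \<tau> \<le> 1" using assms by auto
  have "2 * exp (- k) = integral {- sqrt \<tau>..sqrt \<tau>} (\<lambda>y. exp (- k) / sqrt \<tau>)"
    using s by simp
  also have "\<dots> \<le> integral {- sqrt \<tau>..sqrt \<tau>} (heat_kernel k \<tau>)"
  proof (rule integral_le)
    fix y assume "y \<in> {- sqrt \<tau>..sqrt \<tau>}"
    then have "\<bar>y\<bar> \<le> sqrt \<tau>" by auto
    then have "y\<^sup>2 \<le> \<tau>" using assms by (metis real_sqrt_abs real_sqrt_le_iff)
    then have "k * y\<^sup>2 / \<tau> \<le> k" using assms by (simp add: divide_le_eq)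
    then show "exp (- k) / sqrt \<tau> \<le> heat_kernel k \<tau> y"
      using s by (auto simp: heat_kernel_def intro!: divide_right_mono)
  qed (auto intro!: integrable_continuous_interval c continuous_intros)
  also have "\<dots> \<le> integral {-1..1} (heat_kernel k \<tau>)"
    using s assms by (intro integral_subset_le integrable_continuous_interval c) (auto simp: heat_kernel_def)
  finally show ?thesis .
qed

lemma continuous_on_slice:
  fixes W :: "real \<Rightarrow> real \<Rightarrow> 'a::topological_space"
  assumes "continuous_on (X \<times> Y) (\<lambda>(x, t). W x t)" "continuous_on S p" "continuous_on S q"
    "\<And>x. x \<in> S \<Longrightarrow> p x \<in> X" "\<And>x. x \<in> S \<Longrightarrow> q x \<in> Y"
  shows "continuous_on S (\<lambda>x. W (p x) (q x))"
  using continuous_on_compose2[OF assms(1) continuous_on_Pair[OF assms(2,3)]] assms(4,5) by auto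

text \<open>The bound \<open>M\<close> and the Hoelder bound \<open>H\<close> of the source are
  stated against test functions, in terms of their L1 norm. \<open>WL\<close> is qualitative: its
  constant may depend on \<open>t\<close> and on the solution, and it disappears in a limit, so the
  final estimate contains only \<open>S\<close>, \<open>M\<close> and \<open>H\<close>.\<close>

context
  fixes k T a S M H C :: real and W Wt :: "real \<Rightarrow> real \<Rightarrow> real"
  assumes k: "k > 0" and T: "T > 0" and a: "a > 0" and C: "C \<ge> 1" and MH: "M \<ge> 0" "H \<ge> 0"
    and kb: "\<And>\<tau> y. \<tau> > 0 \<Longrightarrow> \<bar>y\<bar> \<le> 1 \<Longrightarrow> \<bar>cut_kernel k \<tau> y\<bar> \<le> C * poisson \<tau> y"
      "\<And>\<tau> y. \<tau> > 0 \<Longrightarrow> \<bar>y\<bar> \<le> 1 \<Longrightarrow> \<bar>y\<bar> * heat_kernel k \<tau> y \<le> C * sqrt \<tau> * poisson \<tau> y"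
      "\<And>\<tau> y. \<tau> > 0 \<Longrightarrow> \<bar>y\<bar> \<le> 1 \<Longrightarrow> \<bar>cut_kernel_t k \<tau> y\<bar> \<le> C / \<tau> * poisson \<tau> y"
      "\<And>\<tau> y. \<tau> > 0 \<Longrightarrow> \<bar>y\<bar> \<le> 1 \<Longrightarrow> \<bar>cut_rest k \<tau> y\<bar> \<le> C * \<tau> * poisson \<tau> y"
      "\<And>\<tau> y. \<tau> > 0 \<Longrightarrow> \<bar>y\<bar> \<le> 1 \<Longrightarrow> \<bar>cut_rest_t k \<tau> y\<bar> \<le> C * poisson \<tau> y"
    and cW: "continuous_on ({-1..1} \<times> {0..T}) (\<lambda>(y, t). W y t)"
    and cWt: "continuous_on ({-1..1} \<times> {0..T}) (\<lambda>(y, t). Wt y t)"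
    and dW: "\<And>y t. y \<in> {-1..1} \<Longrightarrow> t \<in> {0..T} \<Longrightarrow> (W y has_real_derivative Wt y t) (at t within {0..T})"
    and W0: "\<And>y. y \<in> {-1..1} \<Longrightarrow> W y 0 = 0"
    and WS: "\<And>y t. y \<in> {-1..1} \<Longrightarrow> t \<in> {0..T} \<Longrightarrow> \<bar>W y t\<bar> \<le> S"
    and WL: "\<And>t. t \<in> {0..T} \<Longrightarrow> \<exists>l. \<forall>y\<in>{-1..1}. \<bar>W y t - W 0 t\<bar> \<le> l * \<bar>y\<bar>"
    and wM: "\<And>t \<theta> \<theta>1 \<theta>2. t \<in> {0..T} \<Longrightarrow> test_function \<theta> \<theta>1 \<theta>2 \<Longrightarrow>
       \<bar>weak_form k W Wt t \<theta> \<theta>2\<bar> \<le> M * integral {-1..1} (\<lambda>y. \<bar>\<theta> y\<bar>)"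
    and wH: "\<And>t s \<theta> \<theta>1 \<theta>2. t \<in> {0..T} \<Longrightarrow> s \<in> {0..T} \<Longrightarrow> s \<le> t \<Longrightarrow> test_function \<theta> \<theta>1 \<theta>2 \<Longrightarrow>
       \<bar>weak_form k W Wt s \<theta> \<theta>2 - weak_form k W Wt t \<theta> \<theta>2\<bar> \<le> H * (t - s) powr a * integral {-1..1} (\<lambda>y. \<bar>\<theta> y\<bar>)"
begin

lemmas cW' = continuous_on_slice[OF cW] and cWt' = continuous_on_slice[OF cWt]

private definition "cker2 \<tau> y = cut_rest k \<tau> y + 4 * k * cut_kernel_t k \<tau> y"
private definition "cker_t2 \<tau> y = cut_rest_t k \<tau> y + 4 * k * cut_kernel_tt k \<tau> y"

text \<open>The average of \<open>W\<close> at time \<open>t\<close> against a kernel of fixed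
  width. Its time derivative \<open>mollified'\<close> is bounded uniformly in
  \<open>\<eta>\<close>, so the limit \<open>\<eta> \<rightarrow> 0\<close> transfers a Lipschitz
  bound in time to the centre value, up to the kernel mass.\<close>

private definition "mollified \<eta> t = integral {-1..1} (\<lambda>y. W y t * cut_kernel k \<eta> y)"
private definition "mollified' \<eta> t = integral {-1..1} (\<lambda>y. Wt y t * cut_kernel k \<eta> y)"

private lemma cker_int:
  assumes "\<tau> > 0"
  shows "integral {-1..1} (\<lambda>y. \<bar>cut_kernel k \<tau> y\<bar>) \<le> C * pi"
    "integral {-1..1} (\<lambda>y. \<bar>cut_kernel_t k \<tau> y\<bar>) \<le> C / \<tau> * pi"
    "integral {-1..1} (\<lambda>y. \<bar>cut_rest k \<tau> y\<bar>) \<le> C * \<tau> * pi"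
    "integral {-1..1} (\<lambda>y. \<bar>cut_rest_t k \<tau> y\<bar>) \<le> C * pi"
  using assms C
  by (auto intro!: abs_integral_le_poisson(1)[OF assms] kb[OF assms] continuous_cut_kernel continuous_intros
      simp del: times_divide_eq_left times_divide_eq_right)

private lemma W_int:
  assumes "t \<in> {0..T}" "continuous_on {-1..1} g"
  shows "\<bar>integral {-1..1} (\<lambda>y. W y t * g y)\<bar> \<le> S * integral {-1..1} (\<lambda>y. \<bar>g y\<bar>)"
proof -
  have "norm (integral {-1..1} (\<lambda>y. W y t * g y)) \<le> integral {-1..1} (\<lambda>y. S * \<bar>g y\<bar>)"
    using assms WS
    by (intro integral_norm_bound_integral integrable_continuous_interval continuous_intros cW')
       (auto simp: abs_mult intro!: mult_right_mono)
  then show ?thesis by simp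
qed

private lemma S_nonneg: "S \<ge> 0" using WS[of 0 0] T by auto

text \<open>The kernel's second y-derivative is split into the cutoff part and \<open>4 * k\<close>
  times a time derivative. The first identity isolates the one dangerous term, \<open>W\<close>
  against \<open>cut_kernel_t\<close>. In the second the \<open>cut_kernel_tt\<close> terms cancel,
  which leaves only the source and the harmless cutoff part.\<close>

private lemma integrals_split:
  assumes "s \<in> {0..T}" "\<tau> > 0"
  shows "mollified' \<tau> s = weak_form k W Wt s (cut_kernel k \<tau>) (cker2 \<tau>)
      + integral {-1..1} (\<lambda>y. W y s * cut_rest k \<tau> y) / (4 * k)
      + integral {-1..1} (\<lambda>y. W y s * cut_kernel_t k \<tau> y)"
    "integral {-1..1} (\<lambda>y. Wt y s * cut_kernel_t k \<tau> y - W y s * cut_kernel_tt k \<tau> y) =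
      weak_form k W Wt s (cut_kernel_t k \<tau>) (cker_t2 \<tau>)
      + integral {-1..1} (\<lambda>y. W y s * cut_rest_t k \<tau> y) / (4 * k)"
proof -
  have i: "(\<lambda>y. W y s * g y) integrable_on {-1..1}" "(\<lambda>y. Wt y s * g y) integrable_on {-1..1}"
    if "continuous_on {-1..1} g" for g
    using that assms by (auto intro!: integrable_continuous_interval continuous_intros cW' cWt')

  have c: "continuous_on {-1..1} (cut_kernel k \<tau>)" "continuous_on {-1..1} (cut_kernel_t k \<tau>)"
    "continuous_on {-1..1} (cut_kernel_tt k \<tau>)" "continuous_on {-1..1} (cut_rest k \<tau>)"
    "continuous_on {-1..1} (cut_rest_t k \<tau>)" "continuous_on {-1..1} (cker2 \<tau>)" "continuous_on {-1..1} (cker_t2 \<tau>)"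
    unfolding cker2_def[abs_def] cker_t2_def[abs_def]
    using assms(2) by (auto intro!: continuous_cut_kernel continuous_intros)
  have w: "weak_form k W Wt s g h = integral {-1..1} (\<lambda>y. Wt y s * g y) - integral {-1..1} (\<lambda>y. W y s * h y) / (4 * k)"
    if "continuous_on {-1..1} g" "continuous_on {-1..1} h" for g h
    unfolding weak_form_def
    using i[OF that(1)] i[OF that(2)] by (subst integral_diff) (auto intro: integrable_on_divide)
  have e: "integral {-1..1} (\<lambda>y. W y s * (g y + 4 * k * h y)) =
      integral {-1..1} (\<lambda>y. W y s * g y) + 4 * k * integral {-1..1} (\<lambda>y. W y s * h y)"
    if "continuous_on {-1..1} g" "continuous_on {-1..1} h" for g h
  proof -
    have "integral {-1..1} (\<lambda>y. W y s * (g y + 4 * k * h y)) =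
       integral {-1..1} (\<lambda>y. W y s * g y + (4 * k) * (W y s * h y))" by (simp add: algebra_simps)
    also have "\<dots> = integral {-1..1} (\<lambda>y. W y s * g y) + 4 * k * integral {-1..1} (\<lambda>y. W y s * h y)"
      using i(1)[OF that(1)] i(1)[OF that(2)] by (subst integral_add) (auto intro: integrable_on_mult_right)
    finally show ?thesis .
  qed
  show "mollified' \<tau> s = weak_form k W Wt s (cut_kernel k \<tau>) (cker2 \<tau>)
      + integral {-1..1} (\<lambda>y. W y s * cut_rest k \<tau> y) / (4 * k)
      + integral {-1..1} (\<lambda>y. W y s * cut_kernel_t k \<tau> y)"
    unfolding w[OF c(1,6)] mollified'_def unfolding cker2_def e[OF c(4,2)] using k
    by (simp add: field_simps)
  show "integral {-1..1} (\<lambda>y. Wt y s * cut_kernel_t k \<tau> y - W y s * cut_kernel_tt k \<tau> y) =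
      weak_form k W Wt s (cut_kernel_t k \<tau>) (cker_t2 \<tau>)
      + integral {-1..1} (\<lambda>y. W y s * cut_rest_t k \<tau> y) / (4 * k)"
    unfolding w[OF c(2,7)] unfolding cker_t2_def e[OF c(5,3)] using k i(2)[OF c(2)] i(1)[OF c(3)]
    by (subst integral_diff) (auto simp: field_simps)
qed

text \<open>The first term is the time integral of \<open>\<tau>\<close> to the power
  \<open>a - 1\<close>, the second the cutoff error accumulated over \<open>[0, T]\<close>, the
  third the two frozen source terms at \<open>s = 0\<close> and \<open>s = t\<close>.\<close>

private definition "bigconst = H * pi * C / a * (T + 1) powr a + S * pi * C * T / (4 * k) + 2 * M * C * pi"

private lemma test1: "\<tau> > 0 \<Longrightarrow> test_function (cut_kernel k \<tau>) (cut_kernel1 k \<tau>) (cker2 \<tau>)"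
  unfolding cker2_def[abs_def] by (rule test_function_cut_kernel)

private lemma test2: "\<tau> > 0 \<Longrightarrow> test_function (cut_kernel_t k \<tau>) (cut_kernel_t1 k \<tau>) (cker_t2 \<tau>)"
  unfolding cker_t2_def[abs_def] by (rule test_function_cut_kernel_t)

private lemma weak_cut: "t \<in> {0..T} \<Longrightarrow> \<tau> > 0 \<Longrightarrow> \<bar>weak_form k W Wt t (cut_kernel k \<tau>) (cker2 \<tau>)\<bar> \<le> M * C * pi"
  using wM[OF _ test1, of t \<tau>] cker_int(1)[of \<tau>] mult_left_mono[OF cker_int(1)[of \<tau>] MH(1)] by fastforce

text \<open>Subtracting the source term frozen at time \<open>t\<close> makes the singular integral absolutely convergent.\<close>

private lemma singular_integral_bound:
  assumes t: "t \<in> {0..T}" and \<eta>: "0 < \<eta>" "\<eta> \<le> 1"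
  shows "\<bar>integral {-1..1} (\<lambda>y. W y t * cut_kernel_t k \<eta> y)\<bar> \<le> bigconst"
proof -
  \<comment> \<open>The kernel is run backwards: its age decreases from \<open>t + \<eta>\<close> at
    \<open>s = 0\<close> to \<open>\<eta>\<close> at \<open>s = t\<close>. The bracket is the
    integrand of the weak form at the fixed time \<open>t\<close>; its s-derivative is minus the one
    tested with \<open>cut_kernel_t\<close>, so that \<open>f'\<close> contains only the difference
    of the sources at \<open>s\<close> and \<open>t\<close>.\<close>
  define f where "f s y = W y s * cut_kernel_t k (t + \<eta> - s) y
     + (Wt y t * cut_kernel k (t + \<eta> - s) y - W y t * cker2 (t + \<eta> - s) y / (4 * k))" for s y
  define f' where "f' s y = (Wt y s * cut_kernel_t k (t + \<eta> - s) y - W y s * cut_kernel_tt k (t + \<eta> - s) y)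
     - (Wt y t * cut_kernel_t k (t + \<eta> - s) y - W y t * cker_t2 (t + \<eta> - s) y / (4 * k))" for s y
  define F where "F s = integral {-1..1} (f s)" for s
  have Feq: "F s = integral {-1..1} (\<lambda>y. W y s * cut_kernel_t k (t + \<eta> - s) y)
       + weak_form k W Wt t (cut_kernel k (t + \<eta> - s)) (cker2 (t + \<eta> - s))" if s: "s \<in> {0..t}" for s
    unfolding F_def f_def weak_form_def using t \<eta> s k unfolding cker2_def
    by (intro integral_add integrable_continuous_interval continuous_intros cW' cWt' continuous_cut_kernel) auto
  have dF: "(F has_real_derivative integral {-1..1} (f' s)) (at s within {0..t})" if s: "s \<in> {0..t}" for s
  proof -
    have "((\<lambda>s. integral (cbox (- 1) 1) (f s)) has_real_derivative integral (cbox (- 1) 1) (f' s)) (at s within {0..t})"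
  proof (rule leibniz_rule_field_derivative)
    show "((\<lambda>s. f s y) has_real_derivative f' s y) (at s within {0..t})" if "s \<in> {0..t}" "y \<in> cbox (- 1) 1" for s y
    proof -
      have y: "y \<in> {-1..1}" and sT: "s \<in> {0..T}" and p: "t + \<eta> - s > 0" using that t \<eta> by auto
      have c: "((\<lambda>s. g (t + \<eta> - s)) has_real_derivative - g') (at s within {0..t})"
        if "(g has_real_derivative g') (at (t + \<eta> - s))" for g g'
      proof -
        have h: "((\<lambda>s. t + \<eta> - s) has_real_derivative - 1) (at s within {0..t})"
          by (auto intro!: derivative_eq_intros)
        show ?thesis
          using DERIV_chain2[where f=g and g="\<lambda>s. t + \<eta> - s" and x=s, OF that h] by simp
      qed
      note d = c[OF cut_kernel_deriv_t(1)[OF p]] c[OF cut_kernel_deriv_t(2)[OF p]] c[OF cut_kernel_deriv_t(3)[OF p]]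
      have dw: "(W y has_real_derivative Wt y s) (at s within {0..t})"
        by (rule has_field_derivative_subset[OF dW[OF y sT]]) (use t in auto)
      show ?thesis unfolding f_def f'_def cker2_def cker_t2_def
        by (rule derivative_eq_intros d dw refl | use k in \<open>simp add: field_simps\<close>)+
    qed
    show "f s integrable_on cbox (- 1) 1" if "s \<in> {0..t}" for s
      unfolding f_def cker2_def cbox_interval using t \<eta> that k
      by (intro integrable_continuous_interval continuous_intros cW' cWt' continuous_cut_kernel) auto
    show "continuous_on ({0..t} \<times> cbox (- 1) 1) (\<lambda>(s, y). f' s y)"
      unfolding f'_def cker_t2_def cbox_interval case_prod_beta using t \<eta> k
      by (intro continuous_intros cW' cWt' continuous_cut_kernel) auto
  qed (use s in auto)
  then show ?thesis by (simp add: F_def[abs_def])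
  qed
  have bF: "\<bar>integral {-1..1} (f' s)\<bar> \<le> H * pi * C * (t + \<eta> - s) powr (a - 1) + S * pi * C / (4 * k)"
    if s: "s \<in> {0..t}" for s
  proof -
    define \<tau> where "\<tau> = t + \<eta> - s"
    have p: "\<tau> > 0" "t - s \<le> \<tau>" "0 \<le> t - s" and sT: "s \<in> {0..T}" using s t \<eta> by (auto simp: \<tau>_def)
    have "integral {-1..1} (f' s) =
       integral {-1..1} (\<lambda>y. Wt y s * cut_kernel_t k \<tau> y - W y s * cut_kernel_tt k \<tau> y)
       - weak_form k W Wt t (cut_kernel_t k \<tau>) (cker_t2 \<tau>)"
      unfolding f'_def weak_form_def \<tau>_def[symmetric] using t p sT k unfolding cker_t2_def
      by (intro integral_diff integrable_continuous_interval continuous_intros cW' cWt' continuous_cut_kernel) auto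
    also have "\<dots> = (weak_form k W Wt s (cut_kernel_t k \<tau>) (cker_t2 \<tau>) - weak_form k W Wt t (cut_kernel_t k \<tau>) (cker_t2 \<tau>))
        + integral {-1..1} (\<lambda>y. W y s * cut_rest_t k \<tau> y) / (4 * k)"
      unfolding integrals_split(2)[OF sT p(1)] by simp
    finally have e: "integral {-1..1} (f' s) = \<dots>" .
    have "\<bar>weak_form k W Wt s (cut_kernel_t k \<tau>) (cker_t2 \<tau>) - weak_form k W Wt t (cut_kernel_t k \<tau>) (cker_t2 \<tau>)\<bar>
        \<le> H * (t - s) powr a * integral {-1..1} (\<lambda>y. \<bar>cut_kernel_t k \<tau> y\<bar>)"
      using wH[OF t sT _ test2[OF p(1)]] p by auto
    also have "\<dots> \<le> H * \<tau> powr a * (C / \<tau> * pi)"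
      using cker_int(2)[OF p(1)] p a MH C
      by (intro mult_mono mult_nonneg_nonneg powr_mono2 integral_nonneg)
         (auto intro!: integrable_continuous_interval continuous_intros continuous_cut_kernel)
    also have "\<dots> = H * pi * C * \<tau> powr (a - 1)" using p by (simp add: powr_diff)
    finally have 1: "\<bar>weak_form k W Wt s (cut_kernel_t k \<tau>) (cker_t2 \<tau>) - weak_form k W Wt t (cut_kernel_t k \<tau>) (cker_t2 \<tau>)\<bar>
        \<le> H * pi * C * \<tau> powr (a - 1)" .
    have "\<bar>integral {-1..1} (\<lambda>y. W y s * cut_rest_t k \<tau> y)\<bar> \<le> S * integral {-1..1} (\<lambda>y. \<bar>cut_rest_t k \<tau> y\<bar>)"
      using p by (intro W_int[OF sT] continuous_cut_kernel continuous_intros)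
    also have "\<dots> \<le> S * (C * pi)" by (rule mult_left_mono[OF cker_int(4)[OF p(1)] S_nonneg])
    finally have "\<bar>integral {-1..1} (\<lambda>y. W y s * cut_rest_t k \<tau> y) / (4 * k)\<bar> \<le> S * pi * C / (4 * k)"
      using k by (simp add: divide_right_mono mult_ac)
    with 1 show ?thesis unfolding e \<tau>_def[symmetric] by linarith
  qed
  \<comment> \<open>A primitive of the bound \<open>bF\<close>. Because \<open>a > 0\<close>, its
    increment over \<open>[0, t]\<close> stays bounded as \<open>\<eta>\<close> tends to 0.\<close>
  define ph where "ph s = - (H * pi * C / a) * (t + \<eta> - s) powr a + S * pi * C / (4 * k) * s" for s
  have F0t: "\<bar>F t - F 0\<bar> \<le> ph t - ph 0"
  proof (cases "t = 0")
    case False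
    then have t0: "0 < t" using t by auto
    have "norm (F t - F 0) \<le> ph t - ph 0"
    proof (rule differentiable_bound_general[OF t0])
      show "continuous_on {0..t} F" by (rule DERIV_continuous_on) (rule dF)
      show "continuous_on {0..t} ph" unfolding ph_def using \<eta> by (intro continuous_intros) auto
      fix s assume s: "0 < s" "s < t"
      then show "(F has_vector_derivative integral {-1..1} (f' s)) (at s)"
        using dF[of s] at_within_Icc_at[of 0 s t]
        by (simp add: has_real_derivative_iff_has_vector_derivative)
      have "(ph has_real_derivative H * pi * C * (t + \<eta> - s) powr (a - 1) + S * pi * C / (4 * k)) (at s)"
      proof -
        have "((\<lambda>s. t + \<eta> - s) has_real_derivative - 1) (at s)" by (auto intro!: derivative_eq_intros)
        from DERIV_fun_powr[OF this, of a]
        have "((\<lambda>s. (t + \<eta> - s) powr a) has_real_derivative - a * (t + \<eta> - s) powr (a - 1)) (at s)"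
          using s \<eta> by simp
        from DERIV_add[OF DERIV_cmult[OF this, of "- (H * pi * C / a)"] DERIV_cmult[OF DERIV_ident, of "S * pi * C / (4 * k)"]]
        show ?thesis unfolding ph_def using a by (simp add: mult_ac)
      qed
      then show "(ph has_vector_derivative H * pi * C * (t + \<eta> - s) powr (a - 1) + S * pi * C / (4 * k)) (at s)"
        by (simp add: has_real_derivative_iff_has_vector_derivative)
      show "norm (integral {-1..1} (f' s)) \<le> H * pi * C * (t + \<eta> - s) powr (a - 1) + S * pi * C / (4 * k)"
        using bF[of s] s by simp
    qed
    then show ?thesis by simp
  qed simp
  have "ph t - ph 0 \<le> H * pi * C / a * (T + 1) powr a + S * pi * C * T / (4 * k)"
  proof -
    have "H * pi * C / a * (t + \<eta>) powr a \<le> H * pi * C / a * (T + 1) powr a"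
      using t \<eta> a MH C by (intro mult_left_mono powr_mono2) auto
    moreover have "0 \<le> H * pi * C / a * \<eta> powr a" using a MH C by simp
    moreover have "S * pi * C / (4 * k) * t \<le> S * pi * C / (4 * k) * T"
      using t k S_nonneg C by (intro mult_left_mono) auto
    ultimately show ?thesis unfolding ph_def by (simp add: field_simps)
  qed
  with F0t have A: "\<bar>F t - F 0\<bar> \<le> H * pi * C / a * (T + 1) powr a + S * pi * C * T / (4 * k)" by linarith
  have "integral {-1..1} (\<lambda>y. W y 0 * cut_kernel_t k (t + \<eta> - 0) y) = integral {-1..1} (\<lambda>y::real. 0)"
    by (rule Henstock_Kurzweil_Integration.integral_cong) (simp add: W0)
  then have "F 0 = weak_form k W Wt t (cut_kernel k (t + \<eta>)) (cker2 (t + \<eta>))"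
    using Feq[of 0] t by simp
  then have B: "\<bar>F 0\<bar> \<le> M * C * pi" using weak_cut[OF t, of "t + \<eta>"] t \<eta> by auto
  have D: "F t = integral {-1..1} (\<lambda>y. W y t * cut_kernel_t k \<eta> y) + weak_form k W Wt t (cut_kernel k \<eta>) (cker2 \<eta>)"
    using Feq[of t] t by simp
  show ?thesis using A B D weak_cut[OF t \<eta>(1)] unfolding bigconst_def by linarith
qed

private definition "lipconst = M * C * pi + S * C * pi / (4 * k) + bigconst"

private lemma mollified_deriv_bound:
  assumes t: "t \<in> {0..T}" and \<eta>: "0 < \<eta>" "\<eta> \<le> 1"
  shows "\<bar>mollified' \<eta> t\<bar> \<le> lipconst"
proof -
  have "\<bar>integral {-1..1} (\<lambda>y. W y t * cut_rest k \<eta> y)\<bar> \<le> S * integral {-1..1} (\<lambda>y. \<bar>cut_rest k \<eta> y\<bar>)"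
    using \<eta> by (intro W_int[OF t] continuous_cut_kernel continuous_intros) auto
  also have "\<dots> \<le> S * (C * \<eta> * pi)" by (rule mult_left_mono[OF cker_int(3)[OF \<eta>(1)] S_nonneg])
  also have "\<dots> \<le> S * (C * 1 * pi)"
    using \<eta> C S_nonneg by (intro mult_left_mono mult_right_mono) auto
  finally have "\<bar>integral {-1..1} (\<lambda>y. W y t * cut_rest k \<eta> y) / (4 * k)\<bar> \<le> S * C * pi / (4 * k)"
    using k by (simp add: divide_right_mono mult_ac)
  then show ?thesis
    using integrals_split(1)[OF t \<eta>(1)] weak_cut[OF t \<eta>(1)] singular_integral_bound[OF t \<eta>]
    unfolding lipconst_def by linarith
qed

private lemma mollified_lipschitz:
  assumes "t \<in> {0..T}" "s \<in> {0..T}" "0 < \<eta>" "\<eta> \<le> 1"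
  shows "\<bar>mollified \<eta> s - mollified \<eta> t\<bar> \<le> lipconst * \<bar>s - t\<bar>"
proof -
  have "norm (mollified \<eta> s - mollified \<eta> t) \<le> lipconst * norm (s - t)"
  proof (rule field_differentiable_bound[of "{0..T}"])
    fix z assume z: "z \<in> {0..T}"
    show "(mollified \<eta> has_real_derivative mollified' \<eta> z) (at z within {0..T})"
    proof -
      have "((\<lambda>t. integral (cbox (- 1) 1) (\<lambda>y. W y t * cut_kernel k \<eta> y)) has_real_derivative
        integral (cbox (- 1) 1) (\<lambda>y. Wt y z * cut_kernel k \<eta> y)) (at z within {0..T})"
    proof (rule leibniz_rule_field_derivative)
      show "((\<lambda>t. W y t * cut_kernel k \<eta> y) has_real_derivative Wt y t * cut_kernel k \<eta> y) (at t within {0..T})"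
        if "t \<in> {0..T}" "y \<in> cbox (- 1) 1" for t y
        using dW[of y t] that by (auto intro!: derivative_eq_intros)
      show "(\<lambda>y. W y t * cut_kernel k \<eta> y) integrable_on cbox (- 1) 1" if "t \<in> {0..T}" for t
        unfolding cbox_interval using that assms
        by (intro integrable_continuous_interval continuous_intros cW' continuous_cut_kernel) auto
      show "continuous_on ({0..T} \<times> cbox (- 1) 1) (\<lambda>(t, y). Wt y t * cut_kernel k \<eta> y)"
        unfolding cbox_interval case_prod_beta using assms
        by (intro continuous_intros cWt' continuous_cut_kernel) auto
    qed (use z in auto)
    then show ?thesis by (simp add: mollified_def[abs_def] mollified'_def)
    qed
  qed (use assms mollified_deriv_bound in auto)
  then show ?thesis by simp
qed

text \<open>Near the centre \<open>W y t * cutoff y\<close> differs from \<open>W 0 t\<close> by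
  \<open>O(\<bar>y\<bar>)\<close>, and \<open>\<bar>y\<bar>\<close> times the kernel has integral
  \<open>O(sqrt \<eta>)\<close>.\<close>

private lemma mollified_limit:
  assumes t: "t \<in> {0..T}"
  obtains l where "\<And>\<eta>. 0 < \<eta> \<Longrightarrow> \<bar>mollified \<eta> t - integral {-1..1} (heat_kernel k \<eta>) * W 0 t\<bar> \<le> l * sqrt \<eta>"
proof -
  obtain l0 where l0: "\<forall>y\<in>{-1..1}. \<bar>W y t - W 0 t\<bar> \<le> l0 * \<bar>y\<bar>" using WL[OF t] by blast
  define l where "l = \<bar>l0\<bar> + 3 * S"
  have l: "l \<ge> 0" using S_nonneg by (simp add: l_def)
  have "\<bar>mollified \<eta> t - integral {-1..1} (heat_kernel k \<eta>) * W 0 t\<bar> \<le> (l * C * sqrt \<eta>) * pi"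
    if \<eta>: "0 < \<eta>" for \<eta>
  proof -
    define g where "g y = (W y t * cutoff y - W 0 t) * heat_kernel k \<eta> y" for y
    have ch: "continuous_on {-1..1} (heat_kernel k \<eta>)"
      using \<eta> continuous_cut_kernel(6)[of "{-1..1}" "\<lambda>_. \<eta>" "\<lambda>y. y"] by (simp add: continuous_intros)
    have cg: "continuous_on {-1..1} g"
      unfolding g_def cutoff_def using t by (intro continuous_intros cW' ch) auto
    have "mollified \<eta> t - integral {-1..1} (heat_kernel k \<eta>) * W 0 t =
       integral {-1..1} (\<lambda>y. W y t * cut_kernel k \<eta> y) - integral {-1..1} (\<lambda>y. heat_kernel k \<eta> y * W 0 t)"
      unfolding mollified_def by simp
    also have "\<dots> = integral {-1..1} (\<lambda>y. W y t * cut_kernel k \<eta> y - heat_kernel k \<eta> y * W 0 t)"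
      using t \<eta> by (intro integral_diff[symmetric] integrable_continuous_interval continuous_intros cW' ch
          continuous_cut_kernel) auto
    also have "\<dots> = integral {-1..1} g" by (simp add: g_def[abs_def] cut_kernel_def algebra_simps)
    finally have e: "mollified \<eta> t - integral {-1..1} (heat_kernel k \<eta>) * W 0 t = integral {-1..1} g" .
    show ?thesis unfolding e
    proof (rule abs_integral_le_poisson(2)[OF \<eta> _ cg])
      show "0 \<le> l * C * sqrt \<eta>" using l C \<eta> by simp
      fix y :: real assume y: "\<bar>y\<bar> \<le> 1"
      note cb = cutoff_bounds[OF y]
      have "W y t * cutoff y - W 0 t = (W y t - W 0 t) * cutoff y - W 0 t * (1 - cutoff y)"
        by (simp add: algebra_simps)
      then have "\<bar>W y t * cutoff y - W 0 t\<bar> \<le> \<bar>W y t - W 0 t\<bar> * \<bar>cutoff y\<bar> + \<bar>W 0 t\<bar> * \<bar>1 - cutoff y\<bar>"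
        by (metis abs_mult abs_triangle_ineq4)
      also have "\<dots> \<le> (\<bar>l0\<bar> * \<bar>y\<bar>) * 1 + S * (3 * \<bar>y\<bar>)"
      proof (intro add_mono mult_mono)
        have "\<bar>W y t - W 0 t\<bar> \<le> l0 * \<bar>y\<bar>" using l0 y by (auto simp: abs_le_iff)
        also have "\<dots> \<le> \<bar>l0\<bar> * \<bar>y\<bar>" by (intro mult_right_mono) auto
        finally show "\<bar>W y t - W 0 t\<bar> \<le> \<bar>l0\<bar> * \<bar>y\<bar>" .
        show "\<bar>1 - cutoff y\<bar> \<le> 3 * \<bar>y\<bar>" using cb by auto
      qed (use WS[of 0 t] t cb S_nonneg in auto)
      finally have "\<bar>W y t * cutoff y - W 0 t\<bar> \<le> l * \<bar>y\<bar>" by (simp add: l_def algebra_simps)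
      then have "\<bar>g y\<bar> \<le> (l * \<bar>y\<bar>) * heat_kernel k \<eta> y"
        unfolding g_def abs_mult using \<eta> by (intro mult_mono) (auto simp: heat_kernel_def)
      also have "\<dots> \<le> l * (C * sqrt \<eta> * poisson \<eta> y)"
        using mult_left_mono[OF kb(2)[OF \<eta> y] l] by (simp add: mult.assoc)
      finally show "\<bar>g y\<bar> \<le> l * C * sqrt \<eta> * poisson \<eta> y" by (simp add: mult.assoc)
    qed
  qed
  then show ?thesis by (intro that[of "l * C * pi"]) (simp add: mult_ac)
qed

text \<open>Both approximation errors are \<open>O(sqrt \<eta>)\<close> for fixed \<open>t\<close>
  and \<open>s\<close>. As \<open>\<eta>\<close> tends to 0 only the Lipschitz constant of the
  averages survives; the factor \<open>2 * exp (- k)\<close> is the lower bound of the kernel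
  mass.\<close>

lemma center_lipschitz:
  assumes t: "t \<in> {0..T}" and s: "s \<in> {0..T}"
  shows "2 * exp (- k) * \<bar>W 0 s - W 0 t\<bar> \<le> lipconst * \<bar>s - t\<bar>"
proof -
  obtain l1 where l1: "\<And>\<eta>. 0 < \<eta> \<Longrightarrow> \<bar>mollified \<eta> t - integral {-1..1} (heat_kernel k \<eta>) * W 0 t\<bar> \<le> l1 * sqrt \<eta>"
    using mollified_limit[OF t] by blast
  obtain l2 where l2: "\<And>\<eta>. 0 < \<eta> \<Longrightarrow> \<bar>mollified \<eta> s - integral {-1..1} (heat_kernel k \<eta>) * W 0 s\<bar> \<le> l2 * sqrt \<eta>"
    using mollified_limit[OF s] by blast
  have main: "2 * exp (- k) * \<bar>W 0 s - W 0 t\<bar> \<le> lipconst * \<bar>s - t\<bar> + (l1 + l2) * sqrt \<eta>"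
    if \<eta>: "0 < \<eta>" "\<eta> \<le> 1" for \<eta>
  proof -
    define c where "c = integral {-1..1} (heat_kernel k \<eta>)"
    have "2 * exp (- k) * \<bar>W 0 s - W 0 t\<bar> \<le> c * \<bar>W 0 s - W 0 t\<bar>"
      unfolding c_def by (intro mult_right_mono heat_kernel_mass k \<eta>) auto
    also have "\<dots> = \<bar>c * W 0 s - c * W 0 t\<bar>"
    proof -
      have "c \<ge> 0" using heat_kernel_mass[OF k \<eta>] exp_gt_zero[of "- k"] unfolding c_def[symmetric] by linarith
      then show ?thesis by (simp add: right_diff_distrib[symmetric] abs_mult)
    qed
    also have "\<dots> \<le> lipconst * \<bar>s - t\<bar> + l1 * sqrt \<eta> + l2 * sqrt \<eta>"
      using l1[OF \<eta>(1)] l2[OF \<eta>(1)] mollified_lipschitz[OF t s \<eta>] unfolding c_def[symmetric] by linarith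
    finally show ?thesis by (simp add: algebra_simps)
  qed
  have "((\<lambda>\<eta>. lipconst * \<bar>s - t\<bar> + (l1 + l2) * sqrt \<eta>) \<longlongrightarrow> lipconst * \<bar>s - t\<bar> + (l1 + l2) * sqrt 0) (at_right 0)"
    by (intro tendsto_intros)
  moreover have "\<forall>\<^sub>F \<eta> in at_right 0. 2 * exp (- k) * \<bar>W 0 s - W 0 t\<bar> \<le> lipconst * \<bar>s - t\<bar> + (l1 + l2) * sqrt \<eta>"
    using main by (auto simp: eventually_at_right_field intro!: exI[of _ 1])
  ultimately have "2 * exp (- k) * \<bar>W 0 s - W 0 t\<bar> \<le> lipconst * \<bar>s - t\<bar> + (l1 + l2) * sqrt 0"
    by (rule tendsto_lowerbound) simp
  then show ?thesis by simp
qed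

lemma center_deriv_bound:
  assumes "t \<in> {0..T}"
  shows "\<bar>Wt 0 t\<bar> \<le> exp k / 2 * (M * C * pi + S * C * pi / (4 * k) +
     (H * pi * C / a * (T + 1) powr a + S * pi * C * T / (4 * k) + 2 * M * C * pi))"
proof -
  have "\<bar>Wt 0 t\<bar> \<le> exp k / 2 * lipconst"
  proof (rule has_derivative_bound_of_lipschitz[OF T assms dW[of 0 t]])
    fix s assume "s \<in> {0..T}"
    from center_lipschitz[OF assms this] show "\<bar>W 0 s - W 0 t\<bar> \<le> exp k / 2 * lipconst * \<bar>s - t\<bar>"
      by (simp add: exp_minus field_simps)
  qed (use assms in auto)
  then show ?thesis by (simp add: lipconst_def bigconst_def)
qed

end

text \<open>The order of quantifiers matters: \<open>K\<close> is fixed by \<open>k\<close>,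
  \<open>T\<close> and \<open>a\<close> before \<open>W\<close>, \<open>S\<close>, \<open>M\<close>
  and \<open>H\<close> are given, so one constant serves every cell, component and value of
  eps.\<close>

proposition kernel_derivative_bound:
  fixes k T a :: real
  assumes k: "k > 0" and T: "T > 0" and a: "a > 0"
  obtains K where "K > 0"
    "\<And>W Wt S M H t. \<lbrakk>M \<ge> 0; H \<ge> 0;
      continuous_on ({-1..1} \<times> {0..T}) (\<lambda>(y, t). W y t);
      continuous_on ({-1..1} \<times> {0..T}) (\<lambda>(y, t). Wt y t);
      \<And>y t. y \<in> {-1..1} \<Longrightarrow> t \<in> {0..T} \<Longrightarrow> (W y has_real_derivative Wt y t) (at t within {0..T});
      \<And>y. y \<in> {-1..1} \<Longrightarrow> W y 0 = 0;
      \<And>y t. y \<in> {-1..1} \<Longrightarrow> t \<in> {0..T} \<Longrightarrow> \<bar>W y t\<bar> \<le> S;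
      \<And>t. t \<in> {0..T} \<Longrightarrow> \<exists>l. \<forall>y\<in>{-1..1}. \<bar>W y t - W 0 t\<bar> \<le> l * \<bar>y\<bar>;
      \<And>t \<theta> \<theta>1 \<theta>2. t \<in> {0..T} \<Longrightarrow> test_function \<theta> \<theta>1 \<theta>2 \<Longrightarrow>
        \<bar>weak_form k W Wt t \<theta> \<theta>2\<bar> \<le> M * integral {-1..1} (\<lambda>y. \<bar>\<theta> y\<bar>);
      \<And>t s \<theta> \<theta>1 \<theta>2. t \<in> {0..T} \<Longrightarrow> s \<in> {0..T} \<Longrightarrow> s \<le> t \<Longrightarrow> test_function \<theta> \<theta>1 \<theta>2 \<Longrightarrow>
        \<bar>weak_form k W Wt s \<theta> \<theta>2 - weak_form k W Wt t \<theta> \<theta>2\<bar>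
          \<le> H * (t - s) powr a * integral {-1..1} (\<lambda>y. \<bar>\<theta> y\<bar>);
      t \<in> {0..T}\<rbrakk> \<Longrightarrow> \<bar>Wt 0 t\<bar> \<le> K * (S + M + H)"
proof -
  obtain C where C: "C \<ge> 1"
    "\<And>\<tau> y. \<tau> > 0 \<Longrightarrow> \<bar>y\<bar> \<le> 1 \<Longrightarrow> \<bar>cut_kernel k \<tau> y\<bar> \<le> C * poisson \<tau> y"
    "\<And>\<tau> y. \<tau> > 0 \<Longrightarrow> \<bar>y\<bar> \<le> 1 \<Longrightarrow> \<bar>y\<bar> * heat_kernel k \<tau> y \<le> C * sqrt \<tau> * poisson \<tau> y"
    "\<And>\<tau> y. \<tau> > 0 \<Longrightarrow> \<bar>y\<bar> \<le> 1 \<Longrightarrow> \<bar>cut_kernel_t k \<tau> y\<bar> \<le> C / \<tau> * poisson \<tau> y"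
    "\<And>\<tau> y. \<tau> > 0 \<Longrightarrow> \<bar>y\<bar> \<le> 1 \<Longrightarrow> \<bar>cut_rest k \<tau> y\<bar> \<le> C * \<tau> * poisson \<tau> y"
    "\<And>\<tau> y. \<tau> > 0 \<Longrightarrow> \<bar>y\<bar> \<le> 1 \<Longrightarrow> \<bar>cut_rest_t k \<tau> y\<bar> \<le> C * poisson \<tau> y"
    unfolding cut_kernel_def cut_kernel_t_def cut_rest_def cut_rest_t_def
    by (fact heat_kernel_bounds[OF k])
  define K where "K = exp k / 2 * (3 * C * pi + C * pi / (4 * k) + pi * C / a * (T + 1) powr a + pi * C * T / (4 * k))"
  show ?thesis
  proof (rule that[of K])
    show "K > 0" unfolding K_def using k a T C(1) by (intro mult_pos_pos add_pos_nonneg) auto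
    fix W Wt S M H t
    assume h: "M \<ge> 0" "H \<ge> 0"
      "continuous_on ({-1..1} \<times> {0..T}) (\<lambda>(y, t). W y t)"
      "continuous_on ({-1..1} \<times> {0..T}) (\<lambda>(y, t). Wt y t)"
      "\<And>y t. y \<in> {-1..1} \<Longrightarrow> t \<in> {0..T} \<Longrightarrow> (W y has_real_derivative Wt y t) (at t within {0..T})"
      "\<And>y. y \<in> {-1..1} \<Longrightarrow> W y 0 = 0"
      "\<And>y t. y \<in> {-1..1} \<Longrightarrow> t \<in> {0..T} \<Longrightarrow> \<bar>W y t\<bar> \<le> S"
      "\<And>t. t \<in> {0..T} \<Longrightarrow> \<exists>l. \<forall>y\<in>{-1..1}. \<bar>W y t - W 0 t\<bar> \<le> l * \<bar>y\<bar>"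
      "\<And>t \<theta> \<theta>1 \<theta>2. t \<in> {0..T} \<Longrightarrow> test_function \<theta> \<theta>1 \<theta>2 \<Longrightarrow>
        \<bar>weak_form k W Wt t \<theta> \<theta>2\<bar> \<le> M * integral {-1..1} (\<lambda>y. \<bar>\<theta> y\<bar>)"
      "\<And>t s \<theta> \<theta>1 \<theta>2. t \<in> {0..T} \<Longrightarrow> s \<in> {0..T} \<Longrightarrow> s \<le> t \<Longrightarrow> test_function \<theta> \<theta>1 \<theta>2 \<Longrightarrow>
        \<bar>weak_form k W Wt s \<theta> \<theta>2 - weak_form k W Wt t \<theta> \<theta>2\<bar>
          \<le> H * (t - s) powr a * integral {-1..1} (\<lambda>y. \<bar>\<theta> y\<bar>)"
      "t \<in> {0..T}"
    have S: "S \<ge> 0" using h(7)[of 0 0] T by auto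
    have "\<bar>Wt 0 t\<bar> \<le> exp k / 2 * (M * C * pi + S * C * pi / (4 * k) +
     (H * pi * C / a * (T + 1) powr a + S * pi * C * T / (4 * k) + 2 * M * C * pi))"
      by (rule center_deriv_bound[OF k T a C(1) h(1,2) C(2-6) h(3-11)])
    also have "\<dots> = exp k / 2 * (M * (3 * C * pi) + S * (C * pi / (4 * k) + pi * C * T / (4 * k)) +
         H * (pi * C / a * (T + 1) powr a))" by (simp add: algebra_simps)
    also have "\<dots> \<le> exp k / 2 * ((S + M + H) * (3 * C * pi + C * pi / (4 * k) + pi * C / a * (T + 1) powr a + pi * C * T / (4 * k)))"
    proof (intro mult_left_mono)
      define p q r where "p = 3 * C * pi" and "q = C * pi / (4 * k) + pi * C * T / (4 * k)" and "r = pi * C / a * (T + 1) powr a"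
      have "p \<ge> 0" "q \<ge> 0" "r \<ge> 0" unfolding p_def q_def r_def using C(1) k T a by auto
      then have "0 \<le> M * q + M * r" "0 \<le> S * p + S * r" "0 \<le> H * p + H * q" using S h(1,2) by auto
      moreover have "(S + M + H) * (3 * C * pi + C * pi / (4 * k) + pi * C / a * (T + 1) powr a + pi * C * T / (4 * k)) = (S + M + H) * (p + q + r)"
        by (simp add: p_def q_def r_def)
      ultimately show "M * (3 * C * pi) + S * (C * pi / (4 * k) + pi * C * T / (4 * k)) +
         H * (pi * C / a * (T + 1) powr a) \<le> (S + M + H) * (3 * C * pi + C * pi / (4 * k) + pi * C / a * (T + 1) powr a + pi * C * T / (4 * k))"
        unfolding p_def[symmetric] q_def[symmetric] r_def[symmetric] by (simp add: algebra_simps)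
    qed auto
    also have "\<dots> = K * (S + M + H)" by (simp add: K_def)
    finally show "\<bar>Wt 0 t\<bar> \<le> K * (S + M + H)" .
  qed
qed

section \<open>Scaling to a cell and odd reflection at the end point\<close>

definition odd_ext :: "(real \<Rightarrow> real \<Rightarrow> real) \<Rightarrow> real \<Rightarrow> real \<Rightarrow> real" where
  "odd_ext g v t = (if 0 \<le> v then g v t else - g (- v) t)"

lemma has_real_derivative_eventually_eq:
  assumes "(g has_real_derivative u) (at x)" "\<forall>\<^sub>F s in nhds x. f s = g s"
  shows "(f has_real_derivative u) (at x)"
  using DERIV_cong_ev[OF refl assms(2) refl] assms(1) by blast

lemma abs_odd_ext: "\<bar>odd_ext g v t\<bar> = \<bar>g \<bar>v\<bar> t\<bar>"
  "\<bar>odd_ext g v s - odd_ext g v t\<bar> = \<bar>g \<bar>v\<bar> s - g \<bar>v\<bar> t\<bar>"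
  by (auto simp: odd_ext_def)

lemma continuous_odd_ext:
  assumes "continuous_on ({0..1} \<times> J) (\<lambda>(x, t). g x t)" "\<And>t. t \<in> J \<Longrightarrow> g 0 t = 0" "closed J"
  shows "continuous_on ({-1..1} \<times> J) (\<lambda>(v, t). odd_ext g v t)"
proof -
  have "continuous_on (({0..1} \<times> J) \<union> ({-1..0} \<times> J))
      (\<lambda>p. if 0 \<le> fst p then g (fst p) (snd p) else - g (- fst p) (snd p))"
  proof (rule continuous_on_cases)
    show "closed ({0..1::real} \<times> J)" "closed ({-1..0::real} \<times> J)" using assms(3) by (auto intro: closed_Times)
    show "continuous_on ({0..1} \<times> J) (\<lambda>p. g (fst p) (snd p))"
      using assms(1) by (simp add: case_prod_beta)
    show "continuous_on ({-1..0} \<times> J) (\<lambda>p. - g (- fst p) (snd p))"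
      by (intro continuous_intros continuous_on_slice[OF assms(1)]) auto
  qed (use assms(2) in auto)
  moreover have "({0..1} \<times> J) \<union> ({-1..0} \<times> J) = {-1..1::real} \<times> J" by auto
  ultimately show ?thesis by (simp add: odd_ext_def case_prod_beta)
qed

text \<open>The exceptional set \<open>E\<close> will be the single point where the reflected
  function meets the boundary and no derivative has been computed.\<close>

lemma lipschitz_of_bounded_derivative:
  fixes g :: "real \<Rightarrow> real"
  assumes "finite E" "a \<le> b" "\<And>x. x \<in> {a<..<b} - E \<Longrightarrow> (g has_real_derivative g' x) (at x)"
    "continuous_on {a..b} g" "\<And>x. x \<in> {a..b} \<Longrightarrow> \<bar>g' x\<bar> \<le> B"
  shows "\<bar>g b - g a\<bar> \<le> B * (b - a)"
proof -
  have "(g' has_integral (g b - g a)) {a..b}"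
    using assms by (intro fundamental_theorem_of_calculus_interior_strong[of E])
      (auto simp: has_real_derivative_iff_has_vector_derivative)
  moreover have "B \<ge> 0" using assms(2) assms(5)[of a] by auto
  ultimately have "norm (g b - g a) \<le> B * measure lborel {a..b}"
    using assms(5) by (intro has_integral_bound_real) auto
  then show ?thesis using assms(2) by simp
qed

text \<open>Odd reflection reduces the end point 0 of the interval to the interior; only time regularity
  of the source is used.\<close>

proposition heat_time_derivative_bound:
  fixes c T a :: real
  assumes c: "c > 0" and T: "T > 0" and a: "a > 0"
  obtains K where "K > 0"
    "\<And>d z zt zx zxx x0 S M H t. \<lbrakk>d > 0; S \<ge> 0; M \<ge> 0; H \<ge> 0;
      continuous_on ({0..1} \<times> {0..T}) (\<lambda>(x, t). z x t);
      continuous_on ({0..1} \<times> {0..T}) (\<lambda>(x, t). zt x t);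
      \<And>x t. x \<in> {0..1} \<Longrightarrow> t \<in> {0..T} \<Longrightarrow> (z x has_real_derivative zt x t) (at t within {0..T});
      \<And>x t. x \<in> {0..1} \<Longrightarrow> t \<in> {0..T} \<Longrightarrow> ((\<lambda>x. z x t) has_real_derivative zx x t) (at x within {0..1});
      \<And>x t. x \<in> {0..1} \<Longrightarrow> t \<in> {0..T} \<Longrightarrow> ((\<lambda>x. zx x t) has_real_derivative zxx x t) (at x within {0..1});
      \<And>x. x \<in> {0..1} \<Longrightarrow> z x 0 = 0;
      0 \<le> x0; x0 + c * d \<le> 1; c * d \<le> x0 \<or> (\<forall>t\<in>{0..T}. z 0 t = 0);
      \<And>x t. x \<in> {0..1} \<Longrightarrow> \<bar>x - x0\<bar> \<le> c * d \<Longrightarrow> t \<in> {0..T} \<Longrightarrow> \<bar>z x t\<bar> \<le> S;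
      \<And>x t. x \<in> {0..1} \<Longrightarrow> \<bar>x - x0\<bar> \<le> c * d \<Longrightarrow> t \<in> {0..T} \<Longrightarrow> \<bar>zt x t - d\<^sup>2 * zxx x t\<bar> \<le> M;
      \<And>x t s. x \<in> {0..1} \<Longrightarrow> \<bar>x - x0\<bar> \<le> c * d \<Longrightarrow> t \<in> {0..T} \<Longrightarrow> s \<in> {0..T} \<Longrightarrow> s \<le> t \<Longrightarrow>
        \<bar>(zt x s - d\<^sup>2 * zxx x s) - (zt x t - d\<^sup>2 * zxx x t)\<bar> \<le> H * (t - s) powr a;
      t \<in> {0..T}\<rbrakk> \<Longrightarrow> \<bar>zt x0 t\<bar> \<le> K * (S + M + H)"
proof -
  \<comment> \<open>With \<open>x = x0 + c * d * y\<close> the term \<open>d\<^sup>2 * z_xx\<close>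
    becomes \<open>W_yy / c\<^sup>2\<close>, and \<open>c\<^sup>2 = 4 * k\<close> makes this the
    operator of the kernel. Thus \<open>d\<close> is scaled out completely.\<close>
  define k where "k = c\<^sup>2 / 4"
  have k: "k > 0" using c by (simp add: k_def)
  obtain K where K: "K > 0"
    "\<And>W Wt S M H t. \<lbrakk>M \<ge> 0; H \<ge> 0;
      continuous_on ({-1..1} \<times> {0..T}) (\<lambda>(y, t). W y t);
      continuous_on ({-1..1} \<times> {0..T}) (\<lambda>(y, t). Wt y t);
      \<And>y t. y \<in> {-1..1} \<Longrightarrow> t \<in> {0..T} \<Longrightarrow> (W y has_real_derivative Wt y t) (at t within {0..T});
      \<And>y. y \<in> {-1..1} \<Longrightarrow> W y 0 = 0;
      \<And>y t. y \<in> {-1..1} \<Longrightarrow> t \<in> {0..T} \<Longrightarrow> \<bar>W y t\<bar> \<le> S;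
      \<And>t. t \<in> {0..T} \<Longrightarrow> \<exists>l. \<forall>y\<in>{-1..1}. \<bar>W y t - W 0 t\<bar> \<le> l * \<bar>y\<bar>;
      \<And>t \<theta> \<theta>1 \<theta>2. t \<in> {0..T} \<Longrightarrow> test_function \<theta> \<theta>1 \<theta>2 \<Longrightarrow>
        \<bar>weak_form k W Wt t \<theta> \<theta>2\<bar> \<le> M * integral {-1..1} (\<lambda>y. \<bar>\<theta> y\<bar>);
      \<And>t s \<theta> \<theta>1 \<theta>2. t \<in> {0..T} \<Longrightarrow> s \<in> {0..T} \<Longrightarrow> s \<le> t \<Longrightarrow> test_function \<theta> \<theta>1 \<theta>2 \<Longrightarrow>
        \<bar>weak_form k W Wt s \<theta> \<theta>2 - weak_form k W Wt t \<theta> \<theta>2\<bar>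
          \<le> H * (t - s) powr a * integral {-1..1} (\<lambda>y. \<bar>\<theta> y\<bar>);
      t \<in> {0..T}\<rbrakk> \<Longrightarrow> \<bar>Wt 0 t\<bar> \<le> K * (S + M + H)"
    by (fact kernel_derivative_bound[OF k T a])
  show ?thesis
  proof (rule that[OF K(1)])
    fix d z zt zx zxx x0 S M H t
    assume d: "d > 0" and nn: "S \<ge> 0" "M \<ge> 0" "H \<ge> 0"
      and cz: "continuous_on ({0..1} \<times> {0..T}) (\<lambda>(x, t). z x t)"
      and czt: "continuous_on ({0..1} \<times> {0..T}) (\<lambda>(x, t). zt x t)"
      and dt: "\<And>x t. x \<in> {0..1} \<Longrightarrow> t \<in> {0..T} \<Longrightarrow> (z x has_real_derivative zt x t) (at t within {0..T})"
      and dx: "\<And>x t. x \<in> {0..1} \<Longrightarrow> t \<in> {0..T} \<Longrightarrow> ((\<lambda>x. z x t) has_real_derivative zx x t) (at x within {0..1})"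
      and dxx: "\<And>x t. x \<in> {0..1} \<Longrightarrow> t \<in> {0..T} \<Longrightarrow> ((\<lambda>x. zx x t) has_real_derivative zxx x t) (at x within {0..1})"
      and z0: "\<And>x. x \<in> {0..1} \<Longrightarrow> z x 0 = 0"
      and x0: "0 \<le> x0" "x0 + c * d \<le> 1" "c * d \<le> x0 \<or> (\<forall>t\<in>{0..T}. z 0 t = 0)"
      and bz: "\<And>x t. x \<in> {0..1} \<Longrightarrow> \<bar>x - x0\<bar> \<le> c * d \<Longrightarrow> t \<in> {0..T} \<Longrightarrow> \<bar>z x t\<bar> \<le> S"
      and bG: "\<And>x t. x \<in> {0..1} \<Longrightarrow> \<bar>x - x0\<bar> \<le> c * d \<Longrightarrow> t \<in> {0..T} \<Longrightarrow> \<bar>zt x t - d\<^sup>2 * zxx x t\<bar> \<le> M"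
      and hG: "\<And>x t s. x \<in> {0..1} \<Longrightarrow> \<bar>x - x0\<bar> \<le> c * d \<Longrightarrow> t \<in> {0..T} \<Longrightarrow> s \<in> {0..T} \<Longrightarrow> s \<le> t \<Longrightarrow>
        \<bar>(zt x s - d\<^sup>2 * zxx x s) - (zt x t - d\<^sup>2 * zxx x t)\<bar> \<le> H * (t - s) powr a"
      and t: "t \<in> {0..T}"
    define r where "r = c * d"
    have r: "r > 0" "r \<le> 1" using c d x0 by (auto simp: r_def)
    define X where "X y = x0 + r * y" for y
    \<comment> \<open>If the cell lies within \<open>[0, 1]\<close> it never meets the extension;
      the extended domain, and with it the boundary condition at 0, enters only when the cell
      crosses 0.\<close>
    define D :: "real set" where "D = (if r \<le> x0 then {0..1} else {-1..1})"
    have XD: "X y \<in> D" "\<bar>X y\<bar> \<in> {0..1}" "\<bar>\<bar>X y\<bar> - x0\<bar> \<le> c * d" if "y \<in> {-1..1}" for y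
    proof -
      have "- r \<le> r * y" "r * y \<le> r" using that r by (auto intro: mult_left_le_one_le)
          (use mult_left_mono[of "-1" y r] in auto)
      then show "X y \<in> D" "\<bar>X y\<bar> \<in> {0..1}" "\<bar>\<bar>X y\<bar> - x0\<bar> \<le> c * d"
        using x0 r unfolding X_def D_def r_def by (auto simp: abs_if)
    qed
    have cX: "continuous_on S' X" for S' unfolding X_def by (intro continuous_intros)
    have zt0: "zt 0 t = 0" if "\<not> r \<le> x0" "t \<in> {0..T}" for t
    proof -
      have zz: "\<And>s. s \<in> {0..T} \<Longrightarrow> z 0 s = 0" using x0(3) that(1) by (auto simp: r_def)
      have "\<bar>zt 0 t\<bar> \<le> 0" by (rule has_derivative_bound_of_lipschitz[OF T that(2) dt[OF _ that(2)]]) (use zz that in auto)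
      then show ?thesis by simp
    qed
    have ext: "continuous_on (D \<times> {0..T}) (\<lambda>(v, t). odd_ext g v t)"
      if "continuous_on ({0..1} \<times> {0..T}) (\<lambda>(x, t). g x t)" "\<not> r \<le> x0 \<Longrightarrow> \<forall>t\<in>{0..T}. g 0 t = 0" for g
    proof (cases "r \<le> x0")
      case True
      then have "D = {0..1}" by (simp add: D_def)
      then show ?thesis using that(1) by (auto simp: odd_ext_def elim!: continuous_on_eq)
    next
      case False
      then show ?thesis using continuous_odd_ext[OF that(1)] that(2) by (simp add: D_def)
    qed
    define W where "W y = odd_ext z (X y)" for y
    define Wt where "Wt y = odd_ext zt (X y)" for y
    have cW: "continuous_on ({-1..1} \<times> {0..T}) (\<lambda>(y, t). W y t)"
      unfolding W_def case_prod_beta using x0(3)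
      by (intro continuous_on_slice[OF ext[OF cz]] continuous_on_compose2[OF cX] continuous_intros)
         (auto simp: XD r_def)
    have cWt: "continuous_on ({-1..1} \<times> {0..T}) (\<lambda>(y, t). Wt y t)"
      unfolding Wt_def case_prod_beta using zt0
      by (intro continuous_on_slice[OF ext[OF czt]] continuous_on_compose2[OF cX] continuous_intros)
         (auto simp: XD)
    have dW: "(W y has_real_derivative Wt y t) (at t within {0..T})" if "y \<in> {-1..1}" "t \<in> {0..T}" for y t
    proof (cases "0 \<le> X y")
      case True
      then show ?thesis using dt[of "X y" t] XD(2)[OF that(1)] that(2) by (simp add: W_def Wt_def odd_ext_def[abs_def])
    next
      case False
      then show ?thesis using dt[of "- X y" t] XD(2)[OF that(1)] that(2)
        by (auto simp: W_def Wt_def odd_ext_def[abs_def] intro!: derivative_eq_intros)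
    qed
    have bW: "\<bar>W y t\<bar> \<le> S" if "y \<in> {-1..1}" "t \<in> {0..T}" for y t
      using bz[OF XD(2,3)[OF that(1)] that(2)] by (simp add: W_def abs_odd_ext)
    \<comment> \<open>The point that \<open>X\<close> maps to the boundary, the only one at which
      the second derivative of \<open>W\<close> may jump.\<close>
    define E where "E = {- x0 / r}"
    have E: "X y \<noteq> 0" if "y \<notin> E" for y using that r by (auto simp: E_def X_def field_simps)
    \<comment> \<open>The derivative of an odd function is even, hence the absolute value. It is
      continuous across the reflection point, so the integration by parts there produces no
      interface term.\<close>
    define Wy where "Wy y t = r * zx \<bar>X y\<bar> t" for y t
    define Wyy where "Wyy y = odd_ext (\<lambda>x t. r\<^sup>2 * zxx x t) (X y)" for y
    have dX: "(X has_real_derivative r) (at y)" for y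
      unfolding X_def[abs_def] by (auto intro!: derivative_eq_intros)
    have inner: "(\<lambda>y. W y t) = (\<lambda>y. odd_ext z (X y) t)" for t by (simp add: W_def)
    have loc: "((\<lambda>y. W y t) has_real_derivative Wy y t) (at y) \<and> ((\<lambda>y. Wy y t) has_real_derivative Wyy y t) (at y)"
      if y: "y \<in> {-1<..<1} - E" and t: "t \<in> {0..T}" for y t
    proof -
      have "\<bar>X y\<bar> < 1"
      proof -
        have "r * y < r" "- r < r * y" using y r mult_strict_left_mono[of "-1" y r] by auto
        then show ?thesis using x0 r unfolding X_def r_def by (auto simp: abs_if)
      qed
      then have X1: "0 < \<bar>X y\<bar>" "\<bar>X y\<bar> < 1" using E[of y] y by auto
      have at: "at \<bar>X y\<bar> within {0..1} = at \<bar>X y\<bar>" using X1 by (intro at_within_Icc_at) auto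
      note dz = dx[of "\<bar>X y\<bar>" t, unfolded at] dxx[of "\<bar>X y\<bar>" t, unfolded at]
      have dz: "((\<lambda>x. z x t) has_real_derivative zx \<bar>X y\<bar> t) (at \<bar>X y\<bar>)"
         "((\<lambda>x. zx x t) has_real_derivative zxx \<bar>X y\<bar> t) (at \<bar>X y\<bar>)"
        using dz X1 t by auto
      show ?thesis
      proof (cases "0 < X y")
        case True
        then have a: "\<bar>X y\<bar> = X y" by simp
        have ev: "\<forall>\<^sub>F s in nhds y. 0 < X s"
          using eventually_nhds_in_open[of "{s. 0 < X s}" y] True
          by (simp add: X_def open_Collect_less continuous_intros)
        have "((\<lambda>y. z (X y) t) has_real_derivative zx (X y) t * r) (at y)"
          using DERIV_chain2[OF dz(1)[unfolded a] dX] .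
        moreover have "((\<lambda>y. r * zx (X y) t) has_real_derivative r * (zxx (X y) t * r)) (at y)"
          by (rule DERIV_cmult) (use DERIV_chain2[OF dz(2)[unfolded a] dX] in simp)
        moreover have "\<forall>\<^sub>F s in nhds y. W s t = z (X s) t" "\<forall>\<^sub>F s in nhds y. Wy s t = r * zx (X s) t"
          by (rule eventually_mono[OF ev], simp add: W_def odd_ext_def Wy_def)+
        ultimately have "((\<lambda>s. W s t) has_real_derivative zx (X y) t * r) (at y)"
          "((\<lambda>s. Wy s t) has_real_derivative r * (zxx (X y) t * r)) (at y)"
          by - (rule has_real_derivative_eventually_eq, assumption, assumption)+
        then show ?thesis using a True
          by (simp add: Wy_def Wyy_def odd_ext_def power2_eq_square mult_ac)
      next
        case False
        then have a: "\<bar>X y\<bar> = - X y" and n: "X y < 0" using X1 by auto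
        have ev: "\<forall>\<^sub>F s in nhds y. X s < 0"
          using eventually_nhds_in_open[of "{s. X s < 0}" y] n
          by (simp add: X_def open_Collect_less continuous_intros)
        have dX': "((\<lambda>y. - X y) has_real_derivative - r) (at y)" by (rule DERIV_minus[OF dX])
        have "((\<lambda>y. - z (- X y) t) has_real_derivative - (zx (- X y) t * - r)) (at y)"
          by (rule DERIV_minus) (use DERIV_chain2[OF dz(1)[unfolded a] dX'] in simp)
        moreover have "((\<lambda>y. r * zx (- X y) t) has_real_derivative r * (zxx (- X y) t * - r)) (at y)"
          by (rule DERIV_cmult) (use DERIV_chain2[OF dz(2)[unfolded a] dX'] in simp)
        moreover have "\<forall>\<^sub>F s in nhds y. W s t = - z (- X s) t" "\<forall>\<^sub>F s in nhds y. Wy s t = r * zx (- X s) t"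
          by (rule eventually_mono[OF ev], simp add: W_def odd_ext_def Wy_def)+
        ultimately have "((\<lambda>s. W s t) has_real_derivative - (zx (- X y) t * - r)) (at y)"
          "((\<lambda>s. Wy s t) has_real_derivative r * (zxx (- X y) t * - r)) (at y)"
          by - (rule has_real_derivative_eventually_eq, assumption, assumption)+
        then show ?thesis using a n
          by (simp add: Wy_def Wyy_def odd_ext_def power2_eq_square mult_ac)
      qed
    qed
    have cWy: "continuous_on {-1..1} (\<lambda>y. Wy y t)" if "t \<in> {0..T}" for t
    proof -
      have "continuous_on {0..1} (\<lambda>x. zx x t)" using dxx that by (meson DERIV_continuous_on)
      then show ?thesis unfolding Wy_def
        by (intro continuous_intros continuous_on_compose2[of _ "\<lambda>x. zx x t" _ "\<lambda>y. \<bar>X y\<bar>"] cX) (use XD(2) in auto)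
    qed
    have cW1: "continuous_on {-1..1} (\<lambda>y. W y t)" "continuous_on {-1..1} (\<lambda>y. Wt y t)" if "t \<in> {0..T}" for t
      using that by (auto intro!: continuous_on_slice[OF cW] continuous_on_slice[OF cWt] continuous_intros)
    have WL: "\<exists>l. \<forall>y\<in>{-1..1}. \<bar>W y t - W 0 t\<bar> \<le> l * \<bar>y\<bar>" if t: "t \<in> {0..T}" for t
    proof -
      have "compact ((\<lambda>y. Wy y t) ` {-1..1})" by (rule compact_continuous_image[OF cWy[OF t]]) simp
      then obtain l where l: "\<forall>y\<in>{-1..1}. \<bar>Wy y t\<bar> \<le> l"
        by (metis (no_types, lifting) bounded_iff compact_imp_bounded imageI real_norm_def)
      have "\<bar>W y t - W 0 t\<bar> \<le> l * \<bar>y\<bar>" if y: "y \<in> {-1..1}" for y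
      proof (cases "0 \<le> y")
        case True
        have "\<bar>W y t - W 0 t\<bar> \<le> l * (y - 0)"
          by (rule lipschitz_of_bounded_derivative[of E _ _ _ "\<lambda>y. Wy y t"])
             (use loc t y l True in \<open>auto simp: E_def intro: continuous_on_subset[OF cW1(1)[OF t]]\<close>)
        then show ?thesis using True by simp
      next
        case False
        have "\<bar>W 0 t - W y t\<bar> \<le> l * (0 - y)"
          by (rule lipschitz_of_bounded_derivative[of E _ _ _ "\<lambda>y. Wy y t"])
             (use loc t y l False in \<open>auto simp: E_def intro: continuous_on_subset[OF cW1(1)[OF t]]\<close>)
        then show ?thesis using False by (simp add: abs_minus_commute)
      qed
      then show ?thesis by blast
    qed
    define G where "G y = odd_ext (\<lambda>x t. zt x t - d\<^sup>2 * zxx x t) (X y)" for y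
    have weak: "((\<lambda>y. G y t * \<theta> y) has_integral weak_form k W Wt t \<theta> \<theta>2) {-1..1}"
      if t: "t \<in> {0..T}" and tf: "test_function \<theta> \<theta>1 \<theta>2" for t \<theta> \<theta>1 \<theta>2
    proof -
      have th: "\<And>y. (\<theta> has_real_derivative \<theta>1 y) (at y)" "\<And>y. (\<theta>1 has_real_derivative \<theta>2 y) (at y)"
        "continuous_on {-1..1} \<theta>2" "\<theta> (-1) = 0" "\<theta> 1 = 0" "\<theta>1 (-1) = 0" "\<theta>1 1 = 0"
        using tf unfolding test_function_def by auto
      have ct: "continuous_on {-1..1} \<theta>" "continuous_on {-1..1} \<theta>1"
        by (rule DERIV_continuous_on[OF has_field_derivative_at_within[OF th(1)]])
           (rule DERIV_continuous_on[OF has_field_derivative_at_within[OF th(2)]])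
      \<comment> \<open>Green's formula: the derivative of \<open>F\<close> is
        \<open>W_yy * \<theta> - W * \<theta>2\<close>, and \<open>F\<close> vanishes at both ends
        because \<open>\<theta>\<close> and \<open>\<theta>1\<close> do.\<close>
      define F where "F y = Wy y t * \<theta> y - W y t * \<theta>1 y" for y
      have "((\<lambda>y. Wyy y t * \<theta> y - W y t * \<theta>2 y) has_integral (F 1 - F (-1))) {-1..1}"
      proof (rule fundamental_theorem_of_calculus_interior_strong[of E])
        fix y assume y: "y \<in> {-1<..<1} - E"
        note l = loc[OF y t]
        have "(F has_real_derivative (Wyy y t * \<theta> y + \<theta>1 y * Wy y t) - (Wy y t * \<theta>1 y + \<theta>2 y * W y t)) (at y)"
          unfolding F_def[abs_def] using l th(1,2) by (intro DERIV_diff DERIV_mult) auto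
        then show "(F has_vector_derivative Wyy y t * \<theta> y - W y t * \<theta>2 y) (at y)"
          by (simp add: has_real_derivative_iff_has_vector_derivative mult.commute)
      next
        show "continuous_on {-1..1} F" unfolding F_def
          by (intro continuous_intros cWy t cW1 ct)
      qed (auto simp: E_def F_def)
      also have "F 1 - F (-1) = 0" by (simp add: F_def th)
      finally have i0: "((\<lambda>y. (Wyy y t * \<theta> y - W y t * \<theta>2 y) / c\<^sup>2) has_integral 0 / c\<^sup>2) {-1..1}"
        by (rule has_integral_divide)
      have i1: "((\<lambda>y. Wt y t * \<theta> y - W y t * \<theta>2 y / (4 * k)) has_integral weak_form k W Wt t \<theta> \<theta>2) {-1..1}"
        unfolding weak_form_def using k
        by (intro integrable_integral integrable_continuous_interval continuous_intros cW1[OF t] ct th(3)) auto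
      have "((\<lambda>y. (Wt y t * \<theta> y - W y t * \<theta>2 y / (4 * k)) - (Wyy y t * \<theta> y - W y t * \<theta>2 y) / c\<^sup>2)
          has_integral weak_form k W Wt t \<theta> \<theta>2 - 0 / c\<^sup>2) {-1..1}"
        by (rule has_integral_diff[OF i1 i0])
      moreover have "(Wt y t * \<theta> y - W y t * \<theta>2 y / (4 * k)) - (Wyy y t * \<theta> y - W y t * \<theta>2 y) / c\<^sup>2 = G y t * \<theta> y" for y
      proof -
        have "Wt y t - Wyy y t / c\<^sup>2 = G y t"
          using c unfolding Wt_def Wyy_def G_def odd_ext_def r_def by (simp add: power_mult_distrib)
        moreover have "4 * k = c\<^sup>2" by (simp add: k_def)
        ultimately show ?thesis by (simp add: diff_divide_distrib left_diff_distrib[symmetric] algebra_simps flip: \<open>Wt y t - Wyy y t / c\<^sup>2 = G y t\<close>)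
      qed
      ultimately show ?thesis by simp
    qed
    have bnd: "\<bar>I\<bar> \<le> B * integral {-1..1} (\<lambda>y. \<bar>\<theta> y\<bar>)"
      if "((\<lambda>y. g y * \<theta> y) has_integral I) {-1..1}" "\<And>y. y \<in> {-1..1} \<Longrightarrow> \<bar>g y\<bar> \<le> B" "test_function \<theta> \<theta>1 \<theta>2"
      for g I B and \<theta> \<theta>1 \<theta>2 :: "real \<Rightarrow> real"
    proof -
      have ct: "continuous_on {-1..1} \<theta>"
        using that(3) unfolding test_function_def
        by (meson DERIV_continuous_on has_field_derivative_at_within)
      have "norm (integral {-1..1} (\<lambda>y. g y * \<theta> y)) \<le> integral {-1..1} (\<lambda>y. B * \<bar>\<theta> y\<bar>)"
      proof (rule integral_norm_bound_integral)
        show "(\<lambda>y. g y * \<theta> y) integrable_on {-1..1}" using that(1) by blast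
        show "(\<lambda>y. B * \<bar>\<theta> y\<bar>) integrable_on {-1..1}"
          by (intro integrable_continuous_interval continuous_intros ct)
      qed (use that(2) in \<open>auto simp: abs_mult intro!: mult_right_mono\<close>)
      then show ?thesis using that(1) by (simp add: integral_unique)
    qed
    have "\<bar>Wt 0 t\<bar> \<le> K * (S + M + H)"
    proof (rule K(2)[OF nn(2,3) cW cWt dW _ bW WL _ _ t])
      show "W y 0 = 0" if "y \<in> {-1..1}" for y
        using z0[OF XD(2)[OF that]] by (auto simp: W_def odd_ext_def abs_if)
      fix s t \<theta> \<theta>1 \<theta>2 assume t: "t \<in> {0..T}" and tf: "test_function \<theta> \<theta>1 \<theta>2"
      show "\<bar>weak_form k W Wt t \<theta> \<theta>2\<bar> \<le> M * integral {-1..1} (\<lambda>y. \<bar>\<theta> y\<bar>)"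
      proof (rule bnd[OF weak[OF t tf] _ tf])
        fix y :: real assume y: "y \<in> {-1..1}"
        show "\<bar>G y t\<bar> \<le> M" using bG[OF XD(2,3)[OF y] t] by (simp add: G_def abs_odd_ext)
      qed
      assume s: "s \<in> {0..T}" "s \<le> t"
      have "((\<lambda>y. (G y s - G y t) * \<theta> y) has_integral weak_form k W Wt s \<theta> \<theta>2 - weak_form k W Wt t \<theta> \<theta>2) {-1..1}"
        using has_integral_diff[OF weak[OF s(1) tf] weak[OF t tf]] by (simp add: left_diff_distrib)
      then show "\<bar>weak_form k W Wt s \<theta> \<theta>2 - weak_form k W Wt t \<theta> \<theta>2\<bar>
          \<le> H * (t - s) powr a * integral {-1..1} (\<lambda>y. \<bar>\<theta> y\<bar>)"
      proof (rule bnd[OF _ _ tf])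
        fix y :: real assume y: "y \<in> {-1..1}"
        show "\<bar>G y s - G y t\<bar> \<le> H * (t - s) powr a"
          using hG[OF XD(2,3)[OF y] t s] by (simp add: G_def abs_odd_ext)
      qed
    qed
    moreover have "Wt 0 t = zt x0 t" using x0 by (simp add: Wt_def X_def odd_ext_def)
    ultimately show "\<bar>zt x0 t\<bar> \<le> K * (S + M + H)" by simp
  qed
qed

section \<open>Maximum principle and layer barriers\<close>

lemma vec_component_deriv:
  assumes "(g has_vector_derivative g') F"
  shows "((\<lambda>r. (g r :: real^'n) $ k) has_real_derivative g' $ k) F"
  using bounded_linear.has_vector_derivative[OF bounded_linear_vec_nth assms]
  by (simp add: has_real_derivative_iff_has_vector_derivative)

lemma interior_min_second_derivative:
  fixes g :: "real \<Rightarrow> real"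
  assumes x: "a < x" "x < b"
    and d1: "\<And>y. a < y \<Longrightarrow> y < b \<Longrightarrow> (g has_real_derivative g1 y) (at y)"
    and d2: "(g1 has_real_derivative g2) (at x)"
    and min: "\<And>y. a < y \<Longrightarrow> y < b \<Longrightarrow> g x \<le> g y"
  shows "0 \<le> g2"
proof (rule ccontr)
  assume "\<not> 0 \<le> g2"
  then have neg: "g2 < 0" by simp
  have z: "g1 x = 0"
    using DERIV_local_min[OF d1[OF x], of "min (x - a) (b - x)"] x min by (auto simp: abs_if split: if_splits)
  obtain e where e: "e > 0" "\<And>h. 0 < h \<Longrightarrow> h < e \<Longrightarrow> g1 (x + h) < g1 x"
    using DERIV_neg_dec_right[OF d2 neg] by auto
  define h where "h = min e (b - x) / 2"
  have h: "0 < h" "h < e" "x + h < b" using e(1) x by (auto simp: h_def min_def field_simps)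
  have "\<exists>z>x. z < x + h \<and> g (x + h) - g x = (x + h - x) * g1 z"
    using h x by (intro MVT2 d1) auto
  then obtain z where zz: "x < z" "z < x + h" "g (x + h) - g x = h * g1 z" by auto
  have "g1 z < 0" using e(2)[of "z - x"] zz h z by auto
  then have "h * g1 z < 0" using h(1) by (simp add: mult_pos_neg)
  then have "g (x + h) < g x" using zz(3) by linarith
  then show False using min[of "x + h"] h x by auto
qed

text \<open>The minimum may sit at the final time \<open>T\<close>, so only difference quotients
  from the left are used; all of them are nonpositive.\<close>

lemma end_min_derivative:
  fixes g :: "real \<Rightarrow> real"
  assumes t: "0 < t" "t \<le> T" and d: "(g has_real_derivative g') (at t within {0..T})"
    and min: "\<And>s. s \<in> {0..T} \<Longrightarrow> g t \<le> g s"
  shows "g' \<le> 0"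
proof -
  have "(g has_real_derivative g') (at t within {0..t})"
    by (rule has_field_derivative_subset[OF d]) (use t in auto)
  then have l: "((\<lambda>s. (g s - g t) / (s - t)) \<longlongrightarrow> g') (at t within {0..t})"
    by (simp add: has_field_derivative_iff)
  show ?thesis
  proof (rule tendsto_upperbound[OF l])
    show "\<forall>\<^sub>F s in at t within {0..t}. (g s - g t) / (s - t) \<le> 0"
      unfolding eventually_at_filter using min t
      by (intro always_eventually) (auto simp: divide_le_0_iff)
    show "at t within {0..t} \<noteq> bot" using t by (simp add: trivial_limit_within islimpt_Icc)
  qed
qed

lemma cooperative_minimum_principle:
  fixes A :: "real \<Rightarrow> real^'n^'n" and \<psi> \<psi>t \<psi>x \<psi>xx :: "real \<Rightarrow> real \<Rightarrow> real^'n"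
  assumes T: "T \<ge> 0"
    and A: "\<And>x i j. x \<in> {0..1} \<Longrightarrow> i \<noteq> j \<Longrightarrow> A x $ i $ j \<le> 0"
      "\<And>x i. x \<in> {0..1} \<Longrightarrow> 0 < (\<Sum>j\<in>UNIV. A x $ i $ j)"
    and c: "continuous_on ({0..1} \<times> {0..T}) (\<lambda>(x, t). \<psi> x t)"
    and dt: "\<And>x t. x \<in> {0<..<1} \<Longrightarrow> t \<in> {0<..T} \<Longrightarrow> (\<psi> x has_vector_derivative \<psi>t x t) (at t within {0..T})"
    and dx: "\<And>x t. x \<in> {0<..<1} \<Longrightarrow> t \<in> {0<..T} \<Longrightarrow> ((\<lambda>y. \<psi> y t) has_vector_derivative \<psi>x x t) (at x)"
    and dxx: "\<And>x t. x \<in> {0<..<1} \<Longrightarrow> t \<in> {0<..T} \<Longrightarrow> ((\<lambda>y. \<psi>x y t) has_vector_derivative \<psi>xx x t) (at x)"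
    and P: "\<And>x t k. x \<in> {0<..<1} \<Longrightarrow> t \<in> {0<..T} \<Longrightarrow> 0 \<le> (\<psi>t x t - d\<^sup>2 *\<^sub>R \<psi>xx x t + A x *v \<psi> x t) $ k"
    and bd: "\<And>x t k. x \<in> {0..1} \<Longrightarrow> t \<in> {0..T} \<Longrightarrow> x = 0 \<or> x = 1 \<or> t = 0 \<Longrightarrow> 0 \<le> \<psi> x t $ k"
    and x: "x \<in> {0..1}" and t: "t \<in> {0..T}"
  shows "0 \<le> \<psi> x t $ k"
proof (rule ccontr)
  assume "\<not> 0 \<le> \<psi> x t $ k"
  then have neg: "\<psi> x t $ k < 0" by simp
  have "\<exists>p\<in>{0..1} \<times> {0..T}. \<forall>q\<in>{0..1} \<times> {0..T}. (\<lambda>(x, t). \<psi> x t $ i) p \<le> (\<lambda>(x, t). \<psi> x t $ i) q" for i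
    using x t by (intro continuous_attains_inf compact_Times)
      (auto simp: case_prod_beta intro!: continuous_on_component c[unfolded case_prod_beta])
  then have "\<forall>i. \<exists>p. p \<in> {0..1} \<times> {0..T} \<and>
      (\<forall>q\<in>{0..1} \<times> {0..T}. \<psi> (fst p) (snd p) $ i \<le> \<psi> (fst q) (snd q) $ i)"
    unfolding case_prod_beta by blast
  then obtain p where p': "\<And>i. p i \<in> {0..1} \<times> {0..T}"
    "\<And>i. \<forall>q\<in>{0..1} \<times> {0..T}. \<psi> (fst (p i)) (snd (p i)) $ i \<le> \<psi> (fst q) (snd q) $ i"
    using choice_iff[of "\<lambda>i p. p \<in> {0..1} \<times> {0..T} \<and>
      (\<forall>q\<in>{0..1} \<times> {0..T}. \<psi> (fst p) (snd p) $ i \<le> \<psi> (fst q) (snd q) $ i)"] by blast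
  have p: "p i \<in> {0..1} \<times> {0..T}"
    "y \<in> {0..1} \<Longrightarrow> s \<in> {0..T} \<Longrightarrow> \<psi> (fst (p i)) (snd (p i)) $ i \<le> \<psi> y s $ i" for i y s
    using p'(1)[of i] p'(2)[of i] by force+
  define m where "m i = \<psi> (fst (p i)) (snd (p i)) $ i" for i
  have "Min (range m) \<in> range m" by (rule Min_in) auto
  then obtain i where "Min (range m) = m i" by blast
  then have i: "m i \<le> m j" for j by (metis Min_le finite finite_imageI rangeI)
  define x0 t0 where "x0 = fst (p i)" and "t0 = snd (p i)"
  have xt: "x0 \<in> {0..1}" "t0 \<in> {0..T}" using p(1)[of i] by (auto simp: x0_def t0_def mem_Times_iff)
  have min: "\<psi> x0 t0 $ i \<le> \<psi> y s $ j" if "y \<in> {0..1}" "s \<in> {0..T}" for y s j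
    using p(2)[OF that, of j] i[of j] by (simp add: m_def x0_def t0_def)
  have n: "\<psi> x0 t0 $ i < 0" using min[OF x t, of k] neg by simp
  have int: "x0 \<in> {0<..<1}" "t0 \<in> {0<..T}"
    using bd[OF xt, of i] n xt by (auto simp: less_le)
  have 1: "\<psi>t x0 t0 $ i \<le> 0"
    by (rule end_min_derivative[OF _ _ vec_component_deriv[OF dt[OF int]]]) (use int min xt in auto)
  have 2: "0 \<le> \<psi>xx x0 t0 $ i"
    by (rule interior_min_second_derivative[of 0 x0 1 "\<lambda>y. \<psi> y t0 $ i" "\<lambda>y. \<psi>x y t0 $ i"])
       (use int min xt in \<open>auto intro!: vec_component_deriv dx dxx\<close>)
  have "(A x0 *v \<psi> x0 t0) $ i = (\<Sum>j\<in>UNIV. A x0 $ i $ j * \<psi> x0 t0 $ j)"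
    by (simp add: matrix_vector_mult_def)
  also have "\<dots> \<le> (\<Sum>j\<in>UNIV. A x0 $ i $ j * \<psi> x0 t0 $ i)"
  proof (rule sum_mono)
    fix j show "A x0 $ i $ j * \<psi> x0 t0 $ j \<le> A x0 $ i $ j * \<psi> x0 t0 $ i"
      using A(1)[OF xt(1), of i j] min[OF xt, of j] by (cases "i = j") (auto intro: mult_left_mono_neg)
  qed
  also have "\<dots> = (\<Sum>j\<in>UNIV. A x0 $ i $ j) * \<psi> x0 t0 $ i" by (simp add: sum_distrib_right)
  also have "\<dots> < 0" using A(2)[OF xt(1), of i] n by (rule mult_pos_neg)
  finally have 3: "(A x0 *v \<psi> x0 t0) $ i < 0" .
  have "0 \<le> d\<^sup>2 * \<psi>xx x0 t0 $ i" using 2 by simp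
  with 1 3 P[OF int, of i] show False by simp
qed

section \<open>Layer functions and weighted comparison\<close>

definition layer :: "real \<Rightarrow> real \<Rightarrow> real \<Rightarrow> real" where
  "layer b d x = exp (- b * x / d) + exp (- b * (1 - x) / d)"

definition layer' :: "real \<Rightarrow> real \<Rightarrow> real \<Rightarrow> real" where
  "layer' b d x = (b / d) * (exp (- b * (1 - x) / d) - exp (- b * x / d))"

definition weight :: "real \<Rightarrow> real \<Rightarrow> nat \<Rightarrow> real \<Rightarrow> real" where
  "weight b d m x = 1 + layer b d x / d ^ m"

lemma layer_deriv:
  assumes "d > 0"
  shows "(layer b d has_real_derivative layer' b d x) (at x)"
    "(layer' b d has_real_derivative (b / d)\<^sup>2 * layer b d x) (at x)"
  using assms unfolding layer_def[abs_def] layer'_def[abs_def]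
  by (auto intro!: derivative_eq_intros simp: power2_eq_square field_simps layer_def layer'_def)

lemma layer_pos: "layer b d x > 0" by (simp add: layer_def add_pos_pos)

lemma layer_bdry: "1 \<le> layer b d 0" "1 \<le> layer b d 1" by (simp_all add: layer_def)

lemma weight_ge_1: "d > 0 \<Longrightarrow> 1 \<le> weight b d m x"
  using layer_pos[of b d x] by (simp add: weight_def)

lemma weight_mono:
  assumes "0 < d" "d \<le> 1" "m \<le> n" shows "weight b d m x \<le> weight b d n x"
  using assms layer_pos[of b d x] power_decreasing[OF assms(3), of d]
  by (auto simp: weight_def intro!: divide_left_mono)

text \<open>At the end points the weight dominates the crude bound \<open>d^-m\<close>. Crude bounds
  for derivatives therefore suffice as boundary data in the comparison, and decay into the interior
  comes from the barrier.\<close>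

lemma weight_bdry:
  assumes "d > 0" "x = 0 \<or> x = 1" shows "1 / d ^ m \<le> weight b d m x"
proof -
  have "1 / d ^ m \<le> layer b d x / d ^ m"
    using assms layer_bdry[of b d] by (auto intro!: divide_right_mono)
  then show ?thesis by (simp add: weight_def)
qed

lemma has_vector_derivative_barrier:
  assumes "(g has_real_derivative g') (at y within S)" "(Z has_vector_derivative Z') (at y within S)"
  shows "((\<lambda>y. g y *\<^sub>R v + (s::real) *\<^sub>R Z y) has_vector_derivative g' *\<^sub>R v + s *\<^sub>R Z') (at y within S)"
  using has_vector_derivative_add[OF
      has_vector_derivative_scaleR[OF assms(1) has_vector_derivative_const[of v]]
      has_vector_derivative_scaleR[OF DERIV_const[of s] assms(2)]]
  by simp

text \<open>The barrier \<open>(c0 + c1 t) (1 + d^{-m} layer)\<close> exploits \<open>- d^2 layer'' = - b^2 layer\<close> with \<open>b^2 < \<beta>s\<close>.\<close>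

lemma weighted_comparison:
  fixes A :: "real \<Rightarrow> real^'n^'n" and Z Zt Zx Zxx :: "real \<Rightarrow> real \<Rightarrow> real^'n"
  assumes T: "T \<ge> 0" and d: "d > 0" and b: "0 \<le> b" "b\<^sup>2 < \<beta>s" and c01: "c0 \<ge> 0" "c1 \<ge> 0"
    and A: "\<And>x i j. x \<in> {0..1} \<Longrightarrow> i \<noteq> j \<Longrightarrow> A x $ i $ j \<le> 0"
      "\<And>x i. x \<in> {0..1} \<Longrightarrow> \<beta>s \<le> (\<Sum>j\<in>UNIV. A x $ i $ j)"
    and c: "continuous_on ({0..1} \<times> {0..T}) (\<lambda>(x, t). Z x t)"
    and dt: "\<And>x t. x \<in> {0..1} \<Longrightarrow> t \<in> {0..T} \<Longrightarrow> (Z x has_vector_derivative Zt x t) (at t within {0..T})"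
    and dx: "\<And>x t. x \<in> {0..1} \<Longrightarrow> t \<in> {0..T} \<Longrightarrow> ((\<lambda>y. Z y t) has_vector_derivative Zx x t) (at x within {0..1})"
    and dxx: "\<And>x t. x \<in> {0..1} \<Longrightarrow> t \<in> {0..T} \<Longrightarrow> ((\<lambda>y. Zx y t) has_vector_derivative Zxx x t) (at x within {0..1})"
    and P: "\<And>x t k. x \<in> {0..1} \<Longrightarrow> t \<in> {0..T} \<Longrightarrow>
        \<bar>(Zt x t - d\<^sup>2 *\<^sub>R Zxx x t + A x *v Z x t) $ k\<bar> \<le> (c1 + (\<beta>s - b\<^sup>2) * c0) * weight b d m x"
    and bd: "\<And>x t k. x \<in> {0..1} \<Longrightarrow> t \<in> {0..T} \<Longrightarrow> x = 0 \<or> x = 1 \<or> t = 0 \<Longrightarrow> \<bar>Z x t $ k\<bar> \<le> (c0 + c1 * t) * weight b d m x"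
    and x: "x \<in> {0..1}" and t: "t \<in> {0..T}"
  shows "\<bar>Z x t $ k\<bar> \<le> (c0 + c1 * t) * weight b d m x"
proof -
  define one :: "real^'n" where "one = (\<chi> k. 1)"
  have dw: "(weight b d m has_real_derivative layer' b d y / d ^ m) (at y within S)" for y S
    unfolding weight_def[abs_def] using layer_deriv(1)[OF d]
    using d by (auto intro!: derivative_eq_intros intro: has_field_derivative_at_within)
  have dw2: "((\<lambda>y. layer' b d y / d ^ m) has_real_derivative (b / d)\<^sup>2 * layer b d y / d ^ m) (at y within S)" for y S
    using layer_deriv(2)[OF d] d by (auto intro!: derivative_eq_intros intro: has_field_derivative_at_within)
  have cw: "continuous_on S (weight b d m)" for S using dw by (rule DERIV_continuous_on)
  have "0 \<le> (((c0 + c1 * t) * weight b d m x) *\<^sub>R one + sg *\<^sub>R Z x t) $ k" if sg: "sg = 1 \<or> sg = -1" for sg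
  proof (rule cooperative_minimum_principle[OF T A(1), where d = d
        and \<psi> = "\<lambda>x t. ((c0 + c1 * t) * weight b d m x) *\<^sub>R one + sg *\<^sub>R Z x t"
        and \<psi>t = "\<lambda>x t. (c1 * weight b d m x) *\<^sub>R one + sg *\<^sub>R Zt x t"
        and \<psi>x = "\<lambda>x t. ((c0 + c1 * t) * (layer' b d x / d ^ m)) *\<^sub>R one + sg *\<^sub>R Zx x t"
        and \<psi>xx = "\<lambda>x t. ((c0 + c1 * t) * ((b / d)\<^sup>2 * layer b d x / d ^ m)) *\<^sub>R one + sg *\<^sub>R Zxx x t"])
    show "0 < (\<Sum>j\<in>UNIV. A x $ i $ j)" if "x \<in> {0..1}" for x i
      using A(2)[OF that, of i] b(2) zero_le_power2[of b] by linarith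
    show "continuous_on ({0..1} \<times> {0..T}) (\<lambda>(x, t). ((c0 + c1 * t) * weight b d m x) *\<^sub>R one + sg *\<^sub>R Z x t)"
      unfolding case_prod_beta
      by (intro continuous_intros continuous_on_compose2[OF cw] c[unfolded case_prod_beta]) auto
    fix x t :: real and k :: 'n
    assume xt: "x \<in> {0<..<1}" "t \<in> {0<..T}"
    then have xt': "x \<in> {0..1}" "t \<in> {0..T}" by auto
    have at: "at x within {0..1} = at x" using xt by (intro at_within_Icc_at) auto
    show "((\<lambda>t. ((c0 + c1 * t) * weight b d m x) *\<^sub>R one + sg *\<^sub>R Z x t) has_vector_derivative
            (c1 * weight b d m x) *\<^sub>R one + sg *\<^sub>R Zt x t) (at t within {0..T})"
      by (rule has_vector_derivative_barrier[OF _ dt[OF xt']]) (auto intro!: derivative_eq_intros)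
    have "((\<lambda>y. (c0 + c1 * t) * weight b d m y) has_real_derivative (c0 + c1 * t) * (layer' b d x / d ^ m)) (at x)"
      by (rule DERIV_cmult[OF dw])
    then show "((\<lambda>y. ((c0 + c1 * t) * weight b d m y) *\<^sub>R one + sg *\<^sub>R Z y t) has_vector_derivative
        ((c0 + c1 * t) * (layer' b d x / d ^ m)) *\<^sub>R one + sg *\<^sub>R Zx x t) (at x)"
      by (rule has_vector_derivative_barrier[OF _ dx[OF xt', unfolded at]])
    have "((\<lambda>y. (c0 + c1 * t) * (layer' b d y / d ^ m)) has_real_derivative (c0 + c1 * t) * ((b / d)\<^sup>2 * layer b d x / d ^ m)) (at x)"
      by (rule DERIV_cmult[OF dw2])
    then show "((\<lambda>y. ((c0 + c1 * t) * (layer' b d y / d ^ m)) *\<^sub>R one + sg *\<^sub>R Zx y t) has_vector_derivative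
        ((c0 + c1 * t) * ((b / d)\<^sup>2 * layer b d x / d ^ m)) *\<^sub>R one + sg *\<^sub>R Zxx x t) (at x)"
      by (rule has_vector_derivative_barrier[OF _ dxx[OF xt', unfolded at]])
    define p where "p = c0 + c1 * t"
    define w where "w = weight b d m x"
    define l where "l = layer b d x / d ^ m"
    have p: "p \<ge> 0" "p \<ge> c0" using c01 xt by (auto simp: p_def)
    have l: "l > 0" using layer_pos[of b d x] d by (simp add: l_def)
    have w: "w = 1 + l" by (simp add: w_def weight_def l_def)
    have A1: "(A x *v one) $ k \<ge> \<beta>s" using A(2)[OF xt'(1), of k] by (simp add: matrix_vector_mult_def one_def)
    have "((c1 * w) *\<^sub>R one + sg *\<^sub>R Zt x t - d\<^sup>2 *\<^sub>R ((p * ((b / d)\<^sup>2 * layer b d x / d ^ m)) *\<^sub>R one + sg *\<^sub>R Zxx x t)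
          + A x *v ((p * w) *\<^sub>R one + sg *\<^sub>R Z x t)) $ k
       = c1 * w - b\<^sup>2 * p * l + p * w * (A x *v one) $ k
          + sg * (Zt x t - d\<^sup>2 *\<^sub>R Zxx x t + A x *v Z x t) $ k"
    proof -
      have Av: "A x *v ((p * w) *\<^sub>R one + sg *\<^sub>R Z x t) = (p * w) *\<^sub>R (A x *v one) + sg *\<^sub>R (A x *v Z x t)"
        by (simp add: matrix_vector_right_distrib matrix_vector_mult_scaleR)
      have e: "d\<^sup>2 * (p * ((b / d)\<^sup>2 * layer b d x / d ^ m)) = b\<^sup>2 * p * l"
        using d by (simp add: l_def power_divide)
      have o1: "one $ k = 1" by (simp add: one_def)
      have "((c1 * w) *\<^sub>R one + sg *\<^sub>R Zt x t - d\<^sup>2 *\<^sub>R ((p * ((b / d)\<^sup>2 * layer b d x / d ^ m)) *\<^sub>R one + sg *\<^sub>R Zxx x t)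
          + ((p * w) *\<^sub>R (A x *v one) + sg *\<^sub>R (A x *v Z x t))) $ k
        = c1 * w + sg * Zt x t $ k - (d\<^sup>2 * (p * ((b / d)\<^sup>2 * layer b d x / d ^ m)) + d\<^sup>2 * (sg * Zxx x t $ k))
          + (p * w * (A x *v one) $ k + sg * (A x *v Z x t) $ k)"
        by (simp add: o1 distrib_left)
      then show ?thesis unfolding Av e by (simp add: right_diff_distrib distrib_left)
    qed
    \<comment> \<open>The source bound is matched term by term: \<open>c1 * w\<close> comes from the
      time derivative of the barrier, and \<open>(\<beta>s - b\<^sup>2) * c0 * w\<close> from the
      reaction after the diffusion of the layer part has used up \<open>b\<^sup>2\<close>; the
      latter is affordable because \<open>l\<close> is at most \<open>w = 1 + l\<close>.\<close>
    moreover have "\<dots> \<ge> 0"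
    proof -
      have "sg * (Zt x t - d\<^sup>2 *\<^sub>R Zxx x t + A x *v Z x t) $ k \<ge> - ((c1 + (\<beta>s - b\<^sup>2) * c0) * w)"
        using P[OF xt', of k] sg unfolding w_def by (auto simp: abs_le_iff)
      moreover have "p * w * (A x *v one) $ k \<ge> p * w * \<beta>s"
        using A1 p l w by (intro mult_left_mono) auto
      moreover have "p * w * \<beta>s - b\<^sup>2 * p * l \<ge> p * w * (\<beta>s - b\<^sup>2)"
        using p l unfolding w by (simp add: algebra_simps)
      moreover have "p * w * (\<beta>s - b\<^sup>2) \<ge> c0 * w * (\<beta>s - b\<^sup>2)"
        using p l w b by (intro mult_right_mono) auto
      moreover have "(c1 + (\<beta>s - b\<^sup>2) * c0) * w = c1 * w + c0 * w * (\<beta>s - b\<^sup>2)" by (simp add: algebra_simps)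
      ultimately show ?thesis by linarith
    qed
    ultimately show "0 \<le> ((c1 * weight b d m x) *\<^sub>R one + sg *\<^sub>R Zt x t -
          d\<^sup>2 *\<^sub>R (((c0 + c1 * t) * ((b / d)\<^sup>2 * layer b d x / d ^ m)) *\<^sub>R one + sg *\<^sub>R Zxx x t)
          + A x *v (((c0 + c1 * t) * weight b d m x) *\<^sub>R one + sg *\<^sub>R Z x t)) $ k"
      unfolding p_def w_def by simp
  next
    fix x t :: real and k :: 'n
    assume "x \<in> {0..1}" "t \<in> {0..T}" "x = 0 \<or> x = 1 \<or> t = 0"
    from bd[OF this, of k] sg
    show "0 \<le> (((c0 + c1 * t) * weight b d m x) *\<^sub>R one + sg *\<^sub>R Z x t) $ k"
      by (auto simp: one_def abs_le_iff)
  qed (use x t in auto)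
  from this[of 1] this[of "-1"] show ?thesis by (auto simp: one_def abs_le_iff)
qed

section \<open>A priori bounds for the derivatives\<close>

lemma vector_lipschitz:
  fixes g g1 :: "real \<Rightarrow> 'a::real_normed_vector"
  assumes "convex S" "x \<in> S" "y \<in> S"
    and "\<And>z. z \<in> S \<Longrightarrow> (g has_vector_derivative g1 z) (at z within S)"
    and "\<And>z. z \<in> S \<Longrightarrow> norm (g1 z) \<le> B"
  shows "norm (g y - g x) \<le> B * \<bar>y - x\<bar>"
proof -
  have "norm (g y - g x) \<le> B * norm (y - x)"
  proof (rule differentiable_bound[OF assms(1) _ _ assms(3,2)])
    fix z assume z: "z \<in> S"
    show "(g has_derivative (\<lambda>h. h *\<^sub>R g1 z)) (at z within S)"
      using assms(4)[OF z] by (simp add: has_vector_derivative_def)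
    show "onorm (\<lambda>h. h *\<^sub>R g1 z) \<le> B"
    proof (rule onorm_le)
      show "norm (h *\<^sub>R g1 z) \<le> B * norm h" for h
        using mult_right_mono[OF assms(5)[OF z], of "\<bar>h\<bar>"] by (simp add: mult.commute)
    qed
  qed
  then show ?thesis by simp
qed

text \<open>The first derivative is read off from the increment of \<open>g\<close> up to a
  second-order error. The step \<open>y - x\<close> is free; a choice proportional to
  \<open>d\<close> makes one derivative cost exactly one factor \<open>1 / d\<close>.\<close>

lemma landau_inequality:
  fixes g g1 :: "real \<Rightarrow> 'a::real_normed_vector"
  assumes S: "convex S" "x \<in> S" "y \<in> S"
    and d1: "\<And>z. z \<in> S \<Longrightarrow> (g has_vector_derivative g1 z) (at z within S)"
    and d2: "\<And>z. z \<in> S \<Longrightarrow> (g1 has_vector_derivative g2 z) (at z within S)"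
    and b0: "\<And>z. z \<in> S \<Longrightarrow> norm (g z) \<le> M0" and b2: "\<And>z. z \<in> S \<Longrightarrow> norm (g2 z) \<le> M2"
  shows "\<bar>y - x\<bar> * norm (g1 x) \<le> 2 * M0 + M2 * (y - x)\<^sup>2"
proof -
  let ?I = "closed_segment x y"
  have I: "?I \<subseteq> S" using S by (simp add: closed_segment_subset)
  have M2: "M2 \<ge> 0" using b2[OF S(2)] norm_ge_zero order_trans by blast
  have "norm (g1 z - g1 x) \<le> M2 * \<bar>y - x\<bar>" if z: "z \<in> ?I" for z
  proof -
    have "norm (g1 z - g1 x) \<le> M2 * \<bar>z - x\<bar>"
      by (rule vector_lipschitz[OF S(1,2) _ d2 b2]) (use I z in auto)
    also have "\<dots> \<le> M2 * \<bar>y - x\<bar>"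
      using z M2 by (intro mult_left_mono) (auto simp: closed_segment_eq_real_ivl split: if_splits)
    finally show ?thesis .
  qed
  then have "norm (g y - g x - (y - x) *\<^sub>R g1 x) \<le> norm (y - x) * (M2 * \<bar>y - x\<bar>)"
    using I by (intro vector_differentiable_bound_linearization[where S = ?I])
      (auto intro: has_vector_derivative_within_subset[OF d1])
  then have 1: "norm (g y - g x - (y - x) *\<^sub>R g1 x) \<le> M2 * (y - x)\<^sup>2"
    by (simp add: mult_ac power2_eq_square abs_mult_self_eq)
  have "norm ((y - x) *\<^sub>R g1 x) \<le> norm (g y - g x) + norm (g y - g x - (y - x) *\<^sub>R g1 x)"
    by (metis norm_triangle_ineq4 add_diff_cancel_left' diff_diff_eq2 add.commute diff_add_cancel)
  also have "\<dots> \<le> (norm (g y) + norm (g x)) + M2 * (y - x)\<^sup>2"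
    using 1 by (intro add_mono norm_triangle_ineq4)
  also have "\<dots> \<le> 2 * M0 + M2 * (y - x)\<^sup>2" using b0[OF S(2)] b0[OF S(3)] by simp
  finally show ?thesis by simp
qed

text \<open>Turns Lipschitz bounds on a bounded time interval into Hoelder bounds.\<close>

lemma le_powr_bound:
  fixes \<tau> T a :: real
  assumes "0 \<le> \<tau>" "\<tau> \<le> T" "0 < a" "a \<le> 1" shows "\<tau> \<le> (T + 1) * \<tau> powr a"
proof (cases "\<tau> \<le> 1")
  case True
  have "\<tau> = \<tau> powr 1" using assms by simp
  also have "\<dots> \<le> \<tau> powr a" using True assms by (intro powr_mono') auto
  also have "\<dots> \<le> (T + 1) * \<tau> powr a" using mult_right_mono[of 1 "T + 1" "\<tau> powr a"] assms by simp
  finally show ?thesis .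
next
  case False
  then have "1 \<le> \<tau> powr a" using assms by (intro ge_one_powr_ge_zero) auto
  then have "(T + 1) * 1 \<le> (T + 1) * \<tau> powr a" using assms by (intro mult_left_mono) auto
  moreover have "\<tau> \<le> (T + 1) * 1" using assms by simp
  ultimately show ?thesis by (rule order_trans[rotated])
qed

lemma has_vector_derivative_shift_within:
  assumes "(g has_vector_derivative g') (at (t + \<tau>) within {0..T})" "\<tau> \<ge> 0"
  shows "((\<lambda>r. g (r + \<tau>)) has_vector_derivative g') (at t within {0..T - \<tau>})"
proof -
  have "((\<lambda>r. r + \<tau>) has_vector_derivative 1) (at t within {0..T - \<tau>})"
    by (auto intro!: derivative_eq_intros)
  moreover have "(g has_vector_derivative g') (at (t + \<tau>) within (\<lambda>r. r + \<tau>) ` {0..T - \<tau>})"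
    by (rule has_vector_derivative_within_subset[OF assms(1)]) (use assms(2) in auto)
  ultimately show ?thesis
    using vector_diff_chain_within[of "\<lambda>r. r + \<tau>" 1 t "{0..T - \<tau>}" g g'] by (simp add: o_def)
qed

lemma norm_le_card_component:
  fixes v :: "real^'n" and B :: real
  assumes "\<And>k. \<bar>v $ k\<bar> \<le> B" shows "norm v \<le> CARD('n) * B"
proof -
  have "norm v \<le> (\<Sum>k\<in>UNIV. \<bar>v $ k\<bar>)" by (rule norm_le_l1_cart)
  also have "\<dots> \<le> (\<Sum>k\<in>(UNIV::'n set). B)" by (intro sum_mono assms)
  finally show ?thesis by simp
qed

lemma layer_le_2: "0 \<le> b \<Longrightarrow> d > 0 \<Longrightarrow> x \<in> {0..1} \<Longrightarrow> layer b d x \<le> 2"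
proof -
  assume h: "0 \<le> b" "d > 0" "x \<in> {0..1}"
  have "exp (- b * x / d) \<le> 1" "exp (- b * (1 - x) / d) \<le> 1" using h by auto
  then show ?thesis unfolding layer_def by linarith
qed

type_synonym 'n family = "nat \<Rightarrow> nat \<Rightarrow> real \<Rightarrow> real \<Rightarrow> real^'n"

text \<open>In a family \<open>U\<close>, the function \<open>U s q\<close> stands for $\partial_x^s\partial_t^q u$, and \<open>A l\<close>
  for the \<open>l\<close>-th derivative of the reaction matrix; throughout, \<open>d\<close> is $\sqrt\varepsilon$.\<close>

locale sp_data =
  fixes T \<beta>s \<beta> a CA Cf H :: real
    and A :: "nat \<Rightarrow> real \<Rightarrow> real^'n^'n" and f :: "'n::finite family"
  assumes T: "T > 0" and beta: "0 < \<beta>" "\<beta> < \<beta>s" and a: "0 < a" "a \<le> 1"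
    and nonneg: "0 \<le> CA" "0 \<le> Cf" "0 \<le> H"
    and A_nonpos: "\<And>x i j. x \<in> {0..1} \<Longrightarrow> i \<noteq> j \<Longrightarrow> A 0 x $ i $ j \<le> 0"
    and A_rowsum: "\<And>x i. x \<in> {0..1} \<Longrightarrow> \<beta>s \<le> (\<Sum>j\<in>UNIV. A 0 x $ i $ j)"
    and A_bound: "\<And>l x v. l \<le> 4 \<Longrightarrow> x \<in> {0..1} \<Longrightarrow> norm (A l x *v v) \<le> CA * norm v"
    and f_bound: "\<And>s q x t. s + 2 * q \<le> 4 \<Longrightarrow> x \<in> {0..1} \<Longrightarrow> t \<in> {0..T} \<Longrightarrow> norm (f s q x t) \<le> Cf"
    and f_hoelder: "\<And>s q x t r. s + 2 * q \<le> 4 \<Longrightarrow> q = 0 \<or> s = 0 \<Longrightarrow> x \<in> {0..1} \<Longrightarrow> t \<in> {0..T} \<Longrightarrow> r \<in> {0..T} \<Longrightarrow>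
        norm (f s q x t - f s q x r) \<le> H * \<bar>t - r\<bar> powr a"
begin

text \<open>The Leibniz terms of the differentiated reaction in which at least one derivative falls
  on the matrix. They contain only lower x-derivatives of the solution, so inductions on
  \<open>s\<close> treat them as known data.\<close>

definition lower :: "'n family \<Rightarrow> nat \<Rightarrow> nat \<Rightarrow> real \<Rightarrow> real \<Rightarrow> real^'n" where
  "lower U s q x t = (\<Sum>l\<in>{1..s}. real (s choose l) *\<^sub>R (A l x *v U (s - l) q x t))"

definition sol :: "real \<Rightarrow> 'n family \<Rightarrow> bool" where
  "sol d U \<longleftrightarrow> 0 < d \<and> d < 1 \<and>
     (\<forall>s q x t. s + 2 * q < 6 \<longrightarrow> x \<in> {0..1} \<longrightarrow> t \<in> {0..T} \<longrightarrow>
        ((\<lambda>y. U s q y t) has_vector_derivative U (Suc s) q x t) (at x within {0..1})) \<and>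
     (\<forall>s q x t. s + 2 * q \<le> 4 \<longrightarrow> x \<in> {0..1} \<longrightarrow> t \<in> {0..T} \<longrightarrow>
        (U s q x has_vector_derivative U s (Suc q) x t) (at t within {0..T})) \<and>
     (\<forall>s q. s + 2 * q \<le> 6 \<longrightarrow> continuous_on ({0..1} \<times> {0..T}) (\<lambda>(x, t). U s q x t)) \<and>
     (\<forall>x\<in>{0..1}. U 0 0 x 0 = 0) \<and> (\<forall>t\<in>{0..T}. U 0 0 0 t = 0 \<and> U 0 0 1 t = 0) \<and>
     (\<forall>s q x t. s + 2 * q \<le> 4 \<longrightarrow> x \<in> {0..1} \<longrightarrow> t \<in> {0..T} \<longrightarrow>
        U s (Suc q) x t - d\<^sup>2 *\<^sub>R U (s + 2) q x t + A 0 x *v U s q x t = f s q x t - lower U s q x t)"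

text \<open>The margin \<open>\<beta>s - b\<^sup>2\<close> of the barrier: a source of size
  \<open>\<theta> * c0\<close> times the weight is compensated by a barrier of height
  \<open>c0\<close>.\<close>

definition \<theta> where "\<theta> = \<beta>s - \<beta>"
definition b where "b = sqrt \<beta>"

lemma theta: "\<theta> > 0" using beta by (simp add: \<theta>_def)
lemma b_pos: "b > 0" and b_square: "b\<^sup>2 = \<beta>" using beta by (auto simp: b_def)

lemma T0: "0 \<in> {0..T}" using T by simp

lemma solD:
  assumes "sol d U"
  shows "0 < d" "d < 1"
    "\<And>s q x t. s + 2 * q < 6 \<Longrightarrow> x \<in> {0..1} \<Longrightarrow> t \<in> {0..T} \<Longrightarrow>
        ((\<lambda>y. U s q y t) has_vector_derivative U (Suc s) q x t) (at x within {0..1})"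
    "\<And>s q x t. s + 2 * q \<le> 4 \<Longrightarrow> x \<in> {0..1} \<Longrightarrow> t \<in> {0..T} \<Longrightarrow>
        (U s q x has_vector_derivative U s (Suc q) x t) (at t within {0..T})"
    "\<And>s q. s + 2 * q \<le> 6 \<Longrightarrow> continuous_on ({0..1} \<times> {0..T}) (\<lambda>(x, t). U s q x t)"
    "\<And>x. x \<in> {0..1} \<Longrightarrow> U 0 0 x 0 = 0" "\<And>t. t \<in> {0..T} \<Longrightarrow> U 0 0 0 t = 0" "\<And>t. t \<in> {0..T} \<Longrightarrow> U 0 0 1 t = 0"
    "\<And>s q x t. s + 2 * q \<le> 4 \<Longrightarrow> x \<in> {0..1} \<Longrightarrow> t \<in> {0..T} \<Longrightarrow>
        U s (Suc q) x t - d\<^sup>2 *\<^sub>R U (s + 2) q x t + A 0 x *v U s q x t = f s q x t - lower U s q x t"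
  using assms unfolding sol_def by blast+

lemma initial_zero:
  assumes "sol d U" "s \<le> 6" "x \<in> {0..1}" shows "U s 0 x 0 = 0"
  using assms(2,3)
proof (induction s arbitrary: x)
  case 0
  then show ?case using solD(6)[OF assms(1)] by simp
next
  case (Suc s)
  have "((\<lambda>y. 0) has_vector_derivative U (Suc s) 0 x 0) (at x within {0..1})"
    by (rule has_vector_derivative_transform[OF _ _ solD(3)[OF assms(1)]]) (use Suc T0 in auto)
  moreover have "at x within {0..1} \<noteq> bot" using Suc(3) by (simp add: trivial_limit_within islimpt_Icc)
  ultimately show ?case
    using vector_derivative_unique_within has_vector_derivative_const by blast
qed

lemma boundary_zero:
  assumes "sol d U" "q \<le> 3" "t \<in> {0..T}" "x = 0 \<or> x = 1" shows "U 0 q x t = 0"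
  using assms(2,3)
proof (induction q arbitrary: t)
  case 0
  then show ?case using solD(7,8)[OF assms(1)] assms(4) by auto
next
  case (Suc q)
  have "((\<lambda>y. 0) has_vector_derivative U 0 (Suc q) x t) (at t within {0..T})"
    by (rule has_vector_derivative_transform[OF _ _ solD(4)[OF assms(1)]]) (use Suc assms(4) in auto)
  moreover have "at t within {0..T} \<noteq> bot" using Suc(3) T by (simp add: trivial_limit_within islimpt_Icc)
  ultimately show ?case
    using vector_derivative_unique_within has_vector_derivative_const by blast
qed

text \<open>At time 0 every other term of the differentiated equation contains an x-derivative of
  the zero initial function.\<close>

lemma initial_first:
  assumes "sol d U" "s \<le> 4" "x \<in> {0..1}" shows "U s 1 x 0 = f s 0 x 0"
proof -
  have "lower U s 0 x 0 = 0" unfolding lower_def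
    using initial_zero[OF assms(1) _ assms(3)] assms(2) by (intro sum.neutral) auto
  then show ?thesis
    using solD(9)[OF assms(1), of s 0 x 0] assms T0 initial_zero[OF assms(1) _ assms(3)] by simp
qed

text \<open>The vector form of the weighted comparison; the factor \<open>CARD('n)\<close> is the
  price of passing from components to the norm. The final time is a free parameter because time
  differences live on a shorter interval.\<close>

lemma comparison:
  fixes Z Zt Zx Zxx :: "real \<Rightarrow> real \<Rightarrow> real^'n"
  assumes T': "T' \<ge> 0" and d: "d > 0" and c01: "c0 \<ge> 0" "c1 \<ge> 0"
    and c: "continuous_on ({0..1} \<times> {0..T'}) (\<lambda>(x, t). Z x t)"
    and dt: "\<And>x t. x \<in> {0..1} \<Longrightarrow> t \<in> {0..T'} \<Longrightarrow> (Z x has_vector_derivative Zt x t) (at t within {0..T'})"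
    and dx: "\<And>x t. x \<in> {0..1} \<Longrightarrow> t \<in> {0..T'} \<Longrightarrow> ((\<lambda>y. Z y t) has_vector_derivative Zx x t) (at x within {0..1})"
    and dxx: "\<And>x t. x \<in> {0..1} \<Longrightarrow> t \<in> {0..T'} \<Longrightarrow> ((\<lambda>y. Zx y t) has_vector_derivative Zxx x t) (at x within {0..1})"
    and P: "\<And>x t. x \<in> {0..1} \<Longrightarrow> t \<in> {0..T'} \<Longrightarrow>
        norm (Zt x t - d\<^sup>2 *\<^sub>R Zxx x t + A 0 x *v Z x t) \<le> (c1 + \<theta> * c0) * weight b d m x"
    and bd: "\<And>x t. x \<in> {0..1} \<Longrightarrow> t \<in> {0..T'} \<Longrightarrow> x = 0 \<or> x = 1 \<or> t = 0 \<Longrightarrow> norm (Z x t) \<le> (c0 + c1 * t) * weight b d m x"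
    and x: "x \<in> {0..1}" and t: "t \<in> {0..T'}"
  shows "norm (Z x t) \<le> CARD('n) * ((c0 + c1 * t) * weight b d m x)"
proof (rule norm_le_card_component)
  fix k
  show "\<bar>Z x t $ k\<bar> \<le> (c0 + c1 * t) * weight b d m x"
  proof (rule weighted_comparison[where A = "A 0" and \<beta>s = \<beta>s and b = b, OF T' d _ _ c01 A_nonpos A_rowsum c dt dx dxx _ _ x t])
    show "b\<^sup>2 < \<beta>s" "0 \<le> b" using b_square b_pos beta by auto
    fix x t :: real and k assume xt: "x \<in> {0..1}" "t \<in> {0..T'}"
    show "\<bar>(Zt x t - d\<^sup>2 *\<^sub>R Zxx x t + A 0 x *v Z x t) $ k\<bar> \<le> (c1 + (\<beta>s - b\<^sup>2) * c0) * weight b d m x"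
      using order_trans[OF component_le_norm_cart P[OF xt]] by (simp add: b_square \<theta>_def)
    assume "x = 0 \<or> x = 1 \<or> t = 0"
    from order_trans[OF component_le_norm_cart bd[OF xt this]]
    show "\<bar>Z x t $ k\<bar> \<le> (c0 + c1 * t) * weight b d m x" .
  qed
qed

lemma comparison_sol:
  assumes U: "sol d U" and sq: "s + 2 * q \<le> 4" and c01: "c0 \<ge> 0" "c1 \<ge> 0"
    and P: "\<And>x t. x \<in> {0..1} \<Longrightarrow> t \<in> {0..T} \<Longrightarrow> norm (f s q x t - lower U s q x t) \<le> (c1 + \<theta> * c0) * weight b d m x"
    and bd: "\<And>x t. x \<in> {0..1} \<Longrightarrow> t \<in> {0..T} \<Longrightarrow> x = 0 \<or> x = 1 \<or> t = 0 \<Longrightarrow> norm (U s q x t) \<le> (c0 + c1 * t) * weight b d m x"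
    and x: "x \<in> {0..1}" and t: "t \<in> {0..T}"
  shows "norm (U s q x t) \<le> CARD('n) * ((c0 + c1 * t) * weight b d m x)"
proof (rule comparison[where Zt = "U s (Suc q)" and Zx = "U (Suc s) q" and Zxx = "U (s + 2) q", OF _ _ c01 _ _ _ _ _ bd x t])
  fix x t :: real assume xt: "x \<in> {0..1}" "t \<in> {0..T}"
  show "norm (U s (Suc q) x t - d\<^sup>2 *\<^sub>R U (s + 2) q x t + A 0 x *v U s q x t) \<le> (c1 + \<theta> * c0) * weight b d m x"
    unfolding solD(9)[OF U sq xt] by (rule P[OF xt])
qed (use T solD[OF U] sq in auto)

text \<open>The coefficients do not depend on time, so the difference of a solution and its shift by
  \<open>\<tau>\<close> solves the same system. A Hoelder bound thus reduces to the source and to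
  the first increment, from time 0 to \<open>\<tau>\<close>.\<close>

lemma comparison_difference:
  assumes U: "sol d U" and sq: "s + 2 * q \<le> 4" and c0: "c0 \<ge> 0" and \<tau>: "\<tau> \<in> {0..T}"
    and P: "\<And>x t. x \<in> {0..1} \<Longrightarrow> t \<in> {0..T - \<tau>} \<Longrightarrow>
       norm ((f s q x (t + \<tau>) - lower U s q x (t + \<tau>)) - (f s q x t - lower U s q x t)) \<le> \<theta> * c0 * weight b d m x"
    and bd: "\<And>x t. x \<in> {0..1} \<Longrightarrow> t \<in> {0..T - \<tau>} \<Longrightarrow> x = 0 \<or> x = 1 \<or> t = 0 \<Longrightarrow>
       norm (U s q x (t + \<tau>) - U s q x t) \<le> c0 * weight b d m x"
    and x: "x \<in> {0..1}" and t: "t \<in> {0..T - \<tau>}"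
  shows "norm (U s q x (t + \<tau>) - U s q x t) \<le> CARD('n) * (c0 * weight b d m x)"
proof -
  have "norm (U s q x (t + \<tau>) - U s q x t) \<le> CARD('n) * ((c0 + 0 * t) * weight b d m x)"
  proof (rule comparison[where Z = "\<lambda>x t. U s q x (t + \<tau>) - U s q x t"
        and Zt = "\<lambda>x t. U s (Suc q) x (t + \<tau>) - U s (Suc q) x t"
        and Zx = "\<lambda>x t. U (Suc s) q x (t + \<tau>) - U (Suc s) q x t"
        and Zxx = "\<lambda>x t. U (s + 2) q x (t + \<tau>) - U (s + 2) q x t", OF _ _ c0 _ _ _ _ _ _ _ x t])
    show "continuous_on ({0..1} \<times> {0..T - \<tau>}) (\<lambda>(x, t). U s q x (t + \<tau>) - U s q x t)"
      unfolding case_prod_beta using \<tau> sq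
      by (intro continuous_intros continuous_on_compose2[OF solD(5)[OF U, of s q, unfolded case_prod_beta], where f = "\<lambda>p. (fst p, snd p + \<tau>)", simplified]
         continuous_on_subset[OF solD(5)[OF U, of s q, unfolded case_prod_beta]]) auto
    fix x t :: real assume x: "x \<in> {0..1}" and t: "t \<in> {0..T - \<tau>}"
    have t': "t \<in> {0..T}" "t + \<tau> \<in> {0..T}" using t \<tau> by auto
    show "((\<lambda>t. U s q x (t + \<tau>) - U s q x t) has_vector_derivative U s (Suc q) x (t + \<tau>) - U s (Suc q) x t)
        (at t within {0..T - \<tau>})"
      using \<tau> by (intro has_vector_derivative_diff has_vector_derivative_shift_within[OF solD(4)[OF U sq x t'(2)]]
          has_vector_derivative_within_subset[OF solD(4)[OF U sq x t'(1)]]) auto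
    show "((\<lambda>y. U s q y (t + \<tau>) - U s q y t) has_vector_derivative U (Suc s) q x (t + \<tau>) - U (Suc s) q x t)
        (at x within {0..1})"
      by (intro has_vector_derivative_diff solD(3)[OF U _ x] t') (use sq in auto)
    show "((\<lambda>y. U (Suc s) q y (t + \<tau>) - U (Suc s) q y t) has_vector_derivative U (s + 2) q x (t + \<tau>) - U (s + 2) q x t)
        (at x within {0..1})"
      using solD(3)[OF U _ x t'(1), of "Suc s" q] solD(3)[OF U _ x t'(2), of "Suc s" q] sq
      by (auto intro!: has_vector_derivative_diff)
    have "U s (Suc q) x (t + \<tau>) - U s (Suc q) x t - d\<^sup>2 *\<^sub>R (U (s + 2) q x (t + \<tau>) - U (s + 2) q x t) +
          A 0 x *v (U s q x (t + \<tau>) - U s q x t) =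
        (U s (Suc q) x (t + \<tau>) - d\<^sup>2 *\<^sub>R U (s + 2) q x (t + \<tau>) + A 0 x *v U s q x (t + \<tau>))
        - (U s (Suc q) x t - d\<^sup>2 *\<^sub>R U (s + 2) q x t + A 0 x *v U s q x t)"
      by (simp add: matrix_vector_mult_diff_distrib scaleR_diff_right)
    also have "\<dots> = (f s q x (t + \<tau>) - lower U s q x (t + \<tau>)) - (f s q x t - lower U s q x t)"
      using solD(9)[OF U sq x t'(1)] solD(9)[OF U sq x t'(2)] by simp
    finally show "norm (U s (Suc q) x (t + \<tau>) - U s (Suc q) x t - d\<^sup>2 *\<^sub>R (U (s + 2) q x (t + \<tau>) - U (s + 2) q x t) +
          A 0 x *v (U s q x (t + \<tau>) - U s q x t)) \<le> (0 + \<theta> * c0) * weight b d m x"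
      using P[OF x t] by simp
  qed (use bd \<tau> solD(1)[OF U] in auto)
  then show ?thesis by simp
qed

end

lemma reflect_deriv:
  assumes "x \<in> {0..1}" "(g has_real_derivative g') (at (1 - x) within {0..1})"
  shows "((\<lambda>x. g (1 - x)) has_real_derivative - g') (at x within {0..1})"
proof -
  have "((\<lambda>x. 1 - x) has_real_derivative - 1) (at x within {0..1})" by (auto intro!: derivative_eq_intros)
  moreover have "(\<lambda>x. 1 - x) ` {0..1} = {0..1::real}" by (auto intro!: image_eqI[where x = "1 - z" for z])
  ultimately show ?thesis
    using DERIV_image_chain[of g g' "\<lambda>x. 1 - x" x "{0..1}" "- 1"] assms by (simp add: o_def)
qed

text \<open>With cells of half width \<open>d / 2\<close> a point of the left half never reaches
  \<open>x = 1\<close>, and the right half follows from \<open>x \<mapsto> 1 - x\<close>.\<close>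

lemma heat_time_derivative_bound_dirichlet:
  fixes T a :: real
  assumes T: "T > 0" and a: "a > 0"
  obtains K where "K > 0"
    "\<And>d z zt zx zxx S M H x t. \<lbrakk>0 < d; d < 1; S \<ge> 0; M \<ge> 0; H \<ge> 0;
      continuous_on ({0..1} \<times> {0..T}) (\<lambda>(x, t). z x t);
      continuous_on ({0..1} \<times> {0..T}) (\<lambda>(x, t). zt x t);
      \<And>x t. x \<in> {0..1} \<Longrightarrow> t \<in> {0..T} \<Longrightarrow> (z x has_real_derivative zt x t) (at t within {0..T});
      \<And>x t. x \<in> {0..1} \<Longrightarrow> t \<in> {0..T} \<Longrightarrow> ((\<lambda>x. z x t) has_real_derivative zx x t) (at x within {0..1});
      \<And>x t. x \<in> {0..1} \<Longrightarrow> t \<in> {0..T} \<Longrightarrow> ((\<lambda>x. zx x t) has_real_derivative zxx x t) (at x within {0..1});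
      \<And>x. x \<in> {0..1} \<Longrightarrow> z x 0 = 0; \<And>t. t \<in> {0..T} \<Longrightarrow> z 0 t = 0; \<And>t. t \<in> {0..T} \<Longrightarrow> z 1 t = 0;
      \<And>x t. x \<in> {0..1} \<Longrightarrow> t \<in> {0..T} \<Longrightarrow> \<bar>z x t\<bar> \<le> S;
      \<And>x t. x \<in> {0..1} \<Longrightarrow> t \<in> {0..T} \<Longrightarrow> \<bar>zt x t - d\<^sup>2 * zxx x t\<bar> \<le> M;
      \<And>x t s. x \<in> {0..1} \<Longrightarrow> t \<in> {0..T} \<Longrightarrow> s \<in> {0..T} \<Longrightarrow> s \<le> t \<Longrightarrow>
        \<bar>(zt x s - d\<^sup>2 * zxx x s) - (zt x t - d\<^sup>2 * zxx x t)\<bar> \<le> H * (t - s) powr a;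
      x \<in> {0..1}; t \<in> {0..T}\<rbrakk> \<Longrightarrow> \<bar>zt x t\<bar> \<le> K * (S + M + H)"
proof (rule heat_time_derivative_bound[OF _ T a, of "1/2"])
  fix K :: real
  assume K: "K > 0"
    "\<And>d z zt zx zxx x0 S M H t. \<lbrakk>d > 0; S \<ge> 0; M \<ge> 0; H \<ge> 0;
      continuous_on ({0..1} \<times> {0..T}) (\<lambda>(x, t). z x t);
      continuous_on ({0..1} \<times> {0..T}) (\<lambda>(x, t). zt x t);
      \<And>x t. x \<in> {0..1} \<Longrightarrow> t \<in> {0..T} \<Longrightarrow> (z x has_real_derivative zt x t) (at t within {0..T});
      \<And>x t. x \<in> {0..1} \<Longrightarrow> t \<in> {0..T} \<Longrightarrow> ((\<lambda>x. z x t) has_real_derivative zx x t) (at x within {0..1});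
      \<And>x t. x \<in> {0..1} \<Longrightarrow> t \<in> {0..T} \<Longrightarrow> ((\<lambda>x. zx x t) has_real_derivative zxx x t) (at x within {0..1});
      \<And>x. x \<in> {0..1} \<Longrightarrow> z x 0 = 0;
      0 \<le> x0; x0 + 1/2 * d \<le> 1; 1/2 * d \<le> x0 \<or> (\<forall>t\<in>{0..T}. z 0 t = 0);
      \<And>x t. x \<in> {0..1} \<Longrightarrow> \<bar>x - x0\<bar> \<le> 1/2 * d \<Longrightarrow> t \<in> {0..T} \<Longrightarrow> \<bar>z x t\<bar> \<le> S;
      \<And>x t. x \<in> {0..1} \<Longrightarrow> \<bar>x - x0\<bar> \<le> 1/2 * d \<Longrightarrow> t \<in> {0..T} \<Longrightarrow> \<bar>zt x t - d\<^sup>2 * zxx x t\<bar> \<le> M;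
      \<And>x t s. x \<in> {0..1} \<Longrightarrow> \<bar>x - x0\<bar> \<le> 1/2 * d \<Longrightarrow> t \<in> {0..T} \<Longrightarrow> s \<in> {0..T} \<Longrightarrow> s \<le> t \<Longrightarrow>
        \<bar>(zt x s - d\<^sup>2 * zxx x s) - (zt x t - d\<^sup>2 * zxx x t)\<bar> \<le> H * (t - s) powr a;
      t \<in> {0..T}\<rbrakk> \<Longrightarrow> \<bar>zt x0 t\<bar> \<le> K * (S + M + H)"
  show thesis
  proof (rule that[OF K(1)])
    fix d S M H x t :: real and z zt zx zxx :: "real \<Rightarrow> real \<Rightarrow> real"
    assume d: "0 < d" "d < 1" and nn: "S \<ge> 0" "M \<ge> 0" "H \<ge> 0"
      and cz: "continuous_on ({0..1} \<times> {0..T}) (\<lambda>(x, t). z x t)"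
      and czt: "continuous_on ({0..1} \<times> {0..T}) (\<lambda>(x, t). zt x t)"
      and dt: "\<And>x t. x \<in> {0..1} \<Longrightarrow> t \<in> {0..T} \<Longrightarrow> (z x has_real_derivative zt x t) (at t within {0..T})"
      and dx: "\<And>x t. x \<in> {0..1} \<Longrightarrow> t \<in> {0..T} \<Longrightarrow> ((\<lambda>x. z x t) has_real_derivative zx x t) (at x within {0..1})"
      and dxx: "\<And>x t. x \<in> {0..1} \<Longrightarrow> t \<in> {0..T} \<Longrightarrow> ((\<lambda>x. zx x t) has_real_derivative zxx x t) (at x within {0..1})"
      and z0: "\<And>x. x \<in> {0..1} \<Longrightarrow> z x 0 = 0" "\<And>t. t \<in> {0..T} \<Longrightarrow> z 0 t = 0" "\<And>t. t \<in> {0..T} \<Longrightarrow> z 1 t = 0"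
      and bz: "\<And>x t. x \<in> {0..1} \<Longrightarrow> t \<in> {0..T} \<Longrightarrow> \<bar>z x t\<bar> \<le> S"
      and bG: "\<And>x t. x \<in> {0..1} \<Longrightarrow> t \<in> {0..T} \<Longrightarrow> \<bar>zt x t - d\<^sup>2 * zxx x t\<bar> \<le> M"
      and hG: "\<And>x t s. x \<in> {0..1} \<Longrightarrow> t \<in> {0..T} \<Longrightarrow> s \<in> {0..T} \<Longrightarrow> s \<le> t \<Longrightarrow>
        \<bar>(zt x s - d\<^sup>2 * zxx x s) - (zt x t - d\<^sup>2 * zxx x t)\<bar> \<le> H * (t - s) powr a"
      and x: "x \<in> {0..1}" and t: "t \<in> {0..T}"
    show "\<bar>zt x t\<bar> \<le> K * (S + M + H)"
    proof (cases "x \<le> 1 / 2")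
      case True
      show ?thesis
        by (rule K(2)[OF d(1) nn cz czt dt dx dxx z0(1) _ _ _ bz bG hG t]) (use True d x z0(2) in auto)
    next
      case False
      have "\<bar>zt (1 - (1 - x)) t\<bar> \<le> K * (S + M + H)"
      proof (rule K(2)[where z = "\<lambda>x. z (1 - x)" and zt = "\<lambda>x. zt (1 - x)" and zx = "\<lambda>x t. - zx (1 - x) t"
            and zxx = "\<lambda>x t. zxx (1 - x) t", OF d(1) nn _ _ _ _ _ _ _ _ _ _ _ _ t])
        show "continuous_on ({0..1} \<times> {0..T}) (\<lambda>(x, t). z (1 - x) t)"
          "continuous_on ({0..1} \<times> {0..T}) (\<lambda>(x, t). zt (1 - x) t)"
          unfolding case_prod_beta by (intro continuous_on_slice[OF cz] continuous_on_slice[OF czt] continuous_intros; auto)+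
        fix x t :: real assume xt: "x \<in> {0..1}" "t \<in> {0..T}"
        then have xt': "1 - x \<in> {0..1}" by auto
        show "((\<lambda>x. z (1 - x) t) has_real_derivative - zx (1 - x) t) (at x within {0..1})"
          by (rule reflect_deriv[OF xt(1) dx[OF xt' xt(2)]])
        show "((\<lambda>x. - zx (1 - x) t) has_real_derivative zxx (1 - x) t) (at x within {0..1})"
          using DERIV_minus[OF reflect_deriv[OF xt(1) dxx[OF xt' xt(2)]]] by simp
      qed (use False d x z0 dt bz bG hG in auto)
      then show ?thesis by simp
    qed
  qed
qed simp

section \<open>Uniform bounds: calculus and time derivatives\<close>

context sp_data
begin

text \<open>Landau's O as a predicate: one constant for all \<open>d\<close>, all solutions and all
  points. The rules that follow let the bootstrap be carried out without naming constants.\<close>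

definition ub :: "(real \<Rightarrow> 'n family \<Rightarrow> real \<Rightarrow> real \<Rightarrow> real^'n) \<Rightarrow> (real \<Rightarrow> real \<Rightarrow> real) \<Rightarrow> bool" where
  "ub X w \<longleftrightarrow> (\<exists>C\<ge>0. \<forall>d U x t. sol d U \<longrightarrow> x \<in> {0..1} \<longrightarrow> t \<in> {0..T} \<longrightarrow> norm (X d U x t) \<le> C * w d x)"

lemma ubI:
  assumes "C \<ge> 0" "\<And>d U x t. sol d U \<Longrightarrow> x \<in> {0..1} \<Longrightarrow> t \<in> {0..T} \<Longrightarrow> norm (X d U x t) \<le> C * w d x"
  shows "ub X w"
  using assms unfolding ub_def by blast

lemma ubE:
  assumes "ub X w"
  obtains C where "C \<ge> 0" "\<And>d U x t. sol d U \<Longrightarrow> x \<in> {0..1} \<Longrightarrow> t \<in> {0..T} \<Longrightarrow> norm (X d U x t) \<le> C * w d x"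
  using assms unfolding ub_def by blast

lemma ub_add:
  assumes "ub X w" "ub Y w" shows "ub (\<lambda>d U x t. X d U x t + Y d U x t) w"
proof -
  obtain C where C: "C \<ge> 0" "\<And>d U x t. sol d U \<Longrightarrow> x \<in> {0..1} \<Longrightarrow> t \<in> {0..T} \<Longrightarrow> norm (X d U x t) \<le> C * w d x"
    using ubE[OF assms(1)] by blast
  obtain D where D: "D \<ge> 0" "\<And>d U x t. sol d U \<Longrightarrow> x \<in> {0..1} \<Longrightarrow> t \<in> {0..T} \<Longrightarrow> norm (Y d U x t) \<le> D * w d x"
    using ubE[OF assms(2)] by blast
  show ?thesis
  proof (rule ubI[of "C + D"])
    fix d and U :: "'n family" and x t :: real assume h: "sol d U" "x \<in> {0..1}" "t \<in> {0..T}"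
    show "norm (X d U x t + Y d U x t) \<le> (C + D) * w d x"
      using norm_triangle_ineq[of "X d U x t" "Y d U x t"] C(2)[OF h] D(2)[OF h]
      by (simp add: distrib_right)
  qed (use C D in simp)
qed

lemma ub_uminus: "ub X w \<Longrightarrow> ub (\<lambda>d U x t. - X d U x t) w"
  unfolding ub_def by simp

lemma ub_diff: "ub X w \<Longrightarrow> ub Y w \<Longrightarrow> ub (\<lambda>d U x t. X d U x t - Y d U x t) w"
  using ub_add[of X w "\<lambda>d U x t. - Y d U x t"] ub_uminus by simp

lemma ub_mono:
  assumes "ub X w" "\<And>d x. 0 < d \<Longrightarrow> d < 1 \<Longrightarrow> x \<in> {0..1} \<Longrightarrow> w d x \<le> K * v d x" "K \<ge> 0"
  shows "ub X v"
proof -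
  obtain C where C: "C \<ge> 0" "\<And>d U x t. sol d U \<Longrightarrow> x \<in> {0..1} \<Longrightarrow> t \<in> {0..T} \<Longrightarrow> norm (X d U x t) \<le> C * w d x"
    using ubE[OF assms(1)] by blast
  show ?thesis
  proof (rule ubI[of "C * K"])
    fix d and U :: "'n family" and x t :: real assume h: "sol d U" "x \<in> {0..1}" "t \<in> {0..T}"
    have "C * w d x \<le> C * (K * v d x)" using assms(2) solD(1,2)[OF h(1)] h(2) C(1) by (intro mult_left_mono) auto
    with C(2)[OF h] show "norm (X d U x t) \<le> C * K * v d x" by simp
  qed (use C assms in simp)
qed

lemma ub_A:
  assumes "ub X w" "l \<le> 4" shows "ub (\<lambda>d U x t. A l x *v X d U x t) w"
proof -
  obtain C where C: "C \<ge> 0" "\<And>d U x t. sol d U \<Longrightarrow> x \<in> {0..1} \<Longrightarrow> t \<in> {0..T} \<Longrightarrow> norm (X d U x t) \<le> C * w d x"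
    using ubE[OF assms(1)] by blast
  show ?thesis
  proof (rule ubI[of "CA * C"])
    fix d and U :: "'n family" and x t :: real assume h: "sol d U" "x \<in> {0..1}" "t \<in> {0..T}"
    show "norm (A l x *v X d U x t) \<le> CA * C * w d x"
      using A_bound[OF assms(2) h(2), of "X d U x t"] mult_left_mono[OF C(2)[OF h] nonneg(1)] by simp
  qed (use C nonneg in simp)
qed

lemma ub_scaleR: "ub X w \<Longrightarrow> ub (\<lambda>d U x t. (c::real) *\<^sub>R X d U x t) w"
proof -
  assume "ub X w"
  then obtain C where C: "C \<ge> 0" "\<And>d U x t. sol d U \<Longrightarrow> x \<in> {0..1} \<Longrightarrow> t \<in> {0..T} \<Longrightarrow> norm (X d U x t) \<le> C * w d x"
    using ubE by blast
  show ?thesis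
    by (rule ubI[of "\<bar>c\<bar> * C"]) (use C in \<open>auto simp: mult.assoc intro!: mult_left_mono\<close>)
qed

lemma ub_zero: "(\<And>d x. 0 < d \<Longrightarrow> 0 \<le> w d x) \<Longrightarrow> ub (\<lambda>d U x t. 0) w"
  by (rule ubI[of 0]) auto

lemma ub_sum:
  assumes "finite I" "\<And>i. i \<in> I \<Longrightarrow> ub (X i) w" "\<And>d x. 0 < d \<Longrightarrow> 0 \<le> w d x"
  shows "ub (\<lambda>d U x t. \<Sum>i\<in>I. X i d U x t) w"
  using assms(1,2) by (induction I) (auto intro: ub_add ub_zero assms(3))

lemma ub_f:
  assumes "s + 2 * q \<le> 4" "\<And>d x. 0 < d \<Longrightarrow> d < 1 \<Longrightarrow> 1 \<le> w d x"
  shows "ub (\<lambda>d U x t. f s q x t) w"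
proof (rule ubI[of Cf])
  fix d and U :: "'n family" and x t :: real assume h: "sol d U" "x \<in> {0..1}" "t \<in> {0..T}"
  have "Cf * 1 \<le> Cf * w d x" using assms(2) solD(1,2)[OF h(1)] nonneg by (intro mult_left_mono) auto
  then show "norm (f s q x t) \<le> Cf * w d x" using f_bound[OF assms(1) h(2,3)] by simp
qed (rule nonneg)

abbreviation UU :: "nat \<Rightarrow> nat \<Rightarrow> real \<Rightarrow> 'n family \<Rightarrow> real \<Rightarrow> real \<Rightarrow> real^'n" where
  "UU s q \<equiv> \<lambda>d U x t. U s q x t"

abbreviation wp :: "nat \<Rightarrow> real \<Rightarrow> real \<Rightarrow> real" where "wp m \<equiv> \<lambda>d x. 1 / d ^ m"

abbreviation ww :: "nat \<Rightarrow> real \<Rightarrow> real \<Rightarrow> real" where "ww m \<equiv> \<lambda>d x. weight b d m x"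

lemma wp_mono: "0 < d \<Longrightarrow> d < 1 \<Longrightarrow> l \<le> s \<Longrightarrow> 1 / d ^ l \<le> 1 / (d::real) ^ s"
  by (intro divide_left_mono power_decreasing) auto

lemma ub_lower:
  assumes "s \<le> 4" "\<And>l. l < s \<Longrightarrow> ub (UU l q) w" "\<And>d x. 0 < d \<Longrightarrow> 0 \<le> w d x"
  shows "ub (\<lambda>d U x t. lower U s q x t) w"
  unfolding lower_def using assms by (intro ub_sum ub_scaleR ub_A) auto

text \<open>The equation is solved for its diffusion term: one time derivative buys two space
  derivatives at the price \<open>d^-2\<close>.\<close>

lemma ub_step:
  assumes sq: "s + 2 * q \<le> 4" and "ub (UU s (Suc q)) (wp s)" "\<And>l. l \<le> s \<Longrightarrow> ub (UU l q) (wp l)"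
  shows "ub (UU (s + 2) q) (wp (s + 2))"
proof -
  have l: "ub (UU l q) (wp s)" if "l \<le> s" for l
    by (rule ub_mono[OF assms(3)[OF that], of 1]) (use that wp_mono in auto)
  have "ub (\<lambda>d U x t. U s (Suc q) x t + A 0 x *v U s q x t - (f s q x t - lower U s q x t)) (wp s)"
    using sq by (intro ub_add ub_diff ub_A ub_f ub_lower l assms) (auto intro: one_le_power simp: divide_le_eq_1 power_le_one)
  then obtain C where C: "C \<ge> 0" "\<And>d U x t. sol d U \<Longrightarrow> x \<in> {0..1} \<Longrightarrow> t \<in> {0..T} \<Longrightarrow>
      norm (U s (Suc q) x t + A 0 x *v U s q x t - (f s q x t - lower U s q x t)) \<le> C * (1 / d ^ s)"
    by (rule ubE) blast
  show ?thesis
  proof (rule ubI[OF C(1)])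
    fix d and U :: "'n family" and x t :: real assume h: "sol d U" "x \<in> {0..1}" "t \<in> {0..T}"
    have d: "d > 0" using solD(1)[OF h(1)] .
    have "d\<^sup>2 *\<^sub>R U (s + 2) q x t = U s (Suc q) x t + A 0 x *v U s q x t - (f s q x t - lower U s q x t)"
      using solD(9)[OF h(1) sq h(2,3)] by (simp add: algebra_simps)
    then have "d\<^sup>2 * norm (U (s + 2) q x t) \<le> C * (1 / d ^ s)"
      using C(2)[OF h] by (metis abs_power2 norm_scaleR)
    then show "norm (U (s + 2) q x t) \<le> C * (1 / d ^ (s + 2))"
      using d by (simp add: field_simps power_add power2_eq_square)
  qed
qed

text \<open>Supplies the odd orders, which the equation skips, between two even ones.\<close>

lemma ub_landau:
  assumes sq: "s + 2 * q \<le> 4" and "ub (UU s q) (wp s)" "ub (UU (s + 2) q) (wp (s + 2))"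
  shows "ub (UU (s + 1) q) (wp (s + 1))"
proof -
  obtain C where C: "C \<ge> 0" "\<And>d U x t. sol d U \<Longrightarrow> x \<in> {0..1} \<Longrightarrow> t \<in> {0..T} \<Longrightarrow> norm (U s q x t) \<le> C * (1 / d ^ s)"
    using ubE[OF assms(2)] by blast
  obtain D where D: "D \<ge> 0" "\<And>d U x t. sol d U \<Longrightarrow> x \<in> {0..1} \<Longrightarrow> t \<in> {0..T} \<Longrightarrow> norm (U (s + 2) q x t) \<le> D * (1 / d ^ (s + 2))"
    using ubE[OF assms(3)] by blast
  show ?thesis
  proof (rule ubI[of "4 * C + D"])
    fix d and U :: "'n family" and x t :: real assume h: "sol d U" "x \<in> {0..1}" "t \<in> {0..T}"
    have d: "0 < d" "d < 1" using solD(1,2)[OF h(1)] by auto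
    \<comment> \<open>A step of length \<open>d / 2 < 1 / 2\<close> towards the midpoint stays
      inside the interval.\<close>
    define y where "y = (if x \<le> 1 / 2 then x + d / 2 else x - d / 2)"
    have y: "y \<in> {0..1}" "\<bar>y - x\<bar> = d / 2" "(y - x)\<^sup>2 = d\<^sup>2 / 4" using h(2) d by (auto simp: y_def power2_eq_square)
    have "\<bar>y - x\<bar> * norm (U (s + 1) q x t) \<le> 2 * (C * (1 / d ^ s)) + (D * (1 / d ^ (s + 2))) * (y - x)\<^sup>2"
    proof (rule landau_inequality[of "{0..1}"])
      fix z :: real assume z: "z \<in> {0..1}"
      show "((\<lambda>y. U s q y t) has_vector_derivative U (s + 1) q z t) (at z within {0..1})"
        using solD(3)[OF h(1) _ z h(3), of s q] sq by simp
      show "((\<lambda>y. U (s + 1) q y t) has_vector_derivative U (s + 2) q z t) (at z within {0..1})"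
        using solD(3)[OF h(1) _ z h(3), of "s + 1" q] sq by simp
    qed (use C D h y in auto)
    then have "(d / 2) * norm (U (s + 1) q x t) \<le> (2 * C + D / 4) * (1 / d ^ s)"
      unfolding y using d by (simp add: field_simps power_add power2_eq_square)
    then have "norm (U (s + 1) q x t) \<le> (4 * C + D / 2) * (1 / d ^ (s + 1))"
      using d by (simp add: field_simps)
    also have "\<dots> \<le> (4 * C + D) * (1 / d ^ (s + 1))" using d D by (intro mult_right_mono) auto
    finally show "norm (U (s + 1) q x t) \<le> (4 * C + D) * (1 / d ^ (s + 1))" .
  qed (use C D in auto)
qed

lemma weight_0_bounds: "d > 0 \<Longrightarrow> 1 \<le> weight b d 0 x" "x \<in> {0..1} \<Longrightarrow> d > 0 \<Longrightarrow> weight b d 0 x \<le> 3"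
  using layer_le_2[of b d x] b_pos weight_ge_1[of d b 0 x] by (auto simp: weight_def)

lemma ub_const_of_weight_0: "ub X (ww 0) \<Longrightarrow> ub X (wp 0)"
  by (erule ub_mono[where K = 3]) (use weight_0_bounds in auto)

lemma ub_00: "ub (UU 0 0) (wp 0)"
proof (rule ub_const_of_weight_0, rule ubI[of "CARD('n) * (Cf / \<theta>)"])
  fix d and U :: "'n family" and x t :: real assume h: "sol d U" "x \<in> {0..1}" "t \<in> {0..T}"
  have "norm (U 0 0 x t) \<le> CARD('n) * ((Cf / \<theta> + 0 * t) * weight b d 0 x)"
  proof (rule comparison_sol[OF h(1) _ _ _ _ _ h(2,3)])
    fix x t :: real assume xt: "x \<in> {0..1}" "t \<in> {0..T}"
    have "Cf * 1 \<le> Cf * weight b d 0 x" using nonneg weight_0_bounds(1) solD(1)[OF h(1)] by (intro mult_left_mono) auto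
    then show "norm (f 0 0 x t - lower U 0 0 x t) \<le> (0 + \<theta> * (Cf / \<theta>)) * weight b d 0 x"
      using f_bound[OF _ xt, of 0 0] theta by (simp add: lower_def)
    assume "x = 0 \<or> x = 1 \<or> t = 0"
    then have "U 0 0 x t = 0" using solD(6-8)[OF h(1)] xt by auto
    then show "norm (U 0 0 x t) \<le> (Cf / \<theta> + 0 * t) * weight b d 0 x"
      using nonneg theta weight_0_bounds(1)[of d x] solD(1)[OF h(1)] by simp
  qed (use nonneg theta in auto)
  then show "norm (U 0 0 x t) \<le> CARD('n) * (Cf / \<theta>) * weight b d 0 x" by simp
qed (use nonneg theta in auto)

text \<open>Without x-derivatives there are no Leibniz terms and the lateral values vanish, so the
  source and the initial values decide. The summand \<open>Cf / \<theta>\<close> of the barrier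
  height covers the former, \<open>K\<close> the latter.\<close>

lemma ub_0q:
  assumes q: "q \<le> 2" and init: "\<And>d U x. sol d U \<Longrightarrow> x \<in> {0..1} \<Longrightarrow> norm (U 0 q x 0) \<le> K" and K: "K \<ge> 0"
  shows "ub (UU 0 q) (wp 0)"
proof (rule ub_const_of_weight_0, rule ubI[of "CARD('n) * (Cf / \<theta> + K)"])
  fix d and U :: "'n family" and x t :: real assume h: "sol d U" "x \<in> {0..1}" "t \<in> {0..T}"
  have d: "d > 0" using solD(1)[OF h(1)] .
  have "norm (U 0 q x t) \<le> CARD('n) * ((Cf / \<theta> + K + 0 * t) * weight b d 0 x)"
  proof (rule comparison_sol[OF h(1) _ _ _ _ _ h(2,3)])
    fix x t :: real assume xt: "x \<in> {0..1}" "t \<in> {0..T}"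
    have w: "1 \<le> weight b d 0 x" using weight_0_bounds(1)[OF d] .
    have "Cf * 1 \<le> (Cf + \<theta> * K) * weight b d 0 x" using nonneg w K theta by (intro mult_mono) auto
    then show "norm (f 0 q x t - lower U 0 q x t) \<le> (0 + \<theta> * (Cf / \<theta> + K)) * weight b d 0 x"
      using f_bound[OF _ xt, of 0 q] theta q by (simp add: lower_def distrib_left)
    assume "x = 0 \<or> x = 1 \<or> t = 0"
    then have "norm (U 0 q x t) \<le> K"
      using boundary_zero[OF h(1) _ xt(2), of q x] q init[OF h(1) xt(1)] K by auto
    also have "K \<le> (Cf / \<theta> + K) * weight b d 0 x"
      using mult_mono[of K "Cf / \<theta> + K" 1 "weight b d 0 x"] nonneg theta w K by auto
    finally show "norm (U 0 q x t) \<le> (Cf / \<theta> + K + 0 * t) * weight b d 0 x" by simp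
  qed (use nonneg theta K q in auto)
  then show "norm (U 0 q x t) \<le> CARD('n) * (Cf / \<theta> + K) * weight b d 0 x" by simp
qed (use nonneg theta K in auto)

lemma ub_01: "ub (UU 0 1) (wp 0)"
proof (rule ub_0q)
  fix d and U :: "'n family" and x :: real assume "sol d U" "x \<in> {0..1}"
  then show "norm (U 0 1 x 0) \<le> Cf"
    using initial_first[of d U 0 x] f_bound[of 0 0 x 0] T0 by simp
qed (use nonneg in auto)

lemma norm_lower_le:
  assumes "s \<le> 4" "x \<in> {0..1}" "\<And>l. l < s \<Longrightarrow> norm (U l q x t) \<le> K" "K \<ge> 0"
  shows "norm (lower U s q x t) \<le> 2 ^ s * (CA * K)"
proof -
  have "norm (lower U s q x t) \<le> (\<Sum>l\<in>{1..s}. real (s choose l) * (CA * K))"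
    unfolding lower_def
  proof (rule sum_norm_le)
    fix l assume l: "l \<in> {1..s}"
    have "norm (A l x *v U (s - l) q x t) \<le> CA * norm (U (s - l) q x t)"
      using assms l by (intro A_bound) auto
    also have "\<dots> \<le> CA * K" using assms(3)[of "s - l"] l nonneg by (intro mult_left_mono) auto
    finally show "norm (real (s choose l) *\<^sub>R (A l x *v U (s - l) q x t)) \<le> real (s choose l) * (CA * K)"
      by (simp add: mult_left_mono)
  qed
  also have "\<dots> = (\<Sum>l\<in>{1..s}. real (s choose l)) * (CA * K)" by (simp add: sum_distrib_right)
  also have "\<dots> \<le> 2 ^ s * (CA * K)"
  proof -
    have "0 \<le> CA * K" using nonneg assms(4) by simp
    moreover have "(\<Sum>l\<in>{1..s}. real (s choose l)) \<le> (\<Sum>l\<le>s. real (s choose l))" by (intro sum_mono2) auto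
    moreover have "(\<Sum>l\<le>s. real (s choose l)) = 2 ^ s" by (metis choose_row_sum of_nat_numeral of_nat_power of_nat_sum)
    ultimately show ?thesis by (intro mult_right_mono) auto
  qed
  finally show ?thesis .
qed

text \<open>The equation for \<open>U s 1\<close> at time 0 expresses \<open>U s 2\<close> through
  functions \<open>U l 1\<close> with \<open>l \<le> 4\<close>, and these equal derivatives of the
  source there. Of the factor 5, four comes from the binomial sum \<open>2 ^ 2\<close> and one from
  the undifferentiated reaction.\<close>

lemma initial_second:
  assumes U: "sol d U" and s: "s \<le> 2" and x: "x \<in> {0..1}"
  shows "norm (U s 2 x 0) \<le> 2 * Cf + 5 * CA * Cf"
proof -
  have d: "0 < d" "d < 1" using solD(1,2)[OF U] by auto
  have i: "norm (U l 1 x 0) \<le> Cf" if "l \<le> 4" for l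
    using initial_first[OF U that x] f_bound[of l 0 x 0] x T0 that by simp
  have "U s 2 x 0 = f s 1 x 0 - lower U s 1 x 0 + d\<^sup>2 *\<^sub>R U (s + 2) 1 x 0 - A 0 x *v U s 1 x 0"
    using solD(9)[OF U _ x T0, of s 1] s by (simp add: numeral_2_eq_2 algebra_simps)
  also have "norm \<dots> \<le> norm (f s 1 x 0) + norm (lower U s 1 x 0) + norm (d\<^sup>2 *\<^sub>R U (s + 2) 1 x 0) + norm (A 0 x *v U s 1 x 0)"
    by (intro order_trans[OF norm_triangle_ineq4] order_trans[OF norm_triangle_ineq] add_mono order_refl)
  also have "\<dots> \<le> Cf + 4 * (CA * Cf) + Cf + CA * Cf"
  proof (intro add_mono)
    show "norm (f s 1 x 0) \<le> Cf" using f_bound[of s 1 x 0] s x T0 by simp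
    have "norm (lower U s 1 x 0) \<le> 2 ^ s * (CA * Cf)"
      using norm_lower_le[of s x U 1 0 Cf] i s x nonneg by simp
    also have "\<dots> \<le> 2 ^ 2 * (CA * Cf)" using s nonneg by (intro mult_right_mono power_increasing) auto
    finally show "norm (lower U s 1 x 0) \<le> 4 * (CA * Cf)" by simp
    have "norm (d\<^sup>2 *\<^sub>R U (s + 2) 1 x 0) \<le> 1 * Cf"
      unfolding norm_scaleR using d i[of "s + 2"] s by (intro mult_mono) (auto simp: power_le_one)
    then show "norm (d\<^sup>2 *\<^sub>R U (s + 2) 1 x 0) \<le> Cf" by simp
    have "norm (A 0 x *v U s 1 x 0) \<le> CA * norm (U s 1 x 0)" using x by (intro A_bound) auto
    also have "\<dots> \<le> CA * Cf" using i[of s] s nonneg by (intro mult_left_mono) auto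
    finally show "norm (A 0 x *v U s 1 x 0) \<le> CA * Cf" .
  qed
  finally show ?thesis by (simp add: algebra_simps)
qed

lemma ub_02: "ub (UU 0 2) (wp 0)"
proof (rule ub_0q)
  fix d and U :: "'n family" and x :: real assume "sol d U" "x \<in> {0..1}"
  then show "norm (U 0 2 x 0) \<le> 2 * Cf + 5 * CA * Cf" by (intro initial_second) auto
qed (use nonneg in auto)

text \<open>After the initial value is subtracted the data on the parabolic boundary vanish, so the
  barrier may start from 0 and grow like \<open>c1 * t\<close>. This bounds the first increment of
  \<open>U 0 2\<close> before anything is known about \<open>U 0 3\<close>.\<close>

lemma second_linear_growth:
  obtains C where "C \<ge> 0"
    "\<And>d U x t. sol d U \<Longrightarrow> x \<in> {0..1} \<Longrightarrow> t \<in> {0..T} \<Longrightarrow> norm (U 0 2 x t - U 0 2 x 0) \<le> C * t"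
proof -
  define K where "K = Cf + (2 * Cf + 5 * CA * Cf) + CA * (2 * Cf + 5 * CA * Cf)"
  have K: "K \<ge> 0" using nonneg by (simp add: K_def)
  have "norm (U 0 2 x t - U 0 2 x 0) \<le> (CARD('n) * K * 3) * t"
    if h: "sol d U" "x \<in> {0..1}" "t \<in> {0..T}" for d and U :: "'n family" and x t
  proof -
    have d: "0 < d" "d < 1" using solD(1,2)[OF h(1)] by auto
    have "norm (U 0 2 x t - U 0 2 x 0) \<le> CARD('n) * ((0 + K * t) * weight b d 0 x)"
    proof (rule comparison[where Z = "\<lambda>x t. U 0 2 x t - U 0 2 x 0" and Zt = "U 0 3"
          and Zx = "\<lambda>x t. U 1 2 x t - U 1 2 x 0" and Zxx = "\<lambda>x t. U 2 2 x t - U 2 2 x 0",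
          OF _ d(1) _ K _ _ _ _ _ _ h(2,3)])
      show "continuous_on ({0..1} \<times> {0..T}) (\<lambda>(x, t). U 0 2 x t - U 0 2 x 0)"
        unfolding case_prod_beta using T
        by (intro continuous_intros continuous_on_slice[OF solD(5)[OF h(1), of 0 2]]) auto
      fix x t :: real assume x: "x \<in> {0..1}" and t: "t \<in> {0..T}"
      show "((\<lambda>t. U 0 2 x t - U 0 2 x 0) has_vector_derivative U 0 3 x t) (at t within {0..T})"
        using solD(4)[OF h(1) _ x t, of 0 2] by (auto intro!: derivative_eq_intros simp: eval_nat_numeral)
      show "((\<lambda>y. U 0 2 y t - U 0 2 y 0) has_vector_derivative U 1 2 x t - U 1 2 x 0) (at x within {0..1})"
        using solD(3)[OF h(1) _ x t, of 0 2] solD(3)[OF h(1) _ x T0, of 0 2] by (auto intro!: has_vector_derivative_diff)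
      show "((\<lambda>y. U 1 2 y t - U 1 2 y 0) has_vector_derivative U 2 2 x t - U 2 2 x 0) (at x within {0..1})"
        using solD(3)[OF h(1) _ x t, of 1 2] solD(3)[OF h(1) _ x T0, of 1 2]
        by (auto intro!: has_vector_derivative_diff simp: numeral_2_eq_2)
      have "U 0 3 x t - d\<^sup>2 *\<^sub>R (U 2 2 x t - U 2 2 x 0) + A 0 x *v (U 0 2 x t - U 0 2 x 0)
          = f 0 2 x t + d\<^sup>2 *\<^sub>R U 2 2 x 0 - A 0 x *v U 0 2 x 0"
        using solD(9)[OF h(1) _ x t, of 0 2]
        by (simp add: lower_def eval_nat_numeral matrix_vector_mult_diff_distrib scaleR_diff_right algebra_simps)
      also have "norm \<dots> \<le> norm (f 0 2 x t) + norm (d\<^sup>2 *\<^sub>R U 2 2 x 0) + norm (A 0 x *v U 0 2 x 0)"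
        by (intro order_trans[OF norm_triangle_ineq4] order_trans[OF norm_triangle_ineq] add_mono order_refl)
      also have "\<dots> \<le> K" unfolding K_def
      proof (intro add_mono)
        show "norm (f 0 2 x t) \<le> Cf" using f_bound[of 0 2 x t] x t by simp
        have "norm (d\<^sup>2 *\<^sub>R U 2 2 x 0) \<le> 1 * (2 * Cf + 5 * CA * Cf)"
          unfolding norm_scaleR using d initial_second[OF h(1) _ x, of 2] by (intro mult_mono) (auto simp: power_le_one)
        then show "norm (d\<^sup>2 *\<^sub>R U 2 2 x 0) \<le> 2 * Cf + 5 * CA * Cf" by simp
        show "norm (A 0 x *v U 0 2 x 0) \<le> CA * (2 * Cf + 5 * CA * Cf)"
          using A_bound[OF _ x, of 0 "U 0 2 x 0"] mult_left_mono[OF initial_second[OF h(1) _ x, of 0] nonneg(1)] by simp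
      qed
      also have "K \<le> K * weight b d 0 x" using K weight_0_bounds(1)[OF d(1), of x] mult_left_mono[of 1 _ K] by simp
      finally show "norm (U 0 3 x t - d\<^sup>2 *\<^sub>R (U 2 2 x t - U 2 2 x 0) + A 0 x *v (U 0 2 x t - U 0 2 x 0)) \<le> (K + \<theta> * 0) * weight b d 0 x"
        by simp
      assume "x = 0 \<or> x = 1 \<or> t = 0"
      then have "U 0 2 x t - U 0 2 x 0 = 0"
        using boundary_zero[OF h(1) _ t, of 2 x] boundary_zero[OF h(1) _ T0, of 2 x] by auto
      then show "norm (U 0 2 x t - U 0 2 x 0) \<le> (0 + K * t) * weight b d 0 x"
        using K t weight_0_bounds(1)[OF d(1), of x] by simp
    qed (use T in auto)
    also have "\<dots> \<le> CARD('n) * ((0 + K * t) * 3)"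
      using K h(3) weight_0_bounds(2)[OF h(2) d(1)] by (intro mult_left_mono) auto
    finally show ?thesis by (simp add: mult_ac)
  qed
  then show ?thesis using K by (intro that[of "CARD('n) * K * 3"]) auto
qed

text \<open>Needed because the coupling term \<open>A 0 x *v U 0 2 x t\<close> becomes part of the
  source of the heat equation for \<open>U 0 2\<close>, and that source must be Hoelder in
  time.\<close>

lemma second_hoelder:
  obtains C where "C \<ge> 0"
    "\<And>d U x t r. sol d U \<Longrightarrow> x \<in> {0..1} \<Longrightarrow> t \<in> {0..T} \<Longrightarrow> r \<in> {0..T} \<Longrightarrow>
       norm (U 0 2 x t - U 0 2 x r) \<le> C * \<bar>t - r\<bar> powr a"
proof -
  obtain C1 where C1: "C1 \<ge> 0"
    "\<And>d U x t. sol d U \<Longrightarrow> x \<in> {0..1} \<Longrightarrow> t \<in> {0..T} \<Longrightarrow> norm (U 0 2 x t - U 0 2 x 0) \<le> C1 * t"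
    by (fact second_linear_growth)
  define K where "K = H / \<theta> + C1 * (T + 1)"
  have K: "K \<ge> 0" using nonneg theta C1 T by (simp add: K_def)
  have *: "norm (U 0 2 x (t + \<tau>) - U 0 2 x t) \<le> (CARD('n) * K * 3) * \<tau> powr a"
    if h: "sol d U" "x \<in> {0..1}" "t \<in> {0..T - \<tau>}" "\<tau> \<in> {0..T}" for d and U :: "'n family" and x t \<tau>
  proof -
    have d: "0 < d" "d < 1" using solD(1,2)[OF h(1)] by auto
    have Kp: "K * \<tau> powr a \<ge> 0" using K by simp
    have "norm (U 0 2 x (t + \<tau>) - U 0 2 x t) \<le> CARD('n) * ((K * \<tau> powr a) * weight b d 0 x)"
    proof (rule comparison_difference[OF h(1) _ Kp h(4) _ _ h(2,3)])
      fix x t :: real assume x: "x \<in> {0..1}" and t: "t \<in> {0..T - \<tau>}"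
      have w: "1 \<le> weight b d 0 x" by (rule weight_0_bounds(1)[OF d(1)])
      have t': "t \<in> {0..T}" "t + \<tau> \<in> {0..T}" using t h(4) by auto
      have "norm (f 0 2 x (t + \<tau>) - f 0 2 x t) \<le> H * \<tau> powr a"
        using f_hoelder[of 0 2 x "t + \<tau>" t] x t' h(4) by simp
      also have "\<dots> \<le> \<theta> * (K * \<tau> powr a) * 1"
        using theta C1 T by (simp add: K_def distrib_right distrib_left)
      also have "\<dots> \<le> \<theta> * (K * \<tau> powr a) * weight b d 0 x"
        using w theta Kp by (intro mult_left_mono) auto
      finally show "norm ((f 0 2 x (t + \<tau>) - lower U 0 2 x (t + \<tau>)) - (f 0 2 x t - lower U 0 2 x t)) \<le> \<theta> * (K * \<tau> powr a) * weight b d 0 x"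
        by (simp add: lower_def)
      assume "x = 0 \<or> x = 1 \<or> t = 0"
      then have "norm (U 0 2 x (t + \<tau>) - U 0 2 x t) \<le> C1 * \<tau>"
        using boundary_zero[OF h(1) _ t'(1), of 2 x] boundary_zero[OF h(1) _ t'(2), of 2 x] C1(1) h(4)
          C1(2)[OF h(1) x h(4)] by auto
      also have "\<dots> \<le> C1 * ((T + 1) * \<tau> powr a)" using le_powr_bound[of \<tau> T a] a h(4) C1(1) by (intro mult_left_mono) auto
      also have "\<dots> \<le> K * \<tau> powr a * 1"
      proof -
        have "0 \<le> H / \<theta> * \<tau> powr a" using nonneg theta by simp
        then show ?thesis unfolding K_def distrib_right mult_1_right mult.assoc by linarith
      qed
      also have "\<dots> \<le> K * \<tau> powr a * weight b d 0 x" using w Kp by (intro mult_left_mono) auto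
      finally show "norm (U 0 2 x (t + \<tau>) - U 0 2 x t) \<le> K * \<tau> powr a * weight b d 0 x" .
    qed simp
    also have "\<dots> \<le> CARD('n) * ((K * \<tau> powr a) * 3)"
      using Kp weight_0_bounds(2)[OF h(2) d(1)] by (intro mult_left_mono) auto
    finally show ?thesis by (simp add: mult_ac)
  qed
  show ?thesis
  proof (rule that[of "CARD('n) * K * 3"])
    fix d and U :: "'n family" and x t r :: real
    assume h: "sol d U" "x \<in> {0..1}" "t \<in> {0..T}" "r \<in> {0..T}"
    show "norm (U 0 2 x t - U 0 2 x r) \<le> CARD('n) * K * 3 * \<bar>t - r\<bar> powr a"
    proof (cases "r \<le> t")
      case True
      then show ?thesis using *[OF h(1,2), of r "t - r"] h by auto
    next
      case False
      then show ?thesis using *[OF h(1,2), of t "r - t"] h by (auto simp: norm_minus_commute abs_minus_commute)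
    qed
  qed (use K in auto)
qed

text \<open>With the coupling moved to the right-hand side each component satisfies a scalar heat
  equation, to which the kernel estimate applies. Its requirement of zero initial values is met by
  subtracting \<open>U 0 2 x 0\<close>.\<close>

lemma ub_03: "ub (UU 0 3) (wp 0)"
proof -
  obtain K where K: "K > 0"
    "\<And>d z zt zx zxx S M H x t. \<lbrakk>0 < d; d < 1; S \<ge> 0; M \<ge> 0; H \<ge> 0;
      continuous_on ({0..1} \<times> {0..T}) (\<lambda>(x, t). z x t);
      continuous_on ({0..1} \<times> {0..T}) (\<lambda>(x, t). zt x t);
      \<And>x t. x \<in> {0..1} \<Longrightarrow> t \<in> {0..T} \<Longrightarrow> (z x has_real_derivative zt x t) (at t within {0..T});
      \<And>x t. x \<in> {0..1} \<Longrightarrow> t \<in> {0..T} \<Longrightarrow> ((\<lambda>x. z x t) has_real_derivative zx x t) (at x within {0..1});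
      \<And>x t. x \<in> {0..1} \<Longrightarrow> t \<in> {0..T} \<Longrightarrow> ((\<lambda>x. zx x t) has_real_derivative zxx x t) (at x within {0..1});
      \<And>x. x \<in> {0..1} \<Longrightarrow> z x 0 = 0; \<And>t. t \<in> {0..T} \<Longrightarrow> z 0 t = 0; \<And>t. t \<in> {0..T} \<Longrightarrow> z 1 t = 0;
      \<And>x t. x \<in> {0..1} \<Longrightarrow> t \<in> {0..T} \<Longrightarrow> \<bar>z x t\<bar> \<le> S;
      \<And>x t. x \<in> {0..1} \<Longrightarrow> t \<in> {0..T} \<Longrightarrow> \<bar>zt x t - d\<^sup>2 * zxx x t\<bar> \<le> M;
      \<And>x t s. x \<in> {0..1} \<Longrightarrow> t \<in> {0..T} \<Longrightarrow> s \<in> {0..T} \<Longrightarrow> s \<le> t \<Longrightarrow>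
        \<bar>(zt x s - d\<^sup>2 * zxx x s) - (zt x t - d\<^sup>2 * zxx x t)\<bar> \<le> H * (t - s) powr a;
      x \<in> {0..1}; t \<in> {0..T}\<rbrakk> \<Longrightarrow> \<bar>zt x t\<bar> \<le> K * (S + M + H)"
    by (fact heat_time_derivative_bound_dirichlet[OF T a(1)])
  obtain C2 where C2: "C2 \<ge> 0" "\<And>d U x t. sol d U \<Longrightarrow> x \<in> {0..1} \<Longrightarrow> t \<in> {0..T} \<Longrightarrow> norm (U 0 2 x t) \<le> C2 * (1 / d ^ 0)"
    using ubE[OF ub_02] by blast
  obtain C3 where C3: "C3 \<ge> 0"
    "\<And>d U x t r. sol d U \<Longrightarrow> x \<in> {0..1} \<Longrightarrow> t \<in> {0..T} \<Longrightarrow> r \<in> {0..T} \<Longrightarrow>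
       norm (U 0 2 x t - U 0 2 x r) \<le> C3 * \<bar>t - r\<bar> powr a"
    by (fact second_hoelder)
  define K2 where "K2 = 2 * Cf + 5 * CA * Cf"
  define S M H' where "S = 2 * C2" and "M = Cf + CA * C2 + K2" and "H' = H + CA * C3"
  have nn: "S \<ge> 0" "M \<ge> 0" "H' \<ge> 0" using C2 C3 nonneg by (auto simp: S_def M_def H'_def K2_def)
  show ?thesis
  proof (rule ubI[of "CARD('n) * (K * (S + M + H'))"])
    fix d and U :: "'n family" and x t :: real assume h: "sol d U" "x \<in> {0..1}" "t \<in> {0..T}"
    have d: "0 < d" "d < 1" using solD(1,2)[OF h(1)] by auto
    have "norm (U 0 3 x t) \<le> CARD('n) * (K * (S + M + H'))"
    proof (rule norm_le_card_component)
      fix k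
      \<comment> \<open>The last summand compensates for the subtracted initial value. It does not
        depend on time, so it enters the bound \<open>M\<close> but not the Hoelder
        constant.\<close>
      define g where "g x t = f 0 2 x t - A 0 x *v U 0 2 x t + d\<^sup>2 *\<^sub>R U 2 2 x 0" for x t
      have G: "U 0 3 x t $ k - d\<^sup>2 * (U 2 2 x t - U 2 2 x 0) $ k = g x t $ k" if "x \<in> {0..1}" "t \<in> {0..T}" for x t
      proof -
        have "U 0 3 x t - d\<^sup>2 *\<^sub>R (U 2 2 x t - U 2 2 x 0) = g x t"
          using solD(9)[OF h(1) _ that, of 0 2]
          by (simp add: lower_def eval_nat_numeral scaleR_diff_right g_def algebra_simps)
        then show ?thesis by (simp flip: \<open>U 0 3 x t - d\<^sup>2 *\<^sub>R (U 2 2 x t - U 2 2 x 0) = g x t\<close>)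
      qed
      show "\<bar>U 0 3 x t $ k\<bar> \<le> K * (S + M + H')"
      proof (rule K(2)[where z = "\<lambda>x t. (U 0 2 x t - U 0 2 x 0) $ k" and zt = "\<lambda>x t. U 0 3 x t $ k"
            and zx = "\<lambda>x t. (U 1 2 x t - U 1 2 x 0) $ k" and zxx = "\<lambda>x t. (U 2 2 x t - U 2 2 x 0) $ k",
            OF d nn _ _ _ _ _ _ _ _ _ _ _ h(2,3)])
        show "continuous_on ({0..1} \<times> {0..T}) (\<lambda>(x, t). (U 0 2 x t - U 0 2 x 0) $ k)"
          unfolding case_prod_beta using T
          by (intro continuous_intros continuous_on_slice[OF solD(5)[OF h(1), of 0 2]]) auto
        show "continuous_on ({0..1} \<times> {0..T}) (\<lambda>(x, t). U 0 3 x t $ k)"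
          unfolding case_prod_beta using T
          by (intro continuous_intros continuous_on_slice[OF solD(5)[OF h(1), of 0 3]]) auto
        fix x t :: real assume x: "x \<in> {0..1}" and t: "t \<in> {0..T}"
        have "((\<lambda>t. U 0 2 x t - U 0 2 x 0) has_vector_derivative U 0 3 x t) (at t within {0..T})"
          using solD(4)[OF h(1) _ x t, of 0 2] by (auto intro!: derivative_eq_intros simp: eval_nat_numeral)
        then show "((\<lambda>t. (U 0 2 x t - U 0 2 x 0) $ k) has_real_derivative U 0 3 x t $ k) (at t within {0..T})"
          by (rule vec_component_deriv)
        have "((\<lambda>y. U 0 2 y t - U 0 2 y 0) has_vector_derivative U 1 2 x t - U 1 2 x 0) (at x within {0..1})"
          using solD(3)[OF h(1) _ x t, of 0 2] solD(3)[OF h(1) _ x T0, of 0 2] by (auto intro!: has_vector_derivative_diff)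
        then show "((\<lambda>y. (U 0 2 y t - U 0 2 y 0) $ k) has_real_derivative (U 1 2 x t - U 1 2 x 0) $ k) (at x within {0..1})"
          by (rule vec_component_deriv)
        have "((\<lambda>y. U 1 2 y t - U 1 2 y 0) has_vector_derivative U 2 2 x t - U 2 2 x 0) (at x within {0..1})"
          using solD(3)[OF h(1) _ x t, of 1 2] solD(3)[OF h(1) _ x T0, of 1 2]
          by (auto intro!: has_vector_derivative_diff simp: numeral_2_eq_2)
        then show "((\<lambda>y. (U 1 2 y t - U 1 2 y 0) $ k) has_real_derivative (U 2 2 x t - U 2 2 x 0) $ k) (at x within {0..1})"
          by (rule vec_component_deriv)
        have "\<bar>(U 0 2 x t - U 0 2 x 0) $ k\<bar> \<le> norm (U 0 2 x t - U 0 2 x 0)" by (rule component_le_norm_cart)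
        also have "\<dots> \<le> norm (U 0 2 x t) + norm (U 0 2 x 0)" by (rule norm_triangle_ineq4)
        also have "\<dots> \<le> S" using C2(2)[OF h(1) x t] C2(2)[OF h(1) x T0] by (simp add: S_def)
        finally show "\<bar>(U 0 2 x t - U 0 2 x 0) $ k\<bar> \<le> S" .
        have "norm (g x t) \<le> norm (f 0 2 x t) + norm (A 0 x *v U 0 2 x t) + norm (d\<^sup>2 *\<^sub>R U 2 2 x 0)"
          unfolding g_def by (intro order_trans[OF norm_triangle_ineq] order_trans[OF norm_triangle_ineq4] add_mono order_refl)
        also have "\<dots> \<le> M" unfolding M_def
        proof (intro add_mono)
          show "norm (f 0 2 x t) \<le> Cf" using f_bound[of 0 2 x t] x t by simp
          have "norm (d\<^sup>2 *\<^sub>R U 2 2 x 0) \<le> 1 * K2"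
            unfolding norm_scaleR K2_def using d initial_second[OF h(1) _ x, of 2] by (intro mult_mono) (auto simp: power_le_one)
          then show "norm (d\<^sup>2 *\<^sub>R U 2 2 x 0) \<le> K2" by simp
          show "norm (A 0 x *v U 0 2 x t) \<le> CA * C2"
            using A_bound[OF _ x, of 0 "U 0 2 x t"] mult_left_mono[OF C2(2)[OF h(1) x t] nonneg(1)] by simp
        qed
        finally show "\<bar>U 0 3 x t $ k - d\<^sup>2 * (U 2 2 x t - U 2 2 x 0) $ k\<bar> \<le> M"
          unfolding G[OF x t] using component_le_norm_cart order_trans by blast
        fix s assume s: "s \<in> {0..T}" "s \<le> t"
        have "g x s - g x t = (f 0 2 x s - f 0 2 x t) - A 0 x *v (U 0 2 x s - U 0 2 x t)"
          by (simp add: g_def matrix_vector_mult_diff_distrib)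
        also have "norm \<dots> \<le> norm (f 0 2 x s - f 0 2 x t) + norm (A 0 x *v (U 0 2 x s - U 0 2 x t))"
          by (rule norm_triangle_ineq4)
        also have "\<dots> \<le> H * (t - s) powr a + CA * (C3 * (t - s) powr a)"
        proof (intro add_mono)
          show "norm (f 0 2 x s - f 0 2 x t) \<le> H * (t - s) powr a"
            using f_hoelder[of 0 2 x s t] x s t by (simp add: abs_minus_commute)
          show "norm (A 0 x *v (U 0 2 x s - U 0 2 x t)) \<le> CA * (C3 * (t - s) powr a)"
            using A_bound[OF _ x, of 0 "U 0 2 x s - U 0 2 x t"] mult_left_mono[OF C3(2)[OF h(1) x s(1) t] nonneg(1)] s
            by (simp add: abs_minus_commute)
        qed
        also have "\<dots> = H' * (t - s) powr a" by (simp add: H'_def distrib_right)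
        finally have "norm (g x s - g x t) \<le> H' * (t - s) powr a" .
        then show "\<bar>(U 0 3 x s $ k - d\<^sup>2 * (U 2 2 x s - U 2 2 x 0) $ k) - (U 0 3 x t $ k - d\<^sup>2 * (U 2 2 x t - U 2 2 x 0) $ k)\<bar>
            \<le> H' * (t - s) powr a"
          unfolding G[OF x t] G[OF x s(1)]
          using order_trans[OF component_le_norm_cart[of "g x s - g x t" k]] by simp
      next
        fix t assume "t \<in> {0..T}"
        then show "(U 0 2 0 t - U 0 2 0 0) $ k = 0" "(U 0 2 1 t - U 0 2 1 0) $ k = 0"
          using boundary_zero[OF h(1), of 2] T0 by auto
      qed auto
    qed
    then show "norm (U 0 3 x t) \<le> CARD('n) * (K * (S + M + H')) * (1 / d ^ 0)" by simp
  qed (use K nn in auto)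
qed

end

text \<open>On the length scale \<open>d\<close> of the kernel estimate the weight changes only by a
  bounded factor, so local estimates inherit the weight at the centre.\<close>

lemma weight_shift:
  assumes d: "d > 0" and b: "b \<ge> 0" and y: "\<bar>y - x\<bar> \<le> c * d"
  shows "weight b d m y \<le> exp (b * c) * weight b d m x"
proof -
  have c: "c \<ge> 0" using y d by (smt (verit) mult_neg_pos)
  have e: "exp (- b * p / d) \<le> exp (b * c) * exp (- b * q / d)" if "\<bar>p - q\<bar> \<le> c * d" for p q
  proof -
    have "b * (q - p) \<le> b * (c * d)" using that b by (intro mult_left_mono) auto
    then have "b * (q - p) / d \<le> b * (c * d) / d" using d by (intro divide_right_mono) auto
    then have "- b * p / d \<le> b * c + (- b * q / d)" using d by (simp add: diff_divide_distrib right_diff_distrib)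
    then show ?thesis by (simp flip: exp_add)
  qed
  have "layer b d y \<le> exp (b * c) * layer b d x"
    unfolding layer_def distrib_left by (intro add_mono e) (use y in auto)
  then have "layer b d y / d ^ m \<le> exp (b * c) * (layer b d x / d ^ m)"
    using d by (simp add: divide_right_mono)
  moreover have "1 \<le> exp (b * c)" using b c by simp
  ultimately show ?thesis unfolding weight_def distrib_left mult_1_right by (rule add_mono[rotated])
qed

section \<open>Space derivatives: crude, weighted and interior bounds\<close>

context sp_data
begin

lemma ub_s2: "ub (UU 2 2) (wp 2)"
  using ub_step[of 0 2] ub_03 ub_02 by (simp add: eval_nat_numeral)

text \<open>The chain behind order 4: \<open>U 4 1\<close> needs \<open>U 2 2\<close>, and that
  needs \<open>U 0 3\<close>. This is where the kernel estimate feeds the space derivatives.\<close>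

lemma ub_s1: "s \<le> 4 \<Longrightarrow> ub (UU s 1) (wp s)"
proof -
  have 0: "ub (UU 0 1) (wp 0)" by (rule ub_01)
  have 2: "ub (UU 2 1) (wp 2)" using ub_step[of 0 1] ub_02 0 by (simp add: eval_nat_numeral)
  have 1: "ub (UU 1 1) (wp 1)" using ub_landau[of 0 1] 0 2 by (simp add: eval_nat_numeral)
  have l: "ub (UU l 1) (wp l)" if "l \<le> 2" for l
  proof -
    from that consider "l = 0" | "l = 1" | "l = 2" by linarith
    then show ?thesis using 0 1 2 by cases simp_all
  qed
  have 4: "ub (UU 4 1) (wp 4)" using ub_step[of 2 1] ub_s2 l by (simp add: eval_nat_numeral)
  have 3: "ub (UU 3 1) (wp 3)" using ub_landau[of 2 1] 2 4 by (simp add: eval_nat_numeral)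
  assume "s \<le> 4"
  then consider "s \<le> 2" | "s = 3" | "s = 4" by linarith
  then show "ub (UU s 1) (wp s)" using l 3 4 by cases simp_all
qed

lemma ub_s0: "s \<le> 6 \<Longrightarrow> ub (UU s 0) (wp s)"
proof -
  have 0: "ub (UU 0 0) (wp 0)" by (rule ub_00)
  have 2: "ub (UU 2 0) (wp 2)" using ub_step[of 0 0] ub_s1[of 0] 0 by (simp add: eval_nat_numeral)
  have 1: "ub (UU 1 0) (wp 1)" using ub_landau[of 0 0] 0 2 by (simp add: eval_nat_numeral)
  have l: "ub (UU l 0) (wp l)" if "l \<le> 2" for l
  proof -
    from that consider "l = 0" | "l = 1" | "l = 2" by linarith
    then show ?thesis using 0 1 2 by cases simp_all
  qed
  have 4: "ub (UU 4 0) (wp 4)" using ub_step[of 2 0] ub_s1[of 2] l by (simp add: eval_nat_numeral)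
  have 3: "ub (UU 3 0) (wp 3)" using ub_landau[of 2 0] 2 4 by (simp add: eval_nat_numeral)
  have l': "ub (UU l 0) (wp l)" if "l \<le> 4" for l
  proof -
    from that consider "l \<le> 2" | "l = 3" | "l = 4" by linarith
    then show ?thesis using l 3 4 by cases simp_all
  qed
  have 6: "ub (UU 6 0) (wp 6)" using ub_step[of 4 0] ub_s1[of 4] l' by (simp add: eval_nat_numeral)
  have 5: "ub (UU 5 0) (wp 5)" using ub_landau[of 4 0] 4 6 by (simp add: eval_nat_numeral)
  assume "s \<le> 6"
  then consider "s \<le> 4" | "s = 5" | "s = 6" by linarith
  then show "ub (UU s 0) (wp s)" using l' 5 6 by cases simp_all
qed

lemma ub_source_weighted:
  assumes j: "j \<le> 4" and l: "\<And>l. l < j \<Longrightarrow> ub (UU l 0) (ww l)"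
  shows "ub (\<lambda>d U x t. f j 0 x t - lower U j 0 x t) (ww j)"
proof (intro ub_diff ub_f ub_lower j)
  fix l assume "l < j"
  then show "ub (UU l 0) (ww j)" by (intro ub_mono[OF l, where K = 1]) (auto intro: weight_mono)
qed (use j weight_ge_1 in \<open>auto intro: order_trans[OF zero_le_one weight_ge_1]\<close>)

text \<open>The crude bound \<open>d^-j\<close> is used at \<open>x = 0\<close> and
  \<open>x = 1\<close> only, where the weight is as large; comparison propagates it inwards with the
  decay of the barrier. Strong induction on \<open>j\<close> supplies the Leibniz terms, whose
  smaller weights are dominated by the current one.\<close>

lemma ub_weighted: "j \<le> 4 \<Longrightarrow> ub (UU j 0) (ww j)"
proof (induction j rule: less_induct)
  case (less j)
  have "ub (\<lambda>d U x t. f j 0 x t - lower U j 0 x t) (ww j)"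
    using less by (intro ub_source_weighted) auto
  then obtain C1 where C1: "C1 \<ge> 0"
    "\<And>d U x t. sol d U \<Longrightarrow> x \<in> {0..1} \<Longrightarrow> t \<in> {0..T} \<Longrightarrow> norm (f j 0 x t - lower U j 0 x t) \<le> C1 * weight b d j x"
    by (rule ubE) blast
  obtain C2 where C2: "C2 \<ge> 0"
    "\<And>d U x t. sol d U \<Longrightarrow> x \<in> {0..1} \<Longrightarrow> t \<in> {0..T} \<Longrightarrow> norm (U j 0 x t) \<le> C2 * (1 / d ^ j)"
  proof (rule ubE[OF ub_s0[of j]])
    show "j \<le> 6" using less(2) by simp
  qed blast
  show ?case
  proof (rule ubI[of "CARD('n) * (C1 / \<theta> + C2)"])
    fix d and U :: "'n family" and x t :: real assume h: "sol d U" "x \<in> {0..1}" "t \<in> {0..T}"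
    have d: "0 < d" "d < 1" using solD(1,2)[OF h(1)] by auto
    have "norm (U j 0 x t) \<le> CARD('n) * ((C1 / \<theta> + C2 + 0 * t) * weight b d j x)"
    proof (rule comparison_sol[OF h(1) _ _ _ _ _ h(2,3)])
      fix x t :: real assume xt: "x \<in> {0..1}" "t \<in> {0..T}"
      have w: "1 \<le> weight b d j x" by (rule weight_ge_1[OF d(1)])
      have "C1 * weight b d j x \<le> (0 + \<theta> * (C1 / \<theta> + C2)) * weight b d j x"
        using theta C2 w by (intro mult_right_mono) (auto simp: distrib_left)
      then show "norm (f j 0 x t - lower U j 0 x t) \<le> (0 + \<theta> * (C1 / \<theta> + C2)) * weight b d j x"
        using C1(2)[OF h(1) xt] by linarith
      have n: "0 \<le> C1 / \<theta>" using C1 theta by simp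
      assume "x = 0 \<or> x = 1 \<or> t = 0"
      then consider "x = 0 \<or> x = 1" | "t = 0" by blast
      then show "norm (U j 0 x t) \<le> (C1 / \<theta> + C2 + 0 * t) * weight b d j x"
      proof cases
        case 1
        have "norm (U j 0 x t) \<le> C2 * weight b d j x"
          using C2(2)[OF h(1) xt] mult_left_mono[OF weight_bdry[OF d(1) 1, of j b] C2(1)] by linarith
        also have "\<dots> \<le> (C1 / \<theta> + C2 + 0 * t) * weight b d j x" using n w by (intro mult_right_mono) auto
        finally show ?thesis .
      next
        case 2
        then show ?thesis using initial_zero[OF h(1) _ xt(1), of j] less(2) n C2 w by auto
      qed
    qed (use less(2) C1 C2 theta in auto)
    then show "norm (U j 0 x t) \<le> CARD('n) * (C1 / \<theta> + C2) * weight b d j x" by simp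
  qed (use C1 C2 theta in auto)
qed

lemma time_lipschitz:
  assumes j: "j \<le> 4"
  obtains C where "C \<ge> 0" "\<And>d U x t r. sol d U \<Longrightarrow> x \<in> {0..1} \<Longrightarrow> t \<in> {0..T} \<Longrightarrow> r \<in> {0..T} \<Longrightarrow>
      norm (U j 0 x t - U j 0 x r) \<le> C * (1 / d ^ j) * \<bar>t - r\<bar>"
proof -
  obtain C where C: "C \<ge> 0"
    "\<And>d U x t. sol d U \<Longrightarrow> x \<in> {0..1} \<Longrightarrow> t \<in> {0..T} \<Longrightarrow> norm (U j 1 x t) \<le> C * (1 / d ^ j)"
    using ubE[OF ub_s1[OF j]] by blast
  have "norm (U j 0 x t - U j 0 x r) \<le> C * (1 / d ^ j) * \<bar>t - r\<bar>"
    if h: "sol d U" "x \<in> {0..1}" "t \<in> {0..T}" "r \<in> {0..T}" for d and U :: "'n family" and x t r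
    by (rule vector_lipschitz[of "{0..T}" r t "U j 0 x" "U j 1 x"])
       (use h C solD(4)[OF h(1) _ h(2), of j 0] j in auto)
  then show ?thesis using C(1) that by blast
qed

text \<open>The first increment for the Hoelder estimate. At the end points the time Lipschitz
  constant is again dominated by the weight, and the initial values are zero, so the barrier starts
  at 0.\<close>

lemma weighted_growth:
  assumes j: "j \<le> 4"
  obtains C where "C \<ge> 0" "\<And>d U x t. sol d U \<Longrightarrow> x \<in> {0..1} \<Longrightarrow> t \<in> {0..T} \<Longrightarrow> norm (U j 0 x t) \<le> C * t * weight b d j x"
proof -
  have "ub (\<lambda>d U x t. f j 0 x t - lower U j 0 x t) (ww j)"
    using j by (intro ub_source_weighted ub_weighted) auto
  then obtain C1 where C1: "C1 \<ge> 0"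
    "\<And>d U x t. sol d U \<Longrightarrow> x \<in> {0..1} \<Longrightarrow> t \<in> {0..T} \<Longrightarrow> norm (f j 0 x t - lower U j 0 x t) \<le> C1 * weight b d j x"
    by (rule ubE) blast
  obtain C2 where C2: "C2 \<ge> 0" "\<And>d U x t r. sol d U \<Longrightarrow> x \<in> {0..1} \<Longrightarrow> t \<in> {0..T} \<Longrightarrow> r \<in> {0..T} \<Longrightarrow>
      norm (U j 0 x t - U j 0 x r) \<le> C2 * (1 / d ^ j) * \<bar>t - r\<bar>"
    using time_lipschitz[OF j] by blast
  have "norm (U j 0 x t) \<le> CARD('n) * (C1 + C2) * t * weight b d j x"
    if h: "sol d U" "x \<in> {0..1}" "t \<in> {0..T}" for d and U :: "'n family" and x t
  proof -
    have d: "0 < d" "d < 1" using solD(1,2)[OF h(1)] by auto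
    have "norm (U j 0 x t) \<le> CARD('n) * ((0 + (C1 + C2) * t) * weight b d j x)"
    proof (rule comparison_sol[OF h(1) _ _ _ _ _ h(2,3)])
      fix x t :: real assume xt: "x \<in> {0..1}" "t \<in> {0..T}"
      have w: "1 \<le> weight b d j x" by (rule weight_ge_1[OF d(1)])
      have "C1 * weight b d j x \<le> (C1 + C2 + \<theta> * 0) * weight b d j x"
        using C2 w by (intro mult_right_mono) auto
      then show "norm (f j 0 x t - lower U j 0 x t) \<le> (C1 + C2 + \<theta> * 0) * weight b d j x"
        using C1(2)[OF h(1) xt] by linarith
      assume "x = 0 \<or> x = 1 \<or> t = 0"
      then consider "x = 0 \<or> x = 1" | "t = 0" by blast
      then show "norm (U j 0 x t) \<le> (0 + (C1 + C2) * t) * weight b d j x"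
      proof cases
        case 1
        have "norm (U j 0 x t) \<le> C2 * (1 / d ^ j) * t"
          using C2(2)[OF h(1) xt T0] initial_zero[OF h(1) _ xt(1), of j] j xt by simp
        also have "\<dots> \<le> C2 * weight b d j x * t"
          using weight_bdry[OF d(1) 1, of j b] C2(1) xt by (intro mult_right_mono mult_left_mono) auto
        also have "\<dots> \<le> (C1 + C2) * weight b d j x * t" using w C1 xt by (intro mult_right_mono) auto
        finally show ?thesis by (simp add: mult_ac)
      next
        case 2
        then show ?thesis using initial_zero[OF h(1) _ xt(1), of j] j by auto
      qed
    qed (use j C1 C2 in auto)
    then show ?thesis by (simp add: mult_ac)
  qed
  then show ?thesis using C1(1) C2(1) by (intro that[of "CARD('n) * (C1 + C2)"]) auto
qed

lemma lower_difference:
  "lower U s q x t - lower U s q x r = lower (\<lambda>s q x t. U s q x t - U s q x r) s q x t"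
  unfolding lower_def
  by (simp add: sum_subtractf[symmetric] matrix_vector_mult_diff_distrib scaleR_diff_right)

text \<open>One constant for all orders below \<open>j\<close> is the form in which the induction
  hypothesis estimates the differences of the Leibniz terms. On the lateral boundary and for the
  first increment a Lipschitz bound is available and is weakened to a Hoelder one.\<close>

lemma weighted_hoelder_all:
  "j \<le> 5 \<Longrightarrow> \<exists>C\<ge>0. \<forall>l<j. \<forall>d U x t r. sol d U \<longrightarrow> x \<in> {0..1} \<longrightarrow> t \<in> {0..T} \<longrightarrow> r \<in> {0..T} \<longrightarrow>
       norm (U l 0 x t - U l 0 x r) \<le> C * \<bar>t - r\<bar> powr a * weight b d l x"
proof (induction j)
  case 0
  show ?case by (rule exI[of _ 0]) auto
next
  case (Suc j)
  then have j: "j \<le> 4" by simp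
  obtain C where C: "C \<ge> 0" "\<And>l d U x t r. l < j \<Longrightarrow> sol d U \<Longrightarrow> x \<in> {0..1} \<Longrightarrow> t \<in> {0..T} \<Longrightarrow> r \<in> {0..T} \<Longrightarrow>
       norm (U l 0 x t - U l 0 x r) \<le> C * \<bar>t - r\<bar> powr a * weight b d l x"
    using Suc by (meson Suc_leD)
  obtain C1 where C1: "C1 \<ge> 0" "\<And>d U x t. sol d U \<Longrightarrow> x \<in> {0..1} \<Longrightarrow> t \<in> {0..T} \<Longrightarrow> norm (U j 0 x t) \<le> C1 * t * weight b d j x"
    using weighted_growth[OF j] by blast
  obtain C2 where C2: "C2 \<ge> 0" "\<And>d U x t r. sol d U \<Longrightarrow> x \<in> {0..1} \<Longrightarrow> t \<in> {0..T} \<Longrightarrow> r \<in> {0..T} \<Longrightarrow>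
      norm (U j 0 x t - U j 0 x r) \<le> C2 * (1 / d ^ j) * \<bar>t - r\<bar>"
    using time_lipschitz[OF j] by blast
  define K1 where "K1 = H + 2 ^ j * (CA * C)"
  define K2 where "K2 = (C1 + C2) * (T + 1)"
  define K where "K = K1 / \<theta> + K2"
  have n: "0 \<le> K1" "0 \<le> K2"
    using nonneg C(1) C1(1) C2(1) T by (auto simp: K1_def K2_def)
  then have n: "0 \<le> K1" "0 \<le> K2" "K2 \<le> K" "K1 \<le> \<theta> * K" "0 \<le> K"
    using theta by (auto simp: K_def distrib_left)
  have *: "norm (U j 0 x (t + \<tau>) - U j 0 x t) \<le> (CARD('n) * K) * \<tau> powr a * weight b d j x"
    if h: "sol d U" "x \<in> {0..1}" "t \<in> {0..T - \<tau>}" "\<tau> \<in> {0..T}" for d and U :: "'n family" and x t \<tau>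
  proof -
    have d: "0 < d" "d < 1" using solD(1,2)[OF h(1)] by auto
    define p where "p = \<tau> powr a"
    have p: "p \<ge> 0" "\<tau> \<le> (T + 1) * p" using le_powr_bound[of \<tau> T a] a h(4) by (auto simp: p_def)
    have "norm (U j 0 x (t + \<tau>) - U j 0 x t) \<le> CARD('n) * ((K * p) * weight b d j x)"
    proof (rule comparison_difference[OF h(1) _ _ h(4) _ _ h(2,3)])
      fix x t :: real assume x: "x \<in> {0..1}" and t: "t \<in> {0..T - \<tau>}"
      have w: "1 \<le> weight b d j x" by (rule weight_ge_1[OF d(1)])
      have t': "t \<in> {0..T}" "t + \<tau> \<in> {0..T}" using t h(4) by auto
      have "norm ((f j 0 x (t + \<tau>) - lower U j 0 x (t + \<tau>)) - (f j 0 x t - lower U j 0 x t))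
          = norm ((f j 0 x (t + \<tau>) - f j 0 x t) - (lower U j 0 x (t + \<tau>) - lower U j 0 x t))"
        by (simp add: algebra_simps)
      also have "\<dots> \<le> norm (f j 0 x (t + \<tau>) - f j 0 x t) + norm (lower U j 0 x (t + \<tau>) - lower U j 0 x t)"
        by (rule norm_triangle_ineq4)
      also have "\<dots> \<le> H * p * weight b d j x + 2 ^ j * (CA * (C * p * weight b d j x))"
      proof (intro add_mono)
        have "norm (f j 0 x (t + \<tau>) - f j 0 x t) \<le> H * p"
          using f_hoelder[of j 0 x "t + \<tau>" t] x t' h(4) j by (simp add: p_def)
        also have "\<dots> \<le> H * p * weight b d j x" using w nonneg p mult_left_mono[OF w, of "H * p"] by simp
        finally show "norm (f j 0 x (t + \<tau>) - f j 0 x t) \<le> H * p * weight b d j x" .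
        show "norm (lower U j 0 x (t + \<tau>) - lower U j 0 x t) \<le> 2 ^ j * (CA * (C * p * weight b d j x))"
          unfolding lower_difference
        proof (rule norm_lower_le[OF j x])
          fix l assume l: "l < j"
          have "norm (U l 0 x (t + \<tau>) - U l 0 x t) \<le> C * p * weight b d l x"
            using C(2)[OF l h(1) x t'(2,1)] h(4) by (simp add: p_def)
          also have "\<dots> \<le> C * p * weight b d j x"
            using weight_mono[of d l j b x] l d C p by (intro mult_left_mono) auto
          finally show "norm (U l 0 x (t + \<tau>) - U l 0 x t) \<le> C * p * weight b d j x" .
        qed (use C p w in auto)
      qed
      also have "\<dots> = K1 * (p * weight b d j x)" by (simp add: K1_def algebra_simps)
      also have "\<dots> \<le> \<theta> * K * (p * weight b d j x)" using n p w by (intro mult_right_mono) auto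
      finally show "norm ((f j 0 x (t + \<tau>) - lower U j 0 x (t + \<tau>)) - (f j 0 x t - lower U j 0 x t)) \<le> \<theta> * (K * p) * weight b d j x"
        by (simp add: mult.assoc)
      assume "x = 0 \<or> x = 1 \<or> t = 0"
      then consider "x = 0 \<or> x = 1" | "t = 0" by blast
      then have "norm (U j 0 x (t + \<tau>) - U j 0 x t) \<le> (C1 + C2) * \<tau> * weight b d j x"
      proof cases
        case 1
        have "norm (U j 0 x (t + \<tau>) - U j 0 x t) \<le> C2 * (1 / d ^ j) * \<tau>"
          using C2(2)[OF h(1) x t'(2,1)] h(4) by simp
        also have "\<dots> \<le> C2 * weight b d j x * \<tau>"
          using weight_bdry[OF d(1) 1, of j b] C2(1) h(4) by (intro mult_right_mono mult_left_mono) auto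
        also have "\<dots> \<le> (C1 + C2) * weight b d j x * \<tau>" using w C1 h(4) by (intro mult_right_mono) auto
        finally show ?thesis by (simp add: mult_ac)
      next
        case 2
        have "norm (U j 0 x (t + \<tau>) - U j 0 x t) \<le> C1 * \<tau> * weight b d j x"
          using 2 initial_zero[OF h(1) _ x, of j] j C1(2)[OF h(1) x h(4)] by simp
        also have "\<dots> \<le> (C1 + C2) * \<tau> * weight b d j x" using w C2 h(4) by (intro mult_right_mono) auto
        finally show ?thesis .
      qed
      also have "\<dots> \<le> (C1 + C2) * ((T + 1) * p) * weight b d j x"
        using p C1 C2 w by (intro mult_right_mono mult_left_mono) auto
      also have "\<dots> = K2 * (p * weight b d j x)" by (simp add: K2_def mult_ac)
      also have "\<dots> \<le> K * (p * weight b d j x)" using n p w by (intro mult_right_mono) auto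
      finally show "norm (U j 0 x (t + \<tau>) - U j 0 x t) \<le> K * p * weight b d j x" by (simp add: mult.assoc)
    qed (use n p j in auto)
    then show ?thesis by (simp add: p_def mult_ac)
  qed
  have new: "norm (U j 0 x t - U j 0 x r) \<le> (CARD('n) * K) * \<bar>t - r\<bar> powr a * weight b d j x"
    if h: "sol d U" "x \<in> {0..1}" "t \<in> {0..T}" "r \<in> {0..T}" for d and U :: "'n family" and x t r
  proof (cases "r \<le> t")
    case True
    then show ?thesis using *[OF h(1,2), of r "t - r"] h by auto
  next
    case False
    then show ?thesis using *[OF h(1,2), of t "r - t"] h by (auto simp: norm_minus_commute abs_minus_commute)
  qed
  show ?case
  proof (intro exI[of _ "C + CARD('n) * K"] conjI allI impI)
    show "0 \<le> C + CARD('n) * K" using C n by simp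
    fix l d and U :: "'n family" and x t r :: real
    assume h: "l < Suc j" "sol d U" "x \<in> {0..1}" "t \<in> {0..T}" "r \<in> {0..T}"
    define w where "w = \<bar>t - r\<bar> powr a * weight b d l x"
    have w: "0 \<le> C * w" "0 \<le> (CARD('n) * K) * w"
      using C n weight_ge_1[OF solD(1)[OF h(2)], of b l x] by (auto simp: w_def)
    have "norm (U l 0 x t - U l 0 x r) \<le> (C + CARD('n) * K) * w"
    proof (cases "l < j")
      case True
      then show ?thesis using C(2)[OF True h(2-5)] w by (simp add: w_def distrib_right mult.assoc)
    next
      case False
      then have "l = j" using h(1) by simp
      then show ?thesis using new[OF h(2-5)] w by (simp add: w_def distrib_right mult.assoc)
    qed
    then show "norm (U l 0 x t - U l 0 x r) \<le> (C + CARD('n) * K) * \<bar>t - r\<bar> powr a * weight b d l x"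
      by (simp add: w_def mult.assoc)
  qed
qed

text \<open>The kernel estimate, applied to the components of \<open>U 4 0\<close> on a cell of half
  width \<open>\<rho> * d\<close>, bounds \<open>U 4 1\<close> by the weight without further loss;
  the equation then gives \<open>U 6 0\<close> at the price \<open>d^-2\<close>. Since
  \<open>U 4 0\<close> need not vanish at the ends, the whole cell has to fit into the
  interval.\<close>

lemma sixth_derivative_interior:
  assumes \<rho>: "\<rho> > 0"
  obtains C where "C \<ge> 0" "\<And>d U x t. sol d U \<Longrightarrow> \<rho> * d \<le> x \<Longrightarrow> x + \<rho> * d \<le> 1 \<Longrightarrow> t \<in> {0..T} \<Longrightarrow>
      norm (U 6 0 x t) \<le> C / d\<^sup>2 * weight b d 4 x"
proof -
  obtain K where K: "K > 0"
    "\<And>d z zt zx zxx x0 S M H t. \<lbrakk>d > 0; S \<ge> 0; M \<ge> 0; H \<ge> 0;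
      continuous_on ({0..1} \<times> {0..T}) (\<lambda>(x, t). z x t);
      continuous_on ({0..1} \<times> {0..T}) (\<lambda>(x, t). zt x t);
      \<And>x t. x \<in> {0..1} \<Longrightarrow> t \<in> {0..T} \<Longrightarrow> (z x has_real_derivative zt x t) (at t within {0..T});
      \<And>x t. x \<in> {0..1} \<Longrightarrow> t \<in> {0..T} \<Longrightarrow> ((\<lambda>x. z x t) has_real_derivative zx x t) (at x within {0..1});
      \<And>x t. x \<in> {0..1} \<Longrightarrow> t \<in> {0..T} \<Longrightarrow> ((\<lambda>x. zx x t) has_real_derivative zxx x t) (at x within {0..1});
      \<And>x. x \<in> {0..1} \<Longrightarrow> z x 0 = 0;
      0 \<le> x0; x0 + \<rho> * d \<le> 1; \<rho> * d \<le> x0 \<or> (\<forall>t\<in>{0..T}. z 0 t = 0);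
      \<And>x t. x \<in> {0..1} \<Longrightarrow> \<bar>x - x0\<bar> \<le> \<rho> * d \<Longrightarrow> t \<in> {0..T} \<Longrightarrow> \<bar>z x t\<bar> \<le> S;
      \<And>x t. x \<in> {0..1} \<Longrightarrow> \<bar>x - x0\<bar> \<le> \<rho> * d \<Longrightarrow> t \<in> {0..T} \<Longrightarrow> \<bar>zt x t - d\<^sup>2 * zxx x t\<bar> \<le> M;
      \<And>x t s. x \<in> {0..1} \<Longrightarrow> \<bar>x - x0\<bar> \<le> \<rho> * d \<Longrightarrow> t \<in> {0..T} \<Longrightarrow> s \<in> {0..T} \<Longrightarrow> s \<le> t \<Longrightarrow>
        \<bar>(zt x s - d\<^sup>2 * zxx x s) - (zt x t - d\<^sup>2 * zxx x t)\<bar> \<le> H * (t - s) powr a;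
      t \<in> {0..T}\<rbrakk> \<Longrightarrow> \<bar>zt x0 t\<bar> \<le> K * (S + M + H)"
    by (fact heat_time_derivative_bound[OF \<rho> T a(1)])
  have "ub (\<lambda>d U x t. f 4 0 x t - lower U 4 0 x t - A 0 x *v U 4 0 x t) (ww 4)"
    by (intro ub_diff[OF ub_source_weighted] ub_A ub_weighted) auto
  then obtain M where M: "M \<ge> 0" "\<And>d U x t. sol d U \<Longrightarrow> x \<in> {0..1} \<Longrightarrow> t \<in> {0..T} \<Longrightarrow>
      norm (f 4 0 x t - lower U 4 0 x t - A 0 x *v U 4 0 x t) \<le> M * weight b d 4 x"
    by (rule ubE) blast
  obtain S where S: "S \<ge> 0" "\<And>d U x t. sol d U \<Longrightarrow> x \<in> {0..1} \<Longrightarrow> t \<in> {0..T} \<Longrightarrow> norm (U 4 0 x t) \<le> S * weight b d 4 x"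
    using ubE[OF ub_weighted[of 4]] by (metis order_refl)
  obtain C where C: "C \<ge> 0" "\<And>l d U x t r. l < 5 \<Longrightarrow> sol d U \<Longrightarrow> x \<in> {0..1} \<Longrightarrow> t \<in> {0..T} \<Longrightarrow> r \<in> {0..T} \<Longrightarrow>
       norm (U l 0 x t - U l 0 x r) \<le> C * \<bar>t - r\<bar> powr a * weight b d l x"
    using weighted_hoelder_all[of 5] by (meson order_refl)
  define H' where "H' = H + 16 * (CA * C) + CA * C"
  define E where "E = exp (b * \<rho>)"
  have E: "E > 0" by (simp add: E_def)
  have H': "H' \<ge> 0" using nonneg C by (simp add: H'_def)
  define C6 where "C6 = CARD('n) * (K * (S + M + H') * E) + M"
  have "norm (U 6 0 x t) \<le> C6 / d\<^sup>2 * weight b d 4 x"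
    if h: "sol d U" "\<rho> * d \<le> x" "x + \<rho> * d \<le> 1" "t \<in> {0..T}" for d and U :: "'n family" and x t
  proof -
    have d: "0 < d" "d < 1" using solD(1,2)[OF h(1)] by auto
    have "0 < \<rho> * d" using \<rho> d by simp
    then have x: "x \<in> {0..1}" using h(2,3) by auto
    \<comment> \<open>The number \<open>w\<close> majorises the weight on the whole cell, so it can
      stand in the constants of the kernel estimate.\<close>
    define w where "w = E * weight b d 4 x"
    have wE: "weight b d 4 y \<le> w" if "\<bar>y - x\<bar> \<le> \<rho> * d" for y
      using weight_shift[OF d(1) _ that] b_pos by (simp add: w_def E_def)
    have w: "w > 0" using E weight_ge_1[OF d(1), of b 4 x] by (simp add: w_def)
    define g where "g x t = f 4 0 x t - lower U 4 0 x t - A 0 x *v U 4 0 x t" for x t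
    have gE: "U 4 1 x t - d\<^sup>2 *\<^sub>R U 6 0 x t = g x t" if "x \<in> {0..1}" "t \<in> {0..T}" for x t
      using solD(9)[OF h(1) _ that, of 4 0] by (simp add: g_def algebra_simps)
    have "norm (U 4 1 x t) \<le> CARD('n) * (K * (S * w + M * w + H' * w))"
    proof (rule norm_le_card_component)
      fix k
      have gk: "U 4 1 x t $ k - d\<^sup>2 * U 6 0 x t $ k = g x t $ k" if "x \<in> {0..1}" "t \<in> {0..T}" for x t
        by (simp flip: gE[OF that])
      show "\<bar>U 4 1 x t $ k\<bar> \<le> K * (S * w + M * w + H' * w)"
      proof (rule K(2)[where z = "\<lambda>x t. U 4 0 x t $ k" and zt = "\<lambda>x t. U 4 1 x t $ k"
            and zx = "\<lambda>x t. U 5 0 x t $ k" and zxx = "\<lambda>x t. U 6 0 x t $ k", OF d(1) _ _ _ _ _ _ _ _ _ _ h(3) _ _ _ _ h(4)])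
        show "continuous_on ({0..1} \<times> {0..T}) (\<lambda>(x, t). U 4 0 x t $ k)"
          "continuous_on ({0..1} \<times> {0..T}) (\<lambda>(x, t). U 4 1 x t $ k)"
          unfolding case_prod_beta
          by (intro continuous_intros solD(5)[OF h(1), unfolded case_prod_beta]; simp)+
        fix y t :: real assume y: "y \<in> {0..1}" and t: "t \<in> {0..T}"
        show "((\<lambda>t. U 4 0 y t $ k) has_real_derivative U 4 1 y t $ k) (at t within {0..T})"
          by (rule vec_component_deriv) (use solD(4)[OF h(1) _ y t, of 4 0] in simp)
        show "((\<lambda>y. U 4 0 y t $ k) has_real_derivative U 5 0 y t $ k) (at y within {0..1})"
          by (rule vec_component_deriv) (use solD(3)[OF h(1) _ y t, of 4 0] in \<open>simp add: eval_nat_numeral\<close>)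
        show "((\<lambda>y. U 5 0 y t $ k) has_real_derivative U 6 0 y t $ k) (at y within {0..1})"
          by (rule vec_component_deriv) (use solD(3)[OF h(1) _ y t, of 5 0] in \<open>simp add: eval_nat_numeral\<close>)
        assume n: "\<bar>y - x\<bar> \<le> \<rho> * d"
        have "norm (U 4 0 y t) \<le> S * w"
          using S(2)[OF h(1) y t] mult_left_mono[OF wE[OF n] S(1)] by linarith
        then show "\<bar>U 4 0 y t $ k\<bar> \<le> S * w" using component_le_norm_cart order_trans by blast
        have "norm (g y t) \<le> M * w"
          using M(2)[OF h(1) y t] mult_left_mono[OF wE[OF n] M(1)] unfolding g_def by linarith
        then show "\<bar>U 4 1 y t $ k - d\<^sup>2 * U 6 0 y t $ k\<bar> \<le> M * w"
          unfolding gk[OF y t] using component_le_norm_cart order_trans by blast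
        fix s assume s: "s \<in> {0..T}" "s \<le> t"
        define p where "p = (t - s) powr a"
        have p: "p \<ge> 0" by (simp add: p_def)
        have u4: "norm (U l 0 y s - U l 0 y t) \<le> C * p * w" if "l \<le> 4" for l
        proof -
          have "norm (U l 0 y s - U l 0 y t) \<le> C * p * weight b d l y"
            using C(2)[OF _ h(1) y s(1) t, of l] s that by (simp add: p_def abs_minus_commute)
          also have "\<dots> \<le> C * p * w"
            using weight_mono[of d l 4 b y] wE[OF n] that d C p by (intro mult_left_mono) auto
          finally show ?thesis .
        qed
        have "g y s - g y t = (f 4 0 y s - f 4 0 y t) - (lower U 4 0 y s - lower U 4 0 y t) - A 0 y *v (U 4 0 y s - U 4 0 y t)"
          by (simp add: g_def matrix_vector_mult_diff_distrib)
        also have "norm \<dots> \<le> norm (f 4 0 y s - f 4 0 y t) + norm (lower U 4 0 y s - lower U 4 0 y t) + norm (A 0 y *v (U 4 0 y s - U 4 0 y t))"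
          by (intro order_trans[OF norm_triangle_ineq4] add_mono order_refl)
        also have "\<dots> \<le> H * p * w + 2 ^ 4 * (CA * (C * p * w)) + CA * (C * p * w)"
        proof (intro add_mono)
          have "1 \<le> w" using wE[OF n] weight_ge_1[OF d(1), of b 4 y] by linarith
          have "norm (f 4 0 y s - f 4 0 y t) \<le> H * p"
            using f_hoelder[of 4 0 y s t] y s t by (simp add: p_def abs_minus_commute)
          also have "\<dots> \<le> H * p * w" using \<open>1 \<le> w\<close> nonneg p mult_left_mono[of 1 w "H * p"] by simp
          finally show "norm (f 4 0 y s - f 4 0 y t) \<le> H * p * w" .
          show "norm (lower U 4 0 y s - lower U 4 0 y t) \<le> 2 ^ 4 * (CA * (C * p * w))"
            unfolding lower_difference by (rule norm_lower_le) (use y u4 C p w in auto)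
          show "norm (A 0 y *v (U 4 0 y s - U 4 0 y t)) \<le> CA * (C * p * w)"
            using A_bound[OF _ y, of 0 "U 4 0 y s - U 4 0 y t"] mult_left_mono[OF u4[of 4] nonneg(1)] by simp
        qed
        also have "\<dots> = H' * w * p" by (simp add: H'_def algebra_simps)
        finally show "\<bar>(U 4 1 y s $ k - d\<^sup>2 * U 6 0 y s $ k) - (U 4 1 y t $ k - d\<^sup>2 * U 6 0 y t $ k)\<bar> \<le> H' * w * (t - s) powr a"
          unfolding gk[OF y t] gk[OF y s(1)] p_def
          using order_trans[OF component_le_norm_cart[of "g y s - g y t" k]] by simp
      qed (use S M H' w x h(2) initial_zero[OF h(1)] in auto)
    qed
    moreover have "norm (g x t) \<le> M * weight b d 4 x" using M(2)[OF h(1) x h(4)] by (simp add: g_def)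
    moreover have "d\<^sup>2 *\<^sub>R U 6 0 x t = U 4 1 x t - g x t" using gE[OF x h(4)] by (simp add: algebra_simps)
    then have "d\<^sup>2 * norm (U 6 0 x t) \<le> norm (U 4 1 x t) + norm (g x t)"
      by (metis abs_power2 norm_scaleR norm_triangle_ineq4)
    ultimately have "d\<^sup>2 * norm (U 6 0 x t) \<le> CARD('n) * (K * (S * w + M * w + H' * w)) + M * weight b d 4 x"
      by linarith
    also have "\<dots> = C6 * weight b d 4 x" by (simp add: C6_def w_def algebra_simps)
    finally show ?thesis using d by (simp add: field_simps)
  qed
  moreover have "C6 \<ge> 0" using K M S H' E by (simp add: C6_def)
  ultimately show ?thesis by (intro that)
qed

text \<open>Interpolation between orders 4 and 6 with a step of length \<open>\<rho> * d\<close>,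
  which has to stay where the interior bound on order 6 holds.\<close>

lemma fifth_derivative_interior:
  assumes \<rho>: "\<rho> > 0"
  obtains C where "C \<ge> 0" "\<And>d U x t. sol d U \<Longrightarrow> \<rho> * d \<le> 1 / 8 \<Longrightarrow> \<rho> * d \<le> x \<Longrightarrow> x + \<rho> * d \<le> 1 \<Longrightarrow> t \<in> {0..T} \<Longrightarrow>
      norm (U 5 0 x t) \<le> C / d * weight b d 4 x"
proof -
  obtain C6 where C6: "C6 \<ge> 0" "\<And>d U x t. sol d U \<Longrightarrow> \<rho> * d \<le> x \<Longrightarrow> x + \<rho> * d \<le> 1 \<Longrightarrow> t \<in> {0..T} \<Longrightarrow>
      norm (U 6 0 x t) \<le> C6 / d\<^sup>2 * weight b d 4 x"
    using sixth_derivative_interior[OF \<rho>] by blast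
  obtain C4 where C4: "C4 \<ge> 0" "\<And>d U x t. sol d U \<Longrightarrow> x \<in> {0..1} \<Longrightarrow> t \<in> {0..T} \<Longrightarrow> norm (U 4 0 x t) \<le> C4 * weight b d 4 x"
    using ubE[OF ub_weighted[of 4]] by (metis order_refl)
  define E where "E = exp (b * \<rho>)"
  have E: "E > 0" by (simp add: E_def)
  define C where "C = (2 * C4 + C6 * \<rho>\<^sup>2) * E / \<rho>"
  have "norm (U 5 0 x t) \<le> C / d * weight b d 4 x"
    if h: "sol d U" "\<rho> * d \<le> 1 / 8" "\<rho> * d \<le> x" "x + \<rho> * d \<le> 1" "t \<in> {0..T}" for d and U :: "'n family" and x t
  proof -
    have d: "0 < d" "d < 1" using solD(1,2)[OF h(1)] by auto
    define r where "r = \<rho> * d"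
    have r: "0 < r" "r \<le> 1 / 8" using \<rho> d h(2) by (auto simp: r_def)
    \<comment> \<open>Stepping towards the midpoint with \<open>r \<le> 1 / 8\<close> keeps the
      segment within \<open>[r, 1 - r]\<close>.\<close>
    define y where "y = (if x \<le> 1 / 2 then x + r else x - r)"
    define I where "I = closed_segment x y"
    have I: "z \<in> {r..1 - r} \<and> \<bar>z - x\<bar> \<le> \<rho> * d" if "z \<in> I" for z
      using that h(3,4) r unfolding I_def closed_segment_eq_real_ivl y_def r_def[symmetric]
      by (auto split: if_splits)
    have I01: "I \<subseteq> {0..1}" using I r by force
    have yx: "\<bar>y - x\<bar> = r" "(y - x)\<^sup>2 = r\<^sup>2" using r by (auto simp: y_def)
    define w where "w = E * weight b d 4 x"
    have wE: "weight b d 4 z \<le> w" if "z \<in> I" for z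
      using weight_shift[OF d(1) _ conjunct2[OF I[OF that]]] b_pos by (simp add: w_def E_def)
    have "\<bar>y - x\<bar> * norm (U 5 0 x t) \<le> 2 * (C4 * w) + (C6 / d\<^sup>2 * w) * (y - x)\<^sup>2"
    proof (rule landau_inequality[of I x y "\<lambda>x. U 4 0 x t" "\<lambda>x. U 5 0 x t" "\<lambda>x. U 6 0 x t"])
      show "convex I" "x \<in> I" "y \<in> I" by (auto simp: I_def)
      fix z assume z: "z \<in> I"
      then have z1: "z \<in> {0..1}" using I01 by auto
      show "((\<lambda>x. U 4 0 x t) has_vector_derivative U 5 0 z t) (at z within I)"
        using has_vector_derivative_within_subset[OF solD(3)[OF h(1) _ z1 h(5), of 4 0] I01] by (simp add: eval_nat_numeral)
      show "((\<lambda>x. U 5 0 x t) has_vector_derivative U 6 0 z t) (at z within I)"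
        using has_vector_derivative_within_subset[OF solD(3)[OF h(1) _ z1 h(5), of 5 0] I01] by (simp add: eval_nat_numeral)
      show "norm (U 4 0 z t) \<le> C4 * w"
        using C4(2)[OF h(1) z1 h(5)] mult_left_mono[OF wE[OF z] C4(1)] by linarith
      have "norm (U 6 0 z t) \<le> C6 / d\<^sup>2 * weight b d 4 z"
        using C6(2)[OF h(1) _ _ h(5), of z] I[OF z] by (simp add: r_def)
      also have "\<dots> \<le> C6 / d\<^sup>2 * w" using wE[OF z] C6(1) by (intro mult_left_mono) auto
      finally show "norm (U 6 0 z t) \<le> C6 / d\<^sup>2 * w" .
    qed
    then have "r * norm (U 5 0 x t) \<le> 2 * (C4 * w) + C6 / d\<^sup>2 * w * r\<^sup>2" unfolding yx .
    also have "\<dots> = (2 * C4 + C6 * \<rho>\<^sup>2) * w" using d by (simp add: r_def power_mult_distrib field_simps)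
    finally have "norm (U 5 0 x t) \<le> (2 * C4 + C6 * \<rho>\<^sup>2) * w / r"
      using r by (simp add: field_simps)
    also have "\<dots> = C / d * weight b d 4 x" using d \<rho> by (simp add: C_def w_def r_def)
    finally show ?thesis .
  qed
  moreover have "C \<ge> 0" using C4 C6 E \<rho> by (simp add: C_def)
  ultimately show ?thesis by (intro that)
qed

end

section \<open>Truncation error of the compact difference formula\<close>

definition diff2 :: "(real \<Rightarrow> real) \<Rightarrow> real \<Rightarrow> real \<Rightarrow> real \<Rightarrow> real" where
  "diff2 g x h hp = 2 / (h + hp) * ((g (x + hp) - g x) / hp - (g x - g (x - h)) / h)"

definition derivs_on :: "real \<Rightarrow> real \<Rightarrow> nat \<Rightarrow> (nat \<Rightarrow> real \<Rightarrow> real) \<Rightarrow> bool" where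
  "derivs_on l r n g \<longleftrightarrow> (\<forall>s<n. \<forall>x\<in>{l..r}. (g s has_real_derivative g (Suc s) x) (at x within {l..r}))"

lemma derivs_on_subset: "derivs_on l r n g \<Longrightarrow> l \<le> l' \<Longrightarrow> r' \<le> r \<Longrightarrow> derivs_on l' r' n g"
  unfolding derivs_on_def by (meson atLeastatMost_subset_iff has_field_derivative_subset subsetD)

lemma derivs_on_shift: "derivs_on l r n g \<Longrightarrow> m + k \<le> n \<Longrightarrow> derivs_on l r k (\<lambda>s. g (m + s))"
  unfolding derivs_on_def by auto

lemma taylor_on:
  assumes "derivs_on l r (Suc n) g" "w \<in> {l..r}" "z \<in> {l..r}" "\<And>x. x \<in> {l..r} \<Longrightarrow> \<bar>g (Suc n) x\<bar> \<le> B"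
  shows "\<bar>g 0 z - (\<Sum>i\<le>n. g i w * (z - w) ^ i / fact i)\<bar> \<le> B * \<bar>z - w\<bar> ^ Suc n / fact n"
  using field_Taylor[of "{l..r}" n g B w z] assms unfolding derivs_on_def by auto

text \<open>The difference formula on Taylor polynomials of degree 5: \<open>a0\<close> to
  \<open>a5\<close> are derivatives at the central node, \<open>R1\<close> and \<open>R2\<close> the
  remainders at the right and left node.\<close>

lemma diff2_taylor_algebra:
  fixes h hp :: real
  assumes "0 < h" "0 < hp"
  shows "2 / (h + hp) * ((R1 + (a0 + a1 * hp + a2 * hp\<^sup>2 / 2 + a3 * hp ^ 3 / 6 + a4 * hp ^ 4 / 24 + a5 * hp ^ 5 / 120) - a0) / hp
      - (a0 - (R2 + (a0 - a1 * h + a2 * h\<^sup>2 / 2 - a3 * h ^ 3 / 6 + a4 * h ^ 4 / 24 - a5 * h ^ 5 / 120))) / h)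
    = a2 + a3 * (hp - h) / 3 + a4 * (hp\<^sup>2 - h * hp + h\<^sup>2) / 12 + a5 * (hp - h) * (hp\<^sup>2 + h\<^sup>2) / 60
      + 2 / (h + hp) * (R1 / hp + R2 / h)"
proof -
  have p: "(R1 + (a0 + a1 * hp + a2 * hp\<^sup>2 / 2 + a3 * hp ^ 3 / 6 + a4 * hp ^ 4 / 24 + a5 * hp ^ 5 / 120) - a0) / hp
      = R1 / hp + (a1 + a2 * hp / 2 + a3 * hp\<^sup>2 / 6 + a4 * hp ^ 3 / 24 + a5 * hp ^ 4 / 120)"
    using assms by (simp add: add_divide_distrib eval_nat_numeral)
  have m: "(a0 - (R2 + (a0 - a1 * h + a2 * h\<^sup>2 / 2 - a3 * h ^ 3 / 6 + a4 * h ^ 4 / 24 - a5 * h ^ 5 / 120))) / h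
      = - R2 / h + (a1 - a2 * h / 2 + a3 * h\<^sup>2 / 6 - a4 * h ^ 3 / 24 + a5 * h ^ 4 / 120)"
    using assms by (simp add: add_divide_distrib diff_divide_distrib eval_nat_numeral)
  have "h + hp \<noteq> 0" using assms by simp
  have "2 * ((R1 / hp + (a1 + a2 * hp / 2 + a3 * hp\<^sup>2 / 6 + a4 * hp ^ 3 / 24 + a5 * hp ^ 4 / 120))
      - (- R2 / h + (a1 - a2 * h / 2 + a3 * h\<^sup>2 / 6 - a4 * h ^ 3 / 24 + a5 * h ^ 4 / 120)))
    = (h + hp) * (a2 + a3 * (hp - h) / 3 + a4 * (hp\<^sup>2 - h * hp + h\<^sup>2) / 12 + a5 * (hp - h) * (hp\<^sup>2 + h\<^sup>2) / 60)
      + 2 * (R1 / hp + R2 / h)"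
    by (simp add: algebra_simps add_divide_distrib diff_divide_distrib eval_nat_numeral)
  moreover have "2 / D * X = Y + 2 / D * Z" if "D \<noteq> 0" "2 * X = D * Y + 2 * Z" for D X Y Z :: real
    using that by (simp add: field_simps)
  ultimately show ?thesis unfolding p m using \<open>h + hp \<noteq> 0\<close> by blast
qed

text \<open>The compact weights are made so that the coefficients of \<open>a2\<close> and
  \<open>a3\<close> agree with those of the difference formula even for unequal steps. Subtracting
  the two expansions leaves \<open>(hp - h)\<^sup>2 / 12\<close> at \<open>a4\<close> and a multiple
  of \<open>hp - h\<close> at \<open>a5\<close>.\<close>

lemma compact_taylor_algebra:
  fixes h hp :: real
  assumes "0 < h" "0 < hp"
  shows "(2 * h - hp) / (6 * (h + hp)) * (R4 + (a2 - a3 * h + a4 * h\<^sup>2 / 2 - a5 * h ^ 3 / 6)) + 5 / 6 * a2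
      + (2 * hp - h) / (6 * (h + hp)) * (R3 + (a2 + a3 * hp + a4 * hp\<^sup>2 / 2 + a5 * hp ^ 3 / 6))
     = a2 + a3 * (hp - h) / 3 + a4 * (2 * (hp\<^sup>2 - h * hp + h\<^sup>2) - h * hp) / 12
       + a5 * (hp - h) * (2 * (hp\<^sup>2 + h\<^sup>2) - h * hp) / 36
       + ((2 * h - hp) / (6 * (h + hp)) * R4 + (2 * hp - h) / (6 * (h + hp)) * R3)"
proof -
  define w where "w = 1 / (6 * (h + hp))"
  have w: "6 * w * (h + hp) = 1" using assms by (simp add: w_def)
  have e: "(2 * h - hp) / (6 * (h + hp)) = (2 * h - hp) * w" "(2 * hp - h) / (6 * (h + hp)) = (2 * hp - h) * w"
    by (simp_all add: w_def)
  show ?thesis unfolding e using w by algebra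
qed

text \<open>All three terms are of fourth order once neighbouring steps differ by the square of the
  mesh width; for equal steps only the sixth derivative remains.\<close>

lemma compact_difference_error:
  assumes h: "0 < h" "0 < hp" and g: "derivs_on (x - h) (x + hp) 6 g"
    and M: "\<And>y. y \<in> {x - h..x + hp} \<Longrightarrow> \<bar>g 6 y\<bar> \<le> M"
  shows "\<bar>- diff2 (g 0) x h hp + ((2 * h - hp) / (6 * (h + hp)) * g 2 (x - h) + 5 / 6 * g 2 x
            + (2 * hp - h) / (6 * (h + hp)) * g 2 (x + hp))\<bar>
     \<le> (hp - h)\<^sup>2 * \<bar>g 4 x\<bar> + \<bar>hp - h\<bar> * (h + hp)\<^sup>2 * \<bar>g 5 x\<bar> + (h + hp) ^ 4 * M"
proof -
  have M0: "M \<ge> 0" using M[of x] h by force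
  have g2: "derivs_on (x - h) (x + hp) 4 (\<lambda>s. g (2 + s))" by (rule derivs_on_shift[OF g]) simp
  have M': "\<And>y. y \<in> {x - h..x + hp} \<Longrightarrow> \<bar>g (Suc 5) y\<bar> \<le> M" "\<And>y. y \<in> {x - h..x + hp} \<Longrightarrow> \<bar>g (2 + Suc 3) y\<bar> \<le> M"
    using M by (auto simp: eval_nat_numeral)
  have g6: "derivs_on (x - h) (x + hp) (Suc 5) g" "derivs_on (x - h) (x + hp) (Suc 3) (\<lambda>s. g (2 + s))"
    using g g2 by (simp_all add: eval_nat_numeral)
  define R1 where "R1 = g 0 (x + hp) - (g 0 x + g 1 x * hp + g 2 x * hp\<^sup>2 / 2 + g 3 x * hp ^ 3 / 6 + g 4 x * hp ^ 4 / 24 + g 5 x * hp ^ 5 / 120)"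
  define R2 where "R2 = g 0 (x - h) - (g 0 x - g 1 x * h + g 2 x * h\<^sup>2 / 2 - g 3 x * h ^ 3 / 6 + g 4 x * h ^ 4 / 24 - g 5 x * h ^ 5 / 120)"
  define R3 where "R3 = g 2 (x + hp) - (g 2 x + g 3 x * hp + g 4 x * hp\<^sup>2 / 2 + g 5 x * hp ^ 3 / 6)"
  define R4 where "R4 = g 2 (x - h) - (g 2 x - g 3 x * h + g 4 x * h\<^sup>2 / 2 - g 5 x * h ^ 3 / 6)"
  have x: "x \<in> {x - h..x + hp}" "x + hp \<in> {x - h..x + hp}" "x - h \<in> {x - h..x + hp}" using h by auto
  have R1: "\<bar>R1\<bar> \<le> M * hp ^ 6 / 120"
    using taylor_on[OF g6(1) x(1,2) M'(1)] h
    by (simp add: R1_def atMost_nat_numeral fact_numeral atMost_Suc algebra_simps numeral_2_eq_2[symmetric])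
  have R2: "\<bar>R2\<bar> \<le> M * h ^ 6 / 120"
    using taylor_on[OF g6(1) x(1,3) M'(1)] h
    by (simp add: R2_def atMost_nat_numeral fact_numeral atMost_Suc algebra_simps numeral_2_eq_2[symmetric])
  have R3: "\<bar>R3\<bar> \<le> M * hp ^ 4 / 6"
    using taylor_on[OF g6(2) x(1,2) M'(2)] h
    by (simp add: R3_def atMost_nat_numeral fact_numeral atMost_Suc algebra_simps numeral_2_eq_2[symmetric])
  have R4: "\<bar>R4\<bar> \<le> M * h ^ 4 / 6"
    using taylor_on[OF g6(2) x(1,3) M'(2)] h
    by (simp add: R4_def atMost_nat_numeral fact_numeral atMost_Suc algebra_simps numeral_2_eq_2[symmetric])
  define D where "D = h + hp"
  have D: "D > 0" "h \<le> D" "hp \<le> D" using h by (auto simp: D_def)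
  have e1: "diff2 (g 0) x h hp = g 2 x + g 3 x * (hp - h) / 3 + g 4 x * (hp\<^sup>2 - h * hp + h\<^sup>2) / 12
       + g 5 x * (hp - h) * (hp\<^sup>2 + h\<^sup>2) / 60 + 2 / D * (R1 / hp + R2 / h)"
    using diff2_taylor_algebra[OF h, of R1 "g 0 x" "g 1 x" "g 2 x" "g 3 x" "g 4 x" "g 5 x" R2]
    unfolding diff2_def D_def by (simp add: R1_def R2_def)
  have e2: "(2 * h - hp) / (6 * D) * g 2 (x - h) + 5 / 6 * g 2 x + (2 * hp - h) / (6 * D) * g 2 (x + hp)
     = g 2 x + g 3 x * (hp - h) / 3 + g 4 x * (2 * (hp\<^sup>2 - h * hp + h\<^sup>2) - h * hp) / 12
       + g 5 x * (hp - h) * (2 * (hp\<^sup>2 + h\<^sup>2) - h * hp) / 36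
       + ((2 * h - hp) / (6 * D) * R4 + (2 * hp - h) / (6 * D) * R3)"
    using compact_taylor_algebra[OF h, of R4 "g 2 x" "g 3 x" "g 4 x" "g 5 x" R3]
    unfolding D_def by (simp add: R3_def R4_def)
  have q: "\<bar>(2 * h - hp) / (6 * D)\<bar> \<le> 1 / 3" "\<bar>(2 * hp - h) / (6 * D)\<bar> \<le> 1 / 3"
  proof -
    have "\<bar>2 * h - hp\<bar> * 3 \<le> 6 * h + 6 * hp" "\<bar>2 * hp - h\<bar> * 3 \<le> 6 * h + 6 * hp" using h by (auto simp: abs_if)
    then show "\<bar>(2 * h - hp) / (6 * D)\<bar> \<le> 1 / 3" "\<bar>(2 * hp - h) / (6 * D)\<bar> \<le> 1 / 3"
      using D by (auto simp: D_def abs_mult divide_le_eq)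
  qed
  have pw: "hp ^ 5 \<le> D * D ^ 4" "h ^ 5 \<le> D * D ^ 4" "hp ^ 4 \<le> D ^ 4" "h ^ 4 \<le> D ^ 4"
    using power_mono[of hp D 5] power_mono[of h D 5] power_mono[of hp D 4] power_mono[of h D 4] h D
    by (auto simp: eval_nat_numeral)
  have r12: "\<bar>2 / D * (R1 / hp + R2 / h)\<bar> \<le> M * D ^ 4 / 30"
  proof -
    have "\<bar>R1 / hp\<bar> \<le> M * hp ^ 5 / 120" using R1 h by (simp add: divide_le_eq eval_nat_numeral mult_ac)
    moreover have "\<bar>R2 / h\<bar> \<le> M * h ^ 5 / 120" using R2 h by (simp add: divide_le_eq eval_nat_numeral mult_ac)
    moreover have "M * hp ^ 5 \<le> M * (D * D ^ 4)" "M * h ^ 5 \<le> M * (D * D ^ 4)" using pw M0 by (auto intro: mult_left_mono)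
    ultimately have "\<bar>R1 / hp + R2 / h\<bar> \<le> M * (D * D ^ 4) / 60" by linarith
    then have "2 / D * \<bar>R1 / hp + R2 / h\<bar> \<le> 2 / D * (M * (D * D ^ 4) / 60)" using D by (intro mult_left_mono) auto
    moreover have e: "\<bar>2 / D * X\<bar> = 2 / D * \<bar>X\<bar>" for X using D by (simp add: abs_mult)
    moreover have "2 / D * (M * (D * D ^ 4) / 60) = M * D ^ 4 / 30" using D by simp
    ultimately show ?thesis unfolding e by simp
  qed
  have r34: "\<bar>(2 * h - hp) / (6 * D) * R4 + (2 * hp - h) / (6 * D) * R3\<bar> \<le> M * D ^ 4 / 9"
  proof -
    have "\<bar>(2 * h - hp) / (6 * D) * R4\<bar> \<le> 1 / 3 * (M * h ^ 4 / 6)"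
      unfolding abs_mult using q R4 by (intro mult_mono) auto
    moreover have "\<bar>(2 * hp - h) / (6 * D) * R3\<bar> \<le> 1 / 3 * (M * hp ^ 4 / 6)"
      unfolding abs_mult using q R3 by (intro mult_mono) auto
    moreover have "M * hp ^ 4 \<le> M * D ^ 4" "M * h ^ 4 \<le> M * D ^ 4" using pw M0 by (auto intro: mult_left_mono)
    ultimately show ?thesis by linarith
  qed
  define Y where "Y = - diff2 (g 0) x h hp + ((2 * h - hp) / (6 * D) * g 2 (x - h) + 5 / 6 * g 2 x + (2 * hp - h) / (6 * D) * g 2 (x + hp))"
  have "Y = g 4 x * ((hp - h)\<^sup>2 / 12) + g 5 x * ((hp - h) * ((7 * (hp\<^sup>2 + h\<^sup>2) - 5 * h * hp) / 180))
      - 2 / D * (R1 / hp + R2 / h) + ((2 * h - hp) / (6 * D) * R4 + (2 * hp - h) / (6 * D) * R3)"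
  proof -
    have alg: "- (a2 + a3 * (hp - h) / 3 + a4 * (hp\<^sup>2 - h * hp + h\<^sup>2) / 12 + a5 * (hp - h) * (hp\<^sup>2 + h\<^sup>2) / 60 + r1)
        + (a2 + a3 * (hp - h) / 3 + a4 * (2 * (hp\<^sup>2 - h * hp + h\<^sup>2) - h * hp) / 12
       + a5 * (hp - h) * (2 * (hp\<^sup>2 + h\<^sup>2) - h * hp) / 36 + r2)
      = a4 * ((hp - h)\<^sup>2 / 12) + a5 * ((hp - h) * ((7 * (hp\<^sup>2 + h\<^sup>2) - 5 * h * hp) / 180)) - r1 + r2" for a2 a3 a4 a5 r1 r2
      by (simp add: field_simps power2_eq_square)
    show ?thesis unfolding Y_def e1 e2 by (rule alg)
  qed
  then have Y0: "\<bar>Y\<bar> \<le> \<bar>g 4 x * ((hp - h)\<^sup>2 / 12)\<bar> + \<bar>g 5 x * ((hp - h) * ((7 * (hp\<^sup>2 + h\<^sup>2) - 5 * h * hp) / 180))\<bar>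
      + \<bar>2 / D * (R1 / hp + R2 / h)\<bar> + \<bar>(2 * h - hp) / (6 * D) * R4 + (2 * hp - h) / (6 * D) * R3\<bar>" by linarith
  have b4: "\<bar>g 4 x * ((hp - h)\<^sup>2 / 12)\<bar> \<le> (hp - h)\<^sup>2 * \<bar>g 4 x\<bar>" by (simp add: abs_mult mult.commute)
  have b5: "\<bar>g 5 x * ((hp - h) * ((7 * (hp\<^sup>2 + h\<^sup>2) - 5 * h * hp) / 180))\<bar> \<le> \<bar>hp - h\<bar> * D\<^sup>2 * \<bar>g 5 x\<bar>"
  proof -
    have "0 \<le> h * hp" "0 \<le> h\<^sup>2" "0 \<le> hp\<^sup>2" "D\<^sup>2 = h\<^sup>2 + 2 * (h * hp) + hp\<^sup>2" using h by (auto simp: D_def power2_eq_square algebra_simps)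
    moreover have "5 * h * hp = 5 * (h * hp)" by simp
    moreover have "\<bar>(7 * (p + q) - 5 * r) / 180\<bar> \<le> q + 2 * r + p" if "0 \<le> p" "0 \<le> q" "0 \<le> r" for p q r :: real
      by (rule abs_leI) (use that in \<open>simp_all add: field_simps\<close>)
    ultimately have "\<bar>(7 * (hp\<^sup>2 + h\<^sup>2) - 5 * h * hp) / 180\<bar> \<le> D\<^sup>2" by (metis mult.assoc)
    moreover have "\<bar>a * (e * q)\<bar> \<le> \<bar>e\<bar> * r * \<bar>a\<bar>" if "\<bar>q\<bar> \<le> r" for a e q r :: real
      using mult_left_mono[OF that, of "\<bar>a\<bar> * \<bar>e\<bar>"] by (simp add: abs_mult mult_ac)
    ultimately show ?thesis by blast
  qed
  have "\<bar>Y\<bar> \<le> (hp - h)\<^sup>2 * \<bar>g 4 x\<bar> + \<bar>hp - h\<bar> * D\<^sup>2 * \<bar>g 5 x\<bar> + M * D ^ 4 / 30 + M * D ^ 4 / 9"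
    using add_mono[OF add_mono[OF add_mono[OF b4 b5] r12] r34] Y0 by (rule order_trans[rotated])
  moreover have "0 \<le> M * D ^ 4" using M0 D by simp
  ultimately show ?thesis unfolding Y_def D_def by (simp add: mult.commute)
qed

lemma diff2_bound:
  assumes h: "0 < h" "0 < hp" and g: "derivs_on (x - h) (x + hp) 2 g"
    and M: "\<And>y. y \<in> {x - h..x + hp} \<Longrightarrow> \<bar>g 2 y\<bar> \<le> M"
  shows "\<bar>diff2 (g 0) x h hp\<bar> \<le> 2 * M"
proof -
  have x: "x \<in> {x - h..x + hp}" "x + hp \<in> {x - h..x + hp}" "x - h \<in> {x - h..x + hp}" using h by auto
  have g': "derivs_on (x - h) (x + hp) (Suc 1) g" using g by (simp add: numeral_2_eq_2)
  have M': "\<And>y. y \<in> {x - h..x + hp} \<Longrightarrow> \<bar>g (Suc 1) y\<bar> \<le> M" using M by (simp add: numeral_2_eq_2)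
  define R1 where "R1 = g 0 (x + hp) - (g 0 x + g 1 x * hp)"
  define R2 where "R2 = g 0 (x - h) - (g 0 x - g 1 x * h)"
  have R1: "\<bar>R1\<bar> \<le> M * hp\<^sup>2" using taylor_on[OF g' x(1,2) M'] h by (simp add: R1_def power2_eq_square)
  have R2: "\<bar>R2\<bar> \<le> M * h\<^sup>2" using taylor_on[OF g' x(1,3) M'] h by (simp add: R2_def power2_eq_square)
  have "(g 0 (x + hp) - g 0 x) / hp - (g 0 x - g 0 (x - h)) / h = R1 / hp + R2 / h"
    using h by (simp add: R1_def R2_def field_simps)
  moreover have "\<bar>R1 / hp\<bar> \<le> M * hp" "\<bar>R2 / h\<bar> \<le> M * h"
    using R1 R2 h by (simp_all add: divide_le_eq power2_eq_square mult.assoc)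
  ultimately have "\<bar>(g 0 (x + hp) - g 0 x) / hp - (g 0 x - g 0 (x - h)) / h\<bar> \<le> M * (h + hp)"
    unfolding distrib_left by linarith
  then have "2 / (h + hp) * \<bar>(g 0 (x + hp) - g 0 x) / hp - (g 0 x - g 0 (x - h)) / h\<bar> \<le> 2 / (h + hp) * (M * (h + hp))"
    using h by (intro mult_left_mono) auto
  moreover have e: "\<bar>2 / (h + hp) * X\<bar> = 2 / (h + hp) * \<bar>X\<bar>" for X using h by (simp add: abs_mult)
  moreover have "2 / (h + hp) * (M * (h + hp)) = 2 * M" using h by simp
  ultimately show ?thesis unfolding diff2_def e by simp
qed

text \<open>Expanding \<open>g''\<close> at the far end point \<open>y\<close> keeps the remainder of the layer part bounded by
  its values, however large its derivatives are.\<close>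

lemma far_point_expansion:
  assumes s: "s \<in> {l..y}" and q: "q > 0" and CD: "C \<ge> 0" "D \<ge> 0"
    and d1: "\<And>z. z \<in> {l..y} \<Longrightarrow> (g has_real_derivative g1 z) (at z within {l..y})"
    and d2: "\<And>z. z \<in> {l..y} \<Longrightarrow> (g1 has_real_derivative g2 z) (at z within {l..y})"
    and b: "\<And>z. z \<in> {l..y} \<Longrightarrow> \<bar>g2 z\<bar> \<le> C + D * q\<^sup>2 * exp (- q * z)"
  shows "\<bar>g s - (g y + (s - y) * g1 y)\<bar> \<le> C * (y - s)\<^sup>2 / 2 + D * exp (- q * s)"
proof -
  define m where "m z = C * (y - z)\<^sup>2 / 2 + D * (exp (- q * z) - exp (- q * y) - q * (y - z) * exp (- q * y))" for z
  define m1 where "m1 z = - C * (y - z) + D * (- q * exp (- q * z) + q * exp (- q * y))" for z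
  define m2 where "m2 z = C + D * q\<^sup>2 * exp (- q * z)" for z
  have dm: "(m has_real_derivative m1 z) (at z within S)" "(m1 has_real_derivative m2 z) (at z within S)" for z S
    unfolding m_def[abs_def] m1_def[abs_def] m2_def
    by (auto intro!: derivative_eq_intros simp: field_simps power2_eq_square)
  have main: "0 \<le> m s + e * (g s - (g y + (s - y) * g1 y))" if e: "e = 1 \<or> e = - 1" for e
  proof -
    define F where "F z = m z + e * (g z - (g y + (z - y) * g1 y))" for z
    define F1 where "F1 z = m1 z + e * (g1 z - g1 y)" for z
    have dF: "(F has_real_derivative F1 z) (at z within {l..y})" "(F1 has_real_derivative m2 z + e * g2 z) (at z within {l..y})"
      if "z \<in> {l..y}" for z
      unfolding F_def[abs_def] F1_def[abs_def] using d1[OF that] d2[OF that] dm[of z "{l..y}"]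
      by (auto intro!: derivative_eq_intros)
    have F1: "F1 z \<le> 0" if z: "z \<in> {l..y}" for z
    proof (cases "z = y")
      case True
      then show ?thesis by (simp add: F1_def m1_def)
    next
      case False
      then have zy: "z < y" using z by auto
      have "\<exists>w\<in>{z<..<y}. F1 y - F1 z = (m2 w + e * g2 w) * (y - z)"
      proof (rule mvt_simple[OF zy, of F1 "\<lambda>w h. (m2 w + e * g2 w) * h"])
        fix w assume "z \<le> w" "w \<le> y"
        then have "(F1 has_real_derivative m2 w + e * g2 w) (at w within {z..y})"
          using z by (intro has_field_derivative_subset[OF dF(2)]) auto
        then show "(F1 has_derivative (\<lambda>h. (m2 w + e * g2 w) * h)) (at w within {z..y})"
          by (simp add: has_field_derivative_def)
      qed
      then obtain w where w: "w \<in> {z<..<y}" "F1 y - F1 z = (m2 w + e * g2 w) * (y - z)" by blast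
      have "0 \<le> m2 w + e * g2 w" using b[of w] w(1) z e by (auto simp: m2_def abs_le_iff)
      then have "F1 z \<le> F1 y" using w(2) zy by (smt (verit) mult_nonneg_nonneg)
      then show ?thesis by (simp add: F1_def m1_def)
    qed
    have "0 \<le> F s"
    proof (cases "s = y")
      case True
      then show ?thesis by (simp add: F_def m_def)
    next
      case False
      then have sy: "s < y" using s by auto
      have "\<exists>w\<in>{s<..<y}. F y - F s = F1 w * (y - s)"
      proof (rule mvt_simple[OF sy, of F "\<lambda>w h. F1 w * h"])
        fix w assume "s \<le> w" "w \<le> y"
        then have "(F has_real_derivative F1 w) (at w within {s..y})"
          using s by (intro has_field_derivative_subset[OF dF(1)]) auto
        then show "(F has_derivative (\<lambda>h. F1 w * h)) (at w within {s..y})"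
          by (simp add: has_field_derivative_def)
      qed
      then obtain w where w: "w \<in> {s<..<y}" "F y - F s = F1 w * (y - s)" by blast
      have "F1 w \<le> 0" using F1[of w] w(1) s by auto
      then have "F y \<le> F s" using w(2) sy by (smt (verit) mult_nonpos_nonneg)
      then show ?thesis by (simp add: F_def m_def)
    qed
    then show ?thesis by (simp add: F_def)
  qed
  have "\<bar>g s - (g y + (s - y) * g1 y)\<bar> \<le> m s" using main[of 1] main[of "- 1"] by (auto simp: abs_le_iff)
  also have "m s \<le> C * (y - s)\<^sup>2 / 2 + D * exp (- q * s)"
  proof -
    have "D * (exp (- q * s) - exp (- q * y) - q * (y - s) * exp (- q * y)) \<le> D * exp (- q * s)"
    proof (intro mult_left_mono CD)
      have "0 \<le> q * (y - s) * exp (- q * y)" using q s by auto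
      moreover have "0 < exp (- q * y)" by simp
      ultimately show "exp (- q * s) - exp (- q * y) - q * (y - s) * exp (- q * y) \<le> exp (- q * s)" by linarith
    qed
    then show ?thesis by (simp add: m_def)
  qed
  finally show ?thesis .
qed

text \<open>Central differencing without compact weights. The expansion point \<open>x + hp\<close>
  is the node farthest from the left layer; after multiplication by \<open>d\<^sup>2\<close> the
  layer contributes only its value at \<open>x - h\<close>, with no negative power of
  \<open>d\<close>.\<close>

lemma coarse_difference_error:
  assumes h: "0 < h" "h \<le> hp" and d: "d > 0" and b: "b > 0" and C: "C \<ge> 0"
    and g: "derivs_on (x - h) (x + hp) 4 g"
    and g4: "\<And>y. y \<in> {x - h..x + hp} \<Longrightarrow> \<bar>g 4 y\<bar> \<le> C * (1 + exp (- b * y / d) / d ^ 4)"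
    and g3: "\<bar>g 3 (x + hp)\<bar> \<le> C * (1 + exp (- b * (x + hp) / d) / d ^ 3)"
  shows "d\<^sup>2 * \<bar>g 2 x - diff2 (g 0) x h hp\<bar> \<le>
    C * (d\<^sup>2 * (hp - h) + 2 * d\<^sup>2 * (h + hp)\<^sup>2 + (3 / b\<^sup>2 + 1 / b) * exp (- b * (x - h) / d))"
proof -
  have hp: "0 < hp" using h by simp
  define y where "y = x + hp"
  define q where "q = b / d"
  have q: "q > 0" using b d by (simp add: q_def)
  have qe: "exp (- b * z / d) = exp (- q * z)" for z by (simp add: q_def)
  have y: "x - h \<le> y" using h by (simp add: y_def)
  \<comment> \<open>Chosen so that \<open>D * q\<^sup>2\<close> is the coefficient
    \<open>C / d ^ 4\<close> of the layer part in the bound on the fourth derivative.\<close>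
  define D where "D = C / (b\<^sup>2 * d\<^sup>2)"
  have D: "D \<ge> 0" "D * q\<^sup>2 = C / d ^ 4"
    using C b d by (auto simp: D_def q_def power2_eq_square eval_nat_numeral)
  define e where "e = exp (- q * (x - h))"
  define M where "M = C * (h + hp)\<^sup>2 / 2 + D * e"
  \<comment> \<open>The cubic with second derivative \<open>p2\<close>, the linear Taylor polynomial
    of the second derivative of \<open>g\<close> at \<open>y\<close>. The difference formula is
    evaluated exactly on cubics, so only \<open>g 0 - p\<close> has to be estimated, and its second
    derivative is at most \<open>M\<close>.\<close>
  define p where "p s = g 2 y * (s - y)\<^sup>2 / 2 + g 3 y * (s - y) ^ 3 / 6" for s
  define p1 where "p1 s = g 2 y * (s - y) + g 3 y * (s - y)\<^sup>2 / 2" for s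
  define p2 where "p2 s = g 2 y + (s - y) * g 3 y" for s
  have dg: "(g s has_real_derivative g (Suc s) z) (at z within {x - h..y})" if "z \<in> {x - h..y}" "s < 4" for s z
    using g that unfolding derivs_on_def y_def by blast
  have r: "\<bar>g 2 s - p2 s\<bar> \<le> M" if s: "s \<in> {x - h..y}" for s
  proof -
    have "\<bar>g 2 s - p2 s\<bar> \<le> C * (y - s)\<^sup>2 / 2 + D * exp (- q * s)"
      unfolding p2_def
    proof (rule far_point_expansion[OF s q C D(1)])
      fix z assume z: "z \<in> {x - h..y}"
      show "(g 2 has_real_derivative g 3 z) (at z within {x - h..y})" using dg[OF z, of 2] by (simp add: eval_nat_numeral)
      show "(g 3 has_real_derivative g 4 z) (at z within {x - h..y})" using dg[OF z, of 3] by (simp add: eval_nat_numeral)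
      show "\<bar>g 4 z\<bar> \<le> C + D * q\<^sup>2 * exp (- q * z)"
        using g4[of z] z unfolding D(2) qe y_def by (simp add: distrib_left)
    qed
    also have "\<dots> \<le> M"
    proof -
      have "(y - s)\<^sup>2 \<le> (h + hp)\<^sup>2" using s by (intro power_mono) (auto simp: y_def)
      moreover have "exp (- q * s) \<le> e" using s q by (simp add: e_def)
      ultimately have "C * (y - s)\<^sup>2 \<le> C * (h + hp)\<^sup>2" "D * exp (- q * s) \<le> D * e" using C D(1) by (auto intro: mult_left_mono)
      then show ?thesis by (simp add: M_def)
    qed
    finally show ?thesis .
  qed
  define u where "u s = (if s = 0 then (\<lambda>z. g 0 z - p z) else if s = 1 then (\<lambda>z. g 1 z - p1 z) else (\<lambda>z. g 2 z - p2 z))" for s :: nat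
  have du: "derivs_on (x - h) (x + hp) 2 u"
    unfolding derivs_on_def
  proof (intro allI impI ballI)
    fix s :: nat and z assume s: "s < 2" and z: "z \<in> {x - h..x + hp}"
    have dp: "(p has_real_derivative p1 z) (at z within S)" "(p1 has_real_derivative p2 z) (at z within S)" for S
      unfolding p_def[abs_def] p1_def[abs_def] p2_def
      by (auto intro!: derivative_eq_intros simp: power2_eq_square field_simps)
    have "(g 0 has_real_derivative g 1 z) (at z within {x - h..x + hp})" "(g 1 has_real_derivative g 2 z) (at z within {x - h..x + hp})"
      using dg[of z 0] dg[of z 1] z by (auto simp: y_def numeral_2_eq_2)
    then show "(u s has_real_derivative u (Suc s) z) (at z within {x - h..x + hp})"
      using s dp[of "{x - h..x + hp}"] unfolding u_def by (cases "s = 0") (auto intro!: derivative_eq_intros)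
  qed
  have "\<bar>diff2 (u 0) x h hp\<bar> \<le> 2 * M"
    by (rule diff2_bound[OF h(1) hp du]) (use r in \<open>auto simp: u_def y_def\<close>)
  moreover have "diff2 (u 0) x h hp = diff2 (g 0) x h hp - (p2 x + (hp - h) / 3 * g 3 y)"
  proof -
    have "diff2 (u 0) x h hp = diff2 (g 0) x h hp - diff2 p x h hp"
      unfolding diff2_def u_def by (simp add: diff_divide_distrib right_diff_distrib)
    moreover have "diff2 p x h hp = p2 x + (hp - h) / 3 * g 3 y"
    proof -
      have p1: "p (x + hp) = 0" by (simp add: p_def y_def)
      have p2: "p x = g 2 y * hp\<^sup>2 / 2 - g 3 y * hp ^ 3 / 6" by (simp add: p_def y_def)
      have p3: "p (x - h) = g 2 y * (h + hp)\<^sup>2 / 2 - g 3 y * (h + hp) ^ 3 / 6"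
      proof -
        have e: "x - h - y = - (h + hp)" by (simp add: y_def)
        have "(- (h + hp)) ^ 3 = - ((h + hp) ^ 3)" "(- (h + hp))\<^sup>2 = (h + hp)\<^sup>2"
          by (rule power_minus_odd, simp) (rule power2_minus)
        then show ?thesis unfolding p_def e by simp
      qed
      have m: "(p x - p (x - h)) / h = - (g 2 y * (h + 2 * hp) / 2) + g 3 y * (h\<^sup>2 + 3 * h * hp + 3 * hp\<^sup>2) / 6"
        unfolding p2 p3 using h by (simp add: field_simps power2_eq_square power3_eq_cube)
      have pl: "(p (x + hp) - p x) / hp = - g 2 y * hp / 2 + g 3 y * hp\<^sup>2 / 6"
        unfolding p1 p2 using hp by (simp add: field_simps power2_eq_square power3_eq_cube)
      have "(h + hp) * diff2 p x h hp = 2 * ((p (x + hp) - p x) / hp - (p x - p (x - h)) / h)"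
        using h hp unfolding diff2_def by simp
      also have "\<dots> = (h + hp) * (p2 x + (hp - h) / 3 * g 3 y)"
        unfolding m pl p2_def y_def by (simp add: field_simps power2_eq_square)
      finally show ?thesis using h hp by simp
    qed
    ultimately show ?thesis by simp
  qed
  moreover have "\<bar>g 2 x - p2 x\<bar> \<le> M" using r[of x] h by (auto simp: y_def)
  ultimately have "\<bar>g 2 x - diff2 (g 0) x h hp\<bar> \<le> 3 * M + \<bar>(hp - h) / 3 * g 3 y\<bar>" by linarith
  also have "\<bar>(hp - h) / 3 * g 3 y\<bar> \<le> (hp - h) * (C * (1 + exp (- q * y) / d ^ 3))"
    using g3 h unfolding qe y_def[symmetric] abs_mult by (intro mult_mono) auto
  finally have "\<bar>g 2 x - diff2 (g 0) x h hp\<bar> \<le> 3 * M + (hp - h) * (C * (1 + exp (- q * y) / d ^ 3))" by simp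
  then have "d\<^sup>2 * \<bar>g 2 x - diff2 (g 0) x h hp\<bar> \<le> d\<^sup>2 * (3 * M + (hp - h) * (C * (1 + exp (- q * y) / d ^ 3)))"
    by (intro mult_left_mono) auto
  also have "\<dots> = C * (d\<^sup>2 * (hp - h) + 3 / 2 * d\<^sup>2 * (h + hp)\<^sup>2 + 3 / b\<^sup>2 * e) + C * ((hp - h) / d * exp (- q * y))"
    using d b by (simp add: M_def D_def field_simps eval_nat_numeral power2_eq_square)
  also have "(hp - h) / d * exp (- q * y) \<le> 1 / b * e"
  proof -
    \<comment> \<open>The bound on the third derivative has \<open>d^-3\<close>, one power more than
      \<open>d\<^sup>2\<close> cancels. The surplus \<open>hp / d\<close> is absorbed by the decay
      of the layer between \<open>x\<close> and \<open>x + hp\<close>.\<close>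
    have "q * hp * exp (- (q * hp)) \<le> 1"
    proof -
      have "q * hp \<le> exp (q * hp)" using exp_ge_add_one_self[of "q * hp"] by linarith
      then show ?thesis by (simp add: exp_minus divide_le_eq flip: divide_inverse)
    qed
    then have 1: "hp / d * exp (- (q * hp)) \<le> 1 / b" using b d by (simp add: q_def field_simps)
    have "(hp - h) / d * exp (- q * y) \<le> hp / d * exp (- q * y)" using h d by (intro mult_right_mono divide_right_mono) auto
    also have "\<dots> = hp / d * exp (- (q * hp)) * exp (- q * x)" by (simp add: y_def distrib_left exp_add[symmetric])
    also have "\<dots> \<le> 1 / b * exp (- q * x)" using 1 by (intro mult_right_mono) auto
    also have "\<dots> \<le> 1 / b * e" using h q b by (intro mult_left_mono) (auto simp: e_def)
    finally show ?thesis .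
  qed
  then have "C * ((hp - h) / d * exp (- q * y)) \<le> C * (1 / b * e)" using C by (rule mult_left_mono)
  finally have "d\<^sup>2 * \<bar>g 2 x - diff2 (g 0) x h hp\<bar> \<le>
     C * (d\<^sup>2 * (hp - h) + 3 / 2 * d\<^sup>2 * (h + hp)\<^sup>2 + 3 / b\<^sup>2 * e) + C * (1 / b * e)" by simp
  also have "\<dots> \<le> C * (d\<^sup>2 * (hp - h) + 2 * d\<^sup>2 * (h + hp)\<^sup>2 + (3 / b\<^sup>2 + 1 / b) * e)"
  proof -
    have "C * (3 / 2 * d\<^sup>2 * (h + hp)\<^sup>2) \<le> C * (2 * d\<^sup>2 * (h + hp)\<^sup>2)" using C by (intro mult_left_mono mult_right_mono) auto
    then show ?thesis by (simp add: distrib_left distrib_right)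
  qed
  finally show ?thesis unfolding e_def qe .
qed

section \<open>Truncation error on a single cell\<close>

definition scalar_bounds :: "real \<Rightarrow> real \<Rightarrow> real \<Rightarrow> real \<Rightarrow> (nat \<Rightarrow> real \<Rightarrow> real) \<Rightarrow> bool" where
  "scalar_bounds C b \<rho> d g \<longleftrightarrow> derivs_on 0 1 6 g \<and>
     (\<forall>s\<le>6. \<forall>x\<in>{0..1}. \<bar>g s x\<bar> \<le> C / d ^ s) \<and>
     (\<forall>s\<le>4. \<forall>x\<in>{0..1}. \<bar>g s x\<bar> \<le> C * weight b d s x) \<and>
     (\<forall>x. \<rho> * d \<le> x \<longrightarrow> x + \<rho> * d \<le> 1 \<longrightarrow> \<bar>g 6 x\<bar> \<le> C / d\<^sup>2 * weight b d 4 x) \<and>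
     (\<forall>x. \<rho> * d \<le> 1 / 8 \<longrightarrow> \<rho> * d \<le> x \<longrightarrow> x + \<rho> * d \<le> 1 \<longrightarrow> \<bar>g 5 x\<bar> \<le> C / d * weight b d 4 x)"

text \<open>The diffusion term is the only one that the scheme does not reproduce exactly at the
  nodes: this is the discrete diffusion plus eps times the averaged second derivative, with
  \<open>d\<^sup>2\<close> for eps.\<close>

definition trunc_err :: "real \<Rightarrow> (nat \<Rightarrow> real \<Rightarrow> real) \<Rightarrow> real \<Rightarrow> real \<Rightarrow> real \<Rightarrow> real \<Rightarrow> real \<Rightarrow> real \<Rightarrow> real" where
  "trunc_err d g x h hp qm qc qp =
     d\<^sup>2 * (- diff2 (g 0) x h hp + (qm * g 2 (x - h) + qc * g 2 x + qp * g 2 (x + hp)))"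

lemma scalar_boundsD:
  assumes "scalar_bounds C b \<rho> d g"
  shows "derivs_on 0 1 6 g"
    "\<And>s x. s \<le> 6 \<Longrightarrow> x \<in> {0..1} \<Longrightarrow> \<bar>g s x\<bar> \<le> C / d ^ s"
    "\<And>s x. s \<le> 4 \<Longrightarrow> x \<in> {0..1} \<Longrightarrow> \<bar>g s x\<bar> \<le> C * weight b d s x"
    "\<And>x. \<rho> * d \<le> x \<Longrightarrow> x + \<rho> * d \<le> 1 \<Longrightarrow> \<bar>g 6 x\<bar> \<le> C / d\<^sup>2 * weight b d 4 x"
    "\<And>x. \<rho> * d \<le> 1 / 8 \<Longrightarrow> \<rho> * d \<le> x \<Longrightarrow> x + \<rho> * d \<le> 1 \<Longrightarrow> \<bar>g 5 x\<bar> \<le> C / d * weight b d 4 x"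
  using assms unfolding scalar_bounds_def by blast+

lemma layer_reflect: "layer b d (1 - x) = layer b d x" by (simp add: layer_def)

lemma scalar_bounds_reflect:
  assumes g: "scalar_bounds C b \<rho> d g"
  shows "scalar_bounds C b \<rho> d (\<lambda>s x. (- 1) ^ s * g s (1 - x))"
proof -
  have w: "weight b d m (1 - x) = weight b d m x" for m x by (simp add: weight_def layer_reflect)
  have a: "\<bar>(- 1) ^ s * g s (1 - x)\<bar> = \<bar>g s (1 - x)\<bar>" for s x by (simp add: abs_mult power_abs)
  have "derivs_on 0 1 6 (\<lambda>s x. (- 1) ^ s * g s (1 - x))"
    unfolding derivs_on_def
  proof (intro allI impI ballI)
    fix s :: nat and x :: real assume s: "s < 6" and x: "x \<in> {0..1}"
    have i: "(\<lambda>x. 1 - x) ` {0..1} \<subseteq> {0..1::real}" by auto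
    have "(g s has_real_derivative g (Suc s) (1 - x)) (at (1 - x) within {0..1})"
      using scalar_boundsD(1)[OF g] s x unfolding derivs_on_def by auto
    then have "(g s has_real_derivative g (Suc s) (1 - x)) (at (1 - x) within (\<lambda>x. 1 - x) ` {0..1})"
      by (rule has_field_derivative_subset[OF _ i])
    moreover have "((\<lambda>x. 1 - x) has_real_derivative - 1) (at x within {0..1})" by (auto intro!: derivative_eq_intros)
    ultimately have "((\<lambda>x. g s (1 - x)) has_real_derivative - g (Suc s) (1 - x)) (at x within {0..1})"
      using DERIV_image_chain[of "g s" "g (Suc s) (1 - x)" "\<lambda>x. 1 - x" x "{0..1}" "- 1"] by (simp add: o_def)
    from DERIV_cmult[OF this, of "(- 1) ^ s"]
    show "((\<lambda>x. (- 1) ^ s * g s (1 - x)) has_real_derivative (- 1) ^ Suc s * g (Suc s) (1 - x)) (at x within {0..1})" by simp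
  qed
  moreover have "\<bar>g s (1 - x)\<bar> \<le> C / d ^ s" if "s \<le> 6" "x \<in> {0..1}" for s x
    using scalar_boundsD(2)[OF g that(1), of "1 - x"] that(2) by simp
  moreover have "\<bar>g s (1 - x)\<bar> \<le> C * weight b d s x" if "s \<le> 4" "x \<in> {0..1}" for s x
    using scalar_boundsD(3)[OF g that(1), of "1 - x"] that(2) by (simp add: w)
  moreover have "\<bar>g 6 (1 - x)\<bar> \<le> C / d\<^sup>2 * weight b d 4 x" if "\<rho> * d \<le> x" "x + \<rho> * d \<le> 1" for x
    using scalar_boundsD(4)[OF g, of "1 - x"] that by (simp add: w)
  moreover have "\<bar>g 5 (1 - x)\<bar> \<le> C / d * weight b d 4 x" if "\<rho> * d \<le> 1 / 8" "\<rho> * d \<le> x" "x + \<rho> * d \<le> 1" for x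
    using scalar_boundsD(5)[OF g, of "1 - x"] that by (simp add: w)
  ultimately show ?thesis unfolding scalar_bounds_def a by blast
qed

text \<open>For \<open>x \<le> 15 / 16\<close> the right layer is at distance at least
  \<open>1 / 16\<close>, where its exponential beats \<open>d^-4\<close>; only the left layer has to
  be tracked.\<close>

lemma weight_left_bound:
  fixes b :: real
  assumes b: "b > 0"
  obtains K where "K \<ge> 1"
    "\<And>d x m. 0 < d \<Longrightarrow> d < 1 \<Longrightarrow> x \<le> 15 / 16 \<Longrightarrow> m \<le> 4 \<Longrightarrow> weight b d m x \<le> K * (1 + exp (- b * x / d) / d ^ m)"
proof -
  define c where "c = b / 16"
  have c: "c > 0" using b by (simp add: c_def)
  define K where "K = 1 + (4 / c) ^ 4"
  have "weight b d m x \<le> K * (1 + exp (- b * x / d) / d ^ m)" if h: "0 < d" "d < 1" "x \<le> 15 / 16" "m \<le> 4" for d x m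
  proof -
    define e where "e = exp (- b * x / d) / d ^ m"
    have e: "e \<ge> 0" using h by (simp add: e_def)
    have "(c / (4 * d)) ^ 4 \<le> exp (c / (4 * d)) ^ 4"
    proof (rule power_mono)
      show "c / (4 * d) \<le> exp (c / (4 * d))" using exp_ge_add_one_self[of "c / (4 * d)"] by linarith
    qed (use c h in auto)
    also have "\<dots> = exp (c / d)" by (simp add: exp_of_nat_mult[symmetric])
    finally have "c ^ 4 / (4 ^ 4 * d ^ 4) \<le> exp (c / d)" by (simp add: power_divide power_mult_distrib)
    then have 1: "exp (- (c / d)) / d ^ 4 \<le> (4 / c) ^ 4"
      using c h by (simp add: exp_minus field_simps)
    have "exp (- b * (1 - x) / d) / d ^ m \<le> exp (- (c / d)) / d ^ 4"
    proof (intro frac_le)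
      have "c \<le> b * (1 - x)" using mult_left_mono[of "1 / 16" "1 - x" b] b h by (simp add: c_def)
      then show "exp (- b * (1 - x) / d) \<le> exp (- (c / d))" using h by (simp add: divide_right_mono)
      show "d ^ 4 \<le> d ^ m" using h by (intro power_decreasing) auto
    qed (use h in auto)
    with 1 have "weight b d m x \<le> K + e"
      by (simp add: weight_def layer_def add_divide_distrib K_def e_def)
    also have "\<dots> \<le> K * (1 + e)"
    proof -
      have "1 * e \<le> K * e" using c e by (intro mult_right_mono) (auto simp: K_def)
      then show ?thesis by (simp add: distrib_left)
    qed
    finally show ?thesis by (simp add: e_def)
  qed
  then show ?thesis using c by (intro that[of K]) (auto simp: K_def)
qed

text \<open>An O(1) bound for the cases in which \<open>N\<close> is bounded. The difference formula
  contributes 2, the weighted second derivatives at most 5/3.\<close>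

lemma cell_trivial:
  assumes g: "scalar_bounds C b \<rho> d g" and d: "d > 0" and h: "0 < h" "0 < hp" "0 \<le> x - h" "x + hp \<le> 1"
    and q: "\<bar>qm\<bar> \<le> 1 / 3" "\<bar>qp\<bar> \<le> 1 / 3" "\<bar>qc\<bar> \<le> 1"
  shows "\<bar>trunc_err d g x h hp qm qc qp\<bar> \<le> 4 * C"
proof -
  have B: "\<bar>g 2 y\<bar> \<le> C / d\<^sup>2" if "y \<in> {0..1}" for y using scalar_boundsD(2)[OF g, of 2 y] that by simp
  have C: "C / d\<^sup>2 \<ge> 0" using B[of 0] by (smt (verit) atLeastAtMost_iff abs_ge_zero)
  have "\<bar>diff2 (g 0) x h hp\<bar> \<le> 2 * (C / d\<^sup>2)"
    by (rule diff2_bound[OF h(1,2)]) (use B h in \<open>auto intro!: derivs_on_subset[OF derivs_on_shift[OF scalar_boundsD(1)[OF g], of 0 2, simplified]]\<close>)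
  moreover have "\<bar>qm * g 2 (x - h)\<bar> \<le> 1 / 3 * (C / d\<^sup>2)" "\<bar>qp * g 2 (x + hp)\<bar> \<le> 1 / 3 * (C / d\<^sup>2)" "\<bar>qc * g 2 x\<bar> \<le> 1 * (C / d\<^sup>2)"
    unfolding abs_mult by (intro mult_mono q B; use h in auto)+
  ultimately have "\<bar>- diff2 (g 0) x h hp + (qm * g 2 (x - h) + qc * g 2 x + qp * g 2 (x + hp))\<bar> \<le> 4 * (C / d\<^sup>2)"
    using C by linarith
  then have "d\<^sup>2 * \<bar>- diff2 (g 0) x h hp + (qm * g 2 (x - h) + qc * g 2 x + qp * g 2 (x + hp))\<bar> \<le> d\<^sup>2 * (4 * (C / d\<^sup>2))"
    by (intro mult_left_mono) auto
  also have "\<dots> = 4 * C" using d by simp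
  finally show ?thesis unfolding trunc_err_def by (simp only: abs_mult abs_power2)
qed

text \<open>On equal steps the error is \<open>d\<^sup>2 * h ^ 4 * d^-6\<close>, that is, the fourth
  power of \<open>h / d\<close>.\<close>

lemma cell_fine:
  assumes g: "scalar_bounds C b \<rho> d g" and d: "d > 0" and h: "0 < h" "0 \<le> x - h" "x + h \<le> 1"
    and hd: "h \<le> 8 * \<rho> * d * \<delta>"
  shows "\<bar>trunc_err d g x h h (1/12) (5/6) (1/12)\<bar> \<le> C * (16 * \<rho>) ^ 4 * \<delta> ^ 4"
proof -
  have C: "C \<ge> 0" using scalar_boundsD(2)[OF g, of 0 0] by simp
  have q: "1 / 12 = (2 * h - h) / (6 * (h + h))" using h by simp
  have "\<bar>- diff2 (g 0) x h h + ((2 * h - h) / (6 * (h + h)) * g 2 (x - h) + 5 / 6 * g 2 x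
            + (2 * h - h) / (6 * (h + h)) * g 2 (x + h))\<bar>
     \<le> (h - h)\<^sup>2 * \<bar>g 4 x\<bar> + \<bar>h - h\<bar> * (h + h)\<^sup>2 * \<bar>g 5 x\<bar> + (h + h) ^ 4 * (C / d ^ 6)"
    using scalar_boundsD(2)[OF g, of 6] h
    by (intro compact_difference_error h(1) derivs_on_subset[OF scalar_boundsD(1)[OF g]]) auto
  then have "\<bar>- diff2 (g 0) x h h + (1 / 12 * g 2 (x - h) + 5 / 6 * g 2 x + 1 / 12 * g 2 (x + h))\<bar> \<le> (2 * h) ^ 4 * (C / d ^ 6)"
    unfolding q[symmetric] by simp
  then have "d\<^sup>2 * \<bar>- diff2 (g 0) x h h + (1 / 12 * g 2 (x - h) + 5 / 6 * g 2 x + 1 / 12 * g 2 (x + h))\<bar> \<le> d\<^sup>2 * ((2 * h) ^ 4 * (C / d ^ 6))"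
    by (intro mult_left_mono) auto
  also have "\<dots> = C * (2 * h / d) ^ 4" using d by (simp add: field_simps eval_nat_numeral)
  also have "\<dots> \<le> C * (16 * \<rho> * \<delta>) ^ 4"
    using C h d hd by (intro mult_left_mono power_mono) (auto simp: divide_le_eq mult_ac)
  finally show ?thesis unfolding trunc_err_def by (simp add: abs_mult power_mult_distrib mult_ac)
qed

text \<open>All three parts of the compact error are \<open>N^-4 * d^-2\<close> times the weight,
  and \<open>d\<^sup>2\<close> cancels \<open>d^-2\<close>. The layer part of the weight still has
  \<open>d^-4\<close>; \<open>1 / d\<^sup>2 \<le> Kr * N\<^sup>2\<close> turns this into
  \<open>N^4\<close>, which cancels against \<open>N^-4\<close>, and the smallness
  \<open>\<delta> ^ 4\<close> comes from the decayed exponential.\<close>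

lemma cell_resolved:
  fixes b \<rho> C Kr E :: real
  assumes b: "b > 0" and C: "C \<ge> 0" "Kr \<ge> 0" "E \<ge> 0"
  obtains K where "K \<ge> 0"
    "\<And>d g x h hp N \<delta>. \<lbrakk>scalar_bounds C b \<rho> d g; 0 < d; d < 1; 0 < h; h \<le> hp; \<rho> * d \<le> 1 / 8; 0 \<le> x - h; \<rho> * d \<le> x - h;
       x + hp + \<rho> * d \<le> 1; x + hp \<le> 1; x + hp \<le> 15 / 16; N > 0; hp \<le> 7 / N; hp - h \<le> 49 / N\<^sup>2; 1 / d\<^sup>2 \<le> Kr * N\<^sup>2;
       exp (- b * (x - h) / d) \<le> E * \<delta> ^ 4; 1 / N ^ 4 \<le> \<delta> ^ 4\<rbrakk> \<Longrightarrow>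
       \<bar>trunc_err d g x h hp ((2 * h - hp) / (6 * (h + hp))) (5/6) ((2 * hp - h) / (6 * (h + hp)))\<bar> \<le> K * \<delta> ^ 4"
proof -
  obtain K0 where K0: "K0 \<ge> 1"
    "\<And>d x m. 0 < d \<Longrightarrow> d < 1 \<Longrightarrow> x \<le> 15 / 16 \<Longrightarrow> m \<le> 4 \<Longrightarrow> weight b d m x \<le> K0 * (1 + exp (- b * x / d) / d ^ m)"
    using weight_left_bound[OF b] by blast
  define K where "K = 60000 * (C * K0) * (1 + Kr\<^sup>2 * E)"
  have "\<bar>trunc_err d g x h hp ((2 * h - hp) / (6 * (h + hp))) (5/6) ((2 * hp - h) / (6 * (h + hp)))\<bar> \<le> K * \<delta> ^ 4"
    if g: "scalar_bounds C b \<rho> d g" and d: "0 < d" "d < 1" and h: "0 < h" "h \<le> hp" and r: "\<rho> * d \<le> 1 / 8" "0 \<le> x - h" "\<rho> * d \<le> x - h"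
       "x + hp + \<rho> * d \<le> 1" "x + hp \<le> 1" "x + hp \<le> 15 / 16" and N: "N > 0" "hp \<le> 7 / N" "hp - h \<le> 49 / N\<^sup>2" "1 / d\<^sup>2 \<le> Kr * N\<^sup>2"
       and E: "exp (- b * (x - h) / d) \<le> E * \<delta> ^ 4" "1 / N ^ 4 \<le> \<delta> ^ 4" for d g x h hp N \<delta>
  proof -
    define w where "w = K0 * (1 + E * \<delta> ^ 4 / d ^ 4)"
    have w: "weight b d 4 y \<le> w" if "y \<in> {x - h..x + hp}" for y
    proof -
      have "exp (- b * y / d) \<le> exp (- b * (x - h) / d)" using that b d by (auto intro!: divide_right_mono)
      also have "\<dots> \<le> E * \<delta> ^ 4" by (rule E)
      finally have "exp (- b * y / d) / d ^ 4 \<le> E * \<delta> ^ 4 / d ^ 4" using d by (intro divide_right_mono) auto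
      then have "K0 * (1 + exp (- b * y / d) / d ^ 4) \<le> w" unfolding w_def using K0 by (intro mult_left_mono) auto
      then show ?thesis using K0(2)[OF d, of y 4] that r by auto
    qed
    have w0: "w \<ge> 0" using K0 d C by (simp add: w_def)
    have x: "x \<in> {x - h..x + hp}" using h by auto
    define M where "M = C / d\<^sup>2 * w"
    have M: "\<bar>g 6 y\<bar> \<le> M" if "y \<in> {x - h..x + hp}" for y
    proof -
      have "\<bar>g 6 y\<bar> \<le> C / d\<^sup>2 * weight b d 4 y" using that r by (intro scalar_boundsD(4)[OF g]) auto
      also have "\<dots> \<le> M" unfolding M_def using w[OF that] C by (intro mult_left_mono) auto
      finally show ?thesis .
    qed
    have g4: "\<bar>g 4 x\<bar> \<le> C * w"
      using scalar_boundsD(3)[OF g, of 4 x] mult_left_mono[OF w[OF x] C(1)] r h by auto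
    have g5: "\<bar>g 5 x\<bar> \<le> C / d * w"
    proof -
      have "\<bar>g 5 x\<bar> \<le> C / d * weight b d 4 x" using r h by (intro scalar_boundsD(5)[OF g]) auto
      also have "\<dots> \<le> C / d * w" using w[OF x] C d by (intro mult_left_mono) auto
      finally show ?thesis .
    qed
    define n where "n = 1 / N"
    have n: "n > 0" "hp \<le> 7 * n" "hp - h \<le> 49 * n\<^sup>2" using N by (auto simp: n_def power_divide)
    have e0: "\<bar>- diff2 (g 0) x h hp + ((2 * h - hp) / (6 * (h + hp)) * g 2 (x - h) + 5 / 6 * g 2 x
            + (2 * hp - h) / (6 * (h + hp)) * g 2 (x + hp))\<bar>
       \<le> (hp - h)\<^sup>2 * \<bar>g 4 x\<bar> + \<bar>hp - h\<bar> * (h + hp)\<^sup>2 * \<bar>g 5 x\<bar> + (h + hp) ^ 4 * M" (is "?Y \<le> _")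
      using h r by (intro compact_difference_error M derivs_on_subset[OF scalar_boundsD(1)[OF g]]) auto
    have "(hp - h)\<^sup>2 * \<bar>g 4 x\<bar> \<le> (49 * n\<^sup>2)\<^sup>2 * (C / d\<^sup>2 * w)"
    proof (intro mult_mono power_mono)
      have "1 \<le> 1 / d\<^sup>2" using d by (simp add: power_le_one)
      then have "C * w * 1 \<le> C * w * (1 / d\<^sup>2)" using C w0 by (intro mult_left_mono) auto
      with g4 show "\<bar>g 4 x\<bar> \<le> C / d\<^sup>2 * w" by simp
    qed (use n h C w0 in auto)
    moreover have "\<bar>hp - h\<bar> * (h + hp)\<^sup>2 * \<bar>g 5 x\<bar> \<le> (49 * n\<^sup>2) * (14 * n)\<^sup>2 * (C / d\<^sup>2 * w)"
    proof (intro mult_mono power_mono)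
      have "1 / d \<le> 1 / d\<^sup>2" using d by (simp add: divide_simps power2_eq_square)
      then have "C * w * (1 / d) \<le> C * w * (1 / d\<^sup>2)" using C w0 by (intro mult_left_mono) auto
      with g5 show "\<bar>g 5 x\<bar> \<le> C / d\<^sup>2 * w" by simp
    qed (use n h C w0 in auto)
    moreover have "(h + hp) ^ 4 * M \<le> (14 * n) ^ 4 * (C / d\<^sup>2 * w)"
      unfolding M_def by (intro mult_mono power_mono) (use n h C w0 in auto)
    ultimately have "?Y \<le> (49 * n\<^sup>2)\<^sup>2 * (C / d\<^sup>2 * w) + (49 * n\<^sup>2) * (14 * n)\<^sup>2 * (C / d\<^sup>2 * w) + (14 * n) ^ 4 * (C / d\<^sup>2 * w)"
      using e0 by linarith
    \<comment> \<open>The number is \<open>49 ^ 2 + 49 * 14 ^ 2 + 14 ^ 4\<close>; 60000 in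
      \<open>K\<close> rounds it up.\<close>
    also have "\<dots> = 50421 * n ^ 4 * (C / d\<^sup>2 * w)" by (simp add: power_mult_distrib eval_nat_numeral)
    finally have "d\<^sup>2 * ?Y \<le> d\<^sup>2 * (50421 * n ^ 4 * (C / d\<^sup>2 * w))" by (intro mult_left_mono) auto
    also have "\<dots> = 50421 * (C * (n ^ 4 * w))" using d by simp
    finally have Y: "d\<^sup>2 * ?Y \<le> 50421 * (C * (n ^ 4 * w))" .
    have "n ^ 4 * w \<le> K0 * (1 + Kr\<^sup>2 * E) * \<delta> ^ 4"
    proof -
      have "(1 / d\<^sup>2)\<^sup>2 \<le> (Kr * N\<^sup>2)\<^sup>2" using N d by (intro power_mono) auto
      then have "n ^ 4 * (1 / d ^ 4) \<le> n ^ 4 * (Kr\<^sup>2 * N ^ 4)" using n by (intro mult_left_mono) (auto simp: power_mult_distrib power_divide simp flip: power_mult)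
      also have "\<dots> = Kr\<^sup>2" using N by (simp add: n_def power_divide)
      finally have 1: "n ^ 4 * (1 / d ^ 4) * (E * \<delta> ^ 4) \<le> Kr\<^sup>2 * (E * \<delta> ^ 4)" using C by (intro mult_right_mono) auto
      have 2: "n ^ 4 \<le> \<delta> ^ 4" using E(2) by (simp add: n_def power_divide)
      have "n ^ 4 * w = K0 * (n ^ 4 + n ^ 4 * (1 / d ^ 4) * (E * \<delta> ^ 4))" by (simp add: w_def algebra_simps)
      also have "\<dots> \<le> K0 * (\<delta> ^ 4 + Kr\<^sup>2 * (E * \<delta> ^ 4))" using 1 2 K0 by (intro mult_left_mono add_mono) auto
      finally show ?thesis by (simp add: algebra_simps)
    qed
    then have "C * (n ^ 4 * w) \<le> C * (K0 * (1 + Kr\<^sup>2 * E) * \<delta> ^ 4)" using C(1) by (rule mult_left_mono)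
    moreover have "0 \<le> C * (n ^ 4 * w)" using C w0 n by simp
    ultimately have "50421 * (C * (n ^ 4 * w)) \<le> 60000 * (C * (K0 * (1 + Kr\<^sup>2 * E) * \<delta> ^ 4))"
      by linarith
    with Y have "d\<^sup>2 * ?Y \<le> K * \<delta> ^ 4" by (simp add: K_def mult_ac)
    then show ?thesis unfolding trunc_err_def abs_mult abs_power2 .
  qed
  moreover have "K \<ge> 0" using C K0 by (simp add: K_def)
  ultimately show ?thesis using that by blast
qed

text \<open>The formula is formally of second order only, but the error carries the factor
  \<open>d\<^sup>2\<close>, itself \<open>O(L ^ 4 / N\<^sup>2)\<close> here. The constant 500
  exceeds \<open>49 + 2 * 14 ^ 2\<close>.\<close>

lemma cell_unresolved:
  fixes b \<rho> C Ku E :: real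
  assumes b: "b > 0" and C: "C \<ge> 0" "Ku \<ge> 0" "E \<ge> 0"
  obtains K where "K \<ge> 0"
    "\<And>d g x h hp N L. \<lbrakk>scalar_bounds C b \<rho> d g; 0 < d; d < 1; 0 < h; h \<le> hp; 0 \<le> x - h; x + hp \<le> 1; x + hp \<le> 15 / 16;
       N > 0; hp \<le> 7 / N; hp - h \<le> 49 / N\<^sup>2; d\<^sup>2 \<le> Ku * L ^ 4 / N\<^sup>2;
       exp (- b * (x - h) / d) \<le> E * (L / N) ^ 4\<rbrakk> \<Longrightarrow> \<bar>trunc_err d g x h hp 0 1 0\<bar> \<le> K * (L / N) ^ 4"
proof -
  obtain K0 where K0: "K0 \<ge> 1"
    "\<And>d x m. 0 < d \<Longrightarrow> d < 1 \<Longrightarrow> x \<le> 15 / 16 \<Longrightarrow> m \<le> 4 \<Longrightarrow> weight b d m x \<le> K0 * (1 + exp (- b * x / d) / d ^ m)"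
    using weight_left_bound[OF b] by blast
  define K where "K = C * K0 * (500 * Ku + (3 / b\<^sup>2 + 1 / b) * E)"
  have "\<bar>trunc_err d g x h hp 0 1 0\<bar> \<le> K * (L / N) ^ 4"
    if g: "scalar_bounds C b \<rho> d g" and d: "0 < d" "d < 1" and h: "0 < h" "h \<le> hp" and r: "0 \<le> x - h" "x + hp \<le> 1" "x + hp \<le> 15 / 16"
       and N: "N > 0" "hp \<le> 7 / N" "hp - h \<le> 49 / N\<^sup>2" "d\<^sup>2 \<le> Ku * L ^ 4 / N\<^sup>2"
       and E: "exp (- b * (x - h) / d) \<le> E * (L / N) ^ 4" for d g x h hp N L
  proof -
    have W: "\<bar>g s y\<bar> \<le> C * K0 * (1 + exp (- b * y / d) / d ^ s)" if "s \<le> 4" "y \<in> {x - h..x + hp}" for s y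
    proof -
      have "\<bar>g s y\<bar> \<le> C * weight b d s y" using that r by (intro scalar_boundsD(3)[OF g]) auto
      also have "\<dots> \<le> C * (K0 * (1 + exp (- b * y / d) / d ^ s))"
        using K0(2)[OF d, of y s] that r C by (intro mult_left_mono) auto
      finally show ?thesis by simp
    qed
    have "d\<^sup>2 * \<bar>g 2 x - diff2 (g 0) x h hp\<bar> \<le>
      (C * K0) * (d\<^sup>2 * (hp - h) + 2 * d\<^sup>2 * (h + hp)\<^sup>2 + (3 / b\<^sup>2 + 1 / b) * exp (- b * (x - h) / d))"
    proof (rule coarse_difference_error[OF h d(1) b])
      show "0 \<le> C * K0" using C K0 by simp
      show "derivs_on (x - h) (x + hp) 4 g"
        using derivs_on_subset[OF derivs_on_shift[OF scalar_boundsD(1)[OF g], of 0 4]] r by simp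
    qed (use W[of 4] W[of 3 "x + hp"] h in auto)
    also have "\<dots> \<le> (C * K0) * (500 * Ku * (L / N) ^ 4 + (3 / b\<^sup>2 + 1 / b) * (E * (L / N) ^ 4))"
    proof (intro mult_left_mono add_mono)
      have "(hp - h) + 2 * (h + hp)\<^sup>2 \<le> 49 / N\<^sup>2 + 2 * (14 / N)\<^sup>2"
      proof -
        have "h + hp \<le> 14 / N" using h N by simp
        then have "(h + hp)\<^sup>2 \<le> (14 / N)\<^sup>2" using h by (intro power_mono) auto
        then show ?thesis using N by linarith
      qed
      also have "\<dots> \<le> 500 / N\<^sup>2" using N by (simp add: power_divide divide_right_mono flip: add_divide_distrib)
      finally have "d\<^sup>2 * ((hp - h) + 2 * (h + hp)\<^sup>2) \<le> (Ku * L ^ 4 / N\<^sup>2) * (500 / N\<^sup>2)"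
        using N(4) h N(1) by (intro mult_mono) (auto intro: order_trans[OF zero_le_power2])
      also have "\<dots> = 500 * Ku * (L / N) ^ 4" by (simp add: power_divide eval_nat_numeral mult_ac)
      finally show "d\<^sup>2 * (hp - h) + 2 * d\<^sup>2 * (h + hp)\<^sup>2 \<le> 500 * Ku * (L / N) ^ 4" by (simp add: algebra_simps)
      show "exp (- b * (x - h) / d) \<le> E * (L / N) ^ 4" by (rule E)
    qed (use b C K0 in auto)
    also have "\<dots> = K * (L / N) ^ 4" unfolding K_def by (simp only: distrib_left distrib_right mult_ac)
    finally have "d\<^sup>2 * \<bar>g 2 x - diff2 (g 0) x h hp\<bar> \<le> K * (L / N) ^ 4" .
    moreover have "- diff2 (g 0) x h hp + (0 * g 2 (x - h) + 1 * g 2 x + 0 * g 2 (x + hp)) = g 2 x - diff2 (g 0) x h hp" by simp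
    ultimately show ?thesis unfolding trunc_err_def abs_mult abs_power2 by simp
  qed
  moreover have "K \<ge> 0" using C K0 b by (simp add: K_def)
  ultimately show ?thesis using that by blast
qed

section \<open>The generalized Shishkin mesh\<close>

text \<open>Truncated subtraction of natural numbers merges both branches of the mesh function:
  \<open>j - m\<close> is 0 in the fine part, so the cubic term switches itself off.\<close>

lemma mesh_node_left:
  assumes N: "N = 4 * m" "m > 0" and j: "j \<le> 2 * m" and sg: "sg = shishkin_sigma sigma0 eps l"
  shows "mesh_node sigma0 eps l N j = sg * j / m + mesh_p sg * real (j - m) ^ 3 / (4 * real m) ^ 3"
proof -
  have j2: "j \<le> N div 2" using N j by simp
  show ?thesis
  proof (cases "j \<le> m")
    case True
    then have "real j / real N \<le> 1 / 4" using N by (simp add: divide_le_eq)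
    then show ?thesis using j2 True N unfolding mesh_node_def Let_def sg[symmetric] mesh_fun_def by simp
  next
    case False
    then have "\<not> real j / real N \<le> 1 / 4" using N by (simp add: divide_le_eq)
    moreover have e: "real j / real N - 1 / 4 = real (j - m) / (4 * m)" using N False by (simp add: of_nat_diff field_simps)
    moreover have "4 * sg * (real (j - m) / (4 * m)) + sg = sg * j / m" using N False by (simp add: of_nat_diff field_simps)
    ultimately show ?thesis using j2 unfolding mesh_node_def Let_def sg[symmetric] mesh_fun_def
      by (simp add: power_divide add.assoc del: of_nat_diff)
  qed
qed

lemma mesh_node_right:
  assumes N: "N = 4 * m" "m > 0" and j: "j \<le> 2 * m"
  shows "mesh_node sigma0 eps l N (N - j) = 1 - mesh_node sigma0 eps l N j"
proof (cases "j = 2 * m")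
  case True
  define sg where "sg = shishkin_sigma sigma0 eps l"
  have "mesh_node sigma0 eps l N j = 1 / 2"
    unfolding mesh_node_left[OF N j sg_def] using True N
    by (simp add: mesh_p_def field_simps power3_eq_cube)
  moreover have "N - j = j" using True N by simp
  ultimately show ?thesis by simp
next
  case False
  then have "\<not> N - j \<le> N div 2" "j \<le> N div 2" "N - (N - j) = j" using N j by auto
  then show ?thesis unfolding mesh_node_def Let_def by simp
qed

locale shishkin_mesh =
  fixes sigma0 eps l :: real and N m :: nat
  assumes N: "N = 4 * m" "m > 0" and sigma0: "sigma0 > 0" and eps: "eps > 0" and l: "l > 0"
begin

definition "sg = shishkin_sigma sigma0 eps l"
definition "X = mesh_node sigma0 eps l N"

lemma sg: "0 < sg" "sg \<le> 1 / 4" "sg \<le> sigma0 * sqrt eps * l"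
  using sigma0 eps l by (auto simp: sg_def shishkin_sigma_def)

lemma p: "0 \<le> mesh_p sg" "mesh_p sg \<le> 32" using sg by (auto simp: mesh_p_def)

lemma X_left: "j \<le> 2 * m \<Longrightarrow> X j = sg * j / m + mesh_p sg * real (j - m) ^ 3 / (4 * real m) ^ 3"
  unfolding X_def by (rule mesh_node_left[OF N _ sg_def])

lemma X_right: "j \<le> 2 * m \<Longrightarrow> X (N - j) = 1 - X j"
  unfolding X_def by (rule mesh_node_right[OF N])

lemma X_0: "X 0 = 0" using X_left[of 0] by simp
lemma X_N: "X N = 1" using X_right[of 0] X_0 by simp

lemma h_left:
  assumes "1 \<le> i" "i \<le> 2 * m"
  shows "mesh_h X i = sg / m + mesh_p sg * (real (i - m) ^ 3 - real (i - 1 - m) ^ 3) / (4 * real m) ^ 3"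
proof -
  have "mesh_h X i = X i - X (i - 1)" by (simp add: mesh_h_def)
  also have "\<dots> = sg * (real i - real (i - 1)) / m + mesh_p sg * (real (i - m) ^ 3 - real (i - 1 - m) ^ 3) / (4 * real m) ^ 3"
  proof -
    have 1: "X (i - 1) = sg * real (i - 1) / m + mesh_p sg * real (i - 1 - m) ^ 3 / (4 * real m) ^ 3"
      using assms by (intro X_left) simp
    have 2: "s * a / M + p * c / Q - (s * b / M + p * d / Q) = s * (a - b) / M + p * (c - d) / Q" for s a b c d M p Q :: real
      by (simp add: diff_divide_distrib right_diff_distrib)
    show ?thesis unfolding 1 X_left[OF assms(2)] by (rule 2)
  qed
  also have "real i - real (i - 1) = 1" using assms by (simp add: of_nat_diff)
  finally show ?thesis by simp
qed

lemma h_right: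
  assumes "1 \<le> i" "i \<le> 2 * m" shows "mesh_h X (N + 1 - i) = mesh_h X i"
proof -
  have "N + 1 - i = N - (i - 1)" "N + 1 - i - 1 = N - i" using assms N by auto
  then show ?thesis unfolding mesh_h_def using X_right[of i] X_right[of "i - 1"] assms by simp
qed

lemma cube_diff:
  assumes "1 \<le> i" "i \<le> 2 * m"
  shows "0 \<le> real (i - m) ^ 3 - real (i - 1 - m) ^ 3" "real (i - m) ^ 3 - real (i - 1 - m) ^ 3 \<le> 3 * (real m)\<^sup>2"
proof -
  show "0 \<le> real (i - m) ^ 3 - real (i - 1 - m) ^ 3" by (simp add: power_mono)
  show "real (i - m) ^ 3 - real (i - 1 - m) ^ 3 \<le> 3 * (real m)\<^sup>2"
  proof (cases "i \<le> m")
    case False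
    then obtain k where k: "i = m + Suc k" using less_imp_Suc_add[of m i] by auto
    have km: "real k + 1 \<le> real m" using assms k by linarith
    have "real (i - m) ^ 3 - real (i - 1 - m) ^ 3 = 3 * (real k)\<^sup>2 + 3 * real k + 1"
      using k by (simp add: algebra_simps power2_eq_square power3_eq_cube)
    also have "\<dots> \<le> 3 * (real k + 1)\<^sup>2" by (simp add: power2_eq_square algebra_simps)
    also have "\<dots> \<le> 3 * (real m)\<^sup>2" using km by (simp add: power_mono)
    finally show ?thesis .
  qed simp
qed

lemma h_left_pos: "1 \<le> i \<Longrightarrow> i \<le> 2 * m \<Longrightarrow> 0 < mesh_h X i"
  unfolding h_left using cube_diff(1)[of i] p(1) sg(1) N(2) by (intro add_pos_nonneg) auto

text \<open>Of the 7/4 in \<open>(7 / 4) / m\<close>, the linear part gives 1/4 because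
  \<open>sg \<le> 1 / 4\<close>, and the cubic gives 3/2 because its coefficient is at most
  32.\<close>

lemma h_left_le:
  assumes "1 \<le> i" "i \<le> 2 * m" shows "mesh_h X i \<le> 7 / N"
proof -
  have "sg / m \<le> (1 / 4) / m" using sg by (intro divide_right_mono) auto
  moreover have "mesh_p sg * (real (i - m) ^ 3 - real (i - 1 - m) ^ 3) / (4 * real m) ^ 3 \<le> 32 * (3 * (real m)\<^sup>2) / (4 * real m) ^ 3"
    using cube_diff[OF assms] p by (intro divide_right_mono mult_mono) auto
  moreover have "32 * (3 * (real m)\<^sup>2) / (4 * real m) ^ 3 = (3 / 2) / m"
    using N(2) by (simp add: power_mult_distrib field_simps power2_eq_square power3_eq_cube)
  moreover have "7 / real N = (7 / 4) / m" using N by simp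
  moreover have "(1 / 4) / real m + (3 / 2) / m = (7 / 4) / m" by (simp flip: add_divide_distrib)
  ultimately show ?thesis unfolding h_left[OF assms] by linarith
qed

text \<open>The effect of the cubic grading: step widths never jump, not even at the transition
  point, since the second difference of the cubes is at most \<open>6 * m\<close>. This gives
  \<open>48 / N\<^sup>2\<close>.\<close>

lemma h_left_step:
  assumes "1 \<le> i" "i < 2 * m"
  shows "0 \<le> mesh_h X (i + 1) - mesh_h X i" "mesh_h X (i + 1) - mesh_h X i \<le> 49 / (real N)\<^sup>2"
proof -
  define a where "a = real (i + 1 - m) ^ 3 - 2 * real (i - m) ^ 3 + real (i - 1 - m) ^ 3"
  have e: "mesh_h X (i + 1) - mesh_h X i = mesh_p sg * a / (4 * real m) ^ 3"
    using assms by (simp add: h_left a_def algebra_simps diff_divide_distrib add_divide_distrib)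
  have a: "0 \<le> a \<and> a \<le> 6 * real m"
  proof -
    consider "i < m" | "i = m" | "i > m" by linarith
    then show ?thesis
    proof cases
      case 1
      then show ?thesis by (simp add: a_def)
    next
      case 2
      then show ?thesis using N by (simp add: a_def)
    next
      case 3
      then obtain k where k: "i = m + Suc k" using less_imp_Suc_add[of m i] by auto
      have "a = 6 * (real k + 1)" using k by (simp add: a_def algebra_simps power3_eq_cube)
      moreover have "real k + 1 \<le> real m" using k assms by linarith
      ultimately show ?thesis by simp
    qed
  qed
  then show "0 \<le> mesh_h X (i + 1) - mesh_h X i" unfolding e using p by simp
  have "mesh_p sg * a / (4 * real m) ^ 3 \<le> 32 * (6 * real m) / (4 * real m) ^ 3"
    using a p by (intro divide_right_mono mult_mono) auto
  also have "\<dots> = 48 / (real N)\<^sup>2" using N by (simp add: field_simps power2_eq_square power3_eq_cube)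
  also have "\<dots> \<le> 49 / (real N)\<^sup>2" by (intro divide_right_mono) auto
  finally show "mesh_h X (i + 1) - mesh_h X i \<le> 49 / (real N)\<^sup>2" unfolding e .
qed

lemma h_middle: "mesh_h X (2 * m + 1) = mesh_h X (2 * m)"
  using h_right[of "2 * m"] N by simp

lemma h_cases:
  assumes "1 \<le> i" "i \<le> N"
  obtains j where "1 \<le> j" "j \<le> 2 * m" "mesh_h X i = mesh_h X j"
proof (cases "i \<le> 2 * m")
  case False
  then have "1 \<le> N + 1 - i" "N + 1 - i \<le> 2 * m" "N + 1 - (N + 1 - i) = i" using assms N by auto
  then show ?thesis using that h_right[of "N + 1 - i"] by metis
qed (use that assms in blast)

lemma h_pos: "1 \<le> i \<Longrightarrow> i \<le> N \<Longrightarrow> 0 < mesh_h X i"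
  using h_cases[of i] h_left_pos by metis

lemma h_le: "1 \<le> i \<Longrightarrow> i \<le> N \<Longrightarrow> mesh_h X i \<le> 7 / N"
  using h_cases[of i] h_left_le by metis

lemma h_sum: "n \<le> N \<Longrightarrow> X n = (\<Sum>i\<in>{1..n}. mesh_h X i)"
  by (induction n) (auto simp: X_0 mesh_h_def)

lemma X_mono: "i \<le> j \<Longrightarrow> j \<le> N \<Longrightarrow> X i \<le> X j"
proof (induction j)
  case (Suc j)
  then show ?case using h_pos[of "Suc j"] by (cases "i = Suc j") (auto simp: mesh_h_def)
qed simp

lemma X_range: "i \<le> N \<Longrightarrow> X i \<in> {0..1}"
  using X_mono[of 0 i] X_mono[of i N] by (simp add: X_0 X_N)

text \<open>The lower bound holds because the \<open>N\<close> steps add up to 1. It is what turns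
  the resolution condition into an upper bound on \<open>1 / eps\<close>.\<close>

lemma hmax:
  shows "mesh_hmax N X \<le> 7 / N" "1 / N \<le> mesh_hmax N X"
proof -
  have ne: "mesh_h X ` {1..N} \<noteq> {}" using N by simp
  show "mesh_hmax N X \<le> 7 / N" unfolding mesh_hmax_def using ne h_le by (subst Max_le_iff) auto
  have "1 = (\<Sum>i\<in>{1..N}. mesh_h X i)" using h_sum[of N] X_N by simp
  also have "\<dots> \<le> (\<Sum>i\<in>{1..N}. mesh_hmax N X)" unfolding mesh_hmax_def by (intro sum_mono Max_ge) auto
  also have "\<dots> = N * mesh_hmax N X" by simp
  finally show "1 / N \<le> mesh_hmax N X" using N by (simp add: divide_le_eq mult.commute)
qed

lemma h_fine: "1 \<le> i \<Longrightarrow> i \<le> m \<Longrightarrow> mesh_h X i = 4 * sg / N"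
  using h_left[of i] N by simp

lemma h_uniform:
  assumes "sg = 1 / 4" "1 \<le> i" "i \<le> N" shows "mesh_h X i = 4 * sg / N"
proof -
  obtain j where j: "1 \<le> j" "j \<le> 2 * m" "mesh_h X i = mesh_h X j" using h_cases assms by blast
  show ?thesis unfolding j(3) h_left[OF j(1,2)] using assms(1) N by (simp add: mesh_p_def)
qed

text \<open>The leftmost node of the stencil at \<open>i = m\<close> lies one step inside the fine
  region; hence the loss of the factor \<open>1 - 1 / m\<close>.\<close>

lemma X_coarse: "m \<le> i \<Longrightarrow> i \<le> N \<Longrightarrow> sg * (1 - 1 / m) \<le> X (i - 1)"
proof -
  assume i: "m \<le> i" "i \<le> N"
  have "X (m - 1) = sg * (1 - 1 / m)"
    using X_left[of "m - 1"] N by (simp add: of_nat_diff field_simps)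
  moreover have "X (m - 1) \<le> X (i - 1)" using i by (intro X_mono) auto
  ultimately show ?thesis by simp
qed

text \<open>By symmetry the stencils at \<open>i \<le> 2 * m\<close> then end at or before 15/16,
  out of reach of the right layer. The estimate yields \<open>1 / 16 + 5 / 4 * sg\<close>.\<close>

lemma X_center: "m \<ge> 2 \<Longrightarrow> 1 / 16 \<le> X (2 * m - 1)"
proof -
  assume m: "m \<ge> 2"
  define q where "q = (real m - 1) / m"
  have q: "1 / 2 \<le> q" using m by (simp add: q_def le_divide_eq)
  have "X (2 * m - 1) = sg * real (2 * m - 1) / m + mesh_p sg * real (2 * m - 1 - m) ^ 3 / (4 * real m) ^ 3"
    by (rule X_left) simp
  also have "\<dots> = sg * (1 + q) + mesh_p sg * q ^ 3 / 64"
    using m by (simp add: q_def of_nat_diff field_simps power3_eq_cube)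
  also have "\<dots> \<ge> sg * (3 / 2) + mesh_p sg * (1 / 2) ^ 3 / 64"
    using q sg p by (intro add_mono mult_left_mono divide_right_mono power_mono) auto
  finally have "sg * (3 / 2) + 32 * (1 - 4 * sg) * (1 / 8) / 64 \<le> X (2 * m - 1)" by (simp add: mesh_p_def power3_eq_cube)
  moreover have "sg * (3 / 2) + 32 * (1 - 4 * sg) * (1 / 8) / 64 = 1 / 16 + 5 / 4 * sg" by (simp add: field_simps)
  ultimately show ?thesis using sg(1) by linarith
qed

end

section \<open>Stability of the scheme\<close>

lemma mesh_norm_ge: "i \<le> N \<Longrightarrow> \<bar>V i $ k\<bar> \<le> mesh_norm N V" for V :: "nat \<Rightarrow> real^'n"
  unfolding mesh_norm_def by (rule Max_ge) (auto intro!: image_eqI[of _ _ "(i, k)"])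

lemma mesh_norm_leI: "(\<And>i k. i \<le> N \<Longrightarrow> \<bar>V i $ k\<bar> \<le> B) \<Longrightarrow> mesh_norm N V \<le> B" for V :: "nat \<Rightarrow> real^'n"
  unfolding mesh_norm_def by (subst Max_le_iff) auto

lemma mesh_norm_nonneg: "0 \<le> mesh_norm N V" for V :: "nat \<Rightarrow> real^'n"
  using mesh_norm_ge[of 0 N V] by (rule order_trans[OF abs_ge_zero]) simp

lemma mesh_norm_attained:
  obtains i k where "i \<le> N" "mesh_norm N V = \<bar>(V :: nat \<Rightarrow> real^'n) i $ k\<bar>"
proof -
  have "mesh_norm N V \<in> (\<lambda>(i, k). \<bar>V i $ k\<bar>) ` ({0..N} \<times> UNIV)"
    unfolding mesh_norm_def by (rule Max_in) auto
  then show ?thesis using that by auto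
qed

lemma mesh_norm_triangle: "mesh_norm N (\<lambda>i. V i + W i) \<le> mesh_norm N V + mesh_norm N W" for V W :: "nat \<Rightarrow> real^'n"
  by (rule mesh_norm_leI) (simp, meson abs_triangle_ineq add_mono mesh_norm_ge order_trans)

lemma mesh_norm_scale: "mesh_norm N (\<lambda>i. c *\<^sub>R V i) \<le> \<bar>c\<bar> * mesh_norm N V" for V :: "nat \<Rightarrow> real^'n"
  by (rule mesh_norm_leI) (simp add: abs_mult mesh_norm_ge mult_left_mono)

lemma mesh0_add: "V \<in> mesh0 N \<Longrightarrow> W \<in> mesh0 N \<Longrightarrow> (\<lambda>i. V i + W i) \<in> mesh0 N"
  and mesh0_scale: "V \<in> mesh0 N \<Longrightarrow> (\<lambda>i. c *\<^sub>R V i) \<in> mesh0 N"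
  and mesh0_zero: "(\<lambda>i. 0) \<in> mesh0 N"
  by (auto simp: mesh0_def)

text \<open>Gaussian elimination of a tridiagonal system: the first \<open>n\<close> equations make
  \<open>V n\<close> an affine function of the next value \<open>c\<close>. Diagonal dominance keeps
  the slope at most 1 in modulus, so the next pivot is positive.\<close>

lemma tridiagonal_elimination:
  fixes qm qc qp g :: "nat \<Rightarrow> real"
  assumes dom: "\<And>i. 1 \<le> i \<Longrightarrow> i \<le> n \<Longrightarrow> \<bar>qm i\<bar> + \<bar>qp i\<bar> < qc i"
  shows "\<exists>\<alpha> \<gamma>. \<bar>\<alpha>\<bar> \<le> 1 \<and> (\<forall>c. \<exists>V. V 0 = 0 \<and> (\<forall>i. 1 \<le> i \<longrightarrow> i \<le> n \<longrightarrow>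
     qm i * V (i - 1) + qc i * V i + qp i * V (i + 1) = g i) \<and> V n = \<alpha> * c + \<gamma> \<and> V (Suc n) = c)"
  using dom
proof (induction n)
  case 0
  have "\<exists>V. V 0 = 0 \<and> V (Suc 0) = c" for c :: real
    by (rule exI[of _ "\<lambda>i. if i = 0 then 0 else c"]) simp
  then show ?case by (intro exI[of _ 0]) auto
next
  case (Suc n)
  then obtain \<alpha> \<gamma> where a: "\<bar>\<alpha>\<bar> \<le> 1" and V: "\<And>c. \<exists>V. V 0 = 0 \<and> (\<forall>i. 1 \<le> i \<longrightarrow> i \<le> n \<longrightarrow>
     qm i * V (i - 1) + qc i * V i + qp i * V (i + 1) = g i) \<and> V n = \<alpha> * c + \<gamma> \<and> V (Suc n) = c"
    by (metis le_SucI)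
  let ?k = "Suc n"
  \<comment> \<open>The pivot. It exceeds \<open>\<bar>qp ?k\<bar>\<close> because
    \<open>\<bar>\<alpha>\<bar> \<le> 1\<close>, so the new slope \<open>- qp ?k / D\<close> is
    again at most 1 in modulus.\<close>
  define D where "D = qc ?k + qm ?k * \<alpha>"
  have "\<bar>qm ?k * \<alpha>\<bar> \<le> \<bar>qm ?k\<bar> * 1" unfolding abs_mult using a by (intro mult_left_mono) auto
  then have D: "\<bar>qp ?k\<bar> < D" using Suc.prems[of ?k] by (simp add: D_def)
  then have D0: "D > 0" by linarith
  show ?case
  proof (rule exI[of _ "- qp ?k / D"], rule exI[of _ "(g ?k - qm ?k * \<gamma>) / D"], rule conjI, goal_cases)
    case 1
    show ?case using D D0 by (simp add: divide_le_eq)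
  next
    case 2
    show ?case
    proof
    fix c
    define c' where "c' = - qp ?k / D * c + (g ?k - qm ?k * \<gamma>) / D"
    obtain V0 where V0: "V0 0 = 0" "\<And>i. 1 \<le> i \<Longrightarrow> i \<le> n \<Longrightarrow> qm i * V0 (i - 1) + qc i * V0 i + qp i * V0 (i + 1) = g i"
      "V0 n = \<alpha> * c' + \<gamma>" "V0 ?k = c'" using V[of c'] by blast
    define V1 where "V1 = V0(Suc ?k := c)"
    have "D * c' = - qp ?k * c + (g ?k - qm ?k * \<gamma>)" using D0 by (simp add: c'_def field_simps)
    then have "qm ?k * V1 (?k - 1) + qc ?k * V1 ?k + qp ?k * V1 (?k + 1) = g ?k"
      using V0(3,4) by (simp add: V1_def D_def algebra_simps)
    moreover have "qm i * V1 (i - 1) + qc i * V1 i + qp i * V1 (i + 1) = g i" if "1 \<le> i" "i \<le> n" for i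
    proof -
      have "i - 1 \<noteq> Suc ?k" "i \<noteq> Suc ?k" "i + 1 \<noteq> Suc ?k" using that by auto
      then show ?thesis using V0(2)[OF that] by (simp add: V1_def)
    qed
    ultimately have "\<forall>i. 1 \<le> i \<longrightarrow> i \<le> Suc n \<longrightarrow> qm i * V1 (i - 1) + qc i * V1 i + qp i * V1 (i + 1) = g i"
      by (metis le_Suc_eq)
    then show "\<exists>V. V 0 = 0 \<and> (\<forall>i. 1 \<le> i \<longrightarrow> i \<le> Suc n \<longrightarrow> qm i * V (i - 1) + qc i * V i + qp i * V (i + 1) = g i) \<and>
        V (Suc n) = - qp ?k / D * c + (g ?k - qm ?k * \<gamma>) / D \<and> V (Suc (Suc n)) = c"
      by (intro exI[of _ V1]) (use V0 in \<open>auto simp: V1_def c'_def\<close>)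
    qed
  qed
qed

lemma tridiagonal_solvable:
  fixes qm qc qp g :: "nat \<Rightarrow> real"
  assumes "\<And>i. 1 \<le> i \<Longrightarrow> i \<le> n \<Longrightarrow> \<bar>qm i\<bar> + \<bar>qp i\<bar> < qc i"
  shows "\<exists>V. V 0 = 0 \<and> (\<forall>i>n. V i = 0) \<and> (\<forall>i. 1 \<le> i \<longrightarrow> i \<le> n \<longrightarrow>
     qm i * V (i - 1) + qc i * V i + qp i * V (i + 1) = g i)"
proof -
  obtain V where V: "V 0 = 0" "\<And>i. 1 \<le> i \<Longrightarrow> i \<le> n \<Longrightarrow> qm i * V (i - 1) + qc i * V i + qp i * V (i + 1) = g i"
     "V (Suc n) = 0"
    using tridiagonal_elimination[of n qm qp qc g] assms by blast
  define V1 where "V1 i = (if i \<le> n then V i else 0)" for i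
  have "qm i * V1 (i - 1) + qc i * V1 i + qp i * V1 (i + 1) = g i" if "1 \<le> i" "i \<le> n" for i
    using V(2)[OF that] that V(3) by (cases "i = n") (auto simp: V1_def)
  then show ?thesis using V(1) by (intro exI[of _ V1]) (auto simp: V1_def)
qed

section \<open>The discrete operators\<close>

locale scheme =
  fixes gam :: real and A :: "real \<Rightarrow> real^'n^'n" and eps dt :: real and N :: nat and x :: "nat \<Rightarrow> real"
  assumes dt: "dt > 0" and h_pos: "\<And>i. 1 \<le> i \<Longrightarrow> i \<le> N \<Longrightarrow> 0 < mesh_h x i" and N2: "N \<ge> 2"
begin

abbreviation "qm \<equiv> q_minus gam A eps dt N x"
abbreviation "qc \<equiv> q_cent gam A eps dt N x"
abbreviation "qp \<equiv> q_plus gam A eps dt N x"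
abbreviation "Q \<equiv> Q_vec gam A eps dt N x"
abbreviation "LH \<equiv> L_hat gam A eps dt N x"
abbreviation "R \<equiv> transition_op gam A eps dt N x"

lemma q_sum: "1 \<le> i \<Longrightarrow> i < N \<Longrightarrow> qm k i + qc k i + qp k i = 1"
proof -
  assume i: "1 \<le> i" "i < N"
  have "mesh_h x i + mesh_h x (i + 1) > 0" using h_pos[of i] h_pos[of "i + 1"] i by simp
  then have "(2 * mesh_h x i - mesh_h x (i+1)) / (6 * (mesh_h x i + mesh_h x (i+1)))
     + (2 * mesh_h x (i+1) - mesh_h x i) / (6 * (mesh_h x i + mesh_h x (i+1))) = 1 / 6"
  proof -
    have "(2 * a - b) / (6 * (a + b)) + (2 * b - a) / (6 * (a + b)) = 1 / 6" if "a + b > 0" for a b :: real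
    proof -
      have "(2 * a - b) / (6 * (a + b)) + (2 * b - a) / (6 * (a + b)) = (a + b) / (6 * (a + b))"
        unfolding add_divide_distrib[symmetric] by simp
      then show ?thesis using that by simp
    qed
    then show ?thesis using \<open>mesh_h x i + mesh_h x (i + 1) > 0\<close> by blast
  qed
  then have "(2 * mesh_h x i - mesh_h x (i+1)) / (6 * (mesh_h x i + mesh_h x (i+1))) + 5 / 6
     + (2 * mesh_h x (i+1) - mesh_h x i) / (6 * (mesh_h x i + mesh_h x (i+1))) = 1"
    by linarith
  moreover define a where "a = (2 * mesh_h x i - mesh_h x (i+1)) / (6 * (mesh_h x i + mesh_h x (i+1)))"
  moreover define b where "b = (2 * mesh_h x (i+1) - mesh_h x i) / (6 * (mesh_h x i + mesh_h x (i+1)))"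
  ultimately have "a + 5 / 6 + b = 1" by simp
  then show ?thesis unfolding q_minus_def q_cent_def q_plus_def a_def[symmetric] b_def[symmetric] by auto
qed

text \<open>The outer weights can be negative on unequal steps, hence the absolute values. What
  matters is the margin of diagonal dominance, \<open>5 / 6 - 1 / 2 = 1 / 3\<close>.\<close>

lemma q_bounds:
  assumes i: "1 \<le> i" "i < N"
  shows "\<bar>qm k i\<bar> \<le> 1 / 3" "\<bar>qp k i\<bar> \<le> 1 / 3" "\<bar>qc k i\<bar> \<le> 1" "\<bar>qm k i\<bar> + \<bar>qp k i\<bar> \<le> 1 / 2" "5 / 6 \<le> qc k i"
proof -
  define h hp where "h = mesh_h x i" and "hp = mesh_h x (i + 1)"
  have h: "h > 0" "hp > 0" using h_pos[of i] h_pos[of "i + 1"] i by (auto simp: h_def hp_def)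
  have b: "\<bar>2 * h - hp\<bar> * 3 \<le> 6 * (h + hp)" "\<bar>2 * hp - h\<bar> * 3 \<le> 6 * (h + hp)"
    "(\<bar>2 * h - hp\<bar> + \<bar>2 * hp - h\<bar>) * 2 \<le> 6 * (h + hp)"
    using h by (auto simp: abs_if)
  have "\<bar>(2 * h - hp) / (6 * (h + hp))\<bar> \<le> 1 / 3" "\<bar>(2 * hp - h) / (6 * (h + hp))\<bar> \<le> 1 / 3"
    "\<bar>(2 * h - hp) / (6 * (h + hp))\<bar> + \<bar>(2 * hp - h) / (6 * (h + hp))\<bar> \<le> 1 / 2"
    using b h by (auto simp: abs_mult divide_le_eq simp flip: add_divide_distrib)
  then show "\<bar>qm k i\<bar> \<le> 1 / 3" "\<bar>qp k i\<bar> \<le> 1 / 3" "\<bar>qc k i\<bar> \<le> 1" "\<bar>qm k i\<bar> + \<bar>qp k i\<bar> \<le> 1 / 2" "5 / 6 \<le> qc k i"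
    unfolding q_minus_def q_plus_def q_cent_def h_def[symmetric] hp_def[symmetric] by auto
qed

lemma Q_add: "Q (\<lambda>i. V i + W i) i = Q V i + Q W i"
  and Q_scale: "Q (\<lambda>i. c *\<^sub>R V i) i = c *\<^sub>R Q V i"
  by (auto simp: Q_vec_def Q_scal_def vec_eq_iff algebra_simps)

definition Lam :: "(nat \<Rightarrow> real^'n) \<Rightarrow> nat \<Rightarrow> real^'n" where
  "Lam V i = (- 2 * eps / (mesh_h x i + mesh_h x (i + 1))) *\<^sub>R
     ((V (i + 1) - V i) /\<^sub>R mesh_h x (i + 1) - (V i - V (i - 1)) /\<^sub>R mesh_h x i)"

text \<open>Unfolds the coefficients \<open>r\<close> into the structure of the trapezoidal rule:
  averaged identity plus half a time step of discrete diffusion \<open>Lam\<close> plus averaged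
  reaction. The weights add up to 1, which is what reconciles the \<open>2 / dt\<close> terms with
  the central coefficient. The consistency argument rests on this form.\<close>

lemma L_hat_eq:
  assumes i: "1 \<le> i" "i < N"
  shows "LH V i = Q V i + (dt / 2) *\<^sub>R (Lam V i + Q (\<lambda>l. A (x l) *v V l) i)"
proof -
  have "LH V i $ k = (Q V i + (dt / 2) *\<^sub>R (Lam V i + Q (\<lambda>l. A (x l) *v V l) i)) $ k" for k
  proof -
    define h hp where "h = mesh_h x i" and "hp = mesh_h x (i + 1)"
    have h: "h > 0" "hp > 0" using h_pos[of i] h_pos[of "i + 1"] i by (auto simp: h_def hp_def)
    define v0 v1 v2 where "v0 = V (i - 1) $ k" and "v1 = V i $ k" and "v2 = V (i + 1) $ k"
    define a0 a1 a2 where "a0 = A (x (i - 1)) $ k $ k" and "a1 = A (x i) $ k $ k" and "a2 = A (x (i + 1)) $ k $ k"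
    define S where "S l = (\<Sum>j\<in>UNIV - {k}. A (x l) $ k $ j * V l $ j)" for l
    have mv: "(A (x l) *v V l) $ k = A (x l) $ k $ k * V l $ k + S l" for l
      unfolding S_def matrix_vector_mult_def by (simp add: sum.remove[of UNIV k])
    have SQ: "(\<Sum>j\<in>UNIV - {k}. Q_scal gam A eps dt N x k (\<lambda>l. A (x l) $ k $ j * V l $ j) i)
        = qm k i * S (i - 1) + qc k i * S i + qp k i * S (i + 1)"
      unfolding Q_scal_def S_def by (simp add: sum.distrib sum_distrib_left)
    define m c p where "m = qm k i" and "c = qc k i" and "p = qp k i"
    have s: "c = 1 - m - p" using q_sum[OF i, of k] by (simp add: m_def c_def p_def)
    have "LH V i $ k = (dt / 2 * (- 2 * eps / (h * (h + hp)) + m * (a0 + 2 / dt))) * v0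
        + (dt / 2 * (m * a0 + c * a1 + p * a2) - (dt / 2 * (- 2 * eps / (h * (h + hp)) + m * (a0 + 2 / dt)))
            - (dt / 2 * (- 2 * eps / (hp * (h + hp)) + p * (a2 + 2 / dt))) + 1) * v1
        + (dt / 2 * (- 2 * eps / (hp * (h + hp)) + p * (a2 + 2 / dt))) * v2
        + dt / 2 * (m * S (i - 1) + c * S i + p * S (i + 1))"
      unfolding L_hat_def R_scal_def r_minus_def r_plus_def r_cent_def
      by (simp add: SQ h_def hp_def v0_def v1_def v2_def a0_def a1_def a2_def m_def c_def p_def)
    also have "\<dots> = (m * v0 + c * v1 + p * v2) + dt / 2 * ((- 2 * eps / (h + hp)) * ((v2 - v1) / hp - (v1 - v0) / h)
        + (m * (a0 * v0 + S (i - 1)) + c * (a1 * v1 + S i) + p * (a2 * v2 + S (i + 1))))"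
    proof -
      define e1 e2 where "e1 = eps / (h * (h + hp))" and "e2 = eps / (hp * (h + hp))"
      have f: "- 2 * eps / (h * (h + hp)) = - 2 * e1" "- 2 * eps / (hp * (h + hp)) = - 2 * e2"
        "(- 2 * eps / (h + hp)) * ((v2 - v1) / hp - (v1 - v0) / h) = - 2 * e2 * (v2 - v1) + 2 * e1 * (v1 - v0)"
      proof -
        show "- 2 * eps / (h * (h + hp)) = - 2 * e1" "- 2 * eps / (hp * (h + hp)) = - 2 * e2" by (simp_all add: e1_def e2_def)
        define e where "e = eps / (h + hp)"
        have "e1 = e / h" "e2 = e / hp" "- 2 * eps / (h + hp) = - 2 * e" by (simp_all add: e1_def e2_def e_def mult.commute)
        then show "(- 2 * eps / (h + hp)) * ((v2 - v1) / hp - (v1 - v0) / h) = - 2 * e2 * (v2 - v1) + 2 * e1 * (v1 - v0)"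
          by (simp add: right_diff_distrib left_diff_distrib diff_divide_distrib)
      qed
      have g: "dt / 2 * (y + z * (w + 2 / dt)) = dt / 2 * (y + z * w) + z" for y z w
        using dt by (simp add: field_simps)
      show ?thesis unfolding f g s by (simp add: algebra_simps)
    qed
    also have "\<dots> = (Q V i + (dt / 2) *\<^sub>R (Lam V i + Q (\<lambda>l. A (x l) *v V l) i)) $ k"
    proof -
      have q: "Q W i $ k = m * W (i - 1) $ k + c * W i $ k + p * W (i + 1) $ k" for W :: "nat \<Rightarrow> real^'n"
        by (simp add: Q_vec_def Q_scal_def m_def c_def p_def)
      have l: "Lam V i $ k = (- 2 * eps / (h + hp)) * ((v2 - v1) / hp - (v1 - v0) / h)"
        unfolding Lam_def h_def[symmetric] hp_def[symmetric] v0_def v1_def v2_def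
        by (simp only: vector_scaleR_component vector_minus_component real_scaleR_def divide_inverse mult.commute)
      show ?thesis
        unfolding vector_add_component vector_scaleR_component real_scaleR_def q l mv
        unfolding v0_def v1_def v2_def a0_def a1_def a2_def ..
    qed
    finally show ?thesis .
  qed
  then show ?thesis by (simp add: vec_eq_iff)
qed

lemma LH_add: "1 \<le> i \<Longrightarrow> i < N \<Longrightarrow> LH (\<lambda>i. V i + W i) i = LH V i + LH W i"
  by (simp add: L_hat_def R_scal_def Q_scal_def vec_eq_iff sum.distrib algebra_simps)

lemma LH_scale: "1 \<le> i \<Longrightarrow> i < N \<Longrightarrow> LH (\<lambda>i. c *\<^sub>R V i) i = c *\<^sub>R LH V i"
  by (simp add: L_hat_def R_scal_def Q_scal_def vec_eq_iff sum_distrib_left algebra_simps)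

lemma Q_solvable:
  fixes g :: "nat \<Rightarrow> real^'n"
  obtains V where "V \<in> mesh0 N" "\<And>i. 1 \<le> i \<Longrightarrow> i < N \<Longrightarrow> Q V i = g i"
proof -
  have "\<exists>v. v 0 = 0 \<and> (\<forall>i>N - 1. v i = 0) \<and> (\<forall>i. 1 \<le> i \<longrightarrow> i \<le> N - 1 \<longrightarrow>
     qm k i * v (i - 1) + qc k i * v i + qp k i * v (i + 1) = g i $ k)" for k
    by (rule tridiagonal_solvable) (use q_bounds[of _ k] in fastforce)
  then obtain v where v: "\<And>k. v k 0 = 0" "\<And>k i. i > N - 1 \<Longrightarrow> v k i = 0"
    "\<And>k i. 1 \<le> i \<Longrightarrow> i \<le> N - 1 \<Longrightarrow> qm k i * v k (i - 1) + qc k i * v k i + qp k i * v k (i + 1) = g i $ k"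
    by metis
  show ?thesis
  proof (rule that[of "\<lambda>i. \<chi> k. v k i"])
    show "(\<lambda>i. \<chi> k. v k i) \<in> mesh0 N" using v(1,2) N2 by (auto simp: mesh0_def vec_eq_iff)
    fix i assume "1 \<le> i" "i < N"
    then show "Q (\<lambda>i. \<chi> k. v k i) i = g i" using v(3)[of i] by (simp add: Q_vec_def Q_scal_def vec_eq_iff)
  qed
qed

text \<open>At a node and component where the norm is attained the diagonal wins by the margin 1/3,
  whence the factor 3.\<close>

lemma Q_lower_bound:
  assumes V: "V \<in> mesh0 N" and g: "\<And>i k. 1 \<le> i \<Longrightarrow> i < N \<Longrightarrow> \<bar>Q V i $ k\<bar> \<le> B" and B: "B \<ge> 0"
  shows "mesh_norm N V \<le> 3 * B"
proof -
  obtain i k where ik: "i \<le> N" "mesh_norm N V = \<bar>V i $ k\<bar>" by (rule mesh_norm_attained)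
  show ?thesis
  proof (cases "1 \<le> i \<and> i < N")
    case True
    then have i: "1 \<le> i" "i < N" by auto
    define M where "M = mesh_norm N V"
    have M: "M \<ge> 0" unfolding M_def by (rule mesh_norm_nonneg)
    have "\<bar>qm k i * V (i - 1) $ k\<bar> \<le> \<bar>qm k i\<bar> * M" "\<bar>qp k i * V (i + 1) $ k\<bar> \<le> \<bar>qp k i\<bar> * M"
      unfolding abs_mult M_def using i by (auto intro!: mult_left_mono mesh_norm_ge)
    moreover have "\<bar>qc k i * V i $ k\<bar> = qc k i * M" using q_bounds(5)[OF i, of k] ik(2) by (simp add: abs_mult M_def)
    moreover have "(\<bar>qm k i\<bar> + \<bar>qp k i\<bar>) * M \<le> 1 / 2 * M" "5 / 6 * M \<le> qc k i * M"
      by (rule mult_right_mono[OF q_bounds(4)[OF i] M], rule mult_right_mono[OF q_bounds(5)[OF i] M])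
    moreover have "Q V i $ k = qm k i * V (i - 1) $ k + qc k i * V i $ k + qp k i * V (i + 1) $ k"
      by (simp add: Q_vec_def Q_scal_def)
    ultimately have "1 / 3 * M \<le> \<bar>Q V i $ k\<bar>" unfolding distrib_right by linarith
    then show ?thesis using g[OF i, of k] by (simp add: M_def)
  next
    case False
    then have "i = 0 \<or> i = N" using ik(1) by linarith
    then have "V i = 0" using V by (auto simp: mesh0_def)
    then show ?thesis using ik(2) B by simp
  qed
qed

lemma Q_upper_bound:
  assumes "1 \<le> i" "i < N" "\<And>j. j \<le> N \<Longrightarrow> \<bar>V j $ k\<bar> \<le> B"
  shows "\<bar>Q V i $ k\<bar> \<le> 2 * B"
proof -
  have B: "B \<ge> 0" using assms(3)[of 0] by simp
  have "\<bar>qm k i * V (i - 1) $ k\<bar> \<le> 1 / 3 * B" "\<bar>qp k i * V (i + 1) $ k\<bar> \<le> 1 / 3 * B" "\<bar>qc k i * V i $ k\<bar> \<le> 1 * B"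
    unfolding abs_mult using assms(1,2) B by (intro mult_mono q_bounds assms(3); simp)+
  then show ?thesis using B unfolding Q_vec_def Q_scal_def by simp
qed

section \<open>Powers of the transition operator\<close>

context
  fixes c1 :: real and m :: nat
  assumes def: "transition_defined gam A eps dt N x" and c1: "c1 > 0"
    and pow: "\<And>j. 1 \<le> j \<Longrightarrow> j \<le> m \<Longrightarrow> mesh_onorm N (R ^^ j) \<le> c1"
begin

lemma R_step: "V \<in> mesh0 N \<Longrightarrow> transition_step gam A eps dt N x V (R V)"
  unfolding transition_op_def using def unfolding transition_defined_def by (metis theI')

lemma R_unique: "V \<in> mesh0 N \<Longrightarrow> transition_step gam A eps dt N x V W \<Longrightarrow> W = R V"
  using R_step def unfolding transition_defined_def by blast

lemma R_mesh0: "V \<in> mesh0 N \<Longrightarrow> R V \<in> mesh0 N"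
  using R_step unfolding transition_step_def by blast

lemma R_eq: "V \<in> mesh0 N \<Longrightarrow> 1 \<le> i \<Longrightarrow> i < N \<Longrightarrow> LH (R V) i = 2 *\<^sub>R Q V i - LH V i"
  using R_step unfolding transition_step_def by auto

lemma R_add: "V \<in> mesh0 N \<Longrightarrow> W \<in> mesh0 N \<Longrightarrow> R (\<lambda>i. V i + W i) = (\<lambda>i. R V i + R W i)"
proof (rule R_unique[symmetric])
  assume VW: "V \<in> mesh0 N" "W \<in> mesh0 N"
  show "(\<lambda>i. V i + W i) \<in> mesh0 N" using VW by (rule mesh0_add)
  show "transition_step gam A eps dt N x (\<lambda>i. V i + W i) (\<lambda>i. R V i + R W i)"
    unfolding transition_step_def
    using VW by (auto simp: LH_add R_eq Q_add scaleR_add_right intro!: mesh0_add R_mesh0)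
qed

lemma R_scale: "V \<in> mesh0 N \<Longrightarrow> R (\<lambda>i. c *\<^sub>R V i) = (\<lambda>i. c *\<^sub>R R V i)"
proof (rule R_unique[symmetric])
  assume V: "V \<in> mesh0 N"
  show "(\<lambda>i. c *\<^sub>R V i) \<in> mesh0 N" using V by (rule mesh0_scale)
  have "LH (\<lambda>i. c *\<^sub>R R V i) i = 2 *\<^sub>R Q (\<lambda>i. c *\<^sub>R V i) i - LH (\<lambda>i. c *\<^sub>R V i) i" if "1 \<le> i" "i < N" for i
    by (simp add: LH_scale[OF that] R_eq[OF V that] Q_scale scaleR_diff_right)
  then show "transition_step gam A eps dt N x (\<lambda>i. c *\<^sub>R V i) (\<lambda>i. c *\<^sub>R R V i)"
    unfolding transition_step_def using mesh0_scale[OF R_mesh0[OF V], of c] by auto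
qed

lemma Rp_mesh0: "V \<in> mesh0 N \<Longrightarrow> (R ^^ j) V \<in> mesh0 N"
  by (induction j) (auto intro: R_mesh0)

lemma Rp_add: "V \<in> mesh0 N \<Longrightarrow> W \<in> mesh0 N \<Longrightarrow> (R ^^ j) (\<lambda>i. V i + W i) = (\<lambda>i. (R ^^ j) V i + (R ^^ j) W i)"
  by (induction j) (auto simp: R_add Rp_mesh0)

lemma Rp_scale: "V \<in> mesh0 N \<Longrightarrow> (R ^^ j) (\<lambda>i. c *\<^sub>R V i) = (\<lambda>i. c *\<^sub>R (R ^^ j) V i)"
  by (induction j) (auto simp: R_scale Rp_mesh0)

definition unit_fun :: "nat \<Rightarrow> 'n \<Rightarrow> nat \<Rightarrow> real^'n" where
  "unit_fun i k = (\<lambda>l. if l = i then axis k 1 else 0)"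

lemma unit_fun_mesh0: "1 \<le> i \<Longrightarrow> i < N \<Longrightarrow> unit_fun i k \<in> mesh0 N"
  by (auto simp: unit_fun_def mesh0_def)

lemma Rp_sum:
  assumes "finite S" "\<And>p. p \<in> S \<Longrightarrow> F p \<in> mesh0 N"
  shows "(\<lambda>i. \<Sum>p\<in>S. F p i) \<in> mesh0 N \<and> (R ^^ j) (\<lambda>i. \<Sum>p\<in>S. F p i) = (\<lambda>i. \<Sum>p\<in>S. (R ^^ j) (F p) i)"
  using assms
proof (induction S)
  case empty
  have "(R ^^ j) (\<lambda>i. 0 *\<^sub>R (0 :: real^'n)) = (\<lambda>i. 0 *\<^sub>R (R ^^ j) (\<lambda>i. 0) i)" by (rule Rp_scale[OF mesh0_zero])
  then show ?case by (simp add: mesh0_zero)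
next
  case (insert p S)
  then show ?case using Rp_add[of "F p" "\<lambda>i. \<Sum>p\<in>S. F p i" j] mesh0_add[of "F p" N "\<lambda>i. \<Sum>p\<in>S. F p i"] by auto
qed

text \<open>The supremum in the operator norm is over a bounded set, because \<open>mesh0\<close> is spanned by
  finitely many unit functions.\<close>

lemma Rp_bdd:
  obtains B where "\<And>V. V \<in> mesh0 N \<Longrightarrow> mesh_norm N ((R ^^ j) V) \<le> B * mesh_norm N V"
proof -
  define I where "I = {1..<N} \<times> (UNIV :: 'n set)"
  define B where "B = (\<Sum>p\<in>I. mesh_norm N ((R ^^ j) (unit_fun (fst p) (snd p))))"
  have "mesh_norm N ((R ^^ j) V) \<le> B * mesh_norm N V" if V: "V \<in> mesh0 N" for V
  proof -
    define F where "F p = (\<lambda>i. (V (fst p) $ snd p) *\<^sub>R unit_fun (fst p) (snd p) i)" for p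
    have F: "F p \<in> mesh0 N" if "p \<in> I" for p
      unfolding F_def using that by (intro mesh0_scale unit_fun_mesh0) (auto simp: I_def)
    have "V = (\<lambda>i. \<Sum>p\<in>I. F p i)"
    proof
      fix i
      have "(\<Sum>p\<in>I. F p i) = (\<Sum>l\<in>{1..<N}. \<Sum>k\<in>UNIV. (V l $ k) *\<^sub>R (if i = l then axis k 1 else 0))"
        unfolding I_def by (simp add: sum.cartesian_product F_def unit_fun_def case_prod_beta)
      also have "\<dots> = (\<Sum>l\<in>{1..<N}. if i = l then V l else 0)"
      proof (rule sum.cong[OF refl])
        fix l
        have "(\<Sum>k\<in>UNIV. (V l $ k) *\<^sub>R axis k 1) = V l"
          by (simp add: vec_eq_iff axis_def if_distrib cong: if_cong)
        then show "(\<Sum>k\<in>UNIV. (V l $ k) *\<^sub>R (if i = l then axis k 1 else 0)) = (if i = l then V l else 0)"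
          by (auto simp: if_distrib cong: if_cong)
      qed
      also have "\<dots> = V i" using V by (auto simp: mesh0_def not_le Suc_le_eq)
      finally show "V i = (\<Sum>p\<in>I. F p i)" by (rule sym)
    qed
    moreover have "(R ^^ j) (\<lambda>i. \<Sum>p\<in>I. F p i) = (\<lambda>i. \<Sum>p\<in>I. (R ^^ j) (F p) i)"
      by (rule conjunct2[OF Rp_sum]) (auto simp: I_def intro!: F[unfolded I_def])
    ultimately have "(R ^^ j) V = (\<lambda>i. \<Sum>p\<in>I. (R ^^ j) (F p) i)" by simp
    also have "\<dots> = (\<lambda>i. \<Sum>p\<in>I. (V (fst p) $ snd p) *\<^sub>R (R ^^ j) (unit_fun (fst p) (snd p)) i)"
    proof (intro ext sum.cong refl)
      fix p i assume "p \<in> I"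
      then have "unit_fun (fst p) (snd p) \<in> mesh0 N" by (intro unit_fun_mesh0) (auto simp: I_def)
      then show "(R ^^ j) (F p) i = (V (fst p) $ snd p) *\<^sub>R (R ^^ j) (unit_fun (fst p) (snd p)) i"
        unfolding F_def by (simp add: Rp_scale)
    qed
    finally have e: "(R ^^ j) V = \<dots>" .
    have sn: "mesh_norm N (\<lambda>i. \<Sum>p\<in>S. G p i) \<le> (\<Sum>p\<in>S. mesh_norm N (G p))" if "finite S" for S :: "(nat \<times> 'n) set" and G :: "nat \<times> 'n \<Rightarrow> nat \<Rightarrow> real^'n"
      using that
    proof (induction S)
      case empty
      then show ?case by (auto intro!: mesh_norm_leI)
    next
      case (insert p S)
      then show ?case using mesh_norm_triangle[of N "G p" "\<lambda>i. \<Sum>p\<in>S. G p i"] by simp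
    qed
    have "mesh_norm N ((R ^^ j) V) \<le> (\<Sum>p\<in>I. mesh_norm N (\<lambda>i. (V (fst p) $ snd p) *\<^sub>R (R ^^ j) (unit_fun (fst p) (snd p)) i))"
      unfolding e by (rule sn) (simp add: I_def)
    also have "\<dots> \<le> (\<Sum>p\<in>I. mesh_norm N ((R ^^ j) (unit_fun (fst p) (snd p))) * mesh_norm N V)"
    proof (rule sum_mono)
      fix p assume "p \<in> I"
      then have "\<bar>V (fst p) $ snd p\<bar> \<le> mesh_norm N V" by (intro mesh_norm_ge) (auto simp: I_def)
      then show "mesh_norm N (\<lambda>i. (V (fst p) $ snd p) *\<^sub>R (R ^^ j) (unit_fun (fst p) (snd p)) i)
          \<le> mesh_norm N ((R ^^ j) (unit_fun (fst p) (snd p))) * mesh_norm N V"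
        unfolding mult.commute[of _ "mesh_norm N V"]
        by (intro order_trans[OF mesh_norm_scale] mult_right_mono mesh_norm_nonneg)
    qed
    also have "\<dots> = B * mesh_norm N V" by (simp add: B_def sum_distrib_right)
    finally show ?thesis .
  qed
  then show ?thesis using that by blast
qed

text \<open>Reads a bound for each \<open>V\<close> off the supremum, for which the quotients must
  be bounded above. The constant \<open>1 + c1\<close> covers the power 0 as well.\<close>

lemma Rp_norm:
  assumes V: "V \<in> mesh0 N" and j: "j \<le> m"
  shows "mesh_norm N ((R ^^ j) V) \<le> (1 + c1) * mesh_norm N V"
proof (cases "j = 0")
  case True
  then show ?thesis using mesh_norm_nonneg[of N V] c1 by (simp add: distrib_right)
next
  case False
  obtain B where B: "\<And>V. V \<in> mesh0 N \<Longrightarrow> mesh_norm N ((R ^^ j) V) \<le> B * mesh_norm N V" using Rp_bdd by blast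
  have bdd: "bdd_above ((\<lambda>V. mesh_norm N ((R ^^ j) V) / mesh_norm N V) ` mesh0 N)"
  proof (rule bdd_aboveI2[of _ _ "\<bar>B\<bar>"])
    fix V :: "nat \<Rightarrow> real^'n" assume V: "V \<in> mesh0 N"
    show "mesh_norm N ((R ^^ j) V) / mesh_norm N V \<le> \<bar>B\<bar>"
    proof (cases "mesh_norm N V = 0")
      case False
      then have "mesh_norm N V > 0" using mesh_norm_nonneg[of N V] by linarith
      then have "mesh_norm N ((R ^^ j) V) / mesh_norm N V \<le> B" using B[OF V] by (simp add: divide_le_eq)
      then show ?thesis by linarith
    qed simp
  qed
  show ?thesis
  proof (cases "mesh_norm N V = 0")
    case True
    then show ?thesis using B[OF V] mesh_norm_nonneg[of N "(R ^^ j) V"] by simp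
  next
    case False
    then have p: "mesh_norm N V > 0" using mesh_norm_nonneg[of N V] by linarith
    have "mesh_norm N ((R ^^ j) V) / mesh_norm N V \<le> mesh_onorm N (R ^^ j)"
      unfolding mesh_onorm_def by (rule cSUP_upper[OF V bdd])
    also have "\<dots> \<le> c1" using pow[of j] j \<open>j \<noteq> 0\<close> by simp
    finally have "mesh_norm N ((R ^^ j) V) \<le> c1 * mesh_norm N V" using p by (simp add: divide_le_eq)
    then show ?thesis using p by (simp add: distrib_right)
  qed
qed

text \<open>Since $R = 2\widehat L^{-1}Q - I$, the bound on \<open>R\<close> also controls $\widehat L^{-1}Q$, hence $\widehat L^{-1}$.\<close>

proposition stability:
  fixes e g :: "nat \<Rightarrow> nat \<Rightarrow> real^'n"
  assumes m: "1 \<le> m" and e: "\<And>n. n \<le> m \<Longrightarrow> e n \<in> mesh0 N" and e0: "e 0 = (\<lambda>i. 0)"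
    and rec: "\<And>n i. n < m \<Longrightarrow> 1 \<le> i \<Longrightarrow> i < N \<Longrightarrow> LH (e (Suc n)) i = 2 *\<^sub>R Q (e n) i - LH (e n) i + g n i"
    and g: "\<And>n i k. n < m \<Longrightarrow> 1 \<le> i \<Longrightarrow> i < N \<Longrightarrow> \<bar>g n i $ k\<bar> \<le> B" and B: "B \<ge> 0" and n: "n \<le> m"
  shows "mesh_norm N (e n) \<le> n * ((1 + c1) * (3 * (2 + c1) * B))"
proof -
  have "\<exists>V. V \<in> mesh0 N \<and> (\<forall>i. 1 \<le> i \<longrightarrow> i < N \<longrightarrow> Q V i = g n i)" for n
    using Q_solvable[of "g n"] by metis
  then obtain v where v: "\<And>n. v n \<in> mesh0 N" "\<And>n i. 1 \<le> i \<Longrightarrow> i < N \<Longrightarrow> Q (v n) i = g n i" by metis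
  \<comment> \<open>Adding \<open>LH V\<close> to the defining relation of \<open>R V\<close> gives
    \<open>LH (R V + V) = 2 Q V\<close>. With \<open>Q (v n) = g n\<close> this makes
    \<open>s n\<close> the solution of \<open>LH (s n) = g n\<close>, bounded through
    \<open>R\<close> and \<open>v n\<close>.\<close>
  define s where "s n = (\<lambda>i. (1 / 2 :: real) *\<^sub>R (R (v n) i + v n i))" for n
  have s0: "s n \<in> mesh0 N" for n unfolding s_def by (intro mesh0_scale mesh0_add R_mesh0 v)
  have Ls: "LH (s n) i = g n i" if "1 \<le> i" "i < N" for n i
    unfolding s_def LH_scale[OF that] LH_add[OF that] R_eq[OF v(1) that] by (simp add: v(2)[OF that])
  have sn: "mesh_norm N (s n) \<le> 3 * (2 + c1) * B" if "n < m" for n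
  proof -
    have vn: "mesh_norm N (v n) \<le> 3 * B"
      by (rule Q_lower_bound[OF v(1) _ B]) (simp add: v(2) g[OF that])
    have "mesh_norm N (s n) \<le> 1 / 2 * mesh_norm N (\<lambda>i. R (v n) i + v n i)" unfolding s_def using mesh_norm_scale[of N "1/2" "\<lambda>i. R (v n) i + v n i"] by simp
    also have "\<dots> \<le> 1 / 2 * (mesh_norm N (R (v n)) + mesh_norm N (v n))" by (intro mult_left_mono mesh_norm_triangle) auto
    also have "\<dots> \<le> 1 / 2 * ((1 + c1) * mesh_norm N (v n) + mesh_norm N (v n))"
      using Rp_norm[OF v(1), of 1 n] m by (intro mult_left_mono add_mono) auto
    also have "\<dots> = (2 + c1) / 2 * mesh_norm N (v n)" by (simp add: algebra_simps)
    also have "\<dots> \<le> (2 + c1) / 2 * (3 * B)" using vn c1 by (intro mult_left_mono) auto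
    also have "\<dots> \<le> 3 * (2 + c1) * B" using c1 B by (simp add: field_simps)
    finally show ?thesis .
  qed
  have step: "e (Suc n) = (\<lambda>i. R (e n) i + s n i)" if n: "n < m" for n
  proof -
    have "(\<lambda>i. e (Suc n) i + (- 1 :: real) *\<^sub>R s n i) = R (e n)"
    proof (rule R_unique)
      show "e n \<in> mesh0 N" using e n by simp
      have "LH (\<lambda>i. e (Suc n) i + (- 1 :: real) *\<^sub>R s n i) i = 2 *\<^sub>R Q (e n) i - LH (e n) i" if "1 \<le> i" "i < N" for i
        unfolding LH_add[OF that] LH_scale[OF that] Ls[OF that] rec[OF n that] by simp
      moreover have "(\<lambda>i. e (Suc n) i + (- 1 :: real) *\<^sub>R s n i) \<in> mesh0 N"
        using e[of "Suc n"] n s0 by (intro mesh0_add mesh0_scale) auto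
      ultimately show "transition_step gam A eps dt N x (e n) (\<lambda>i. e (Suc n) i + (- 1 :: real) *\<^sub>R s n i)"
        unfolding transition_step_def by auto
    qed
    then show ?thesis by (auto simp: fun_eq_iff algebra_simps)
  qed
  \<comment> \<open>Generalised to \<open>R ^^ j\<close> applied to the error: the recursion turns
    \<open>e (Suc n)\<close> into one more power of \<open>R\<close> on \<open>e n\<close> plus
    \<open>R ^^ j\<close> on a source. Each source is thus hit by a single power, and the norms add
    instead of multiplying.\<close>
  have main: "j + n \<le> m \<Longrightarrow> mesh_norm N ((R ^^ j) (e n)) \<le> n * ((1 + c1) * (3 * (2 + c1) * B))" for j
  proof (induction n arbitrary: j)
    case 0
    have "(R ^^ j) (e 0) = (\<lambda>i. 0)"
      using Rp_sum[of "{}" "\<lambda>_::nat. undefined" j] e0 by simp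
    then show ?case by (auto intro!: mesh_norm_leI)
  next
    case (Suc n)
    have "(R ^^ j) (e (Suc n)) = (\<lambda>i. (R ^^ Suc j) (e n) i + (R ^^ j) (s n) i)"
      using step[of n] Suc.prems Rp_add[OF R_mesh0[OF e] s0, of n j n] by (simp add: funpow_swap1)
    then have "mesh_norm N ((R ^^ j) (e (Suc n))) \<le> mesh_norm N ((R ^^ Suc j) (e n)) + mesh_norm N ((R ^^ j) (s n))"
      by (simp only: mesh_norm_triangle)
    also have "\<dots> \<le> n * ((1 + c1) * (3 * (2 + c1) * B)) + (1 + c1) * (3 * (2 + c1) * B)"
    proof (intro add_mono)
      show "mesh_norm N ((R ^^ Suc j) (e n)) \<le> n * ((1 + c1) * (3 * (2 + c1) * B))" using Suc.IH[of "Suc j"] Suc.prems by simp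
      have "mesh_norm N ((R ^^ j) (s n)) \<le> (1 + c1) * mesh_norm N (s n)" using Suc.prems by (intro Rp_norm s0) simp
      also have "\<dots> \<le> (1 + c1) * (3 * (2 + c1) * B)" using sn[of n] Suc.prems c1 by (intro mult_left_mono) auto
      finally show "mesh_norm N ((R ^^ j) (s n)) \<le> (1 + c1) * (3 * (2 + c1) * B)" .
    qed
    also have "\<dots> = real (Suc n) * ((1 + c1) * (3 * (2 + c1) * B))" by (simp add: algebra_simps)
    finally show ?case .
  qed
  show ?thesis using main[of 0] n by simp
qed

end
end

section \<open>The differentiated parabolic system\<close>

text \<open>Equality of mixed derivatives on the closed rectangle with one-sided derivatives. The
  function is written as its initial value plus the time integral of \<open>gt\<close>,
  differentiated in x under the integral, and then in t by the fundamental theorem.\<close>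

lemma swap_derivatives:
  fixes g gt gx gtx :: "real \<Rightarrow> real \<Rightarrow> real"
  assumes T: "T > 0"
    and dt: "\<And>x t. x \<in> {0..1} \<Longrightarrow> t \<in> {0..T} \<Longrightarrow> (g x has_real_derivative gt x t) (at t within {0..T})"
    and dx: "\<And>x t. x \<in> {0..1} \<Longrightarrow> t \<in> {0..T} \<Longrightarrow> ((\<lambda>y. g y t) has_real_derivative gx x t) (at x within {0..1})"
    and dtx: "\<And>x t. x \<in> {0..1} \<Longrightarrow> t \<in> {0..T} \<Longrightarrow> ((\<lambda>y. gt y t) has_real_derivative gtx x t) (at x within {0..1})"
    and ct: "continuous_on ({0..1} \<times> {0..T}) (\<lambda>(x, t). gt x t)"
    and ctx: "continuous_on ({0..1} \<times> {0..T}) (\<lambda>(x, t). gtx x t)"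
    and x: "x \<in> {0..1}" and t: "t \<in> {0..T}"
  shows "(gx x has_real_derivative gtx x t) (at t within {0..T})"
proof -
  have eq: "gx x s = gx x 0 + integral {0..s} (gtx x)" if s: "s \<in> {0..T}" for s
  proof -
    have i: "gt y integrable_on {0..s}" if "y \<in> {0..1}" for y
      using that s by (intro integrable_continuous_interval continuous_on_slice[OF ct] continuous_intros) auto
    have "((\<lambda>y. integral (cbox 0 s) (gt y)) has_real_derivative integral (cbox 0 s) (gtx x)) (at x within {0..1})"
    proof (rule leibniz_rule_field_derivative)
      show "((\<lambda>y. gt y r) has_real_derivative gtx y r) (at y within {0..1})" if "y \<in> {0..1}" "r \<in> cbox 0 s" for y r
        using dtx[of y r] that s by auto
      show "continuous_on ({0..1} \<times> cbox 0 s) (\<lambda>(y, r). gtx y r)"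
        by (rule continuous_on_subset[OF ctx]) (use s in auto)
    qed (use i x in auto)
    then have "((\<lambda>y. g y 0 + integral {0..s} (gt y)) has_real_derivative gx x 0 + integral {0..s} (gtx x)) (at x within {0..1})"
      using dx[OF x, of 0] T by (auto intro!: derivative_eq_intros)
    moreover have "g y s = g y 0 + integral {0..s} (gt y)" if y: "y \<in> {0..1}" for y
    proof -
      have "(gt y has_integral (g y s - g y 0)) {0..s}"
      proof (rule fundamental_theorem_of_calculus)
        fix r assume "r \<in> {0..s}"
        then show "(g y has_vector_derivative gt y r) (at r within {0..s})"
          using has_field_derivative_subset[OF dt[OF y, of r], of "{0..s}"] s
          by (auto simp: has_real_derivative_iff_has_vector_derivative)
      qed (use s in auto)
      then show ?thesis by (simp add: integral_unique)
    qed
    ultimately have "((\<lambda>y. g y s) has_real_derivative gx x 0 + integral {0..s} (gtx x)) (at x within {0..1})"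
      unfolding has_real_derivative_iff_has_vector_derivative
      by (rule has_vector_derivative_transform[OF x, rotated])
    moreover have "at x within {0..1} \<noteq> bot" using x by (simp add: trivial_limit_within islimpt_Icc)
    ultimately show ?thesis
      using dx[OF x s] vector_derivative_unique_within by (metis has_real_derivative_iff_has_vector_derivative)
  qed
  have "((\<lambda>s. integral {0..s} (gtx x)) has_vector_derivative gtx x t) (at t within {0..T})"
    using x by (intro integral_has_vector_derivative continuous_on_slice[OF ctx] continuous_intros t) auto
  then have "((\<lambda>s. gx x 0 + integral {0..s} (gtx x)) has_real_derivative gtx x t) (at t within {0..T})"
    by (auto intro!: derivative_eq_intros simp: has_real_derivative_iff_has_vector_derivative)
  then show ?thesis
    unfolding has_real_derivative_iff_has_vector_derivative
    by (rule has_vector_derivative_transform[OF t eq, rotated])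
qed

lemma pd_Suc: "pd T (Suc s) q v x t = vector_derivative (\<lambda>y. pd T s q v y t) (at x within {0..1})"
  by (simp add: pd_def pdx_def dx_def)

lemma pd_0_Suc: "pd T 0 (Suc q) v x t = vector_derivative (\<lambda>r. pd T 0 q v x r) (at t within {0..T})"
  by (simp add: pd_def pdt_def)

lemma C_par_continuous:
  "C_par T m v \<Longrightarrow> s + 2 * q \<le> 2 * m \<Longrightarrow> continuous_on ({0..1} \<times> {0..T}) (\<lambda>(x, t). pd T s q v x t)"
  unfolding C_par_def by blast

lemma C_par_dx:
  assumes "C_par T m v" "s + 2 * q < 2 * m" "x \<in> {0..1}" "t \<in> {0..T}"
  shows "((\<lambda>y. pd T s q v y t) has_real_derivative pd T (Suc s) q v x t) (at x within {0..1})"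
proof -
  have "(\<lambda>y. pd T s q v y t) differentiable (at x within {0..1})" using assms unfolding C_par_def by blast
  then show ?thesis unfolding pd_Suc has_real_derivative_iff_has_vector_derivative by (simp add: vector_derivative_works)
qed

text \<open>\<open>C_par\<close> postulates time differentiability only without x-derivatives;
  interchanging derivatives raises \<open>s\<close> one at a time.\<close>

lemma C_par_dt:
  assumes T: "T > 0" and v: "C_par T m v"
  shows "s + 2 * q + 2 \<le> 2 * m \<Longrightarrow> x \<in> {0..1} \<Longrightarrow> t \<in> {0..T} \<Longrightarrow>
    (pd T s q v x has_real_derivative pd T s (Suc q) v x t) (at t within {0..T})"
proof (induction s arbitrary: x t)
  case 0
  then have "(\<lambda>r. pd T 0 q v x r) differentiable (at t within {0..T})" using v unfolding C_par_def by auto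
  then show ?case unfolding pd_0_Suc has_real_derivative_iff_has_vector_derivative by (simp add: vector_derivative_works)
next
  case (Suc s)
  show ?case
    by (rule swap_derivatives[OF T Suc.IH C_par_dx[OF v] C_par_dx[OF v] C_par_continuous[OF v] C_par_continuous[OF v] Suc.prems(2,3)])
       (use Suc.prems in auto)
qed

lemma finite_uniform_bound:
  assumes "finite I" "\<And>i. i \<in> I \<Longrightarrow> \<exists>C::real. \<forall>z\<in>Z. F i z \<le> C * w z" "\<And>z. z \<in> Z \<Longrightarrow> 0 \<le> w z"
  obtains C where "C \<ge> 0" "\<And>i z. i \<in> I \<Longrightarrow> z \<in> Z \<Longrightarrow> F i z \<le> C * w z"
proof -
  obtain c where c: "\<And>i z. i \<in> I \<Longrightarrow> z \<in> Z \<Longrightarrow> F i z \<le> c i * w z" using assms(2) by metis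
  show ?thesis
  proof (rule that[of "\<Sum>i\<in>I. \<bar>c i\<bar>"])
    fix i z assume iz: "i \<in> I" "z \<in> Z"
    have "c i \<le> \<bar>c i\<bar>" by simp
    also have "\<dots> \<le> (\<Sum>i\<in>I. \<bar>c i\<bar>)" using iz assms(1) by (intro member_le_sum) auto
    finally have "c i * w z \<le> (\<Sum>i\<in>I. \<bar>c i\<bar>) * w z" using assms(3)[OF iz(2)] by (rule mult_right_mono)
    then show "F i z \<le> (\<Sum>i\<in>I. \<bar>c i\<bar>) * w z" using c[OF iz] by linarith
  qed (simp add: sum_nonneg)
qed

lemma C_par_bounded:
  assumes "C_par T m v" "s + 2 * q \<le> 2 * m"
  shows "\<exists>C. \<forall>z\<in>{0..1} \<times> {0..T}. \<bar>pd T s q v (fst z) (snd z)\<bar> \<le> C"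
proof -
  have "compact ((\<lambda>(x, t). pd T s q v x t) ` ({0..1} \<times> {0..T}))"
    by (intro compact_continuous_image C_par_continuous[OF assms] compact_Times) auto
  then have "bounded ((\<lambda>(x, t). pd T s q v x t) ` ({0..1} \<times> {0..T}))" by (rule compact_imp_bounded)
  then show ?thesis unfolding bounded_iff by (auto simp: case_prod_beta)
qed

text \<open>The class gives Hoelder bounds at top order only. Orders with room for another time
  derivative are Lipschitz in time.\<close>

lemma C_par_hoelder_time:
  assumes T: "T > 0" and \<alpha>: "0 < \<alpha>" "\<alpha> < 1" and v: "C_par_hoelder T 2 \<alpha> v" and sq: "s + 2 * q \<le> 4" "q = 0 \<or> s = 0"
  shows "\<exists>C. \<forall>x\<in>{0..1}. \<forall>t\<in>{0..T}. \<forall>r\<in>{0..T}. \<bar>pd T s q v x t - pd T s q v x r\<bar> \<le> C * \<bar>t - r\<bar> powr (\<alpha> / 2)"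
proof -
  have v2: "C_par T 2 v" using v by (simp add: C_par_hoelder_def)
  have top: "\<exists>C. \<forall>x\<in>{0..1}. \<forall>t\<in>{0..T}. \<forall>r\<in>{0..T}. \<bar>pd T s q v x t - pd T s q v x r\<bar> \<le> C * \<bar>t - r\<bar> powr (\<alpha> / 2)"
    if "s + 2 * q = 4" for s q
  proof -
    have "s + 2 * q = 2 * 2" using that by simp
    with v have "\<exists>H. \<forall>x\<in>{0..1}. \<forall>y\<in>{0..1}. \<forall>t\<in>{0..T}. \<forall>r\<in>{0..T}.
       \<bar>pd T s q v x t - pd T s q v y r\<bar> \<le> H * (\<bar>x - y\<bar> powr \<alpha> + \<bar>t - r\<bar> powr (\<alpha> / 2))"
      unfolding C_par_hoelder_def by simp
    then obtain H where H: "\<forall>x\<in>{0..1}. \<forall>y\<in>{0..1}. \<forall>t\<in>{0..T}. \<forall>r\<in>{0..T}.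
       \<bar>pd T s q v x t - pd T s q v y r\<bar> \<le> H * (\<bar>x - y\<bar> powr \<alpha> + \<bar>t - r\<bar> powr (\<alpha> / 2))" ..
    show ?thesis
    proof (intro exI[of _ H] ballI)
      fix x t r :: real assume h: "x \<in> {0..1}" "t \<in> {0..T}" "r \<in> {0..T}"
      show "\<bar>pd T s q v x t - pd T s q v x r\<bar> \<le> H * \<bar>t - r\<bar> powr (\<alpha> / 2)"
        using bspec[OF bspec[OF bspec[OF bspec[OF H h(1)] h(1)] h(2)] h(3)] by simp
    qed
  qed
  have lip: "\<exists>C. \<forall>x\<in>{0..1}. \<forall>t\<in>{0..T}. \<forall>r\<in>{0..T}. \<bar>pd T s q v x t - pd T s q v x r\<bar> \<le> C * \<bar>t - r\<bar> powr (\<alpha> / 2)"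
    if l: "s + 2 * q + 2 \<le> 4" for s q
  proof -
    obtain C where C: "\<forall>z\<in>{0..1} \<times> {0..T}. \<bar>pd T s (Suc q) v (fst z) (snd z)\<bar> \<le> C"
      using C_par_bounded[OF v2, of s "Suc q"] l by auto
    have C': "\<And>x t. x \<in> {0..1} \<Longrightarrow> t \<in> {0..T} \<Longrightarrow> \<bar>pd T s (Suc q) v x t\<bar> \<le> C" using C by auto
    have C0: "C \<ge> 0" using C'[of 0 0] T by auto
    show ?thesis
    proof (intro exI[of _ "C * (T + 1)"] ballI)
      fix x t r :: real assume h: "x \<in> {0..1}" "t \<in> {0..T}" "r \<in> {0..T}"
      have "norm (pd T s q v x t - pd T s q v x r) \<le> C * \<bar>t - r\<bar>"
        by (rule vector_lipschitz[of "{0..T}" r t "pd T s q v x" "pd T s (Suc q) v x"])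
           (use h C' l C_par_dt[OF T v2 _ h(1)] in \<open>auto simp: has_real_derivative_iff_has_vector_derivative[symmetric]\<close>)
      also have "\<dots> \<le> C * ((T + 1) * \<bar>t - r\<bar> powr (\<alpha> / 2))"
        using h \<alpha> C0 by (intro mult_left_mono le_powr_bound) auto
      finally show "\<bar>pd T s q v x t - pd T s q v x r\<bar> \<le> C * (T + 1) * \<bar>t - r\<bar> powr (\<alpha> / 2)" by simp
    qed
  qed
  \<comment> \<open>The third space derivative is the gap: not of top order, yet without room for a
    time derivative. Its time differences are interpolated between those of orders 2 and 4 with a
    step of length 1/2.\<close>
  have "s + 2 * q = 4 \<or> s + 2 * q + 2 \<le> 4 \<or> s = 3 \<and> q = 0" using sq by presburger
  then consider "s + 2 * q = 4" | "s + 2 * q + 2 \<le> 4" | "s = 3" "q = 0" by blast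
  then show ?thesis
  proof cases
    case 3
    have "2 + 2 * 0 + 2 \<le> (4::nat)" by simp
    from lip[OF this] obtain C2 where C2: "\<forall>x\<in>{0..1}. \<forall>t\<in>{0..T}. \<forall>r\<in>{0..T}.
        \<bar>pd T 2 0 v x t - pd T 2 0 v x r\<bar> \<le> C2 * \<bar>t - r\<bar> powr (\<alpha> / 2)" ..
    note C2 = C2[rule_format]
    have "4 + 2 * 0 = (4::nat)" by simp
    from top[OF this] obtain C4 where C4: "\<forall>x\<in>{0..1}. \<forall>t\<in>{0..T}. \<forall>r\<in>{0..T}.
        \<bar>pd T 4 0 v x t - pd T 4 0 v x r\<bar> \<le> C4 * \<bar>t - r\<bar> powr (\<alpha> / 2)" ..
    note C4 = C4[rule_format]
    show ?thesis
    proof (intro exI[of _ "4 * C2 + C4"] ballI)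
      fix x t r :: real assume h: "x \<in> {0..1}" "t \<in> {0..T}" "r \<in> {0..T}"
      define p where "p = \<bar>t - r\<bar> powr (\<alpha> / 2)"
      define y where "y = (if x \<le> 1 / 2 then x + 1 / 2 else x - 1 / 2)"
      have y: "y \<in> {0..1}" "\<bar>y - x\<bar> = 1 / 2" "(y - x)\<^sup>2 = 1 / 4" using h by (auto simp: y_def power2_eq_square)
      have "\<bar>y - x\<bar> * norm (pd T 3 0 v x t - pd T 3 0 v x r) \<le> 2 * (C2 * p) + (C4 * p) * (y - x)\<^sup>2"
      proof (rule landau_inequality[of "{0..1}" x y "\<lambda>x. pd T 2 0 v x t - pd T 2 0 v x r"
            "\<lambda>x. pd T 3 0 v x t - pd T 3 0 v x r" "\<lambda>x. pd T 4 0 v x t - pd T 4 0 v x r"])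
        fix z :: real assume z: "z \<in> {0..1}"
        show "((\<lambda>x. pd T 2 0 v x t - pd T 2 0 v x r) has_vector_derivative pd T 3 0 v z t - pd T 3 0 v z r) (at z within {0..1})"
          using C_par_dx[OF v2 _ z h(2), of 2 0] C_par_dx[OF v2 _ z h(3), of 2 0]
          by (auto intro!: has_vector_derivative_diff simp: has_real_derivative_iff_has_vector_derivative eval_nat_numeral)
        show "((\<lambda>x. pd T 3 0 v x t - pd T 3 0 v x r) has_vector_derivative pd T 4 0 v z t - pd T 4 0 v z r) (at z within {0..1})"
          using C_par_dx[OF v2 _ z h(2), of 3 0] C_par_dx[OF v2 _ z h(3), of 3 0]
          by (auto intro!: has_vector_derivative_diff simp: has_real_derivative_iff_has_vector_derivative eval_nat_numeral)
      qed (use y h C2 C4 in \<open>auto simp: p_def\<close>)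
      then have "\<bar>pd T 3 0 v x t - pd T 3 0 v x r\<bar> \<le> 4 * (C2 * p) + C4 * p / 2" unfolding y by simp
      moreover have "0 \<le> C4 * p" using C4[OF h(1,2,3)] unfolding p_def by linarith
      ultimately show "\<bar>pd T s q v x t - pd T s q v x r\<bar> \<le> (4 * C2 + C4) * \<bar>t - r\<bar> powr (\<alpha> / 2)"
        unfolding p_def[symmetric] using 3 by (simp add: distrib_right)
    qed
  qed (use top lip in auto)
qed

text \<open>The induction step of the Leibniz rule, with \<open>X i j\<close> for the product of an
  i-th and a j-th derivative.\<close>

lemma pascal_sum:
  fixes X :: "nat \<Rightarrow> nat \<Rightarrow> 'a::real_vector"
  shows "(\<Sum>l\<le>s. real (s choose l) *\<^sub>R (X (Suc l) (s - l) + X l (Suc s - l))) =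
    (\<Sum>l\<le>Suc s. real (Suc s choose l) *\<^sub>R X l (Suc s - l))"
proof -
  have 1: "(\<Sum>l\<le>s. real (s choose l) *\<^sub>R X l (Suc s - l)) = X 0 (Suc s) + (\<Sum>l\<le>s. real (s choose Suc l) *\<^sub>R X (Suc l) (s - l))"
  proof -
    have "(\<Sum>l\<le>Suc s. real (s choose l) *\<^sub>R X l (Suc s - l)) = X 0 (Suc s) + (\<Sum>l\<le>s. real (s choose Suc l) *\<^sub>R X (Suc l) (s - l))"
      by (subst sum.atMost_Suc_shift) simp
    moreover have "s choose Suc s = 0" by (rule binomial_eq_0) simp
    ultimately show ?thesis by simp
  qed
  have "(\<Sum>l\<le>Suc s. real (Suc s choose l) *\<^sub>R X l (Suc s - l)) =
      X 0 (Suc s) + (\<Sum>l\<le>s. real (Suc s choose Suc l) *\<^sub>R X (Suc l) (s - l))"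
    by (subst sum.atMost_Suc_shift) simp
  also have "\<dots> = X 0 (Suc s) + (\<Sum>l\<le>s. real (s choose Suc l) *\<^sub>R X (Suc l) (s - l)) + (\<Sum>l\<le>s. real (s choose l) *\<^sub>R X (Suc l) (s - l))"
    by (simp add: scaleR_add_left sum.distrib add_ac)
  finally show ?thesis using 1 by (simp add: scaleR_add_right sum.distrib)
qed

lemma vec_lambda_axis:
  fixes v :: "'n::finite \<Rightarrow> real"
  shows "(\<chi> k. v k) = (\<Sum>k\<in>UNIV. v k *\<^sub>R axis k (1::real))"
  by (simp add: vec_eq_iff axis_def if_distrib[where f="\<lambda>z. _ * z"] cong: if_cong)

lemma has_vector_derivative_vec:
  fixes g :: "real \<Rightarrow> 'n::finite \<Rightarrow> real"
  assumes "\<And>k. ((\<lambda>y. g y k) has_real_derivative g' k) (at x within S)"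
  shows "((\<lambda>y. \<chi> k. g y k) has_vector_derivative (\<chi> k. g' k)) (at x within S)"
  unfolding vec_lambda_axis using assms
  by (intro has_vector_derivative_sum) (auto intro!: derivative_eq_intros)


lemma has_vector_derivative_matrix_vector:
  fixes A :: "real \<Rightarrow> real^'n^'n" and U :: "real \<Rightarrow> real^'n"
  assumes "\<And>k j. ((\<lambda>y. A y $ k $ j) has_real_derivative A' $ k $ j) (at x within S)"
    and "\<And>j. ((\<lambda>y. U y $ j) has_real_derivative U' $ j) (at x within S)"
  shows "((\<lambda>y. A y *v U y) has_vector_derivative A' *v U x + A x *v U') (at x within S)"
proof -
  have "((\<lambda>y. \<chi> k. \<Sum>j\<in>UNIV. A y $ k $ j * U y $ j) has_vector_derivative
      (\<chi> k. \<Sum>j\<in>UNIV. A' $ k $ j * U x $ j + U' $ j * A x $ k $ j)) (at x within S)"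
    by (intro has_vector_derivative_vec DERIV_sum DERIV_mult assms)
  moreover have "(\<chi> k. \<Sum>j\<in>UNIV. A' $ k $ j * U x $ j + U' $ j * A x $ k $ j) = A' *v U x + A x *v U'"
    by (simp add: vec_eq_iff matrix_vector_mult_def sum.distrib mult.commute)
  ultimately show ?thesis by (simp add: matrix_vector_mult_def)
qed

lemma has_vector_derivative_components:
  fixes g :: "real \<Rightarrow> real^'n"
  assumes "\<And>k. ((\<lambda>y. g y $ k) has_real_derivative g' $ k) (at x within S)"
  shows "(g has_vector_derivative g') (at x within S)"
  using has_vector_derivative_vec[of "\<lambda>y k. g y $ k" "\<lambda>k. g' $ k", OF assms] by simp

text \<open>An expression that vanishes identically has derivative 0, and derivatives are unique.
  Time derivatives are taken first, at \<open>s = 0\<close>, where no Leibniz terms arise; then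
  x-derivatives follow, in the order built into \<open>pd\<close>.\<close>

lemma differentiated_system:
  fixes U F :: "'n::finite family" and A :: "nat \<Rightarrow> real \<Rightarrow> real^'n^'n"
  assumes T: "T > 0"
    and dxU: "\<And>s q k x t. s + 2 * q < 6 \<Longrightarrow> x \<in> {0..1} \<Longrightarrow> t \<in> {0..T} \<Longrightarrow>
        ((\<lambda>y. U s q y t $ k) has_real_derivative U (Suc s) q x t $ k) (at x within {0..1})"
    and dtU: "\<And>s q k x t. s + 2 * q \<le> 4 \<Longrightarrow> x \<in> {0..1} \<Longrightarrow> t \<in> {0..T} \<Longrightarrow>
        ((\<lambda>r. U s q x r $ k) has_real_derivative U s (Suc q) x t $ k) (at t within {0..T})"
    and dxA: "\<And>l k j x. l < 4 \<Longrightarrow> x \<in> {0..1} \<Longrightarrow>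
        ((\<lambda>y. A l y $ k $ j) has_real_derivative A (Suc l) x $ k $ j) (at x within {0..1})"
    and dxF: "\<And>s q k x t. s + 2 * q < 4 \<Longrightarrow> x \<in> {0..1} \<Longrightarrow> t \<in> {0..T} \<Longrightarrow>
        ((\<lambda>y. F s q y t $ k) has_real_derivative F (Suc s) q x t $ k) (at x within {0..1})"
    and dtF: "\<And>s q k x t. s + 2 * q \<le> 2 \<Longrightarrow> x \<in> {0..1} \<Longrightarrow> t \<in> {0..T} \<Longrightarrow>
        ((\<lambda>r. F s q x r $ k) has_real_derivative F s (Suc q) x t $ k) (at t within {0..T})"
    and eq: "\<And>x t. x \<in> {0..1} \<Longrightarrow> t \<in> {0..T} \<Longrightarrow>
        U 0 1 x t - e *\<^sub>R U 2 0 x t + A 0 x *v U 0 0 x t = F 0 0 x t"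
  shows "s + 2 * q \<le> 4 \<Longrightarrow> x \<in> {0..1} \<Longrightarrow> t \<in> {0..T} \<Longrightarrow>
      U s (Suc q) x t - e *\<^sub>R U (s + 2) q x t + (\<Sum>l\<le>s. real (s choose l) *\<^sub>R (A l x *v U (s - l) q x t)) = F s q x t"
proof (induction s arbitrary: x t)
  case 0
  have "2 * q \<le> 4 \<Longrightarrow> x \<in> {0..1} \<Longrightarrow> t \<in> {0..T} \<Longrightarrow>
      U 0 (Suc q) x t - e *\<^sub>R U 2 q x t + A 0 x *v U 0 q x t = F 0 q x t" for x t
  proof (induction q arbitrary: x t)
    case 0
    then show ?case using eq by simp
  next
    case (Suc q)
    have ne: "at t within {0..T} \<noteq> bot" using T Suc.prems by (simp add: trivial_limit_within islimpt_Icc)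
    have "((\<lambda>r. U 0 (Suc q) x r - e *\<^sub>R U 2 q x r + A 0 x *v U 0 q x r - F 0 q x r) has_vector_derivative
        U 0 (Suc (Suc q)) x t - e *\<^sub>R U 2 (Suc q) x t + (0 *v U 0 q x t + A 0 x *v U 0 (Suc q) x t) - F 0 (Suc q) x t)
        (at t within {0..T})"
      by (intro has_vector_derivative_diff has_vector_derivative_add bounded_linear.has_vector_derivative[OF bounded_linear_scaleR_right]
          has_vector_derivative_matrix_vector has_vector_derivative_components dtU dtF)
         (use Suc.prems in auto)
    moreover have "((\<lambda>r. U 0 (Suc q) x r - e *\<^sub>R U 2 q x r + A 0 x *v U 0 q x r - F 0 q x r) has_vector_derivative 0)
        (at t within {0..T})"
      by (rule has_vector_derivative_transform[OF Suc.prems(3) _ has_vector_derivative_const[of 0]])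
         (use Suc in auto)
    ultimately show ?case using vector_derivative_unique_within[OF ne] by fastforce
  qed
  from this[OF _ 0(2,3)] 0(1) show ?case by (simp add: numeral_2_eq_2)
next
  case (Suc s)
  have ne: "at x within {0..1} \<noteq> bot" using Suc.prems by (simp add: trivial_limit_within islimpt_Icc)
  let ?G = "\<lambda>y. U s (Suc q) y t - e *\<^sub>R U (s + 2) q y t + (\<Sum>l\<le>s. real (s choose l) *\<^sub>R (A l y *v U (s - l) q y t)) - F s q y t"
  have "(?G has_vector_derivative
      U (Suc s) (Suc q) x t - e *\<^sub>R U (Suc (s + 2)) q x t +
      (\<Sum>l\<le>s. real (s choose l) *\<^sub>R (A (Suc l) x *v U (s - l) q x t + A l x *v U (Suc (s - l)) q x t)) - F (Suc s) q x t)
      (at x within {0..1})"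
    by (intro has_vector_derivative_diff has_vector_derivative_add has_vector_derivative_sum
        bounded_linear.has_vector_derivative[OF bounded_linear_scaleR_right]
        has_vector_derivative_matrix_vector has_vector_derivative_components dxU dxF dxA)
       (use Suc.prems in auto)
  moreover have "(?G has_vector_derivative 0) (at x within {0..1})"
    by (rule has_vector_derivative_transform[OF Suc.prems(2) _ has_vector_derivative_const[of 0]])
       (use Suc in auto)
  ultimately have "U (Suc s) (Suc q) x t - e *\<^sub>R U (Suc (s + 2)) q x t +
      (\<Sum>l\<le>s. real (s choose l) *\<^sub>R (A (Suc l) x *v U (s - l) q x t + A l x *v U (Suc (s - l)) q x t)) - F (Suc s) q x t = 0"
    by (rule vector_derivative_unique_within[OF ne])
  moreover have "(\<Sum>l\<le>s. real (s choose l) *\<^sub>R (A (Suc l) x *v U (s - l) q x t + A l x *v U (Suc (s - l)) q x t)) =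
      (\<Sum>l\<le>Suc s. real (Suc s choose l) *\<^sub>R (A l x *v U (Suc s - l) q x t))"
    using pascal_sum[of s "\<lambda>i j. A i x *v U j q x t"] by (simp add: Suc_diff_le cong: sum.cong_simp)
  ultimately show ?case by simp
qed

section \<open>From the regularity classes to the derivative families\<close>

definition matrix_family :: "(real \<Rightarrow> real^'n^'n) \<Rightarrow> nat \<Rightarrow> real \<Rightarrow> real^'n^'n" where
  "matrix_family A l x = (\<chi> k j. (dx ^^ l) (\<lambda>x. A x $ k $ j) x)"

definition pd_family :: "real \<Rightarrow> (real \<Rightarrow> real \<Rightarrow> real^'n) \<Rightarrow> 'n family" where
  "pd_family T v s q x t = (\<chi> k. pd T s q (\<lambda>x t. v x t $ k) x t)"

lemma matrix_family_0 [simp]: "matrix_family A 0 = A"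
  by (simp add: matrix_family_def fun_eq_iff)

lemma pd_family_0 [simp]: "pd_family T v 0 0 = v"
  by (simp add: pd_family_def pd_def fun_eq_iff)

lemma C_hoelder_dx:
  assumes "C_hoelder m \<alpha> g" "l < m" "x \<in> {0..1}"
  shows "((dx ^^ l) g has_real_derivative (dx ^^ Suc l) g x) (at x within {0..1})"
proof -
  have "(dx ^^ l) g differentiable (at x within {0..1})" using assms unfolding C_hoelder_def by blast
  then show ?thesis
    unfolding has_real_derivative_iff_has_vector_derivative by (simp add: dx_def vector_derivative_works)
qed

lemma matrix_family_bound:
  fixes A :: "real \<Rightarrow> real^'n^'n"
  assumes A: "\<And>k j. C_hoelder 4 \<alpha> (\<lambda>x. A x $ k $ j)"
  obtains C where "C \<ge> 0" "\<And>l x v. l \<le> 4 \<Longrightarrow> x \<in> {0..1} \<Longrightarrow> norm (matrix_family A l x *v v) \<le> C * norm v"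
proof -
  let ?g = "\<lambda>(l::nat, k, j) x. \<bar>(dx ^^ l) (\<lambda>x. A x $ k $ j) x\<bar>"
  obtain C where C: "C \<ge> 0" "\<And>i x. i \<in> {..4::nat} \<times> UNIV \<times> UNIV \<Longrightarrow> x \<in> {0..1} \<Longrightarrow> ?g i x \<le> C * 1"
  proof (rule finite_uniform_bound[of "{..4::nat} \<times> (UNIV::'n set) \<times> (UNIV::'n set)" "{0..1}" ?g "\<lambda>_. 1"])
    fix i assume i: "i \<in> {..4::nat} \<times> (UNIV::'n set) \<times> (UNIV::'n set)"
    obtain l k j where ik: "i = (l, k, j)" by (cases i)
    have "continuous_on {0..1} ((dx ^^ l) (\<lambda>x. A x $ k $ j))" using A[of k j] i ik unfolding C_hoelder_def by auto
    then have "bounded ((dx ^^ l) (\<lambda>x. A x $ k $ j) ` {0..1})"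
      by (intro compact_imp_bounded compact_continuous_image) auto
    then show "\<exists>C. \<forall>x\<in>{0..1}. ?g i x \<le> C * 1" unfolding bounded_iff ik by auto
  qed auto
  show ?thesis
  proof (rule that[of "CARD('n) * (CARD('n) * C)"])
    fix l :: nat and x :: real and v :: "real^'n" assume h: "l \<le> 4" "x \<in> {0..1}"
    have "norm (matrix_family A l x *v v) \<le> CARD('n) * (CARD('n) * (C * norm v))"
    proof (rule norm_le_card_component)
      fix k
      have "\<bar>(matrix_family A l x *v v) $ k\<bar> \<le> (\<Sum>j\<in>UNIV. \<bar>matrix_family A l x $ k $ j * v $ j\<bar>)"
        unfolding matrix_vector_mult_def by simp
      also have "\<dots> \<le> (\<Sum>j\<in>(UNIV::'n set). C * norm v)"
      proof (rule sum_mono)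
        fix j
        have "\<bar>matrix_family A l x $ k $ j\<bar> \<le> C" using C(2)[of "(l, k, j)" x] h by (simp add: matrix_family_def)
        then show "\<bar>matrix_family A l x $ k $ j * v $ j\<bar> \<le> C * norm v"
          unfolding abs_mult using C(1) component_le_norm_cart[of v j] by (intro mult_mono) auto
      qed
      finally show "\<bar>(matrix_family A l x *v v) $ k\<bar> \<le> CARD('n) * (C * norm v)" by simp
    qed
    then show "norm (matrix_family A l x *v v) \<le> CARD('n) * (CARD('n) * C) * norm v" by (simp add: mult_ac)
  qed (use C in simp)
qed

lemma pd_family_bounds:
  fixes f :: "real \<Rightarrow> real \<Rightarrow> real^'n"
  assumes T: "T > 0" and \<alpha>: "0 < \<alpha>" "\<alpha> < 1" and f: "\<And>k. C_par_hoelder T 2 \<alpha> (\<lambda>x t. f x t $ k)"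
  obtains Cf H where "Cf \<ge> 0" "H \<ge> 0"
    "\<And>s q x t. s + 2 * q \<le> 4 \<Longrightarrow> x \<in> {0..1} \<Longrightarrow> t \<in> {0..T} \<Longrightarrow> norm (pd_family T f s q x t) \<le> Cf"
    "\<And>s q x t r. s + 2 * q \<le> 4 \<Longrightarrow> q = 0 \<or> s = 0 \<Longrightarrow> x \<in> {0..1} \<Longrightarrow> t \<in> {0..T} \<Longrightarrow> r \<in> {0..T} \<Longrightarrow>
        norm (pd_family T f s q x t - pd_family T f s q x r) \<le> H * \<bar>t - r\<bar> powr (\<alpha> / 2)"
proof -
  let ?I = "{(s, q). s + 2 * q \<le> (4::nat)} \<times> (UNIV::'n set)"
  have "{(s, q). s + 2 * q \<le> (4::nat)} \<subseteq> {..4} \<times> {..4}" by auto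
  then have I: "finite ?I" by (intro finite_cartesian_product finite_subset[OF _ finite_SigmaI]) auto
  let ?g = "\<lambda>((s, q), k) z. \<bar>pd T s q (\<lambda>x t. f x t $ k) (fst z) (snd z)\<bar>"
  obtain C where C: "C \<ge> 0" "\<And>i z. i \<in> ?I \<Longrightarrow> z \<in> {0..1} \<times> {0..T} \<Longrightarrow> ?g i z \<le> C * 1"
  proof (rule finite_uniform_bound[OF I, of "{0..1} \<times> {0..T}" ?g "\<lambda>_. 1"])
    fix i assume i: "i \<in> ?I"
    obtain s q k where ik: "i = ((s, q), k)" by (metis prod.exhaust)
    have "C_par T 2 (\<lambda>x t. f x t $ k)" "s + 2 * q \<le> 2 * 2" using f i ik by (auto simp: C_par_hoelder_def)
    from C_par_bounded[OF this] show "\<exists>C. \<forall>z\<in>{0..1} \<times> {0..T}. ?g i z \<le> C * 1" unfolding ik by simp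
  qed auto
  let ?J = "{i \<in> ?I. snd (fst i) = 0 \<or> fst (fst i) = 0}"
  let ?h = "\<lambda>((s, q), k) (x, t, r). \<bar>pd T s q (\<lambda>x t. f x t $ k) x t - pd T s q (\<lambda>x t. f x t $ k) x r\<bar>"
  let ?Z = "{0..1} \<times> {0..T} \<times> {0..T}"
  obtain H where H: "H \<ge> 0" "\<And>i z. i \<in> ?J \<Longrightarrow> z \<in> ?Z \<Longrightarrow> ?h i z \<le> H * (\<lambda>(x, t, r). \<bar>t - r\<bar> powr (\<alpha> / 2)) z"
  proof (rule finite_uniform_bound[of ?J ?Z ?h "\<lambda>(x, t, r). \<bar>t - r\<bar> powr (\<alpha> / 2)"])
    fix i assume i: "i \<in> ?J"
    obtain s q k where ik: "i = ((s, q), k)" by (metis prod.exhaust)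
    have "s + 2 * q \<le> 4" "q = 0 \<or> s = 0" using i ik by auto
    from C_par_hoelder_time[OF T \<alpha> f[of k] this]
    show "\<exists>C. \<forall>z\<in>?Z. ?h i z \<le> C * (\<lambda>(x, t, r). \<bar>t - r\<bar> powr (\<alpha> / 2)) z" unfolding ik by auto
  qed (use I in auto)
  show ?thesis
  proof (rule that[of "CARD('n) * C" "CARD('n) * H"])
    fix s q :: nat and x t :: real assume h: "s + 2 * q \<le> 4" "x \<in> {0..1}" "t \<in> {0..T}"
    show "norm (pd_family T f s q x t) \<le> CARD('n) * C"
      by (rule norm_le_card_component) (use C(2)[of "((s, q), _)" "(x, t)"] h in \<open>auto simp: pd_family_def\<close>)
    fix r :: real assume "q = 0 \<or> s = 0" "r \<in> {0..T}"
    then have "\<bar>(pd_family T f s q x t - pd_family T f s q x r) $ k\<bar> \<le> H * \<bar>t - r\<bar> powr (\<alpha> / 2)" for k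
      using H(2)[of "((s, q), k)" "(x, t, r)"] h by (auto simp: pd_family_def)
    then have "norm (pd_family T f s q x t - pd_family T f s q x r) \<le> CARD('n) * (H * \<bar>t - r\<bar> powr (\<alpha> / 2))"
      by (rule norm_le_card_component)
    then show "norm (pd_family T f s q x t - pd_family T f s q x r) \<le> CARD('n) * H * \<bar>t - r\<bar> powr (\<alpha> / 2)" by simp
  qed (use C H in auto)
qed

lemma sp_data_family:
  fixes A :: "real \<Rightarrow> real^'n^'n" and f :: "real \<Rightarrow> real \<Rightarrow> real^'n"
  assumes "T > 0" "coupling_conditions beta_star A" "0 < \<alpha>" "\<alpha> < 1"
    and "\<And>k j. C_hoelder 4 \<alpha> (\<lambda>x. A x $ k $ j)" "\<And>k. C_par_hoelder T 2 \<alpha> (\<lambda>x t. f x t $ k)"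
    and "0 < beta" "beta < beta_star"
  obtains CA Cf H where "sp_data T beta_star beta (\<alpha> / 2) CA Cf H (matrix_family A) (pd_family T f)"
proof -
  obtain CA where CA: "CA \<ge> 0" "\<And>l x v. l \<le> 4 \<Longrightarrow> x \<in> {0..1} \<Longrightarrow> norm (matrix_family A l x *v v) \<le> CA * norm v"
    using matrix_family_bound[of \<alpha> A] assms(5) by metis
  obtain Cf H where fH: "Cf \<ge> 0" "H \<ge> 0"
    "\<And>s q x t. s + 2 * q \<le> 4 \<Longrightarrow> x \<in> {0..1} \<Longrightarrow> t \<in> {0..T} \<Longrightarrow> norm (pd_family T f s q x t) \<le> Cf"
    "\<And>s q x t r. s + 2 * q \<le> 4 \<Longrightarrow> q = 0 \<or> s = 0 \<Longrightarrow> x \<in> {0..1} \<Longrightarrow> t \<in> {0..T} \<Longrightarrow> r \<in> {0..T} \<Longrightarrow>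
        norm (pd_family T f s q x t - pd_family T f s q x r) \<le> H * \<bar>t - r\<bar> powr (\<alpha> / 2)"
    using pd_family_bounds[OF assms(1,3,4,6)] by blast
  have "sp_data T beta_star beta (\<alpha> / 2) CA Cf H (matrix_family A) (pd_family T f)"
    by standard (use assms CA fH in \<open>auto simp: coupling_conditions_def\<close>)
  then show ?thesis by (rule that)
qed

lemma continuous_on_matrix_vector_mult:
  fixes A :: "'b::topological_space \<Rightarrow> real^'n^'n" and u :: "'b \<Rightarrow> real^'n"
  assumes "\<And>k j. continuous_on S (\<lambda>z. A z $ k $ j)" "\<And>j. continuous_on S (\<lambda>z. u z $ j)"
  shows "continuous_on S (\<lambda>z. A z *v u z)"
  unfolding matrix_vector_mult_def by (intro continuous_on_vec_lambda continuous_on_sum continuous_on_mult assms)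

lemma sol_family:
  fixes A :: "real \<Rightarrow> real^'n^'n" and f u :: "real \<Rightarrow> real \<Rightarrow> real^'n"
  assumes S: "sp_data T beta_star beta a CA Cf H (matrix_family A) (pd_family T f)"
    and A: "\<And>k j. C_hoelder 4 \<alpha> (\<lambda>x. A x $ k $ j)" and f: "\<And>k. C_par_hoelder T 2 \<alpha> (\<lambda>x t. f x t $ k)"
    and eps: "0 < eps" "eps < 1" and u: "parabolic_solution T eps A f u" and C: "\<And>k. C_par T 3 (\<lambda>x t. u x t $ k)"
  shows "sp_data.sol T (matrix_family A) (pd_family T f) (sqrt eps) (pd_family T u)"
proof -
  interpret sp_data T beta_star beta a CA Cf H "matrix_family A" "pd_family T f" by (fact S)
  let ?U = "pd_family T u" and ?F = "pd_family T f"
  have f2: "C_par T 2 (\<lambda>x t. f x t $ k)" for k using f by (simp add: C_par_hoelder_def)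
  have dxU: "((\<lambda>y. ?U s q y t $ k) has_real_derivative ?U (Suc s) q x t $ k) (at x within {0..1})"
    if "s + 2 * q < 6" "x \<in> {0..1}" "t \<in> {0..T}" for s q k x t
    using C_par_dx[OF C[of k], of s q x t] that by (simp add: pd_family_def)
  have dtU: "((\<lambda>r. ?U s q x r $ k) has_real_derivative ?U s (Suc q) x t $ k) (at t within {0..T})"
    if "s + 2 * q \<le> 4" "x \<in> {0..1}" "t \<in> {0..T}" for s q k x t
    using C_par_dt[OF T C[of k], of s q x t] that by (simp add: pd_family_def)
  have cU: "continuous_on ({0..1} \<times> {0..T}) (\<lambda>z. ?U s q (fst z) (snd z))" if "s + 2 * q \<le> 6" for s q
    unfolding pd_family_def
    by (intro continuous_on_vec_lambda) (use C_par_continuous[OF C, of s q] that in \<open>simp add: case_prod_beta\<close>)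
  have cf: "continuous_on ({0..1} \<times> {0..T}) (\<lambda>z. f (fst z) (snd z))"
  proof -
    have "continuous_on ({0..1} \<times> {0..T}) (\<lambda>z. \<chi> k. f (fst z) (snd z) $ k)"
      by (intro continuous_on_vec_lambda) (use C_par_continuous[OF f2, of 0 0] in \<open>simp add: case_prod_beta pd_def\<close>)
    then show ?thesis by simp
  qed
  have cA: "continuous_on {0..1} (\<lambda>x. A x $ k $ j)" for k j
    using A[of k j] unfolding C_hoelder_def by (metis funpow_0 le0)
  have in_dom: "?U 0 1 x t - eps *\<^sub>R ?U 2 0 x t + A x *v u x t - f x t = 0"
    if "x \<in> {0<..<1}" "t \<in> {0<..T}" for x t
  proof -
    have "(\<chi> k. pdt T (\<lambda>y r. u y r $ k) x t) + L_op eps A u x t = f x t"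
      using u that unfolding parabolic_solution_def by blast
    moreover have "(\<chi> k. pdt T (\<lambda>y r. u y r $ k) x t) = ?U 0 1 x t" by (simp add: pd_family_def pd_def)
    moreover have "(\<chi> k. - eps * pdx (pdx (\<lambda>y r. u y r $ k)) x t) = - eps *\<^sub>R ?U 2 0 x t"
      by (simp add: pd_family_def pd_def vec_eq_iff numeral_2_eq_2)
    ultimately have "?U 0 1 x t + (- eps *\<^sub>R ?U 2 0 x t + A x *v u x t) = f x t" unfolding L_op_def by metis
    then show ?thesis by (simp add: algebra_simps)
  qed
  \<comment> \<open>The equation is assumed in the open domain only. Both sides are continuous on
    the closed rectangle, so it extends to the boundary, where the initial values and the end nodes
    use it.\<close>
  have cl: "closure ({0<..<1} \<times> {0<..T}) = {0..1::real} \<times> {0..T}" using T by (simp add: closure_Times)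
  have eq: "?U 0 1 x t - eps *\<^sub>R ?U 2 0 x t + A x *v u x t - f x t = 0" if "x \<in> {0..1}" "t \<in> {0..T}" for x t
  proof -
    let ?G = "\<lambda>z. ?U 0 1 (fst z) (snd z) - eps *\<^sub>R ?U 2 0 (fst z) (snd z) + A (fst z) *v u (fst z) (snd z) - f (fst z) (snd z)"
    have "continuous_on ({0..1} \<times> {0..T}) ?G"
    proof (intro continuous_on_diff continuous_on_add continuous_on_scaleR continuous_on_const cU cf continuous_on_matrix_vector_mult)
      show "continuous_on ({0..1} \<times> {0..T}) (\<lambda>z. A (fst z) $ k $ j)" for k j
        by (rule continuous_on_compose2[OF cA continuous_on_fst[OF continuous_on_id]]) auto
      show "continuous_on ({0..1} \<times> {0..T}) (\<lambda>z. u (fst z) (snd z) $ j)" for j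
        using cU[of 0 0] by (intro continuous_on_component) simp
    qed auto
    moreover have "?G z = 0" if "z \<in> {0<..<1} \<times> {0<..T}" for z
      by (rule in_dom) (use that in auto)
    moreover have "(x, t) \<in> {0..1} \<times> {0..T}" using that by simp
    ultimately have "?G (x, t) = 0"
      using continuous_constant_on_closure[of "{0<..<1} \<times> {0<..T}" ?G 0 "(x, t)"] unfolding cl by blast
    then show ?thesis by simp
  qed
  have main: "?U s (Suc q) x t - eps *\<^sub>R ?U (s + 2) q x t + (\<Sum>l\<le>s. real (s choose l) *\<^sub>R (matrix_family A l x *v ?U (s - l) q x t)) = ?F s q x t"
    if "s + 2 * q \<le> 4" "x \<in> {0..1}" "t \<in> {0..T}" for s q x t
  proof (rule differentiated_system[where T = T and U = ?U and F = ?F and A = "matrix_family A" and e = eps])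
    show "s + 2 * q \<le> 4" "x \<in> {0..1}" "t \<in> {0..T}" by fact+
    show "T > 0" by (rule T)
    show "((\<lambda>y. ?U s q y t $ k) has_real_derivative ?U (Suc s) q x t $ k) (at x within {0..1})"
      if "s + 2 * q < 6" "x \<in> {0..1}" "t \<in> {0..T}" for s q k x t by (rule dxU[OF that])
    show "((\<lambda>r. ?U s q x r $ k) has_real_derivative ?U s (Suc q) x t $ k) (at t within {0..T})"
      if "s + 2 * q \<le> 4" "x \<in> {0..1}" "t \<in> {0..T}" for s q k x t by (rule dtU[OF that])
    show "((\<lambda>y. matrix_family A l y $ k $ j) has_real_derivative matrix_family A (Suc l) x $ k $ j) (at x within {0..1})"
      if "l < 4" "x \<in> {0..1}" for l k j x
      using C_hoelder_dx[OF A[of k j], of l x] that by (simp add: matrix_family_def)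
    show "((\<lambda>y. ?F s q y t $ k) has_real_derivative ?F (Suc s) q x t $ k) (at x within {0..1})"
      if "s + 2 * q < 4" "x \<in> {0..1}" "t \<in> {0..T}" for s q k x t
      using C_par_dx[OF f2[of k], of s q x t] that by (simp add: pd_family_def)
    show "((\<lambda>r. ?F s q x r $ k) has_real_derivative ?F s (Suc q) x t $ k) (at t within {0..T})"
      if "s + 2 * q \<le> 2" "x \<in> {0..1}" "t \<in> {0..T}" for s q k x t
      using C_par_dt[OF T f2[of k], of s q x t] that by (simp add: pd_family_def)
    show "?U 0 1 x t - eps *\<^sub>R ?U 2 0 x t + matrix_family A 0 x *v ?U 0 0 x t = ?F 0 0 x t"
      if "x \<in> {0..1}" "t \<in> {0..T}" for x t
      using eq[OF that] by simp
  qed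
  show ?thesis
    unfolding sol_def
  proof (intro conjI allI impI ballI)
    fix s q :: nat and x t :: real
    { assume h: "s + 2 * q < 6" "x \<in> {0..1}" "t \<in> {0..T}"
      show "((\<lambda>y. ?U s q y t) has_vector_derivative ?U (Suc s) q x t) (at x within {0..1})"
        by (rule has_vector_derivative_components[OF dxU[OF h]]) }
    assume h: "s + 2 * q \<le> 4" "x \<in> {0..1}" "t \<in> {0..T}"
    show "(?U s q x has_vector_derivative ?U s (Suc q) x t) (at t within {0..T})"
      by (rule has_vector_derivative_components[OF dtU[OF h]])
    have "{..s} = insert 0 {1..s}" by auto
    then have "(\<Sum>l\<le>s. real (s choose l) *\<^sub>R (matrix_family A l x *v ?U (s - l) q x t)) =
        matrix_family A 0 x *v ?U s q x t + lower ?U s q x t"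
      unfolding lower_def by simp
    then show "?U s (Suc q) x t - (sqrt eps)\<^sup>2 *\<^sub>R ?U (s + 2) q x t + matrix_family A 0 x *v ?U s q x t = ?F s q x t - lower ?U s q x t"
      using main[OF h] eps by (simp add: algebra_simps)
  qed (use eps u cU in \<open>auto simp: parabolic_solution_def case_prod_beta\<close>)
qed


context sp_data
begin

text \<open>Collects all derivative bounds in one constant for every time and component; from here
  on the solution enters the truncation error only as a scalar function of x.\<close>

lemma uniform_scalar_bounds:
  assumes \<rho>: "\<rho> > 0"
  obtains C where "C \<ge> 0"
    "\<And>d U t k. sol d U \<Longrightarrow> t \<in> {0..T} \<Longrightarrow> scalar_bounds C b \<rho> d (\<lambda>s x. U s 0 x t $ k)"
proof -
  have "\<exists>C\<ge>0. \<forall>d U x t. sol d U \<longrightarrow> x \<in> {0..1} \<longrightarrow> t \<in> {0..T} \<longrightarrow> norm (U s 0 x t) \<le> C * (1 / d ^ s)" if "s \<le> 6" for s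
    using ub_s0[OF that] unfolding ub_def .
  then obtain Cp where Cp: "\<And>s. s \<le> 6 \<Longrightarrow> Cp s \<ge> 0"
    "\<And>s d U x t. s \<le> 6 \<Longrightarrow> sol d U \<Longrightarrow> x \<in> {0..1} \<Longrightarrow> t \<in> {0..T} \<Longrightarrow> norm (U s 0 x t) \<le> Cp s * (1 / d ^ s)" by metis
  have "\<exists>C\<ge>0. \<forall>d U x t. sol d U \<longrightarrow> x \<in> {0..1} \<longrightarrow> t \<in> {0..T} \<longrightarrow> norm (U s 0 x t) \<le> C * weight b d s x" if "s \<le> 4" for s
    using ub_weighted[OF that] unfolding ub_def .
  then obtain Cw where Cw: "\<And>s. s \<le> 4 \<Longrightarrow> Cw s \<ge> 0"
    "\<And>s d U x t. s \<le> 4 \<Longrightarrow> sol d U \<Longrightarrow> x \<in> {0..1} \<Longrightarrow> t \<in> {0..T} \<Longrightarrow> norm (U s 0 x t) \<le> Cw s * weight b d s x" by metis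
  obtain C6 where C6: "C6 \<ge> 0" "\<And>d U x t. sol d U \<Longrightarrow> \<rho> * d \<le> x \<Longrightarrow> x + \<rho> * d \<le> 1 \<Longrightarrow> t \<in> {0..T} \<Longrightarrow>
      norm (U 6 0 x t) \<le> C6 / d\<^sup>2 * weight b d 4 x"
    using sixth_derivative_interior[OF \<rho>] by blast
  obtain C5 where C5: "C5 \<ge> 0" "\<And>d U x t. sol d U \<Longrightarrow> \<rho> * d \<le> 1 / 8 \<Longrightarrow> \<rho> * d \<le> x \<Longrightarrow> x + \<rho> * d \<le> 1 \<Longrightarrow> t \<in> {0..T} \<Longrightarrow>
      norm (U 5 0 x t) \<le> C5 / d * weight b d 4 x"
    using fifth_derivative_interior[OF \<rho>] by blast
  define C where "C = (\<Sum>s\<le>6. Cp s) + (\<Sum>s\<le>4. Cw s) + C6 + C5"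
  have nn: "0 \<le> (\<Sum>s\<le>6. Cp s)" "0 \<le> (\<Sum>s\<le>4. Cw s)" by (auto intro!: sum_nonneg Cp Cw)
  have le: "Cp s \<le> C" if "s \<le> 6" for s
  proof -
    have "Cp s \<le> (\<Sum>s\<le>6. Cp s)" using that by (intro member_le_sum) (auto intro: Cp)
    then show ?thesis using nn C6 C5 unfolding C_def by linarith
  qed
  have lew: "Cw s \<le> C" if "s \<le> 4" for s
  proof -
    have "Cw s \<le> (\<Sum>s\<le>4. Cw s)" using that by (intro member_le_sum) (auto intro: Cw)
    then show ?thesis using nn C6 C5 unfolding C_def by linarith
  qed
  have le65: "C6 \<le> C" "C5 \<le> C" using nn C6 C5 unfolding C_def by linarith+
  show ?thesis
  proof (rule that[of C])
    show "C \<ge> 0" using le65 C6 by linarith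
    fix d U t k assume S: "sol d U" and t: "t \<in> {0..T}"
    have d: "d > 0" using solD(1)[OF S] by simp
    have w: "weight b d m x \<ge> 0" for m x using weight_ge_1[OF d, of b m x] by linarith
    show "scalar_bounds C b \<rho> d (\<lambda>s x. U s 0 x t $ k)"
      unfolding scalar_bounds_def
    proof (intro conjI allI impI ballI)
      show "derivs_on 0 1 6 (\<lambda>s x. U s 0 x t $ k)"
        unfolding derivs_on_def
      proof (intro allI impI ballI)
        fix s :: nat and x :: real assume "s < 6" "x \<in> {0..1}"
        then show "((\<lambda>x. U s 0 x t $ k) has_real_derivative U (Suc s) 0 x t $ k) (at x within {0..1})"
          using S t unfolding sol_def by (intro vec_component_deriv) simp
      qed
      fix s :: nat and x :: real
      have n: "\<bar>U s 0 x t $ k\<bar> \<le> norm (U s 0 x t)" for s x by (rule component_le_norm_cart)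
      { assume h: "s \<le> 6" "x \<in> {0..1}"
        have "Cp s * (1 / d ^ s) \<le> C * (1 / d ^ s)" using le[OF h(1)] d by (intro mult_right_mono) auto
        then show "\<bar>U s 0 x t $ k\<bar> \<le> C / d ^ s" using n[of s x] Cp(2)[OF h(1) S h(2) t] by simp }
      { assume h: "s \<le> 4" "x \<in> {0..1}"
        have "Cw s * weight b d s x \<le> C * weight b d s x" using lew[OF h(1)] w by (intro mult_right_mono) auto
        then show "\<bar>U s 0 x t $ k\<bar> \<le> C * weight b d s x" using n[of s x] Cw(2)[OF h(1) S h(2) t] by linarith }
      { assume h: "\<rho> * d \<le> x" "x + \<rho> * d \<le> 1"
        have "C6 / d\<^sup>2 * weight b d 4 x \<le> C / d\<^sup>2 * weight b d 4 x"
          using le65 w d by (intro mult_right_mono divide_right_mono) auto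
        then show "\<bar>U 6 0 x t $ k\<bar> \<le> C / d\<^sup>2 * weight b d 4 x" using n[of 6 x] C6(2)[OF S h t] by linarith }
      { assume h: "\<rho> * d \<le> 1 / 8" "\<rho> * d \<le> x" "x + \<rho> * d \<le> 1"
        have "C5 / d * weight b d 4 x \<le> C / d * weight b d 4 x"
          using le65 w d by (intro mult_right_mono divide_right_mono) auto
        then show "\<bar>U 5 0 x t $ k\<bar> \<le> C / d * weight b d 4 x" using n[of 5 x] C5(2)[OF S h t] by linarith }
    qed
  qed
qed

end

section \<open>Truncation error on the mesh\<close>

lemma trunc_err_reflect:
  "trunc_err d g x h hp qm qc qp = trunc_err d (\<lambda>s x. (- 1) ^ s * g s (1 - x)) (1 - x) hp h qp qc qm"
proof -
  have n: "(u - v) / r = - ((v - u) / r)" for u v r :: real by (simp add: minus_divide_left)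
  have "diff2 (\<lambda>y. g 0 (1 - y)) (1 - x) hp h = diff2 (g 0) x h hp"
    unfolding diff2_def n[of "g 0 (1 - (1 - x + h))"] n[of "g 0 (1 - (1 - x))" "g 0 (1 - (1 - x - hp))"]
    by (simp add: add.commute)
  then show ?thesis by (simp add: trunc_err_def add_ac)
qed

context shishkin_mesh
begin

text \<open>The step \<open>4 * sg / N\<close> is at most
  \<open>4 * sigma0 * sqrt eps * (l / N)\<close>, so \<open>h / d\<close> is
  \<open>O(l / N)\<close>. If \<open>sg = 1 / 4\<close> the mesh is uniform and the same argument
  covers all its nodes.\<close>

lemma trunc_err_fine:
  assumes g: "scalar_bounds C b (sigma0 / 2) (sqrt eps) g" and i: "1 \<le> i" "i < N" and c: "i < m \<or> sg = 1 / 4"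
  shows "\<bar>trunc_err (sqrt eps) g (X i) (mesh_h X i) (mesh_h X (i + 1)) (1/12) (5/6) (1/12)\<bar> \<le> C * (8 * sigma0) ^ 4 * (l / N) ^ 4"
    "mesh_h X (i + 1) = mesh_h X i"
proof -
  have h: "mesh_h X i = 4 * sg / N" "mesh_h X (i + 1) = 4 * sg / N"
    using c h_fine[of i] h_fine[of "i + 1"] h_uniform[of i] h_uniform[of "i + 1"] i by auto
  then show "mesh_h X (i + 1) = mesh_h X i" by simp
  have "4 * sg / N \<le> 4 * (sigma0 * sqrt eps * l) / N" using sg by (intro divide_right_mono) auto
  then have le: "mesh_h X i \<le> 8 * (sigma0 / 2) * sqrt eps * (l / N)" using h by (simp add: mult_ac)
  have x: "X i - mesh_h X i = X (i - 1)" "X i + mesh_h X i = X (i + 1)" using h by (auto simp: mesh_h_def)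
  have "\<bar>trunc_err (sqrt eps) g (X i) (mesh_h X i) (mesh_h X i) (1/12) (5/6) (1/12)\<bar> \<le> C * (16 * (sigma0 / 2)) ^ 4 * (l / N) ^ 4"
    using X_range[of "i - 1"] X_range[of "i + 1"] i eps by (intro cell_fine[OF g _ h_pos _ _ le]) (auto simp: x)
  then show "\<bar>trunc_err (sqrt eps) g (X i) (mesh_h X i) (mesh_h X (i + 1)) (1/12) (5/6) (1/12)\<bar> \<le> C * (8 * sigma0) ^ 4 * (l / N) ^ 4"
    using h by simp
qed

text \<open>At the transition point the exponent is \<open>b * sigma0 * l \<ge> 4 * l\<close>, and
  \<open>exp (- l) \<le> l / N\<close>. Being one node short of it costs
  \<open>b * sigma0 * l / m \<le> 4 * (b * sigma0)\<close>, which is the exponential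
  constant.\<close>

lemma coarse_decay:
  assumes b: "b > 0" "4 \<le> b * sigma0" and L: "l \<le> ln N" "exp (- l) \<le> l / N" and c: "sg < 1 / 4" and i: "m \<le> i" "i \<le> N"
  shows "exp (- b * X (i - 1) / sqrt eps) \<le> exp (4 * (b * sigma0)) * (l / N) ^ 4"
proof -
  have sg_eq: "sg = sigma0 * sqrt eps * l" using c unfolding sg_def shishkin_sigma_def by auto
  have d: "sqrt eps > 0" using eps by simp
  have "ln (real N) \<le> N" using N ln_le_minus_one[of "real N"] by linarith
  then have lm: "l / m \<le> 4" using L N by (simp add: field_simps)
  have "b * (sigma0 * l * (1 - 1 / m)) = b * (sg * (1 - 1 / m)) / sqrt eps" using d by (simp add: sg_eq field_simps)
  also have "\<dots> \<le> b * X (i - 1) / sqrt eps"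
    using X_coarse[OF i] b d by (intro divide_right_mono mult_left_mono) auto
  finally have 1: "b * sigma0 * l - b * sigma0 * (l / m) \<le> b * X (i - 1) / sqrt eps" by (simp add: algebra_simps)
  have 2: "4 * l \<le> b * sigma0 * l" using b l by (intro mult_right_mono) auto
  have 3: "b * sigma0 * (l / m) \<le> b * sigma0 * 4" using b lm by (intro mult_left_mono) auto
  have "exp (- b * X (i - 1) / sqrt eps) \<le> exp (4 * (b * sigma0) + 4 * (- l))" using 1 2 3 by simp
  also have "\<dots> = exp (4 * (b * sigma0)) * exp (- l) ^ 4" unfolding exp_add by (simp add: exp_of_nat_mult[of 4 "- l", symmetric])
  also have "\<dots> \<le> exp (4 * (b * sigma0)) * (l / N) ^ 4" using L by (intro mult_left_mono power_mono) auto
  finally show ?thesis .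
qed

text \<open>The geometry required by the cell estimates. The last two claims keep the stencil at
  distance \<open>sg / 2\<close> from both ends; for \<open>sg < 1 / 4\<close> and
  \<open>l \<ge> 1\<close> this is at least \<open>sigma0 / 2 * sqrt eps\<close>, the radius of the
  interior derivative bounds.\<close>

lemma coarse_cell:
  assumes i: "m \<le> i" "i \<le> 2 * m" and m2: "m \<ge> 2"
  shows "0 < mesh_h X i" "mesh_h X i \<le> mesh_h X (i + 1)" "mesh_h X (i + 1) \<le> 7 / N"
    "mesh_h X (i + 1) - mesh_h X i \<le> 49 / (real N)\<^sup>2"
    "X i - mesh_h X i = X (i - 1)" "0 \<le> X (i - 1)" "X i + mesh_h X (i + 1) \<le> 15 / 16" "X i + mesh_h X (i + 1) \<le> 1"
    "sg / 2 \<le> X (i - 1)" "X i + mesh_h X (i + 1) + sg / 2 \<le> 1"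
proof -
  have i1: "1 \<le> i" "i + 1 \<le> N" using i m2 N by auto
  show "0 < mesh_h X i" using h_pos[of i] i1 by simp
  show "mesh_h X (i + 1) \<le> 7 / N" using h_le[of "i + 1"] i1 by simp
  have "i = 2 * m \<or> i < 2 * m" using i by auto
  then show "mesh_h X i \<le> mesh_h X (i + 1)" "mesh_h X (i + 1) - mesh_h X i \<le> 49 / (real N)\<^sup>2"
    using h_middle h_left_step[of i] i1 by auto
  show "X i - mesh_h X i = X (i - 1)" by (simp add: mesh_h_def)
  show "0 \<le> X (i - 1)" using X_range[of "i - 1"] i1 by simp
  have sg': "sg / 2 \<le> X (j - 1)" if "m \<le> j" "j \<le> N" for j
  proof -
    have "sg * (1 / 2) \<le> sg * (1 - 1 / m)" using m2 sg by (intro mult_left_mono) (auto simp: field_simps)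
    then show ?thesis using X_coarse[OF that] by linarith
  qed
  then show "sg / 2 \<le> X (i - 1)" using i i1 by simp
  have e: "X i + mesh_h X (i + 1) = X (i + 1)" by (simp add: mesh_h_def)
  have "X (i + 1) \<le> X (N - (2 * m - 1))" using i i1 m2 N by (intro X_mono) auto
  also have "\<dots> = 1 - X (2 * m - 1)" using X_right[of "2 * m - 1"] by simp
  finally have *: "X i + mesh_h X (i + 1) \<le> 1 - X (2 * m - 1)" unfolding e .
  show "X i + mesh_h X (i + 1) \<le> 15 / 16" using * X_center[OF m2] by simp
  then show "X i + mesh_h X (i + 1) \<le> 1" by simp
  show "X i + mesh_h X (i + 1) + sg / 2 \<le> 1" using * sg'[of "2 * m"] N by simp
qed

lemma trunc_err_trivial:
  assumes g: "scalar_bounds C b \<rho> (sqrt eps) g" and dt: "dt > 0" and i: "1 \<le> i" "i < N"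
  shows "\<bar>trunc_err (sqrt eps) g (X i) (mesh_h X i) (mesh_h X (i + 1))
      (q_minus gam A eps dt N X k i) (q_cent gam A eps dt N X k i) (q_plus gam A eps dt N X k i)\<bar> \<le> 4 * C"
proof -
  interpret scheme gam A eps dt N X by standard (use dt h_pos N in auto)
  show ?thesis
    using X_range[of "i - 1"] X_range[of "i + 1"] h_pos[of i] h_pos[of "i + 1"] i eps q_bounds[OF i]
    by (intro cell_trivial[OF g]) (auto simp: mesh_h_def)
qed

end

lemma sup_norm_a_hat:
  assumes A: "continuous_on {0..1} (\<lambda>x. A x $ k $ k)" "\<And>x. x \<in> {0..1} \<Longrightarrow> \<bar>A x $ k $ k\<bar> \<le> Ca"
    "\<And>x. x \<in> {0..1} \<Longrightarrow> 0 < A x $ k $ k" and dt: "dt > 0"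
  shows "2 / dt \<le> sup_norm01 (a_hat A dt k)" "sup_norm01 (a_hat A dt k) \<le> Ca + 2 / dt"
proof -
  have b: "\<bar>a_hat A dt k x\<bar> \<le> Ca + 2 / dt" if "x \<in> {0..1}" for x
    using A(2)[OF that] dt abs_triangle_ineq[of "A x $ k $ k" "2 / dt"] by (simp add: a_hat_def)
  then show "sup_norm01 (a_hat A dt k) \<le> Ca + 2 / dt" unfolding sup_norm01_def by (intro cSUP_least) auto
  have "2 / dt \<le> \<bar>a_hat A dt k 0\<bar>" using A(3)[of 0] dt by (simp add: a_hat_def)
  also have "\<dots> \<le> sup_norm01 (a_hat A dt k)"
    unfolding sup_norm01_def using b by (intro cSUP_upper bdd_aboveI2[where M = "Ca + 2 / dt"]) auto
  finally show "2 / dt \<le> sup_norm01 (a_hat A dt k)" .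
qed

text \<open>Here the pieces meet: fine cells, bounded \<open>N\<close>, resolved cells and
  unresolved cells, for nodes up to and including the midpoint, where the two steps are
  equal.\<close>

lemma truncation_left_half:
  fixes A :: "real \<Rightarrow> real^'n^'n" and b sigma0 C T c0 Ca :: real
  assumes b: "b > 0" "sigma0 > 0" "4 \<le> b * sigma0" and C: "C \<ge> 0" and T: "T > 0" and c0: "c0 > 0"
    and A: "\<And>k. continuous_on {0..1} (\<lambda>x. A x $ k $ k)" "\<forall>x\<in>{0..1}. \<forall>k. \<bar>A x $ k $ k\<bar> \<le> Ca \<and> 0 < A x $ k $ k"
  obtains K where "K \<ge> 0"
    "\<And>eps dt N l k g i m. \<lbrakk>0 < eps; eps < 1; 0 < dt; dt \<le> T; N = 4 * m; 0 < m; 1 \<le> l; l \<le> ln (real N); exp (- l) \<le> l / N;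
      1 / l ^ 4 \<le> c0 * dt; scalar_bounds C b (sigma0 / 2) (sqrt eps) g; 1 \<le> i; i \<le> 2 * m\<rbrakk> \<Longrightarrow>
      \<bar>trunc_err (sqrt eps) g (mesh_node sigma0 eps l N i) (mesh_h (mesh_node sigma0 eps l N) i) (mesh_h (mesh_node sigma0 eps l N) (i + 1))
        (q_minus (1/6) A eps dt N (mesh_node sigma0 eps l N) k i) (q_cent (1/6) A eps dt N (mesh_node sigma0 eps l N) k i)
        (q_plus (1/6) A eps dt N (mesh_node sigma0 eps l N) k i)\<bar> \<le> K * (l / N) ^ 4"
proof -
  \<comment> \<open>The two sides of the switch. Resolved: maximal step at least
    \<open>1 / N\<close> and norm of \<open>a_hat\<close> at least \<open>2 / T\<close> give
    \<open>1 / eps \<le> 3 * T * N\<^sup>2\<close>. Unresolved: maximal step at most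
    \<open>7 / N\<close>, and that norm is at most \<open>(Ca + 2 * c0) * l ^ 4\<close>, since
    \<open>1 / dt \<le> c0 * l ^ 4\<close>; this gives \<open>Ku\<close>.\<close>
  define Kr where "Kr = 3 * T"
  define Ku where "Ku = 49 / 6 * (Ca + 2 * c0)"
  define E where "E = exp (4 * (b * sigma0))"
  have "\<bar>A 0 $ undefined $ undefined\<bar> \<le> Ca" using A(2) by simp
  then have Ca: "Ca \<ge> 0" by linarith
  have nn: "Kr \<ge> 0" "Ku \<ge> 0" "E \<ge> 0" using T c0 Ca by (auto simp: Kr_def Ku_def E_def)
  obtain K1 where K1: "K1 \<ge> 0"
    "\<And>d g x h hp N \<delta>. \<lbrakk>scalar_bounds C b (sigma0 / 2) d g; 0 < d; d < 1; 0 < h; h \<le> hp; sigma0 / 2 * d \<le> 1 / 8; 0 \<le> x - h; sigma0 / 2 * d \<le> x - h;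
       x + hp + sigma0 / 2 * d \<le> 1; x + hp \<le> 1; x + hp \<le> 15 / 16; N > 0; hp \<le> 7 / N; hp - h \<le> 49 / N\<^sup>2; 1 / d\<^sup>2 \<le> Kr * N\<^sup>2;
       exp (- b * (x - h) / d) \<le> E * \<delta> ^ 4; 1 / N ^ 4 \<le> \<delta> ^ 4\<rbrakk> \<Longrightarrow>
       \<bar>trunc_err d g x h hp ((2 * h - hp) / (6 * (h + hp))) (5/6) ((2 * hp - h) / (6 * (h + hp)))\<bar> \<le> K1 * \<delta> ^ 4"
    by (fact cell_resolved[OF b(1) C nn(1,3), where \<rho> = "sigma0 / 2"])
  obtain K2 where K2: "K2 \<ge> 0"
    "\<And>d g x h hp N L. \<lbrakk>scalar_bounds C b (sigma0 / 2) d g; 0 < d; d < 1; 0 < h; h \<le> hp; 0 \<le> x - h; x + hp \<le> 1; x + hp \<le> 15 / 16;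
       N > 0; hp \<le> 7 / N; hp - h \<le> 49 / N\<^sup>2; d\<^sup>2 \<le> Ku * L ^ 4 / N\<^sup>2;
       exp (- b * (x - h) / d) \<le> E * (L / N) ^ 4\<rbrakk> \<Longrightarrow> \<bar>trunc_err d g x h hp 0 1 0\<bar> \<le> K2 * (L / N) ^ 4"
    by (fact cell_unresolved[OF b(1) C nn(2,3), where \<rho> = "sigma0 / 2"])
  \<comment> \<open>A bound on \<open>N\<close> in the unresolved case with uniform mesh; 46656 is
    \<open>6 ^ 6\<close>, from \<open>l ^ 6 \<le> 6 ^ 6 * exp l\<close>.\<close>
  define N0 where "N0 = 46656 * (16 * sigma0\<^sup>2 * Ku)"
  have N0: "N0 \<ge> 0" unfolding N0_def using nn by simp
  define K where "K = C * (8 * sigma0) ^ 4 + 1024 * C + K1 + K2 + 4 * C * N0 ^ 4"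
  have parts: "0 \<le> C * (8 * sigma0) ^ 4" "0 \<le> 4 * C * N0 ^ 4" using C N0 by auto
  show ?thesis
  proof (rule that[of K])
    show "K \<ge> 0" using parts C K1 K2 unfolding K_def by linarith
    fix eps dt l :: real and N m i :: nat and k :: 'n and g :: "nat \<Rightarrow> real \<Rightarrow> real"
    assume eps: "0 < eps" "eps < 1" and dt: "0 < dt" "dt \<le> T" and N: "N = 4 * m" "0 < m" and l: "1 \<le> l" "l \<le> ln (real N)" "exp (- l) \<le> l / N"
      and l4: "1 / l ^ 4 \<le> c0 * dt" and g: "scalar_bounds C b (sigma0 / 2) (sqrt eps) g" and i: "1 \<le> i" "i \<le> 2 * m"
    interpret M: shishkin_mesh sigma0 eps l N m by standard (use b eps N l in auto)
    let ?X = "mesh_node sigma0 eps l N"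
    have X: "M.X = ?X" by (simp add: M.X_def)
    define \<delta> where "\<delta> = l / N"
    have iN: "i < N" using i N by simp
    have Np: "real N > 0" using N by simp
    have \<delta>4: "\<delta> ^ 4 \<ge> 0" by simp
    let ?h = "mesh_h ?X i" and ?hp = "mesh_h ?X (i + 1)"
    let ?R = "resolved (1/6) A eps dt N ?X k"
    let ?t = "trunc_err (sqrt eps) g (?X i) ?h ?hp (q_minus (1/6) A eps dt N ?X k i) (q_cent (1/6) A eps dt N ?X k i) (q_plus (1/6) A eps dt N ?X k i)"
    have up: "\<bar>?t\<bar> \<le> K * \<delta> ^ 4" if "\<bar>?t\<bar> \<le> c * \<delta> ^ 4" "c \<le> K" for c
      using that mult_right_mono[OF that(2) \<delta>4] by linarith
    have triv: "\<bar>?t\<bar> \<le> 4 * C" using M.trunc_err_trivial[OF g dt(1) i(1) iN] unfolding X .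
    have d: "0 < sqrt eps" "sqrt eps < 1" "(sqrt eps)\<^sup>2 = eps" using eps by auto
    have sup: "2 / dt \<le> sup_norm01 (a_hat A dt k)" "sup_norm01 (a_hat A dt k) \<le> Ca + 2 / dt"
      by (rule sup_norm_a_hat[where Ca = Ca]; use A dt in simp)+
    have hm: "1 / N \<le> mesh_hmax N ?X" "mesh_hmax N ?X \<le> 7 / N" using M.hmax unfolding X by auto
    have hm2: "1 / (real N)\<^sup>2 \<le> (mesh_hmax N ?X)\<^sup>2" "(mesh_hmax N ?X)\<^sup>2 \<le> 49 / (real N)\<^sup>2"
    proof -
      have "0 \<le> mesh_hmax N ?X" using hm(1) by (smt (verit) Np divide_nonneg_pos)
      then show "(mesh_hmax N ?X)\<^sup>2 \<le> 49 / (real N)\<^sup>2" using power_mono[OF hm(2), of 2] by (simp add: power_divide)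
      show "1 / (real N)\<^sup>2 \<le> (mesh_hmax N ?X)\<^sup>2" using power_mono[OF hm(1), of 2] by (simp add: power_divide)
    qed
    \<comment> \<open>\<open>m = 1\<close> is separated because the geometry of the coarse cells
      needs two fine cells; there \<open>N = 4\<close> and \<open>l / N \<ge> 1 / 4\<close>, so the
      O(1) bound suffices, with \<open>1024 = 4 * 4 ^ 4\<close>.\<close>
    consider "i < m" | "m \<le> i" "m = 1" | "m \<le> i" "m \<ge> 2" "?R" | "m \<le> i" "m \<ge> 2" "\<not> ?R" using N by linarith
    then have "\<bar>?t\<bar> \<le> K * \<delta> ^ 4"
    proof cases
      case 1
      then have "in_fine N i" using N by (simp add: in_fine_def)
      then have "\<bar>?t\<bar> \<le> C * (8 * sigma0) ^ 4 * \<delta> ^ 4"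
        using M.trunc_err_fine(1)[OF g i(1) iN] 1 unfolding X \<delta>_def by (simp add: q_minus_def q_plus_def q_cent_def)
      then show ?thesis by (rule up) (use parts C K1 K2 in \<open>unfold K_def, linarith\<close>)
    next
      case 2
      have "1 / 4 \<le> \<delta>" using l N 2 by (simp add: \<delta>_def)
      then have "(1 / 4) ^ 4 \<le> \<delta> ^ 4" by (intro power_mono) auto
      then have "C * (1 / 4) ^ 4 \<le> C * \<delta> ^ 4" using C by (rule mult_left_mono)
      then have "\<bar>?t\<bar> \<le> 1024 * C * \<delta> ^ 4" using triv by (simp add: power4_eq_xxxx)
      then show ?thesis by (rule up) (use parts C K1 K2 in \<open>unfold K_def, linarith\<close>)
    next
      case 3
      have nf: "\<not> in_fine N i" using 3 i N by (simp add: in_fine_def)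
      have q: "q_minus (1/6) A eps dt N ?X k i = (2 * ?h - ?hp) / (6 * (?h + ?hp))" "q_cent (1/6) A eps dt N ?X k i = 5 / 6"
        "q_plus (1/6) A eps dt N ?X k i = (2 * ?hp - ?h) / (6 * (?h + ?hp))"
        using nf 3 by (auto simp: q_minus_def q_plus_def q_cent_def)
      show ?thesis
      proof (cases "M.sg = 1 / 4")
        case True
        \<comment> \<open>On a uniform mesh the resolved compact weights reduce to those of the fine
          region.\<close>
        have hh: "?hp = ?h" using M.trunc_err_fine(2)[OF g i(1) iN] True unfolding X by simp
        have "0 < ?h" using M.h_pos[of i] i(1) iN unfolding X by simp
        then have w: "(2 * ?h - ?h) / (6 * (?h + ?h)) = 1 / 12" by (simp add: field_simps)
        have "\<bar>?t\<bar> \<le> C * (8 * sigma0) ^ 4 * \<delta> ^ 4"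
          using M.trunc_err_fine(1)[OF g i(1) iN disjI2[OF True]] unfolding X \<delta>_def q hh w .
        then show ?thesis by (rule up) (use parts C K1 K2 in \<open>unfold K_def, linarith\<close>)
      next
        case False
        then have sg: "M.sg < 1 / 4" using M.sg by simp
        then have "M.sg = sigma0 * sqrt eps * l" unfolding M.sg_def shishkin_sigma_def by auto
        moreover have "sigma0 * sqrt eps * 1 \<le> sigma0 * sqrt eps * l" using b d l by (intro mult_left_mono) auto
        ultimately have sg2: "sigma0 / 2 * sqrt eps \<le> M.sg / 2" by simp
        note cc = M.coarse_cell[OF 3(1) i(2) 3(2), unfolded X]
        have "1 / 6 * (1 / (real N)\<^sup>2) * (2 / T) \<le> 1 / 6 * (mesh_hmax N ?X)\<^sup>2 * sup_norm01 (a_hat A dt k)"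
        proof (intro mult_mono hm2 order_refl)
          have "2 / T \<le> 2 / dt" using dt T by (simp add: frac_le)
          then show "2 / T \<le> sup_norm01 (a_hat A dt k)" using sup by linarith
        qed (use T in auto)
        also have "\<dots> \<le> eps" using 3(3) unfolding resolved_def .
        finally have "1 / eps \<le> Kr * (real N)\<^sup>2" unfolding Kr_def using T Np eps by (simp add: field_simps)
        then have r: "1 / (sqrt eps)\<^sup>2 \<le> Kr * (real N)\<^sup>2" unfolding d(3) .
        have l14: "1 / real N ^ 4 \<le> \<delta> ^ 4"
        proof -
          have "1 / real N \<le> \<delta>" unfolding \<delta>_def using l by (intro divide_right_mono) auto
          from power_mono[OF this, of 4] show ?thesis by (simp add: power_divide)
        qed
        have dec: "exp (- b * (?X i - ?h) / sqrt eps) \<le> E * \<delta> ^ 4"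
          unfolding cc(5) E_def \<delta>_def using M.coarse_decay[OF b(1,3) l(2,3) sg 3(1)] iN unfolding X by simp
        have "\<bar>?t\<bar> \<le> K1 * \<delta> ^ 4"
          unfolding q
          by (rule K1(2)[where N = "real N"]) (use g d cc sg2 sg r l14 dec Np in \<open>auto simp: cc(5)\<close>)
        then show ?thesis by (rule up) (use parts C K1 K2 in \<open>unfold K_def, linarith\<close>)
      qed
    next
      case 4
      have nf: "\<not> in_fine N i" using 4 i N by (simp add: in_fine_def)
      have q: "q_minus (1/6) A eps dt N ?X k i = 0" "q_cent (1/6) A eps dt N ?X k i = 1" "q_plus (1/6) A eps dt N ?X k i = 0"
        using nf 4 by (auto simp: q_minus_def q_plus_def q_cent_def)
      have l1: "1 \<le> l ^ 4" using l by simp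
      have "1 \<le> c0 * dt * l ^ 4" using mult_right_mono[OF l4, of "l ^ 4"] l1 l by simp
      then have "1 / dt \<le> c0 * l ^ 4" using dt by (simp add: field_simps)
      moreover have "Ca * 1 \<le> Ca * l ^ 4" using l1 Ca by (intro mult_left_mono) auto
      ultimately have s: "sup_norm01 (a_hat A dt k) \<le> (Ca + 2 * c0) * l ^ 4" using sup by (simp add: algebra_simps)
      have "eps < 1 / 6 * (mesh_hmax N ?X)\<^sup>2 * sup_norm01 (a_hat A dt k)" using 4(3) unfolding resolved_def by simp
      also have "\<dots> \<le> 1 / 6 * (49 / (real N)\<^sup>2) * ((Ca + 2 * c0) * l ^ 4)"
        using hm2 s sup(1) dt by (intro mult_mono order_refl) (auto intro: order_trans[rotated])
      also have "\<dots> = Ku * l ^ 4 / (real N)\<^sup>2" unfolding Ku_def using Np by (simp add: field_simps)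
      finally have e: "eps \<le> Ku * l ^ 4 / (real N)\<^sup>2" by simp
      show ?thesis
      proof (cases "M.sg = 1 / 4")
        case True
        \<comment> \<open>Now eps is bounded below by a multiple of \<open>l^-2\<close> and above by
          a multiple of \<open>l ^ 4 / N\<^sup>2\<close>. So
          \<open>N\<^sup>2 = O(l ^ 6) = O(N)\<close>, and \<open>N\<close> is bounded.\<close>
        have "1 / 4 \<le> sigma0 * sqrt eps * l" using M.sg(3) True by simp
        then have "(1 / 4)\<^sup>2 \<le> (sigma0 * sqrt eps * l)\<^sup>2" by (intro power_mono) auto
        then have "1 \<le> 16 * sigma0\<^sup>2 * l\<^sup>2 * eps" using d by (simp add: power_mult_distrib power_divide mult_ac)
        also have "\<dots> \<le> 16 * sigma0\<^sup>2 * l\<^sup>2 * (Ku * l ^ 4 / (real N)\<^sup>2)" using e by (intro mult_left_mono) auto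
        also have "\<dots> = 16 * sigma0\<^sup>2 * Ku * l ^ 6 / (real N)\<^sup>2" by (simp add: eval_nat_numeral)
        finally have n1: "(real N)\<^sup>2 \<le> 16 * sigma0\<^sup>2 * Ku * l ^ 6" using Np by (simp add: field_simps)
        have "l / 6 \<le> exp (l / 6)" using exp_ge_add_one_self[of "l / 6"] by linarith
        then have "(l / 6) ^ 6 \<le> exp (l / 6) ^ 6" using l by (intro power_mono) auto
        also have "\<dots> = exp l" by (simp add: exp_of_nat_mult[of 6 "l / 6", symmetric])
        also have "\<dots> \<le> N" using l Np by (simp add: ln_ge_iff)
        finally have "l ^ 6 \<le> 46656 * N" by (simp add: power_divide)
        then have "16 * sigma0\<^sup>2 * Ku * l ^ 6 \<le> 16 * sigma0\<^sup>2 * Ku * (46656 * N)" using nn by (intro mult_left_mono) auto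
        then have "real N * real N \<le> N0 * N" using n1 unfolding N0_def by (simp add: power2_eq_square mult_ac)
        then have "real N \<le> N0" using Np by simp
        then have "real N ^ 4 \<le> N0 ^ 4" by (intro power_mono) auto
        moreover have "N0 ^ 4 * 1 \<le> N0 ^ 4 * l ^ 4" using l1 by (intro mult_left_mono) auto
        ultimately have "1 \<le> N0 ^ 4 * \<delta> ^ 4" using Np by (simp add: \<delta>_def power_divide)
        then have "4 * C * 1 \<le> 4 * C * (N0 ^ 4 * \<delta> ^ 4)" using C by (intro mult_left_mono) auto
        then have "\<bar>?t\<bar> \<le> 4 * C * N0 ^ 4 * \<delta> ^ 4" using triv by (simp add: mult_ac)
        then show ?thesis by (rule up) (use parts C K1 K2 in \<open>unfold K_def, linarith\<close>)
      next
        case False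
        then have sg: "M.sg < 1 / 4" using M.sg by simp
        note cc = M.coarse_cell[OF 4(1) i(2) 4(2), unfolded X]
        have dec: "exp (- b * (?X i - ?h) / sqrt eps) \<le> E * (l / N) ^ 4"
          unfolding cc(5) E_def using M.coarse_decay[OF b(1,3) l(2,3) sg 4(1)] iN unfolding X by simp
        have "\<bar>?t\<bar> \<le> K2 * \<delta> ^ 4"
          unfolding q \<delta>_def
          by (rule K2(2)[where N = "real N"]) (use g d cc e dec Np in \<open>auto simp: cc(5)\<close>)
        then show ?thesis by (rule up) (use parts C K1 K2 in \<open>unfold K_def, linarith\<close>)
      qed
    qed
    then show "\<bar>?t\<bar> \<le> K * (l / N) ^ 4" unfolding \<delta>_def .
  qed
qed

text \<open>The right half is the mirror image: under \<open>i \<mapsto> N - i\<close> the steps and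
  the outer weights exchange roles, and the derivative bounds are symmetric.\<close>

lemma truncation_error:
  fixes A :: "real \<Rightarrow> real^'n^'n" and b sigma0 C T c0 Ca :: real
  assumes "b > 0" "sigma0 > 0" "4 \<le> b * sigma0" "C \<ge> 0" "T > 0" "c0 > 0"
    and "\<And>k. continuous_on {0..1} (\<lambda>x. A x $ k $ k)" "\<forall>x\<in>{0..1}. \<forall>k. \<bar>A x $ k $ k\<bar> \<le> Ca \<and> 0 < A x $ k $ k"
  obtains K where "K \<ge> 0"
    "\<And>eps dt N l k g i m. \<lbrakk>0 < eps; eps < 1; 0 < dt; dt \<le> T; N = 4 * m; 0 < m; 1 \<le> l; l \<le> ln (real N); exp (- l) \<le> l / N;
      1 / l ^ 4 \<le> c0 * dt; scalar_bounds C b (sigma0 / 2) (sqrt eps) g; 1 \<le> i; i < N\<rbrakk> \<Longrightarrow>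
      \<bar>trunc_err (sqrt eps) g (mesh_node sigma0 eps l N i) (mesh_h (mesh_node sigma0 eps l N) i) (mesh_h (mesh_node sigma0 eps l N) (i + 1))
        (q_minus (1/6) A eps dt N (mesh_node sigma0 eps l N) k i) (q_cent (1/6) A eps dt N (mesh_node sigma0 eps l N) k i)
        (q_plus (1/6) A eps dt N (mesh_node sigma0 eps l N) k i)\<bar> \<le> K * (l / N) ^ 4"
proof -
  obtain K where K: "K \<ge> 0"
    "\<And>eps dt N l k g i m. \<lbrakk>0 < eps; eps < 1; 0 < dt; dt \<le> T; N = 4 * m; 0 < m; 1 \<le> l; l \<le> ln (real N); exp (- l) \<le> l / N;
      1 / l ^ 4 \<le> c0 * dt; scalar_bounds C b (sigma0 / 2) (sqrt eps) g; 1 \<le> i; i \<le> 2 * m\<rbrakk> \<Longrightarrow>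
      \<bar>trunc_err (sqrt eps) g (mesh_node sigma0 eps l N i) (mesh_h (mesh_node sigma0 eps l N) i) (mesh_h (mesh_node sigma0 eps l N) (i + 1))
        (q_minus (1/6) A eps dt N (mesh_node sigma0 eps l N) k i) (q_cent (1/6) A eps dt N (mesh_node sigma0 eps l N) k i)
        (q_plus (1/6) A eps dt N (mesh_node sigma0 eps l N) k i)\<bar> \<le> K * (l / N) ^ 4"
    by (fact truncation_left_half[OF assms])
  show ?thesis
  proof (rule that[of K])
    fix eps dt l :: real and N m i :: nat and k :: 'n and g :: "nat \<Rightarrow> real \<Rightarrow> real"
    assume h: "0 < eps" "eps < 1" "0 < dt" "dt \<le> T" "N = 4 * m" "0 < m" "1 \<le> l" "l \<le> ln (real N)" "exp (- l) \<le> l / N"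
      "1 / l ^ 4 \<le> c0 * dt" and g: "scalar_bounds C b (sigma0 / 2) (sqrt eps) g" and i: "1 \<le> i" "i < N"
    interpret M: shishkin_mesh sigma0 eps l N m by standard (use assms h in auto)
    let ?X = "mesh_node sigma0 eps l N"
    have X: "M.X = ?X" by (simp add: M.X_def)
    let ?t = "\<lambda>g i. trunc_err (sqrt eps) g (?X i) (mesh_h ?X i) (mesh_h ?X (i + 1))
      (q_minus (1/6) A eps dt N ?X k i) (q_cent (1/6) A eps dt N ?X k i) (q_plus (1/6) A eps dt N ?X k i)"
    show "\<bar>?t g i\<bar> \<le> K * (l / N) ^ 4"
    proof (cases "i \<le> 2 * m")
      case True
      then show ?thesis by (rule K(2)[OF h g i(1)])
    next
      case False
      define j where "j = N - i"
      have j: "1 \<le> j" "j < 2 * m" and ij: "i = N - j" using i h(5) False by (auto simp: j_def)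
      have hi: "mesh_h ?X i = mesh_h ?X (Suc j)" "mesh_h ?X (Suc i) = mesh_h ?X j"
        using M.h_right[of "j + 1"] M.h_right[of j] j ij i unfolding X by (auto simp: Suc_diff_le)
      have xi: "?X i = 1 - ?X j" using M.X_right[of j] j unfolding X ij by simp
      have "in_fine N i \<longleftrightarrow> in_fine N j" using h(5) ij j by (auto simp: in_fine_def)
      then have q: "q_minus (1/6) A eps dt N ?X k i = q_plus (1/6) A eps dt N ?X k j"
        "q_plus (1/6) A eps dt N ?X k i = q_minus (1/6) A eps dt N ?X k j"
        "q_cent (1/6) A eps dt N ?X k i = q_cent (1/6) A eps dt N ?X k j"
        by (auto simp: q_minus_def q_plus_def q_cent_def hi add.commute)
      have "?t g i = ?t (\<lambda>s x. (- 1) ^ s * g s (1 - x)) j"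
        by (subst trunc_err_reflect) (simp add: q hi xi)
      then show ?thesis using K(2)[OF h scalar_bounds_reflect[OF g] j(1)] j by simp
    qed
  qed (use K in auto)
qed

section \<open>The recursion for the error\<close>

context scheme
begin

lemma LH_diff: "1 \<le> i \<Longrightarrow> i < N \<Longrightarrow> LH (\<lambda>i. V i - W i) i = LH V i - LH W i"
  using LH_add[of i V "\<lambda>i. - 1 *\<^sub>R W i"] LH_scale[of i "- 1" W] by simp

lemma Q_diff: "Q (\<lambda>i. V i - W i) i = Q V i - Q W i"
  using Q_add[of V "\<lambda>i. - 1 *\<^sub>R W i" i] Q_scale[of "- 1" W i] by simp

lemma Q_cong: "1 \<le> i \<Longrightarrow> i < N \<Longrightarrow> (\<And>l. l \<le> N \<Longrightarrow> V l = W l) \<Longrightarrow> Q V i = Q W i"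
  by (simp add: Q_vec_def Q_scal_def)

lemma LH_cong: "1 \<le> i \<Longrightarrow> i < N \<Longrightarrow> (\<And>l. l \<le> N \<Longrightarrow> V l = W l) \<Longrightarrow> LH V i = LH W i"
  by (simp add: L_hat_def R_scal_def Q_scal_def)

text \<open>The defect of the discrete diffusion for nodal values \<open>V\<close> of a function
  with second x-derivatives \<open>z\<close>; its components are values of
  \<open>trunc_err\<close>.\<close>

definition "consistency V z i = Lam V i + eps *\<^sub>R Q z i"

text \<open>Averaging the differential equation over the three nodes reproduces the reaction, the
  source and the time derivative exactly, so that diffusion alone leaves a defect.\<close>

lemma LH_exact:
  assumes i: "1 \<le> i" "i < N" and pde: "\<And>l. l \<le> N \<Longrightarrow> w l - eps *\<^sub>R z l + A (x l) *v v l = fn l"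
  shows "LH v i = Q v i + (dt / 2) *\<^sub>R (consistency v z i + (Q fn i - Q w i))"
proof -
  have "Q (\<lambda>l. A (x l) *v v l) i = Q (\<lambda>l. (fn l - w l) + eps *\<^sub>R z l) i"
    by (rule Q_cong[OF i]) (simp add: pde[symmetric])
  also have "\<dots> = Q fn i - Q w i + eps *\<^sub>R Q z i" by (simp only: Q_add Q_diff Q_scale)
  finally show ?thesis unfolding L_hat_eq[OF i] consistency_def by (simp add: add_ac)
qed

text \<open>Hence the recursively defined $\mathbf L^N_{x,\varepsilon}\mathbf U^n$ drops out of the scheme.\<close>

lemma eliminate_LU:
  assumes D0: "\<And>i. i \<le> N \<Longrightarrow> D 0 i = 0" and Lu0: "\<And>i. i \<le> N \<Longrightarrow> Lu 0 i = 0"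
    and Lu: "\<And>n i. Lu (Suc n) i = - Lu n i - (2 / dt) *\<^sub>R (D (Suc n) i - D n i) + fn n i + fn (Suc n) i"
    and sch: "\<And>n i. n < M \<Longrightarrow> 1 \<le> i \<Longrightarrow> i < N \<Longrightarrow>
        LH (D (Suc n)) i = Q (\<lambda>i. D n i + (dt / 2) *\<^sub>R (- Lu n i + fn n i + fn (Suc n) i)) i"
    and i: "1 \<le> i" "i < N"
  shows "n \<le> M \<Longrightarrow> Lam (D n) i + Q (\<lambda>l. A (x l) *v D n l) i = Q (Lu n) i"
proof (induction n)
  case 0
  have "Q (Lu 0) i = Q (\<lambda>l. 0) i" by (rule Q_cong[OF i Lu0])
  moreover have "Q (\<lambda>l. A (x l) *v D 0 l) i = Q (\<lambda>l. 0) i" by (rule Q_cong[OF i]) (simp add: D0)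
  moreover have "Lam (D 0) i = 0" unfolding Lam_def using i by (simp add: D0)
  ultimately show ?case by simp
next
  case (Suc n)
  \<comment> \<open>By the recursion for \<open>Lu\<close> the argument of \<open>Q\<close> already
    contains the next \<open>Lu\<close>. Comparison with \<open>L_hat_eq\<close> and cancellation of
    \<open>dt / 2\<close> yield the claim at \<open>Suc n\<close>.\<close>
  have "D n l + (dt / 2) *\<^sub>R (- Lu n l + fn n l + fn (Suc n) l) = D (Suc n) l + (dt / 2) *\<^sub>R Lu (Suc n) l" for l
    unfolding Lu using dt by (simp add: vec_eq_iff field_simps)
  then have "LH (D (Suc n)) i = Q (D (Suc n)) i + (dt / 2) *\<^sub>R Q (Lu (Suc n)) i"
    using sch[of n i] Suc i by (simp add: Q_add Q_scale)
  then show ?case unfolding L_hat_eq[OF i] using dt by simp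
qed

text \<open>With \<open>Lu\<close> eliminated the scheme is the trapezoidal rule in the form of the
  transition operator plus a source. The exact solution obeys it up to the quadrature defect in time
  and the mean of two spatial defects, so the error is driven by these alone.\<close>

lemma error_recursion:
  assumes pde: "\<And>n l. n \<le> M \<Longrightarrow> l \<le> N \<Longrightarrow> w n l - eps *\<^sub>R z n l + A (x l) *v v n l = fn n l"
    and D0: "\<And>i. i \<le> N \<Longrightarrow> D 0 i = 0" and Lu0: "\<And>i. i \<le> N \<Longrightarrow> Lu 0 i = 0"
    and Lu: "\<And>n i. Lu (Suc n) i = - Lu n i - (2 / dt) *\<^sub>R (D (Suc n) i - D n i) + fn n i + fn (Suc n) i"
    and sch: "\<And>n i. n < M \<Longrightarrow> 1 \<le> i \<Longrightarrow> i < N \<Longrightarrow>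
        LH (D (Suc n)) i = Q (\<lambda>i. D n i + (dt / 2) *\<^sub>R (- Lu n i + fn n i + fn (Suc n) i)) i"
    and n: "n < M" and i: "1 \<le> i" "i < N"
  shows "LH (\<lambda>i. v (Suc n) i - D (Suc n) i) i = 2 *\<^sub>R Q (\<lambda>i. v n i - D n i) i - LH (\<lambda>i. v n i - D n i) i +
      (Q (\<lambda>l. v (Suc n) l - v n l - (dt / 2) *\<^sub>R (w n l + w (Suc n) l)) i
        + (dt / 2) *\<^sub>R (consistency (v n) (z n) i + consistency (v (Suc n)) (z (Suc n)) i))"
proof -
  have a: "LH (D (Suc n)) i = Q (D n) i + (dt / 2) *\<^sub>R (- Q (Lu n) i + Q (fn n) i + Q (fn (Suc n)) i)"
    unfolding sch[OF n i] Q_add Q_scale using Q_scale[of "- 1" "Lu n" i] by simp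
  have b: "LH (D n) i = Q (D n) i + (dt / 2) *\<^sub>R Q (Lu n) i"
    unfolding L_hat_eq[OF i]
    by (simp only: eliminate_LU[where D = D and Lu = Lu and fn = fn and M = M, OF D0 Lu0 Lu sch i less_imp_le[OF n]])
  have c: "LH (v n) i = Q (v n) i + (dt / 2) *\<^sub>R (consistency (v n) (z n) i + (Q (fn n) i - Q (w n) i))"
    using n by (intro LH_exact[OF i] pde) auto
  have d: "LH (v (Suc n)) i = Q (v (Suc n)) i +
      (dt / 2) *\<^sub>R (consistency (v (Suc n)) (z (Suc n)) i + (Q (fn (Suc n)) i - Q (w (Suc n)) i))"
    using n by (intro LH_exact[OF i] pde) auto
  show ?thesis
    unfolding LH_diff[OF i] Q_diff Q_add Q_scale a b c d by (simp add: algebra_simps scaleR_2)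
qed

lemma consistency_component:
  assumes i: "1 \<le> i" and eps: "eps \<ge> 0" and V: "\<And>l. g 0 (x l) = V l $ k" "\<And>l. g 2 (x l) = z l $ k"
  shows "consistency V z i $ k = trunc_err (sqrt eps) g (x i) (mesh_h x i) (mesh_h x (i + 1)) (qm k i) (qc k i) (qp k i)"
proof -
  have n: "x i - mesh_h x i = x (i - 1)" "x i + mesh_h x (i + 1) = x (i + 1)" by (auto simp: mesh_h_def)
  show ?thesis
    unfolding consistency_def Lam_def trunc_err_def diff2_def n V
    using eps by (simp add: Q_vec_def Q_scal_def divide_inverse algebra_simps)
qed

end

section \<open>The trapezoidal rule and the global estimate\<close>

lemma trapezoidal_error:
  fixes g0 g1 g2 g3 :: "real \<Rightarrow> real"
  assumes s: "s \<le> r" "{s..r} \<subseteq> S"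
    and d: "\<And>t. t \<in> S \<Longrightarrow> (g0 has_real_derivative g1 t) (at t within S)"
    "\<And>t. t \<in> S \<Longrightarrow> (g1 has_real_derivative g2 t) (at t within S)"
    "\<And>t. t \<in> S \<Longrightarrow> (g2 has_real_derivative g3 t) (at t within S)"
    and B: "\<And>t. t \<in> S \<Longrightarrow> \<bar>g3 t\<bar> \<le> B"
  shows "\<bar>g0 r - g0 s - (r - s) / 2 * (g1 s + g1 r)\<bar> \<le> B * (r - s) ^ 3"
proof -
  define g where "g n = (if n = 0 then g0 else if n = 1 then g1 else if n = 2 then g2 else g3)" for n :: nat
  have D: "derivs_on s r 3 g"
    unfolding derivs_on_def
  proof (intro allI impI ballI)
    fix n :: nat and t assume n: "n < 3" and t: "t \<in> {s..r}"
    then have tS: "t \<in> S" using s by auto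
    have "(g n has_real_derivative g (Suc n) t) (at t within S)"
      using d[OF tS] n by (cases "n = 0"; cases "n = 1") (auto simp: g_def)
    then show "(g n has_real_derivative g (Suc n) t) (at t within {s..r})"
      by (rule has_field_derivative_subset) (use s in auto)
  qed
  have D1: "derivs_on s r (Suc 2) g" and D2: "derivs_on s r (Suc 1) (\<lambda>n. g (1 + n))"
    using D derivs_on_shift[OF D, of 1 2] by (auto simp: eval_nat_numeral)
  have B1: "\<bar>g (Suc 2) t\<bar> \<le> B" and B2: "\<bar>g (1 + Suc 1) t\<bar> \<le> B" if "t \<in> {s..r}" for t
    using s B that by (auto simp: g_def)
  have "\<bar>g 0 r - (\<Sum>i\<le>2. g i s * (r - s) ^ i / fact i)\<bar> \<le> B * \<bar>r - s\<bar> ^ Suc 2 / fact 2"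
    by (rule taylor_on[OF D1 _ _ B1]) (use s in auto)
  then have 1: "\<bar>g0 r - (g0 s + g1 s * (r - s) + g2 s * (r - s)\<^sup>2 / 2)\<bar> \<le> B * (r - s) ^ 3 / 2"
    using s by (simp add: g_def eval_nat_numeral)
  have "\<bar>g (1 + 0) r - (\<Sum>i\<le>1. g (1 + i) s * (r - s) ^ i / fact i)\<bar> \<le> B * \<bar>r - s\<bar> ^ Suc 1 / fact 1"
    by (rule taylor_on[OF D2 _ _ B2]) (use s in auto)
  then have 2: "\<bar>g1 r - (g1 s + g2 s * (r - s))\<bar> \<le> B * (r - s)\<^sup>2"
    using s by (simp add: g_def eval_nat_numeral)
  \<comment> \<open>The Taylor remainders of \<open>g0\<close> and of \<open>g1\<close>, both about
    the left end point, contribute half of the bound each.\<close>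
  have "\<bar>(r - s) / 2 * (g1 r - (g1 s + g2 s * (r - s)))\<bar> \<le> (r - s) / 2 * (B * (r - s)\<^sup>2)"
    unfolding abs_mult using 2 s by (intro mult_mono) auto
  moreover have "(r - s) / 2 * (B * (r - s)\<^sup>2) = B * (r - s) ^ 3 / 2" by (simp add: eval_nat_numeral)
  moreover have "g0 r - g0 s - (r - s) / 2 * (g1 s + g1 r) =
      (g0 r - (g0 s + g1 s * (r - s) + g2 s * (r - s)\<^sup>2 / 2)) - (r - s) / 2 * (g1 r - (g1 s + g2 s * (r - s)))"
    by (simp add: field_simps power2_eq_square)
  ultimately show ?thesis using 1 by linarith
qed

text \<open>If \<open>L N < 1\<close> then \<open>exp (- L N) > exp (- 1) > 1 / 4\<close>, whereas
  \<open>L N / N < 1 / N \<le> 1 / 4\<close>.\<close>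

lemma admissible_L_ge_1:
  assumes "admissible_L L" "0 < N" "4 dvd N" shows "1 \<le> L N"
proof (rule ccontr)
  assume h: "\<not> 1 \<le> L N"
  have N: "4 \<le> real N" using assms(2,3) dvd_imp_le by fastforce
  have "exp (- L N) \<le> L N / N" using assms unfolding admissible_L_def by blast
  also have "\<dots> \<le> 1 / N" using h N by (intro divide_right_mono) auto
  also have "\<dots> \<le> 1 / 4" using N by (simp add: field_simps)
  finally have 1: "exp (- L N) \<le> 1 / 4" .
  have "exp (- 1) \<le> exp (- L N)" using h by simp
  then have "exp (- 1) \<le> (1 / 4 :: real)" using 1 by linarith
  then have "inverse (exp 1) \<le> (1 / 4 :: real)" unfolding exp_minus .
  moreover have "1 / 3 \<le> inverse (exp 1 :: real)" using exp_le by (simp add: field_simps)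
  ultimately show False by linarith
qed

theorem theorem5p1:
  fixes T beta_star beta sigma0 \<alpha> c0 c1 gam :: real
    and A :: "real \<Rightarrow> real^'n^'n"
    and f :: "real \<Rightarrow> real \<Rightarrow> real^'n"
    and u :: "real \<Rightarrow> real \<Rightarrow> real \<Rightarrow> real^'n"
    and L :: "nat \<Rightarrow> real"
  assumes "CARD('n) \<ge> 2" and "T > 0"
    and "beta_star > 0" and "coupling_conditions beta_star A"
    and "0 < \<alpha>" and "\<alpha> < 1"
    and "\<And>k j. C_hoelder 4 \<alpha> (\<lambda>x. A x $ k $ j)"
    and "\<And>k. C_par_hoelder T 2 \<alpha> (\<lambda>x t. f x t $ k)"
    and "\<And>k s q. s + 2 * q \<le> 4 \<Longrightarrow>
           pd T s q (\<lambda>x t. f x t $ k) 0 0 = 0 \<and> pd T s q (\<lambda>x t. f x t $ k) 1 0 = 0"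
    and "\<And>eps. 0 < eps \<Longrightarrow> eps < 1 \<Longrightarrow> parabolic_solution T eps A f (u eps)"
    and "\<And>eps k. 0 < eps \<Longrightarrow> eps < 1 \<Longrightarrow> C_par T 3 (\<lambda>x t. u eps x t $ k)"
    and "0 < beta" and "beta < beta_star"
    and "sigma0 \<ge> 4 / sqrt beta"
    and "admissible_L L"
    and "gam = 1/6"
    and "c1 > 0"
    and "\<And>eps dt N. 0 < eps \<Longrightarrow> eps < 1 \<Longrightarrow> admissible_dt T dt \<Longrightarrow> 0 < N \<Longrightarrow> 4 dvd N \<Longrightarrow>
           N \<ge> N_zero sigma0 L A dt \<Longrightarrow>
           transition_defined gam A eps dt N (mesh_node sigma0 eps (L N) N) \<and>
           (\<forall>j::nat. 1 \<le> j \<and> real j \<le> T / dt \<longrightarrow>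
              mesh_onorm N (transition_op gam A eps dt N (mesh_node sigma0 eps (L N) N) ^^ j) \<le> c1)"
    and "c0 > 0"
  shows "\<exists>C>0. \<forall>eps dt N U.
           0 < eps \<and> eps < 1 \<and> admissible_dt T dt \<and> 0 < N \<and> 4 dvd N \<and>
           N \<ge> N_zero sigma0 L A dt \<and> 1 / L N ^ 4 \<le> c0 * dt \<and>
           discrete_solution gam T A f (u eps) eps dt N (mesh_node sigma0 eps (L N) N) U \<longrightarrow>
           (\<forall>n::nat. real (Suc n) \<le> T / dt \<longrightarrow>
              mesh_norm N (\<lambda>i. u eps (mesh_node sigma0 eps (L N) N i) (real (Suc n) * dt) - U (Suc n) i)
                \<le> C * (dt\<^sup>2 + (L N / real N) ^ 4))"
proof -
  note A = assms(7) and f = assms(8) and u = assms(10) and Cu = assms(11) and transition = assms(18)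
  obtain CA Cf H where S: "sp_data T beta_star beta (\<alpha> / 2) CA Cf H (matrix_family A) (pd_family T f)"
    by (rule sp_data_family[OF assms(2,4-8,12,13)])
  interpret P: sp_data T beta_star beta "\<alpha> / 2" CA Cf H "matrix_family A" "pd_family T f" by (fact S)
  have sol: "P.sol (sqrt eps) (pd_family T (u eps))" if "0 < eps" "eps < 1" for eps
    by (rule sol_family[OF S A f that u[OF that] Cu[OF that]])
  have bs: "4 \<le> P.b * sigma0"
    using assms(12,14) unfolding P.b_def by (simp add: field_simps)
  then have sigma0: "sigma0 > 0" using P.b_pos by (smt (verit) mult_nonneg_nonpos)
  obtain C where C: "C \<ge> 0" "\<And>d U t k. P.sol d U \<Longrightarrow> t \<in> {0..T} \<Longrightarrow> scalar_bounds C P.b (sigma0 / 2) d (\<lambda>s x. U s 0 x t $ k)"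
    by (rule P.uniform_scalar_bounds[of "sigma0 / 2"]) (use sigma0 in auto)
  obtain C3 where C3: "C3 \<ge> 0" "\<And>d U x t. P.sol d U \<Longrightarrow> x \<in> {0..1} \<Longrightarrow> t \<in> {0..T} \<Longrightarrow> norm (U 0 3 x t) \<le> C3 * (1 / d ^ 0)"
    by (rule P.ubE[OF P.ub_03]) blast
  have A_cont: "continuous_on {0..1} (\<lambda>x. A x $ k $ k)" for k
    using A[of k k] unfolding C_hoelder_def by (metis funpow_0 le0)
  have A_diag: "\<forall>x\<in>{0..1}. \<forall>k. \<bar>A x $ k $ k\<bar> \<le> CA \<and> 0 < A x $ k $ k"
  proof (intro ballI allI conjI)
    fix x :: real and k assume x: "x \<in> {0..1}"
    have "\<bar>(A x *v axis k 1) $ k\<bar> \<le> norm (A x *v axis k 1)" by (rule component_le_norm_cart)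
    also have "\<dots> \<le> CA * norm (axis k 1 :: real^'n)" using P.A_bound[of 0 x "axis k 1"] x by simp
    finally show "\<bar>A x $ k $ k\<bar> \<le> CA" by (simp add: matrix_vector_mult_basis column_def)
    show "0 < A x $ k $ k" using assms(4) x unfolding coupling_conditions_def by blast
  qed
  obtain K where K: "K \<ge> 0"
    "\<And>eps dt N l k g i m. \<lbrakk>0 < eps; eps < 1; 0 < dt; dt \<le> T; N = 4 * m; 0 < m; 1 \<le> l; l \<le> ln (real N); exp (- l) \<le> l / N;
      1 / l ^ 4 \<le> c0 * dt; scalar_bounds C P.b (sigma0 / 2) (sqrt eps) g; 1 \<le> i; i < N\<rbrakk> \<Longrightarrow>
      \<bar>trunc_err (sqrt eps) g (mesh_node sigma0 eps l N i) (mesh_h (mesh_node sigma0 eps l N) i) (mesh_h (mesh_node sigma0 eps l N) (i + 1))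
        (q_minus (1/6) A eps dt N (mesh_node sigma0 eps l N) k i) (q_cent (1/6) A eps dt N (mesh_node sigma0 eps l N) k i)
        (q_plus (1/6) A eps dt N (mesh_node sigma0 eps l N) k i)\<bar> \<le> K * (l / N) ^ 4"
    by (fact truncation_error[OF P.b_pos sigma0 bs C(1) assms(2,19) A_cont A_diag])
  \<comment> \<open>The stability factor times the total time: the per-step source \<open>B\<close>
    carries a factor \<open>dt\<close>, and the sum of these over the steps is at most
    \<open>T\<close>.\<close>
  define Z where "Z = T * ((1 + c1) * (3 * (2 + c1)))"
  have Z: "Z > 0" unfolding Z_def using assms(2,17) by (intro mult_pos_pos) auto
  \<comment> \<open>The summand 1 in the constant makes it strictly positive even if
    \<open>C3\<close> and \<open>K\<close> are 0.\<close>
  show ?thesis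
  proof (intro exI[of _ "Z * (2 * C3 + K + 1)"] conjI allI impI)
    show "Z * (2 * C3 + K + 1) > 0" using Z C3 K by (intro mult_pos_pos) auto
    fix eps dt :: real and N :: nat and U :: "nat \<Rightarrow> nat \<Rightarrow> real^'n" and n0 :: nat
    let ?x = "mesh_node sigma0 eps (L N) N"
    assume hyps: "0 < eps \<and> eps < 1 \<and> admissible_dt T dt \<and> 0 < N \<and> 4 dvd N \<and>
           N \<ge> N_zero sigma0 L A dt \<and> 1 / L N ^ 4 \<le> c0 * dt \<and> discrete_solution gam T A f (u eps) eps dt N ?x U"
      and n0: "real (Suc n0) \<le> T / dt"
    have eps: "0 < eps" "eps < 1" and N: "0 < N" "4 dvd N" and l4: "1 / L N ^ 4 \<le> c0 * dt" using hyps by auto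
    obtain M :: nat where M: "0 < M" "T / dt = real M" and dt: "dt > 0" using hyps unfolding admissible_dt_def by auto
    have Tdt: "T = real M * dt" using M dt by (simp add: field_simps)
    have "1 * dt \<le> real M * dt" using M dt by (intro mult_right_mono) auto
    then have dtT: "dt \<le> T" unfolding Tdt by simp
    obtain m where m: "N = 4 * m" "0 < m" using N by auto
    have l: "1 \<le> L N" "L N \<le> ln (real N)" "exp (- L N) \<le> L N / N"
      using admissible_L_ge_1[OF assms(15) N] assms(15) N unfolding admissible_L_def by auto
    interpret G: shishkin_mesh sigma0 eps "L N" N m by standard (use sigma0 eps m l in auto)
    have X: "G.X = ?x" by (simp add: G.X_def)
    interpret D: scheme gam A eps dt N ?x by standard (use dt m G.h_pos[unfolded X] in auto)
    have xr: "?x i \<in> {0..1}" if "i \<le> N" for i using G.X_range[OF that] unfolding X .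
    have tr: "real n * dt \<in> {0..T}" if "n \<le> M" for n unfolding Tdt using that dt by (auto intro: mult_right_mono)
    define W where "W = pd_family T (u eps)"
    have W: "P.sol (sqrt eps) W" unfolding W_def by (rule sol[OF eps])
    have W0: "W 0 0 = u eps" by (simp add: W_def)
    have d: "(sqrt eps)\<^sup>2 = eps" using eps by simp
    define v where "v = (\<lambda>n i. u eps (?x i) (real n * dt))"
    define w where "w = (\<lambda>n i. W 0 1 (?x i) (real n * dt))"
    define z where "z = (\<lambda>n i. W 2 0 (?x i) (real n * dt))"
    define fn where "fn = (\<lambda>n i. f (?x i) (real n * dt))"
    define Lu where "Lu = LU A f (u eps) eps dt ?x U"
    have pde: "w n i - eps *\<^sub>R z n i + A (?x i) *v v n i = fn n i" if "n \<le> M" "i \<le> N" for n i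
      using P.solD(9)[OF W, of 0 0 "?x i" "real n * dt"] xr[OF that(2)] tr[OF that(1)]
      unfolding d by (simp add: w_def z_def v_def fn_def W0 P.lower_def numeral_2_eq_2)
    have U0: "U 0 i = 0" if "i \<le> N" for i using hyps that unfolding discrete_solution_def by blast
    have Lu0: "Lu 0 i = 0" if "i \<le> N" for i
    proof -
      have "(\<chi> k. - eps * pdx (pdx (\<lambda>y r. u eps y r $ k)) (?x i) 0) = - eps *\<^sub>R W 2 0 (?x i) 0"
        by (simp add: W_def pd_family_def pd_def vec_eq_iff numeral_2_eq_2)
      then show ?thesis
        using P.initial_zero[OF W, of 2 "?x i"] P.initial_zero[OF W, of 0 "?x i"] xr[OF that]
        by (simp add: Lu_def L_op_def W0 del: scaleR_minus_left)
    qed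
    have LuS: "Lu (Suc n) i = - Lu n i - (2 / dt) *\<^sub>R (U (Suc n) i - U n i) + fn n i + fn (Suc n) i" for n i
      by (simp add: Lu_def fn_def)
    have step: "D.LH (U (Suc n)) i = D.Q (\<lambda>i. U n i + (dt / 2) *\<^sub>R (- Lu n i + fn n i + fn (Suc n) i)) i"
      and bdry: "U (Suc n) 0 = 0" "U (Suc n) N = 0" if "n < M" "1 \<le> i" "i < N" for n i
    proof -
      have "real (Suc n) \<le> T / dt" using that M by simp
      then have "U (Suc n) 0 = 0 \<and> U (Suc n) N = 0 \<and>
          (\<forall>i\<in>{1..N-1}. D.LH (U (Suc n)) i = D.Q (F_rhs A f (u eps) eps dt ?x U n) i)"
        using hyps unfolding discrete_solution_def by blast
      moreover have "F_rhs A f (u eps) eps dt ?x U n = (\<lambda>i. U n i + (dt / 2) *\<^sub>R (- Lu n i + fn n i + fn (Suc n) i))"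
        by (simp add: fun_eq_iff F_rhs_def Lu_def fn_def)
      ultimately show "D.LH (U (Suc n)) i = D.Q (\<lambda>i. U n i + (dt / 2) *\<^sub>R (- Lu n i + fn n i + fn (Suc n) i)) i"
        "U (Suc n) 0 = 0" "U (Suc n) N = 0" using that by auto
    qed
    define \<rho> where "\<rho> = (\<lambda>n l. v (Suc n) l - v n l - (dt / 2) *\<^sub>R (w n l + w (Suc n) l))"
    define \<tau> where "\<tau> = (\<lambda>n. D.consistency (v n) (z n))"
    \<comment> \<open>Cut off beyond \<open>N\<close> so that the error is an element of
      \<open>mesh0\<close>; the scheme sees only the nodes up to \<open>N\<close>.\<close>
    define e where "e = (\<lambda>n i. if i \<le> N then v n i - U n i else 0)"
    have e_rec: "D.LH (e (Suc n)) i = 2 *\<^sub>R D.Q (e n) i - D.LH (e n) i + (D.Q (\<rho> n) i + (dt / 2) *\<^sub>R (\<tau> n i + \<tau> (Suc n) i))"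
      if n: "n < M" and i: "1 \<le> i" "i < N" for n i
    proof -
      have "D.LH (e n) i = D.LH (\<lambda>i. v n i - U n i) i" "D.Q (e n) i = D.Q (\<lambda>i. v n i - U n i) i" for n
        by (rule D.LH_cong[OF i] D.Q_cong[OF i], simp add: e_def)+
      then show ?thesis
        using D.error_recursion[where M = M and v = v and w = w and z = z and fn = fn and D = U and Lu = Lu,
            OF pde U0 Lu0 LuS step n i] by (simp only: \<rho>_def \<tau>_def)
    qed
    have rho: "\<bar>\<rho> n i $ k\<bar> \<le> C3 * dt ^ 3" if "n < M" "i \<le> N" for n i k
    proof -
      let ?s = "real n * dt" and ?r = "real (Suc n) * dt"
      have sr: "?s \<in> {0..T}" "?r \<in> {0..T}" "?s \<le> ?r" "?r - ?s = dt" using tr[of n] tr[of "Suc n"] that dt by (auto simp: algebra_simps)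
      have D: "((\<lambda>t. W 0 q (?x i) t $ k) has_real_derivative W 0 (Suc q) (?x i) t $ k) (at t within {0..T})"
        if "t \<in> {0..T}" "q \<le> 2" for t q
        using P.solD(4)[OF W, of 0 q "?x i" t] xr[OF \<open>i \<le> N\<close>] that by (intro vec_component_deriv) simp
      have "\<bar>W 0 0 (?x i) ?r $ k - W 0 0 (?x i) ?s $ k - (?r - ?s) / 2 * (W 0 1 (?x i) ?s $ k + W 0 1 (?x i) ?r $ k)\<bar> \<le> C3 * (?r - ?s) ^ 3"
      proof (rule trapezoidal_error[where S = "{0..T}"])
        show "?s \<le> ?r" "{?s..?r} \<subseteq> {0..T}" using sr by auto
        fix t assume t: "t \<in> {0..T}"
        show "((\<lambda>t. W 0 0 (?x i) t $ k) has_real_derivative W 0 1 (?x i) t $ k) (at t within {0..T})"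
          "((\<lambda>t. W 0 1 (?x i) t $ k) has_real_derivative W 0 2 (?x i) t $ k) (at t within {0..T})"
          "((\<lambda>t. W 0 2 (?x i) t $ k) has_real_derivative W 0 3 (?x i) t $ k) (at t within {0..T})"
          using D[OF t, of 0] D[OF t, of 1] D[OF t, of 2] by (simp_all add: eval_nat_numeral)
        show "\<bar>W 0 3 (?x i) t $ k\<bar> \<le> C3"
          using component_le_norm_cart[of "W 0 3 (?x i) t" k] C3(2)[OF W xr[OF that(2)] t] by simp
      qed
      then show ?thesis unfolding sr(4) by (simp add: \<rho>_def v_def w_def W0)
    qed
    have tau: "\<bar>\<tau> n i $ k\<bar> \<le> K * (L N / N) ^ 4" if n: "n \<le> M" and i: "1 \<le> i" "i < N" for n i k
    proof -
      have "\<tau> n i $ k = trunc_err (sqrt eps) (\<lambda>s x. W s 0 x (real n * dt) $ k) (?x i) (mesh_h ?x i) (mesh_h ?x (i + 1))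
          (D.qm k i) (D.qc k i) (D.qp k i)"
        unfolding \<tau>_def using eps by (intro D.consistency_component i) (auto simp: v_def z_def W0)
      then show ?thesis
        using K(2)[OF eps dt dtT m l l4 C(2)[OF W tr[OF n]] i] unfolding assms(16) by simp
    qed
    \<comment> \<open>A bound on the source of one step: the averaging \<open>Q\<close> at most
      doubles the quadrature defect \<open>C3 * dt ^ 3\<close>, and the spatial defects at both ends
      of the step carry \<open>dt / 2\<close> each.\<close>
    define B where "B = dt * (2 * C3 * dt\<^sup>2 + K * (L N / N) ^ 4)"
    have B: "B \<ge> 0" unfolding B_def using dt C3 K l by (intro mult_nonneg_nonneg add_nonneg_nonneg) auto
    have def: "transition_defined gam A eps dt N ?x"
      and pow: "\<And>j. 1 \<le> j \<Longrightarrow> j \<le> M \<Longrightarrow> mesh_onorm N (D.R ^^ j) \<le> c1"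
      using transition[OF eps, of dt N] hyps M by auto
    have SM: "Suc n0 \<le> M" using n0 M by simp
    have "mesh_norm N (e (Suc n0)) \<le> real (Suc n0) * ((1 + c1) * (3 * (2 + c1) * B))"
    proof (rule D.stability[OF def assms(17) pow])
      show "1 \<le> M" "Suc n0 \<le> M" "B \<ge> 0" using M SM B by auto
      show "e 0 = (\<lambda>i. 0)"
        using P.solD(6)[OF W xr] by (auto simp: e_def fun_eq_iff v_def U0 W0)
      show "e n \<in> mesh0 N" if "n \<le> M" for n
      proof -
        have "U n 0 = 0" "U n N = 0" using U0 bdry[of "n - 1" 1] that m by (cases n; simp)+
        moreover have "v n 0 = 0" "v n N = 0"
          using P.solD(7,8)[OF W tr[OF that]] G.X_0 G.X_N unfolding X by (auto simp: v_def W0)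
        ultimately show ?thesis by (auto simp: mesh0_def e_def)
      qed
      fix n i assume n: "n < M" and i: "1 \<le> i" "i < N"
      show "D.LH (e (Suc n)) i = 2 *\<^sub>R D.Q (e n) i - D.LH (e n) i + (D.Q (\<rho> n) i + (dt / 2) *\<^sub>R (\<tau> n i + \<tau> (Suc n) i))"
        by (rule e_rec[OF n i])
      fix k
      have "\<bar>D.Q (\<rho> n) i $ k\<bar> \<le> 2 * (C3 * dt ^ 3)" by (rule D.Q_upper_bound[OF i rho[OF n]])
      moreover have "\<bar>dt / 2 * (\<tau> n i $ k + \<tau> (Suc n) i $ k)\<bar> \<le> dt / 2 * (K * (L N / N) ^ 4 + K * (L N / N) ^ 4)"
        unfolding abs_mult using tau[of n i k] tau[of "Suc n" i k] n i dt by (intro mult_mono) auto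
      moreover have "2 * (C3 * dt ^ 3) + dt / 2 * (K * (L N / N) ^ 4 + K * (L N / N) ^ 4) = B"
        by (simp add: B_def algebra_simps eval_nat_numeral)
      ultimately show "\<bar>(D.Q (\<rho> n) i + (dt / 2) *\<^sub>R (\<tau> n i + \<tau> (Suc n) i)) $ k\<bar> \<le> B" by simp
    qed
    also have "\<dots> = (real (Suc n0) * dt) * ((1 + c1) * (3 * (2 + c1))) * (2 * C3 * dt\<^sup>2 + K * (L N / N) ^ 4)"
      by (simp add: B_def mult_ac)
    also have "\<dots> \<le> Z * (2 * C3 * dt\<^sup>2 + K * (L N / N) ^ 4)"
      unfolding Z_def using tr[OF SM] assms(17) C3 K l by (intro mult_right_mono) auto
    also have "\<dots> \<le> Z * ((2 * C3 + K + 1) * (dt\<^sup>2 + (L N / N) ^ 4))"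
    proof (rule mult_left_mono)
      have "0 \<le> (K + 1) * dt\<^sup>2" "0 \<le> (2 * C3 + 1) * (L N / N) ^ 4" using C3 K by auto
      then show "2 * C3 * dt\<^sup>2 + K * (L N / N) ^ 4 \<le> (2 * C3 + K + 1) * (dt\<^sup>2 + (L N / N) ^ 4)"
        by (simp add: algebra_simps)
    qed (use Z in simp)
    finally have fin: "mesh_norm N (e (Suc n0)) \<le> Z * (2 * C3 + K + 1) * (dt\<^sup>2 + (L N / N) ^ 4)" by (simp add: mult_ac)
    have "mesh_norm N (\<lambda>i. u eps (?x i) (real (Suc n0) * dt) - U (Suc n0) i) \<le> mesh_norm N (e (Suc n0))"
    proof (rule mesh_norm_leI)
      fix i k assume "i \<le> N"
      then show "\<bar>(u eps (?x i) (real (Suc n0) * dt) - U (Suc n0) i) $ k\<bar> \<le> mesh_norm N (e (Suc n0))"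
        using mesh_norm_ge[of i N "e (Suc n0)" k] by (simp add: e_def v_def)
    qed
    then show "mesh_norm N (\<lambda>i. u eps (?x i) (real (Suc n0) * dt) - U (Suc n0) i) \<le> Z * (2 * C3 + K + 1) * (dt\<^sup>2 + (L N / real N) ^ 4)"
      using fin by linarith
  qed
qed

end
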